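(* Let $E$ be a separable Hilbert space and let $G:[0,T]\times\Omega\times E\times E\to\mathscr{K}_{ccmpt}(E)$ be a $\Sigma_{\mathbb{F}}\otimes\mathscr{B}(E)\otimes\mathscr{B}(E)$-measurable set-valued function. Consider the following two packages of assertions. $(\Gamma_1)$: (i) for all $Y,Z$ defining elements of $L^2_{\mathbb{F}}(\Omega;\gamma(0,T;E))$, the set $$\Lambda^{Y,Z}:=\{g\in L^2_{\mathbb{F}}(\Omega;\gamma(0,T;E)):\ g\in G(\cdot,Y,Z)\ \text{a.e. } (u,\omega)\in[0,T]\times\Omega\}$$ is non-empty; (ii) $\sup_{g\in\Lambda^{0_E,0_E}}\|g\|_{L^2_{\mathbb{F}}(\Omega;\gamma(0,T;E))}<\infty$; (iii) there exists $K_1>0$ such that for all $Y,Z,Y',Z'$ defining elements of $L^2_{\mathbb{F}}(\Omega;\gamma(0,T;E))$, $$\rho(\Lambda^{Y,Z},\Lambda^{Y',Z'})\le K_1\left(\|Y-Y'\|_{L^2_{\mathbb{F}}(\Omega;\gamma(0,T;E))}+\|Z-Z'\|_{L^2_{\mathbb{F}}(\Omega;\gamma(0,T;E))}\right),$$ where $\rho$ is the Hausdorff distance between subsets of $L^2_{\mathbb{F}}(\Omega;\gamma(0,T;E))$. $(\Gamma_2)$: (i) $\mathbb{E}\left(\big\|\,|G(\cdot,0_E,0_E)|_{\varrho}\,\big\|^2_{L^2([0,T])}\right)<\infty$; (ii) there exists $K_2>0$ such that for almost every $(u,\omega)$ and for all $y,z,y',z'\in E$, $$\varrho\left(G(u,y,z),G(u,y',z')\right)\le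 K_2\left(\|y-y'\|_E+\|z-z'\|_E\right).$$ Then $(\Gamma_1)$ and $(\Gamma_2)$ are equivalent.
   Context: $T>0$; $(\Omega,\mathscr{F},\mathbb{P})$ is a probability space carrying a real standard Brownian motion $W=(W_t)_{t\in[0,T]}$; $\mathbb{F}=(\mathscr{F}_t)_{t\in[0,T]}$ is the augmented natural filtration of $W$, and $\mathscr{F}=\mathscr{F}_T$. All vector spaces are real. The dependence of $G$ on $\omega$ is suppressed in notation. $\Sigma_{\mathbb{F}}$ is the $\sigma$-algebra of all measurable and adapted subsets of $[0,T]\times\Omega$, i.e. sets $B\in\mathscr{B}([0,T])\otimes\mathscr{F}$ with $\mathbf{1}_B(u,\cdot)$ $\mathscr{F}_u$-measurable for every $u$. $\mathscr{K}_{cmpt}(E)$ (resp. $\mathscr{K}_{ccmpt}(E)$) is the family of non-empty compact (resp. non-empty convex compact) subsets of $E$; $\varrho$ is the Hausdorff distance $\varrho(B,C)=\max(\sup_{x\in B}\inf_{y\in C}\|x-y\|,\sup_{y\in C}\inf_{x\in B}\|x-y\|)$ on $\mathscr{K}_{cmpt}(E)$, $|B|_{\varrho}=\varrho(B,\{0_E\})$, and $\rho$ is given by the same formula for subsets of $L^2_{\mathbb{F}}(\Omega;\gamma(0,T;E))$ with the norm of that space. A set-valued $H$ on a measurable space $(\mathcal{S},\mathscr{A})$ is $\mathscr{A}$-measurable if $\{s:H(s)\cap B\ne\emptyset\}\in\mathscr{A}$ for every closed $B$. $\gamma(0,T;E)$ is the space of $\gamma$-radonifying operators $L^2([0,T])\to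 E$, i.e. the closure of the finite rank operators for the norm $\|R\|=(\sup\mathbb{E}'\|\sum_{j}\gamma'_jRh_j\|^2)^{1/2}$, the supremum being over finite orthonormal systems $(h_j)$ in $L^2([0,T])$ and $(\gamma'_j)$ being independent standard Gaussians. A strongly measurable process $\phi:[0,T]\times\Omega\to E$ defines a random variable $X:\Omega\to\gamma(0,T;E)$ if for all $x^*\in E^*$, $\langle\phi(\cdot,\omega),x^*\rangle\in L^2([0,T])$ a.s., and for all $h\in L^2([0,T])$, $x^*\in E^*$, $\langle X(\omega)h,x^*\rangle=\int_{[0,T]}h(u)\langle\phi(u,\omega),x^*\rangle du$ a.s.; $\phi$ is then identified with $X$. $L^2_{\mathbb{F}}(\Omega;\gamma(0,T;E))$ is the closure in $L^2(\Omega;\gamma(0,T;E))$ of the $\mathbb{F}$-adapted step processes $\mathbf{1}_{\{0\}\times A}\tilde e+\sum_{i=1}^n\sum_{j=1}^m\mathbf{1}_{(t_{i-1},t_i]\times D_{ji}}e_{ji}$ with $0\le t_0<\dots<t_n\le T$, $A\in\mathscr{F}_0$, $D_{1i},\dots,D_{mi}\in\mathscr{F}_{t_{i-1}}$ disjoint, $\tilde e,e_{ji}\in E$. $Y,Z,Y',Z'$ are measurable processes, and $\Lambda^{Y,Z}$ consists of the elements of $L^2_{\mathbb{F}}(\Omega;\gamma(0,T;E))$ that can be defined by a $\mathscr{B}([0,T])\otimes\mathscr{F}$-measurable process $g$ with $g(u,\omega)\in G(u,\omega,Y(u,\omega),Z(u,\omega))$ for a.e. $(u,\omega)$. *)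

theory Defs
  imports "HOL-Probability.Probability"
begin

text \<open>A real standard Brownian motion on \<open>[0,T]\<close>. Since \<open>W 0 = 0\<close> almost surely, independence of
  the increments over a partition needs no separate clause for \<open>W 0\<close>.\<close>

definition std_brownian_motion :: "'a measure \<Rightarrow> real \<Rightarrow> (real \<Rightarrow> 'a \<Rightarrow> real) \<Rightarrow> bool" where
  "std_brownian_motion M T W \<longleftrightarrow>
     (\<forall>t\<in>{0..T}. W t \<in> borel_measurable M) \<and>
     (AE \<omega> in M. W 0 \<omega> = 0) \<and>
     (\<forall>s t. 0 \<le> s \<and> s < t \<and> t \<le> T \<longrightarrow>
        distributed M lborel (\<lambda>\<omega>. W t \<omega> - W s \<omega>)
          (\<lambda>x. ennreal (normal_density 0 (sqrt (t - s)) x))) \<and>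
     (\<forall>(n::nat) t. 0 \<le> t 0 \<and> (\<forall>i<n. t i < t (Suc i)) \<and> t n \<le> T \<longrightarrow>
        prob_space.indep_vars M (\<lambda>_. borel) (\<lambda>i \<omega>. W (t (Suc i)) \<omega> - W (t i) \<omega>) {..<n}) \<and>
     (AE \<omega> in M. continuous_on {0..T} (\<lambda>t. W t \<omega>))"

text \<open>All subsets of null sets are added, so \<open>sets M = sets (aug_filtration M W T)\<close> makes \<open>M\<close>
  complete. Only the \<open>\<sigma>\<close>-algebra of \<open>aug_filtration M W t\<close> is meaningful, not its measure.\<close>

definition aug_filtration :: "'a measure \<Rightarrow> (real \<Rightarrow> 'a \<Rightarrow> real) \<Rightarrow> real \<Rightarrow> 'a measure" where
  "aug_filtration M W t = sigma (space M)
     ({W s -` B \<inter> space M | s B. s \<in> {0..t} \<and> B \<in> sets borel} \<union>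
      {N. \<exists>N'\<in>null_sets M. N \<subseteq> N'})"

abbreviation time_measure :: "real \<Rightarrow> real measure" where
  "time_measure T \<equiv> restrict_space lborel {0..T}"

abbreviation process_measure :: "'a measure \<Rightarrow> real \<Rightarrow> (real \<times> 'a) measure" where
  "process_measure M T \<equiv> time_measure T \<Otimes>\<^sub>M M"

text \<open>\<open>\<Sigma>\<^sub>\<FF>\<close>; the generating family is already a \<open>\<sigma>\<close>-algebra.\<close>

definition Sigma_adapted :: "'a measure \<Rightarrow> real \<Rightarrow> (real \<Rightarrow> 'a measure) \<Rightarrow> (real \<times> 'a) measure" where
  "Sigma_adapted M T F = sigma ({0..T} \<times> space M)
     {B \<in> sets (process_measure M T).
        \<forall>u\<in>{0..T}. (\<lambda>\<omega>. indicator B (u, \<omega>) :: real) \<in> borel_measurable (F u)}"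

definition K_ccmpt :: "'e::real_normed_vector set set" where
  "K_ccmpt = {B. B \<noteq> {} \<and> compact B \<and> convex B}"

definition set_valued_measurable :: "'s measure \<Rightarrow> ('s \<Rightarrow> 'e::topological_space set) \<Rightarrow> bool" where
  "set_valued_measurable A H \<longleftrightarrow>
     (\<forall>B. closed B \<longrightarrow> {s \<in> space A. H s \<inter> B \<noteq> {}} \<in> sets A)"

text \<open>The distance function is a parameter, because elements of \<open>L\<^sup>2\<^sub>\<FF>(\<Omega>; \<gamma>(0,T;E))\<close> do not form
  a type. Values are extended reals, so that suprema over unbounded sets are \<open>\<infinity>\<close>.\<close>

definition hausdorff_dist :: "('b \<Rightarrow> 'b \<Rightarrow> real) \<Rightarrow> 'b set \<Rightarrow> 'b set \<Rightarrow> ennreal" where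
  "hausdorff_dist d B C =
     max (SUP x\<in>B. INF y\<in>C. ennreal (d x y)) (SUP y\<in>C. INF x\<in>B. ennreal (d x y))"

text \<open>The library has no Hilbert space \<open>L\<^sup>2([0,T])\<close>. Its elements are represented by square
  integrable functions, and operators on it by functions on these representatives; boundedness and
  linearity force an operator to respect almost everywhere equality. Operators are compared only
  through the seminorm of their difference, so values outside \<open>L2_fun T\<close> are irrelevant.\<close>

definition L2_fun :: "real \<Rightarrow> (real \<Rightarrow> real) set" where
  "L2_fun T = {h \<in> borel_measurable (time_measure T). integrable (time_measure T) (\<lambda>u. (h u)\<^sup>2)}"

definition L2_inner :: "real \<Rightarrow> (real \<Rightarrow> real) \<Rightarrow> (real \<Rightarrow> real) \<Rightarrow> real" where
  "L2_inner T f g = (LINT u|time_measure T. f u * g u)"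

definition L2_operators :: "real \<Rightarrow> ((real \<Rightarrow> real) \<Rightarrow> 'e::real_normed_vector) set" where
  "L2_operators T = {R.
     (\<forall>f\<in>L2_fun T. \<forall>g\<in>L2_fun T. R (\<lambda>u. f u + g u) = R f + R g) \<and>
     (\<forall>c. \<forall>f\<in>L2_fun T. R (\<lambda>u. c * f u) = c *\<^sub>R R f) \<and>
     (\<exists>C. \<forall>f\<in>L2_fun T. norm (R f) \<le> C * sqrt (L2_inner T f f))}"

definition finite_rank_operators :: "real \<Rightarrow> ((real \<Rightarrow> real) \<Rightarrow> 'e::real_normed_vector) set" where
  "finite_rank_operators T =
     {R \<in> L2_operators T. \<exists>B. finite B \<and> R ` L2_fun T \<subseteq> span B}"

definition op_diff :: "('h \<Rightarrow> 'e::real_normed_vector) \<Rightarrow> ('h \<Rightarrow> 'e) \<Rightarrow> 'h \<Rightarrow> 'e" where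
  "op_diff R S = (\<lambda>h. R h - S h)"

definition L2_orthonormal :: "real \<Rightarrow> nat \<Rightarrow> (nat \<Rightarrow> real \<Rightarrow> real) \<Rightarrow> bool" where
  "L2_orthonormal T n h \<longleftrightarrow> (\<forall>j<n. h j \<in> L2_fun T) \<and>
     (\<forall>i<n. \<forall>j<n. L2_inner T (h i) (h j) = (if i = j then 1 else 0))"

text \<open>The expectation \<open>E'\<close> in the \<open>\<gamma>\<close>-norm depends only on the joint law of the Gaussians, so it is
  taken over their product distribution instead of an abstract probability space.\<close>

definition std_gaussians :: "nat \<Rightarrow> (nat \<Rightarrow> real) measure" where
  "std_gaussians n = (\<Pi>\<^sub>M j\<in>{..<n}. density lborel (\<lambda>x. ennreal (std_normal_density x)))"

definition gamma_norm_sq :: "real \<Rightarrow> ((real \<Rightarrow> real) \<Rightarrow> 'e::real_normed_vector) \<Rightarrow> ennreal" where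
  "gamma_norm_sq T R = (SUP (n, h)\<in>{(n, h). L2_orthonormal T n h}.
     \<integral>\<^sup>+ x. ennreal ((norm (\<Sum>j<n. x j *\<^sub>R R (h j)))\<^sup>2) \<partial>std_gaussians n)"

definition gamma_norm :: "real \<Rightarrow> ((real \<Rightarrow> real) \<Rightarrow> 'e::real_normed_vector) \<Rightarrow> real" where
  "gamma_norm T R = sqrt (enn2real (gamma_norm_sq T R))"

text \<open>\<open>\<gamma>(0,T;E)\<close>. Approximation is stated with the extended-valued squared norm because
  \<open>gamma_norm\<close> is a junk value where the supremum is infinite; on \<open>gamma_space T\<close> it is finite.\<close>

definition gamma_space :: "real \<Rightarrow> ((real \<Rightarrow> real) \<Rightarrow> 'e::real_normed_vector) set" where
  "gamma_space T = {R \<in> L2_operators T.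
     \<forall>\<epsilon>>0. \<exists>S\<in>finite_rank_operators T. gamma_norm_sq T (op_diff R S) < ennreal (\<epsilon>\<^sup>2)}"

text \<open>Random variables are taken in the sense of Bochner spaces: almost sure limits of simple
  functions. Elements of \<open>L\<^sup>2\<close> spaces are represented by functions, not equivalence classes.\<close>

definition gamma_rv ::
    "'a measure \<Rightarrow> real \<Rightarrow> ('a \<Rightarrow> (real \<Rightarrow> real) \<Rightarrow> 'e::real_normed_vector) \<Rightarrow> bool" where
  "gamma_rv M T X \<longleftrightarrow> (\<forall>\<omega>\<in>space M. X \<omega> \<in> gamma_space T) \<and>
     (\<exists>S. (\<forall>n::nat. simple_function M (S n) \<and> S n ` space M \<subseteq> gamma_space T) \<and>
          (AE \<omega> in M. (\<lambda>n. gamma_norm T (op_diff (S n \<omega>) (X \<omega>))) \<longlonglongrightarrow> 0))"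

definition L2_gamma ::
    "'a measure \<Rightarrow> real \<Rightarrow> ('a \<Rightarrow> (real \<Rightarrow> real) \<Rightarrow> 'e::real_normed_vector) set" where
  "L2_gamma M T = {X. gamma_rv M T X \<and> integrable M (\<lambda>\<omega>. (gamma_norm T (X \<omega>))\<^sup>2)}"

definition L2_gamma_norm ::
    "'a measure \<Rightarrow> real \<Rightarrow> ('a \<Rightarrow> (real \<Rightarrow> real) \<Rightarrow> 'e::real_normed_vector) \<Rightarrow> real" where
  "L2_gamma_norm M T X = sqrt (LINT \<omega>|M. (gamma_norm T (X \<omega>))\<^sup>2)"

definition L2_gamma_dist :: "'a measure \<Rightarrow> real \<Rightarrow> ('a \<Rightarrow> (real \<Rightarrow> real) \<Rightarrow> 'e::real_normed_vector)
    \<Rightarrow> ('a \<Rightarrow> (real \<Rightarrow> real) \<Rightarrow> 'e) \<Rightarrow> real" where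
  "L2_gamma_dist M T X Y = L2_gamma_norm M T (\<lambda>\<omega>. op_diff (X \<omega>) (Y \<omega>))"

text \<open>The process \<open>\<phi>\<close> defines the random variable \<open>X\<close>. For separable \<open>E\<close>, strong measurability
  of \<open>\<phi>\<close> is Borel measurability. As in the source, the exceptional null sets may depend on \<open>h\<close> and
  on the functional.\<close>

definition defines_rv :: "'a measure \<Rightarrow> real \<Rightarrow> (real \<times> 'a \<Rightarrow> 'e::{real_normed_vector, second_countable_topology})
    \<Rightarrow> ('a \<Rightarrow> (real \<Rightarrow> real) \<Rightarrow> 'e) \<Rightarrow> bool" where
  "defines_rv M T \<phi> X \<longleftrightarrow>
     \<phi> \<in> borel_measurable (process_measure M T) \<and> gamma_rv M T X \<and>
     (\<forall>x :: 'e \<Rightarrow>\<^sub>L real. AE \<omega> in M. (\<lambda>u. blinfun_apply x (\<phi> (u, \<omega>))) \<in> L2_fun T) \<and>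
     (\<forall>h\<in>L2_fun T. \<forall>x :: 'e \<Rightarrow>\<^sub>L real. AE \<omega> in M.
        blinfun_apply x (X \<omega> h) = (LINT u|time_measure T. h u * blinfun_apply x (\<phi> (u, \<omega>))))"

definition step_process :: "real \<Rightarrow> (real \<Rightarrow> 'a measure) \<Rightarrow> (real \<times> 'a \<Rightarrow> 'e::real_normed_vector) \<Rightarrow> bool" where
  "step_process T F \<phi> \<longleftrightarrow>
     (\<exists>(n::nat) (m::nat) t A e\<^sub>0 D e.
        0 \<le> t 0 \<and> (\<forall>i<n. t i < t (Suc i)) \<and> t n \<le> T \<and>
        A \<in> sets (F 0) \<and>
        (\<forall>i<n. (\<forall>j<m. D j i \<in> sets (F (t i))) \<and> disjoint_family_on (\<lambda>j. D j i) {..<m}) \<and>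
        \<phi> = (\<lambda>p. indicator ({0} \<times> A) p *\<^sub>R e\<^sub>0 +
               (\<Sum>i<n. \<Sum>j<m. indicator ({t i<..t (Suc i)} \<times> D j i) p *\<^sub>R e j i)))"

definition L2_gamma_adapted :: "'a measure \<Rightarrow> real \<Rightarrow> (real \<Rightarrow> 'a measure)
    \<Rightarrow> ('a \<Rightarrow> (real \<Rightarrow> real) \<Rightarrow> 'e::{real_normed_vector, second_countable_topology}) set" where
  "L2_gamma_adapted M T F = {X \<in> L2_gamma M T.
     \<forall>\<epsilon>>0. \<exists>\<phi> S. step_process T F \<phi> \<and> S \<in> L2_gamma M T \<and> defines_rv M T \<phi> S \<and>
       L2_gamma_dist M T X S < \<epsilon>}"

definition defines_adapted :: "'a measure \<Rightarrow> real \<Rightarrow> (real \<Rightarrow> 'a measure)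
    \<Rightarrow> (real \<times> 'a \<Rightarrow> 'e::{real_normed_vector, second_countable_topology})
    \<Rightarrow> ('a \<Rightarrow> (real \<Rightarrow> real) \<Rightarrow> 'e) \<Rightarrow> bool" where
  "defines_adapted M T F \<phi> X \<longleftrightarrow> defines_rv M T \<phi> X \<and> X \<in> L2_gamma_adapted M T F"

definition Lambda_set :: "'a measure \<Rightarrow> real \<Rightarrow> (real \<Rightarrow> 'a measure)
    \<Rightarrow> (real \<Rightarrow> 'a \<Rightarrow> 'e \<Rightarrow> 'e \<Rightarrow> 'e::{real_normed_vector, second_countable_topology} set)
    \<Rightarrow> (real \<times> 'a \<Rightarrow> 'e) \<Rightarrow> (real \<times> 'a \<Rightarrow> 'e) \<Rightarrow> ('a \<Rightarrow> (real \<Rightarrow> real) \<Rightarrow> 'e) set" where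
  "Lambda_set M T F G Y Z = {X. \<exists>g. defines_adapted M T F g X \<and>
     (AE (u, \<omega>) in process_measure M T. g (u, \<omega>) \<in> G u \<omega> (Y (u, \<omega>)) (Z (u, \<omega>)))}"

end

theory Submission
  imports Defs
begin

text \<open>
  Since \<open>E\<close> is a Hilbert space, the second moment of \<open>\<Sum>j. \<gamma>\<^sub>j R h\<^sub>j\<close> is \<open>\<Sum>j. \<parallel>R h\<^sub>j\<parallel>\<^sup>2\<close>, so the
  \<open>\<gamma>\<close>-norm is the Hilbert-Schmidt norm. For the integral operator of a square integrable function
  \<open>f\<close> this is the \<open>L\<^sup>2\<close> norm of \<open>f\<close>: Bessel's inequality is an upper bound, and normalised indicators
  of the level sets of a simple function near \<open>f\<close> almost attain it (\<open>gamma_norm_sq_kernel_op\<close>).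
  Conversely, an operator of finite \<open>\<gamma>\<close>-norm that is weakly represented by \<open>f\<close> is the integral
  operator of \<open>f\<close>, and \<open>f\<close> is square integrable (\<open>gamma_operator_is_kernel_op\<close>). Therefore the
  distance of two random operators that are defined by processes is the \<open>L\<^sup>2([0,T] \<times> \<Omega>; E)\<close> distance
  of the processes (\<open>L2sq_eq_L2_gamma_dist\<close>). Adapted step processes are dense among the square
  integrable \<open>\<Sigma>\<^sub>\<FF>\<close>-measurable processes (\<open>step_process_dense\<close>), and a process that they approximate
  has a \<open>\<Sigma>\<^sub>\<FF>\<close>-measurable modification (\<open>adapted_modification\<close>). So \<open>\<Lambda>\<close> is, up to null sets, the
  set of square integrable \<open>\<Sigma>\<^sub>\<FF>\<close>-measurable selections of \<open>G(\<cdot>, Y, Z)\<close>, and the theorem becomes a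
  comparison of pointwise and integrated statements about selections.

  From the pointwise conditions to the selection sets: the metric projection onto a convex
  compact set is unique and depends measurably on the set (\<open>measurable_metric_proj\<close>). Projecting
  \<open>0\<close> gives a selection that the radius of \<open>G(\<cdot>, 0, 0)\<close> and the Lipschitz condition bound, and projecting
  a selection of \<open>G(\<cdot>, Y, Z)\<close> onto \<open>G(\<cdot>, Y', Z')\<close> gives the Lipschitz estimate for \<open>\<Lambda>\<close>.

  From the selection sets to the pointwise conditions: a selection of \<open>G(\<cdot>, 0, 0)\<close> whose norm is
  within \<open>1\<close> of the radius (\<open>far_selection\<close>) is square integrable because its truncations lie in the
  bounded set \<open>\<Lambda>\<close> for \<open>Y = Z = 0\<close>. For the Lipschitz condition with constant \<open>2 K\<^sub>1\<close>, consider the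
  set of all \<open>(u, \<omega>, y, z, y', z', x)\<close> such that \<open>x \<in> G(u, \<omega>, y, z)\<close> violates the estimate. It is
  product measurable. If its projection to \<open>[0,T] \<times> \<Omega>\<close> is not null, it has a measurable section over
  a set of positive measure (\<open>nonnull_projection_section\<close>), by Choquet's capacitability argument and
  the leftmost branch of a finitely branching tree. Processes cut from this section contradict the
  Lipschitz property of \<open>\<Lambda>\<close> (\<open>no_violating_section\<close>); here the factor \<open>2\<close> absorbs the loss in
  \<open>(a + b)\<^sup>2 \<le> 2 (a\<^sup>2 + b\<^sup>2)\<close>.
\<close>

section \<open>Orthonormal sequences\<close>

lemma dense_sequence:
  obtains d :: "nat \<Rightarrow> 'e::second_countable_topology" where "\<And>X. open X \<Longrightarrow> X \<noteq> {} \<Longrightarrow> \<exists>n. d n \<in> X"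
proof -
  obtain D :: "'e set" where D: "countable D" "\<And>X. open X \<Longrightarrow> X \<noteq> {} \<Longrightarrow> \<exists>d\<in>D. d \<in> X"
    by (erule countable_dense_setE)
  have "\<exists>n. from_nat_into D n \<in> X" if "open X" "X \<noteq> {}" for X
    using D(2)[OF that] from_nat_into_surj[OF D(1)] by metis
  then show ?thesis by (rule that)
qed

text \<open>Zero vectors are admitted, so that one sequence indexed by all natural numbers serves spaces of
  finite and of infinite dimension.\<close>

definition orthonormal_seq :: "(nat \<Rightarrow> 'e::real_inner) \<Rightarrow> bool" where
  "orthonormal_seq e \<longleftrightarrow> (\<forall>i j. i \<noteq> j \<longrightarrow> e i \<bullet> e j = 0) \<and> (\<forall>i. e i = 0 \<or> norm (e i) = 1)"

lemma orthonormal_seq_inner_sum: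
  assumes "orthonormal_seq e"
  shows "(\<Sum>k<n. c k *\<^sub>R e k) \<bullet> e j = (if j < n then c j * (e j \<bullet> e j) else 0)"
proof -
  have "(\<Sum>k<n. c k *\<^sub>R e k) \<bullet> e j = (\<Sum>k<n. if k = j then c j * (e j \<bullet> e j) else 0)"
    unfolding inner_sum_left using assms
    by (intro sum.cong) (auto simp: orthonormal_seq_def)
  then show ?thesis by simp
qed

lemma orthonormal_seq_self:
  assumes "orthonormal_seq e"
  shows "(x \<bullet> e j) * (e j \<bullet> e j) = x \<bullet> e j"
proof -
  have "e j = 0 \<or> norm (e j) = 1" using assms by (auto simp: orthonormal_seq_def)
  then show ?thesis by (auto simp: dot_square_norm)
qed

lemma orthonormal_seq_norm_combination:
  assumes "orthonormal_seq e"
  shows "(norm (\<Sum>k<n. (x \<bullet> e k) *\<^sub>R e k))\<^sup>2 = (\<Sum>k<n. (x \<bullet> e k)\<^sup>2)"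
proof -
  let ?p = "\<Sum>k<n. (x \<bullet> e k) *\<^sub>R e k"
  have "y \<bullet> ?p = (\<Sum>j<n. (x \<bullet> e j) * (y \<bullet> e j))" for y
    by (simp add: inner_sum_right)
  then have "?p \<bullet> ?p = (\<Sum>j<n. (x \<bullet> e j) * (?p \<bullet> e j))" .
  also have "\<dots> = (\<Sum>j<n. (x \<bullet> e j) * (x \<bullet> e j))"
  proof (intro sum.cong refl)
    fix j assume "j \<in> {..<n}"
    then show "(x \<bullet> e j) * (?p \<bullet> e j) = (x \<bullet> e j) * (x \<bullet> e j)"
      using orthonormal_seq_inner_sum[OF assms, of "\<lambda>k. x \<bullet> e k" n j]
        orthonormal_seq_self[OF assms, of x j] by simp
  qed
  finally show ?thesis unfolding power2_norm_eq_inner by (simp add: power2_eq_square)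
qed

lemma orthonormal_seq_residual:
  assumes "orthonormal_seq e"
  shows "(norm (x - (\<Sum>k<n. (x \<bullet> e k) *\<^sub>R e k)))\<^sup>2 = (norm x)\<^sup>2 - (\<Sum>k<n. (x \<bullet> e k)\<^sup>2)"
proof -
  let ?p = "\<Sum>k<n. (x \<bullet> e k) *\<^sub>R e k"
  have 1: "x \<bullet> ?p = (\<Sum>k<n. (x \<bullet> e k)\<^sup>2)"
    by (simp add: inner_sum_right power2_eq_square)
  have 2: "?p \<bullet> ?p = (\<Sum>k<n. (x \<bullet> e k)\<^sup>2)"
    using orthonormal_seq_norm_combination[OF assms, of x n] by (simp add: power2_norm_eq_inner)
  show ?thesis
    using 1 2 unfolding power2_norm_eq_inner
    by (simp add: inner_diff_left inner_diff_right inner_commute[of ?p x])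
qed

lemma orthonormal_seq_bessel:
  assumes "orthonormal_seq e"
  shows "(\<Sum>k<n. (x \<bullet> e k)\<^sup>2) \<le> (norm x)\<^sup>2"
  using orthonormal_seq_residual[OF assms, of x n] by (simp add: algebra_simps) (metis zero_le_power2 le_add_same_cancel1)

text \<open>The left side is the squared distance from \<open>x\<close> to the span of the first \<open>n\<close> vectors, and
  subtracting a vector \<open>v\<close> of the span does not change it. Approximating \<open>x\<close> by \<open>v\<close> therefore
  makes Bessel's inequality nearly an equality.\<close>

lemma orthonormal_seq_residual_le:
  assumes "orthonormal_seq e" and v: "v = (\<Sum>k<n. (v \<bullet> e k) *\<^sub>R e k)"
  shows "(norm x)\<^sup>2 - (\<Sum>k<n. (x \<bullet> e k)\<^sup>2) \<le> (norm (x - v))\<^sup>2"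
proof -
  let ?p = "\<lambda>x. \<Sum>k<n. (x \<bullet> e k) *\<^sub>R e k"
  have "x - v - ?p (x - v) = x - ?p x - (v - ?p v)"
    by (simp add: inner_diff_left scaleR_diff_left sum_subtractf)
  also have "\<dots> = x - ?p x" using v by simp
  finally have "(norm (x - v))\<^sup>2 - (\<Sum>k<n. ((x - v) \<bullet> e k)\<^sup>2) = (norm x)\<^sup>2 - (\<Sum>k<n. (x \<bullet> e k)\<^sup>2)"
    unfolding orthonormal_seq_residual[OF assms(1), symmetric] by (rule arg_cong)
  moreover have "(\<Sum>k<n. ((x - v) \<bullet> e k)\<^sup>2) \<ge> 0" by (simp add: sum_nonneg)
  ultimately show ?thesis by linarith
qed

text \<open>Where the input is linearly dependent, \<open>sgn 0 = 0\<close> puts a zero vector into the output.\<close>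

fun gram_schmidt :: "(nat \<Rightarrow> 'e::real_inner) \<Rightarrow> nat \<Rightarrow> 'e" where
  "gram_schmidt d n = sgn (d n - (\<Sum>k\<in>{..<n}. (d n \<bullet> gram_schmidt d k) *\<^sub>R gram_schmidt d k))"

declare gram_schmidt.simps [simp del]

lemma gram_schmidt_norm: "gram_schmidt d n = 0 \<or> norm (gram_schmidt d n) = 1"
  by (subst (1 2) gram_schmidt.simps) (auto simp: norm_sgn sgn_zero_iff)

lemma gram_schmidt_orthogonal: "j < n \<Longrightarrow> gram_schmidt d n \<bullet> gram_schmidt d j = 0"
proof (induction n arbitrary: j rule: less_induct)
  case (less n)
  let ?e = "gram_schmidt d"
  have "(\<Sum>k<n. (d n \<bullet> ?e k) *\<^sub>R ?e k) \<bullet> ?e j = (\<Sum>k<n. if k = j then (d n \<bullet> ?e j) * (?e j \<bullet> ?e j) else 0)"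
    unfolding inner_sum_left
  proof (intro sum.cong refl)
    fix k assume "k \<in> {..<n}"
    then show "((d n \<bullet> ?e k) *\<^sub>R ?e k) \<bullet> ?e j = (if k = j then (d n \<bullet> ?e j) * (?e j \<bullet> ?e j) else 0)"
      using less.IH[of k j] less.IH[of j k] less.prems by (cases k j rule: linorder_cases) (auto simp: inner_commute)
  qed
  also have "\<dots> = d n \<bullet> ?e j"
    using less.prems gram_schmidt_norm[of d j] by (auto simp: dot_square_norm)
  finally show ?case
    by (subst gram_schmidt.simps) (simp add: sgn_div_norm inner_diff_left)
qed

lemma orthonormal_seq_gram_schmidt: "orthonormal_seq (gram_schmidt d)"
  unfolding orthonormal_seq_def
  by (metis gram_schmidt_norm gram_schmidt_orthogonal inner_commute linorder_neqE_nat)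

lemma gram_schmidt_expansion:
  assumes "i < n"
  shows "d i = (\<Sum>k<n. (d i \<bullet> gram_schmidt d k) *\<^sub>R gram_schmidt d k)"
proof -
  let ?e = "gram_schmidt d"
  let ?r = "d i - (\<Sum>k<i. (d i \<bullet> ?e k) *\<^sub>R ?e k)"
  have e: "?e i = sgn ?r" by (rule gram_schmidt.simps)
  have r: "?r = norm ?r *\<^sub>R ?e i" unfolding e sgn_div_norm by (cases "?r = 0") simp_all
  have d: "d i = (\<Sum>k<i. (d i \<bullet> ?e k) *\<^sub>R ?e k) + norm ?r *\<^sub>R ?e i" using r by (metis add.commute diff_add_cancel)
  define c where "c = (\<lambda>k. if k < i then d i \<bullet> ?e k else if k = i then norm ?r else 0)"
  have "(\<Sum>k<n. c k *\<^sub>R ?e k) = (\<Sum>k<Suc i. c k *\<^sub>R ?e k)"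
    using assms by (intro sum.mono_neutral_right) (auto simp: c_def)
  also have "\<dots> = d i"
    by (subst d) (simp add: c_def)
  finally have c: "d i = (\<Sum>k<n. c k *\<^sub>R ?e k)" by simp
  have "(d i \<bullet> ?e k) *\<^sub>R ?e k = c k *\<^sub>R ?e k" if "k < n" for k
  proof -
    have "d i \<bullet> ?e k = c k * (?e k \<bullet> ?e k)"
      by (subst c) (simp add: orthonormal_seq_inner_sum[OF orthonormal_seq_gram_schmidt] that)
    then show ?thesis using gram_schmidt_norm[of d k] by (auto simp: dot_square_norm)
  qed
  then have "(\<Sum>k<n. (d i \<bullet> ?e k) *\<^sub>R ?e k) = (\<Sum>k<n. c k *\<^sub>R ?e k)"
    by (intro sum.cong) auto
  with c show ?thesis by argo
qed

text \<open>Orthonormalising a dense sequence \<open>d\<close> works: \<open>x\<close> is close to some \<open>d i\<close>, which lies in the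
  span of the first \<open>i + 1\<close> vectors, so the gap in Bessel's inequality is small from there on.\<close>

lemma parseval_separable:
  "\<exists>e :: nat \<Rightarrow> 'e::{real_inner, second_countable_topology}.
     orthonormal_seq e \<and> (\<forall>x. (\<lambda>k. (x \<bullet> e k)\<^sup>2) sums (norm x)\<^sup>2)"
proof -
  obtain d :: "nat \<Rightarrow> 'e" where d: "\<And>X. open X \<Longrightarrow> X \<noteq> {} \<Longrightarrow> \<exists>n. d n \<in> X"
    by (rule dense_sequence) blast
  let ?e = "gram_schmidt d"
  have "(\<lambda>k. (x \<bullet> ?e k)\<^sup>2) sums (norm x)\<^sup>2" for x
    unfolding sums_def
  proof (rule LIMSEQ_I)
    fix r :: real assume "0 < r"
    obtain i where "d i \<in> ball x (sqrt r)" using d[of "ball x (sqrt r)"] \<open>0 < r\<close> by auto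
    then have i: "(norm (x - d i))\<^sup>2 < r"
      using \<open>0 < r\<close> by (auto simp: dist_norm real_less_rsqrt dest: real_less_rsqrt power_strict_mono[where n=2])
    have "norm ((\<Sum>k<n. (x \<bullet> ?e k)\<^sup>2) - (norm x)\<^sup>2) < r" if "n \<ge> Suc i" for n
      using orthonormal_seq_residual_le[OF orthonormal_seq_gram_schmidt gram_schmidt_expansion[of i n d], of x] i that
        orthonormal_seq_bessel[OF orthonormal_seq_gram_schmidt, of x d n] by (simp add: abs_if)
    then show "\<exists>no. \<forall>n\<ge>no. norm ((\<Sum>k<n. (x \<bullet> ?e k)\<^sup>2) - (norm x)\<^sup>2) < r" by blast
  qed
  then show ?thesis using orthonormal_seq_gram_schmidt by blast
qed

lemma parseval_finite_span:
  fixes B :: "'e::real_inner set"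
  assumes "finite B"
  shows "\<exists>e n. orthonormal_seq e \<and> (\<forall>x\<in>span B. (norm x)\<^sup>2 = (\<Sum>k<n. (x \<bullet> e k)\<^sup>2))"
proof -
  obtain n and d :: "nat \<Rightarrow> 'e" where B: "B = d ` {i. i < n}"
    using finite_imp_nat_seg_image_inj_on[OF assms] by blast
  let ?e = "gram_schmidt d"
  have "x = (\<Sum>k<n. (x \<bullet> ?e k) *\<^sub>R ?e k)" if "x \<in> span B" for x
    using that
  proof (induction rule: span_induct_alt)
    case (step c b y)
    then have "b = (\<Sum>k<n. (b \<bullet> ?e k) *\<^sub>R ?e k)" using gram_schmidt_expansion B by auto
    with step show ?case
      by (simp add: inner_add_left scaleR_add_left sum.distrib scaleR_sum_right[symmetric] flip: scaleR_scaleR)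
  qed simp
  then have "(norm x)\<^sup>2 = (\<Sum>k<n. (x \<bullet> ?e k)\<^sup>2)" if "x \<in> span B" for x
    using orthonormal_seq_norm_combination[OF orthonormal_seq_gram_schmidt, of x d n] that by force
  then show ?thesis using orthonormal_seq_gram_schmidt by blast
qed



section \<open>Square integrable functions\<close>

text \<open>The squared norm is kept as an extended real, so that square integrability is the statement
  \<open>L2sq N f < \<infinity>\<close> and estimates need no integrability side conditions.\<close>

definition L2sq :: "'a measure \<Rightarrow> ('a \<Rightarrow> 'b::real_normed_vector) \<Rightarrow> ennreal" where
  "L2sq N f = (\<integral>\<^sup>+ x. ennreal ((norm (f x))\<^sup>2) \<partial>N)"

lemma norm_add_sq_le: "(norm (a + b :: 'b::real_normed_vector))\<^sup>2 \<le> 2 * (norm a)\<^sup>2 + 2 * (norm b)\<^sup>2"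
proof -
  have "(norm (a + b))\<^sup>2 \<le> (norm a + norm b)\<^sup>2" by (intro power_mono norm_triangle_ineq) simp
  also have "\<dots> \<le> 2 * (norm a)\<^sup>2 + 2 * (norm b)\<^sup>2"
    using sum_squares_bound[of "norm a" "norm b"] by (simp add: power2_sum)
  finally show ?thesis .
qed

lemma L2sq_add:
  fixes f g :: "'a \<Rightarrow> 'b::{real_normed_vector, second_countable_topology}"
  assumes [measurable]: "f \<in> borel_measurable N" "g \<in> borel_measurable N"
  shows "L2sq N (\<lambda>x. f x + g x) \<le> 2 * L2sq N f + 2 * L2sq N g"
proof -
  have "L2sq N (\<lambda>x. f x + g x) \<le> (\<integral>\<^sup>+ x. 2 * ennreal ((norm (f x))\<^sup>2) + 2 * ennreal ((norm (g x))\<^sup>2) \<partial>N)"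
    unfolding L2sq_def
  proof (rule nn_integral_mono)
    fix x
    have "ennreal ((norm (f x + g x))\<^sup>2) \<le> ennreal (2 * (norm (f x))\<^sup>2 + 2 * (norm (g x))\<^sup>2)"
      by (intro ennreal_leI norm_add_sq_le)
    then show "ennreal ((norm (f x + g x))\<^sup>2) \<le> 2 * ennreal ((norm (f x))\<^sup>2) + 2 * ennreal ((norm (g x))\<^sup>2)"
      by (simp add: ennreal_plus ennreal_mult)
  qed
  also have "\<dots> = 2 * L2sq N f + 2 * L2sq N g"
    unfolding L2sq_def by (simp add: nn_integral_add nn_integral_cmult)
  finally show ?thesis .
qed

lemma L2sq_uminus [simp]: "L2sq N (\<lambda>x. - f x) = L2sq N f"
  by (simp add: L2sq_def)

lemma L2sq_zero [simp]: "L2sq N (\<lambda>x. 0) = 0"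
  by (simp add: L2sq_def)

lemma L2sq_diff:
  fixes f g :: "'a \<Rightarrow> 'b::{real_normed_vector, second_countable_topology}"
  assumes "f \<in> borel_measurable N" "g \<in> borel_measurable N"
  shows "L2sq N (\<lambda>x. f x - g x) \<le> 2 * L2sq N f + 2 * L2sq N g"
  using L2sq_add[of f N "\<lambda>x. - g x"] assms by simp

lemma L2sq_diff_commute: "L2sq N (\<lambda>x. f x - g x) = L2sq N (\<lambda>x. g x - f x)"
  by (simp add: L2sq_def norm_minus_commute)

lemma L2sq_cong_AE: "AE x in N. f x = g x \<Longrightarrow> L2sq N f = L2sq N g"
  unfolding L2sq_def by (rule nn_integral_cong_AE) auto

lemma L2sq_cong: "(\<And>x. x \<in> space N \<Longrightarrow> f x = g x) \<Longrightarrow> L2sq N f = L2sq N g"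
  unfolding L2sq_def by (rule nn_integral_cong) auto

lemma L2sq_mono_AE: "AE x in N. norm (f x) \<le> norm (g x) \<Longrightarrow> L2sq N f \<le> L2sq N g"
  unfolding L2sq_def by (rule nn_integral_mono_AE) (auto intro!: ennreal_leI power_mono)

lemma L2sq_mono: "(\<And>x. norm (f x) \<le> norm (g x)) \<Longrightarrow> L2sq N f \<le> L2sq N g"
  unfolding L2sq_def by (rule nn_integral_mono) (auto intro!: ennreal_leI power_mono)

lemma L2sq_add_finite:
  fixes f g :: "'a \<Rightarrow> 'b::{real_normed_vector, second_countable_topology}"
  assumes "f \<in> borel_measurable N" "g \<in> borel_measurable N" "L2sq N f < \<infinity>" "L2sq N g < \<infinity>"
  shows "L2sq N (\<lambda>x. f x + g x) < \<infinity>" "L2sq N (\<lambda>x. f x - g x) < \<infinity>"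
proof -
  have "2 * L2sq N f + 2 * L2sq N g < \<infinity>" using assms by (simp add: ennreal_mult_less_top)
  then show "L2sq N (\<lambda>x. f x + g x) < \<infinity>" "L2sq N (\<lambda>x. f x - g x) < \<infinity>"
    using L2sq_add[of f N g] L2sq_diff[of f N g] assms(1,2) by (meson le_less_trans)+
qed

lemma L2sq_scaleR: "L2sq N (\<lambda>x. c *\<^sub>R f x) = ennreal (c\<^sup>2) * L2sq N f"
  if "f \<in> borel_measurable N" for f :: "'a \<Rightarrow> 'b::{real_normed_vector, second_countable_topology}"
  using that unfolding L2sq_def by (simp add: power_mult_distrib ennreal_mult nn_integral_cmult)

lemma L2sq_integrable:
  fixes f :: "'a \<Rightarrow> 'b::{real_normed_vector, second_countable_topology}"
  assumes "f \<in> borel_measurable N" "L2sq N f < \<infinity>"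
  shows "integrable N (\<lambda>x. (norm (f x))\<^sup>2)" "L2sq N f = ennreal (\<integral>x. (norm (f x))\<^sup>2 \<partial>N)"
proof -
  show *: "integrable N (\<lambda>x. (norm (f x))\<^sup>2)"
    by (rule integrableI_nonneg) (use assms in \<open>auto simp: L2sq_def\<close>)
  show "L2sq N f = ennreal (\<integral>x. (norm (f x))\<^sup>2 \<partial>N)"
    unfolding L2sq_def by (rule nn_integral_eq_integral[OF *]) simp
qed

lemma (in finite_measure) L2sq_simple_finite:
  fixes s :: "'a \<Rightarrow> 'b::{real_normed_vector, second_countable_topology}"
  assumes "simple_function M s"
  shows "L2sq M s < \<infinity>"
proof -
  have fin: "finite (s ` space M)" using assms by (rule simple_functionD)
  define B where "B = Max (insert 0 (norm ` s ` space M))"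
  have "norm (s x) \<le> B" if "x \<in> space M" for x
    unfolding B_def by (rule Max_ge) (use fin that in auto)
  then have "L2sq M s \<le> (\<integral>\<^sup>+ x. ennreal (B\<^sup>2) \<partial>M)"
    unfolding L2sq_def by (intro nn_integral_mono ennreal_leI power_mono) auto
  also have "\<dots> < \<infinity>" by (simp add: ennreal_mult_less_top emeasure_eq_measure)
  finally show ?thesis .
qed

text \<open>Simple functions that converge pointwise and satisfy \<open>\<parallel>s\<parallel> \<le> 2\<parallel>f\<parallel>\<close> also converge in
  \<open>L\<^sup>2\<close>, because \<open>\<parallel>f - s\<parallel>\<^sup>2 \<le> 9\<parallel>f\<parallel>\<^sup>2\<close> dominates.\<close>

lemma L2_simple_dense:
  fixes f :: "'a \<Rightarrow> 'b::{real_normed_vector, second_countable_topology}"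
  assumes [measurable]: "f \<in> borel_measurable N" and fin: "L2sq N f < \<infinity>" and "0 < (\<epsilon>::real)"
  shows "\<exists>s. simple_function N s \<and> L2sq N (\<lambda>x. f x - s x) < ennreal \<epsilon> \<and>
    (\<forall>x\<in>space N. norm (s x) \<le> 2 * norm (f x))"
proof -
  obtain s :: "nat \<Rightarrow> 'a \<Rightarrow> 'b" where S: "(\<forall>i. simple_function N (s i)) \<and> (\<forall>x\<in>space N. (\<lambda>i. s i x) \<longlonglongrightarrow> f x) \<and>
    (\<forall>i. \<forall>x\<in>space N. dist (s i x) 0 \<le> 2 * dist (f x) 0)"
    using borel_measurable_implies_sequence_metric[OF assms(1), of 0] by (elim exE) (erule that)
  then have s: "\<And>i. simple_function N (s i)" "\<And>x. x \<in> space N \<Longrightarrow> (\<lambda>i. s i x) \<longlonglongrightarrow> f x" by simp_all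
  have s_le: "norm (s i x) \<le> 2 * norm (f x)" if "x \<in> space N" for i x
    using S that by simp
  note [measurable] = borel_measurable_simple_function[OF s(1)]
  have "(\<lambda>i. L2sq N (\<lambda>x. f x - s i x)) \<longlonglongrightarrow> (\<integral>\<^sup>+ x. 0 \<partial>N)"
    unfolding L2sq_def
  proof (rule nn_integral_dominated_convergence[where w = "\<lambda>x. 9 * ennreal ((norm (f x))\<^sup>2)"])
    show "(\<integral>\<^sup>+ x. 9 * ennreal ((norm (f x))\<^sup>2) \<partial>N) < \<infinity>"
      using fin by (simp add: L2sq_def nn_integral_cmult ennreal_mult_less_top)
    show "AE x in N. ennreal ((norm (f x - s i x))\<^sup>2) \<le> 9 * ennreal ((norm (f x))\<^sup>2)" for i
    proof (rule AE_I2)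
      fix x assume "x \<in> space N"
      then have "norm (f x - s i x) \<le> 3 * norm (f x)"
        using norm_triangle_ineq4[of "f x" "s i x"] s_le[of x i] by simp
      then have "(norm (f x - s i x))\<^sup>2 \<le> (3 * norm (f x))\<^sup>2" by (intro power_mono) auto
      then have "ennreal ((norm (f x - s i x))\<^sup>2) \<le> ennreal (9 * (norm (f x))\<^sup>2)"
        by (intro ennreal_leI) (simp add: power_mult_distrib)
      then show "ennreal ((norm (f x - s i x))\<^sup>2) \<le> 9 * ennreal ((norm (f x))\<^sup>2)"
        by (simp add: ennreal_mult)
    qed
    show "AE x in N. (\<lambda>i. ennreal ((norm (f x - s i x))\<^sup>2)) \<longlonglongrightarrow> 0"
    proof (rule AE_I2)
      fix x assume "x \<in> space N"
      then have "(\<lambda>i. (norm (f x - s i x))\<^sup>2) \<longlonglongrightarrow> (norm (f x - f x))\<^sup>2"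
        by (intro tendsto_intros s(2))
      then show "(\<lambda>i. ennreal ((norm (f x - s i x))\<^sup>2)) \<longlonglongrightarrow> 0"
        using tendsto_ennrealI by fastforce
    qed
  qed simp_all
  then have "(\<lambda>i. L2sq N (\<lambda>x. f x - s i x)) \<longlonglongrightarrow> 0" by simp
  moreover have "0 < ennreal \<epsilon>" using \<open>0 < \<epsilon>\<close> by simp
  ultimately have "eventually (\<lambda>i. L2sq N (\<lambda>x. f x - s i x) < ennreal \<epsilon>) sequentially"
    by (rule order_tendstoD)
  then obtain i where "L2sq N (\<lambda>x. f x - s i x) < ennreal \<epsilon>" by (auto simp: eventually_sequentially)
  then show ?thesis using s(1) s_le by blast
qed

text \<open>An additive property that passes to \<open>L\<^sup>2\<close> limits need only be checked on indicators of a
  generating \<open>\<pi>\<close>-system. Dynkin's argument extends it to indicators of all measurable sets: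
  complements are differences, and the tail of a countable disjoint union is small in \<open>L\<^sup>2\<close> since
  the measure is finite. Sums then give simple functions, which are dense.\<close>

lemma L2_induct [consumes 6, case_names indicator add limit]:
  fixes f :: "'a \<Rightarrow> 'b::{real_normed_vector, second_countable_topology}"
  assumes fin: "finite_measure N"
    and gen: "Int_stable G" "sets N = sigma_sets (space N) G" "space N \<in> G"
    and f: "f \<in> borel_measurable N" "L2sq N f < \<infinity>"
    and indicator: "\<And>A e. A \<in> G \<Longrightarrow> P (\<lambda>x. indicat_real A x *\<^sub>R e)"
    and add: "\<And>f g. f \<in> borel_measurable N \<Longrightarrow> L2sq N f < \<infinity> \<Longrightarrow> g \<in> borel_measurable N \<Longrightarrow> L2sq N g < \<infinity> \<Longrightarrow>
      P f \<Longrightarrow> P g \<Longrightarrow> P (\<lambda>x. f x + g x)"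
    and limit: "\<And>f. f \<in> borel_measurable N \<Longrightarrow> L2sq N f < \<infinity> \<Longrightarrow>
      (\<And>\<epsilon>::real. \<epsilon> > 0 \<Longrightarrow> \<exists>g\<in>borel_measurable N. L2sq N g < \<infinity> \<and> P g \<and> L2sq N (\<lambda>x. f x - g x) < ennreal \<epsilon>) \<Longrightarrow> P f"
  shows "P f"
proof -
  interpret finite_measure N by fact
  have sub: "G \<subseteq> Pow (space N)"
  proof
    fix A assume "A \<in> G"
    then have "A \<in> sets N" using gen(2) by auto
    then show "A \<in> Pow (space N)" using sets.sets_into_space by auto
  qed
  have cong: "P f" if "f \<in> borel_measurable N" "g \<in> borel_measurable N" "L2sq N g < \<infinity>" "P g"
    "\<And>x. x \<in> space N \<Longrightarrow> f x = g x" for f g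
  proof -
    have "L2sq N f = L2sq N g" by (rule L2sq_cong) (rule that)
    moreover have "L2sq N (\<lambda>x. f x - g x) = L2sq N (\<lambda>x. 0 :: 'b)" by (rule L2sq_cong) (simp add: that)
    ultimately show ?thesis using that by (intro limit) auto
  qed
  have fin_ind: "L2sq N (\<lambda>x. indicat_real A x *\<^sub>R e) < \<infinity>" if "A \<in> sets N" for A and e :: 'b
  proof -
    have "L2sq N (\<lambda>x. indicat_real A x *\<^sub>R e) \<le> (\<integral>\<^sup>+ x. ennreal ((norm e)\<^sup>2) \<partial>N)"
      unfolding L2sq_def by (intro nn_integral_mono ennreal_leI power_mono) (auto simp: indicator_def)
    also have "\<dots> < \<infinity>" by (simp add: ennreal_mult_less_top emeasure_eq_measure)
    finally show ?thesis .
  qed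
  have meas_ind: "(\<lambda>x. indicat_real A x *\<^sub>R e) \<in> borel_measurable N" if "A \<in> sets N" for A and e :: 'b
    using that by measurable
  have zero: "P (\<lambda>x. 0)" using indicator[OF gen(3), of 0] by simp
  have sum: "P (\<lambda>x. \<Sum>i\<in>I. indicat_real (A i) x *\<^sub>R e i) \<and> L2sq N (\<lambda>x. \<Sum>i\<in>I. indicat_real (A i) x *\<^sub>R e i) < \<infinity>"
    if "finite I" "\<And>i. i \<in> I \<Longrightarrow> A i \<in> sets N \<and> P (\<lambda>x. indicat_real (A i) x *\<^sub>R e i)" for I :: "'i set" and A and e :: "'i \<Rightarrow> 'b"
    using that
  proof (induction I rule: finite_induct)
    case (insert i I)
    have m: "(\<lambda>x. \<Sum>i\<in>I. indicat_real (A i) x *\<^sub>R e i) \<in> borel_measurable N"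
      using insert.prems by (intro borel_measurable_sum meas_ind) auto
    have i: "A i \<in> sets N" "P (\<lambda>x. indicat_real (A i) x *\<^sub>R e i)" using insert.prems by auto
    have IH: "P (\<lambda>x. \<Sum>i\<in>I. indicat_real (A i) x *\<^sub>R e i)" "L2sq N (\<lambda>x. \<Sum>i\<in>I. indicat_real (A i) x *\<^sub>R e i) < \<infinity>"
      using insert by auto
    show ?case
      using insert.hyps add[OF meas_ind[OF i(1)] fin_ind[OF i(1)] m IH(2) i(2) IH(1)]
        L2sq_add_finite(1)[OF meas_ind[OF i(1)] m fin_ind[OF i(1)] IH(2)]
      by (simp only: sum.insert[OF insert.hyps])
  qed (simp add: zero)
  have ind: "\<forall>e. P (\<lambda>x. indicat_real A x *\<^sub>R e)" if "A \<in> sets N" for A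
  proof -
    have "A \<in> sigma_sets (space N) G" using that gen(2) by simp
    with gen(1) sub show ?thesis
    proof (induction rule: sigma_sets_induct_disjoint)
      case (basic A)
      then show ?case using indicator by blast
    next
      case empty
      then show ?case using zero by simp
    next
      case (compl A)
      then have A: "A \<in> sets N" using gen(2) by simp
      show ?case
      proof
        fix e :: 'b
        let ?g = "\<lambda>x. indicat_real (space N) x *\<^sub>R e + indicat_real A x *\<^sub>R (- e)"
        have Pg: "P ?g"
          by (rule add[OF meas_ind[OF sets.top] fin_ind[OF sets.top] meas_ind[OF A] fin_ind[OF A]
                indicator[OF gen(3)] compl.IH[rule_format]])
        have Lg: "L2sq N ?g < \<infinity>"
          by (rule L2sq_add_finite(1)[OF meas_ind[OF sets.top] meas_ind[OF A] fin_ind[OF sets.top] fin_ind[OF A]])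
        show "P (\<lambda>x. indicat_real (space N - A) x *\<^sub>R e)"
          by (rule cong[OF meas_ind borel_measurable_add[OF meas_ind[OF sets.top] meas_ind[OF A]] Lg Pg])
            (use A in \<open>auto simp: indicator_def\<close>)
      qed
    next
      case (union A)
      then have A [measurable]: "\<And>i. A i \<in> sets N" using gen(2) by auto
      show ?case
      proof
        fix e :: 'b
        define S where "S = (\<lambda>n x. \<Sum>i<n. indicat_real (A i) x *\<^sub>R e)"
        define R where "R = (\<lambda>n. (\<Union>i. A i) - (\<Union>i<n. A i))"
        have S: "P (S n)" "L2sq N (S n) < \<infinity>" for n
          using sum[of "{..<n}" A "\<lambda>_. e"] A union.IH unfolding S_def by auto
        have S_meas: "S n \<in> borel_measurable N" for n unfolding S_def by measurable
        have [measurable]: "R n \<in> sets N" for n unfolding R_def by measurable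
        have diff: "indicat_real (\<Union>i. A i) x *\<^sub>R e - S n x = indicat_real (R n) x *\<^sub>R e" for n x
        proof -
          have "(\<Sum>i<n. indicat_real (A i) x) = indicat_real (\<Union>i<n. A i) x"
            using union.hyps(1) by (intro indicator_UN_disjoint[symmetric]) (auto simp: disjoint_family_on_def)
          then show ?thesis
            unfolding S_def scaleR_sum_left[symmetric] R_def by (auto simp: indicator_def)
        qed
        have "decseq R" unfolding R_def decseq_def by force
        then have "(\<lambda>n. emeasure N (R n)) \<longlonglongrightarrow> emeasure N (\<Inter>n. R n)"
          by (intro Lim_emeasure_decseq) auto
        also have "(\<Inter>n. R n) = {}" unfolding R_def by auto
        finally have R0: "(\<lambda>n. ennreal ((norm e)\<^sup>2) * emeasure N (R n)) \<longlonglongrightarrow> ennreal ((norm e)\<^sup>2) * emeasure N {}"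
          by (intro tendsto_mult_ennreal) auto
        have L2: "L2sq N (\<lambda>x. indicat_real (\<Union>i. A i) x *\<^sub>R e - S n x) = ennreal ((norm e)\<^sup>2) * emeasure N (R n)" for n
        proof -
          have "L2sq N (\<lambda>x. indicat_real (\<Union>i. A i) x *\<^sub>R e - S n x) = (\<integral>\<^sup>+ x. ennreal ((norm e)\<^sup>2) * indicator (R n) x \<partial>N)"
            unfolding diff L2sq_def by (intro nn_integral_cong) (auto simp: indicator_def)
          then show ?thesis by (simp add: nn_integral_cmult_indicator)
        qed
        show "P (\<lambda>x. indicat_real (\<Union>i. A i) x *\<^sub>R e)"
        proof (rule limit[OF meas_ind fin_ind])
          fix \<epsilon> :: real assume "\<epsilon> > 0"
          then have "0 < ennreal \<epsilon>" by simp
          then have "eventually (\<lambda>n. ennreal ((norm e)\<^sup>2) * emeasure N (R n) < ennreal \<epsilon>) sequentially"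
            using R0 by (intro order_tendstoD[OF _ \<open>0 < ennreal \<epsilon>\<close>]) simp
          then obtain n where "ennreal ((norm e)\<^sup>2) * emeasure N (R n) < ennreal \<epsilon>"
            by (auto simp: eventually_sequentially)
          then show "\<exists>g\<in>borel_measurable N. L2sq N g < \<infinity> \<and> P g \<and>
              L2sq N (\<lambda>x. indicat_real (\<Union>i. A i) x *\<^sub>R e - g x) < ennreal \<epsilon>"
            using S S_meas L2 by (intro bexI[of _ "S n"]) auto
        qed auto
      qed
    qed
  qed
  have simple: "P s" if "simple_function N s" for s
  proof -
    let ?g = "\<lambda>x. \<Sum>y\<in>s ` space N. indicat_real (s -` {y} \<inter> space N) x *\<^sub>R y"
    have fin: "finite (s ` space N)" and A: "\<And>y. s -` {y} \<inter> space N \<in> sets N"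
      using that by (auto dest: simple_functionD)
    have g: "P ?g \<and> L2sq N ?g < \<infinity>"
      by (rule sum[OF fin]) (use A ind in auto)
    have mg: "?g \<in> borel_measurable N"
      using A by (intro borel_measurable_sum meas_ind)
    have eq: "s x = ?g x" if "x \<in> space N" for x
    proof -
      have "?g x = (\<Sum>y\<in>s ` space N. if y = s x then y else 0)"
        using that by (intro sum.cong) (auto simp: indicator_def)
      then show ?thesis using fin that by simp
    qed
    show ?thesis
      by (rule cong[OF borel_measurable_simple_function[OF that] mg conjunct2[OF g] conjunct1[OF g] eq])
  qed
  show ?thesis
  proof (rule limit[OF f])
    fix \<epsilon> :: real assume "\<epsilon> > 0"
    then obtain s where "simple_function N s" "L2sq N (\<lambda>x. f x - s x) < ennreal \<epsilon>"
      using L2_simple_dense[OF f] by blast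
    then show "\<exists>g\<in>borel_measurable N. L2sq N g < \<infinity> \<and> P g \<and> L2sq N (\<lambda>x. f x - g x) < ennreal \<epsilon>"
      by (intro bexI[of _ s] conjI simple L2sq_simple_finite borel_measurable_simple_function)
  qed
qed



section \<open>The \<open>\<gamma>\<close>-norm of an integral operator\<close>

lemma std_gaussians_moments:
  assumes "i < n" "j < n"
  shows "integrable (std_gaussians n) (\<lambda>x. x i * x j)"
    and "(LINT x|std_gaussians n. x i * x j) = (if i = j then 1 else 0)"
proof -
  interpret prob_space std_normal_distribution by (rule prob_space_normal_density) simp
  interpret product_sigma_finite "\<lambda>_::nat. std_normal_distribution"
    by standard
  define g where "g = (\<lambda>k (y::real). (if k = i then y else 1) * (if k = j then y else 1))"
  have prod: "(\<Prod>k<n. g k (x k)) = x i * x j" for x :: "nat \<Rightarrow> real"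
    unfolding g_def prod.distrib using assms by simp
  have int1: "integrable std_normal_distribution (\<lambda>x. x)" "(LINT x|std_normal_distribution. x) = 0"
    using integrable_std_normal_distribution_moment[of 1] integral_std_normal_distribution_moment_odd[of 1] by auto
  have int2: "integrable std_normal_distribution (\<lambda>x. x * x)" "(LINT x|std_normal_distribution. x * x) = 1"
    using integrable_std_normal_distribution_moment[of 2] std_normal_distribution_even_moments[of 1]
    by (auto simp: power2_eq_square fact_numeral)
  have g: "integrable std_normal_distribution (g k)" for k
    using int1 int2 by (cases "k = i"; cases "k = j") (auto simp: g_def)
  have gi: "(LINT y|std_normal_distribution. g k y) = (if i = j then 1 else if k = i \<or> k = j then 0 else 1)" for k
    using int1 int2 prob_space by (cases "k = i"; cases "k = j") (auto simp: g_def)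
  show "integrable (std_gaussians n) (\<lambda>x. x i * x j)"
    using product_integrable_prod[of "{..<n}" g] g unfolding prod std_gaussians_def by simp
  have "(LINT x|std_gaussians n. x i * x j) = (\<Prod>k<n. (LINT y|std_normal_distribution. g k y))"
    using product_integral_prod[of "{..<n}" g] g unfolding prod std_gaussians_def by simp
  also have "\<dots> = (if i = j then 1 else 0)"
    unfolding gi using assms by (auto intro!: prod_zero)
  finally show "(LINT x|std_gaussians n. x i * x j) = (if i = j then 1 else 0)" .
qed

lemma integral_sum_sum:
  fixes F :: "nat \<Rightarrow> nat \<Rightarrow> 'a \<Rightarrow> 'b::{real_normed_vector, complete_space, second_countable_topology}"
  assumes "\<And>i j. i < n \<Longrightarrow> j < n \<Longrightarrow> integrable N (F i j)"
  shows "(LINT u|N. (\<Sum>i<n. \<Sum>j<n. F i j u)) = (\<Sum>i<n. \<Sum>j<n. (LINT u|N. F i j u))"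
proof -
  have "(LINT u|N. (\<Sum>i<n. \<Sum>j<n. F i j u)) = (\<Sum>i<n. (LINT u|N. (\<Sum>j<n. F i j u)))"
    using assms by (intro Bochner_Integration.integral_sum Bochner_Integration.integrable_sum) auto
  also have "\<dots> = (\<Sum>i<n. \<Sum>j<n. (LINT u|N. F i j u))"
    using assms by (intro sum.cong refl Bochner_Integration.integral_sum) auto
  finally show ?thesis .
qed

lemma inner_sum_sum: "(\<Sum>i\<in>I. a i) \<bullet> (\<Sum>j\<in>J. b j) = (\<Sum>i\<in>I. \<Sum>j\<in>J. a i \<bullet> b j)"
  by (simp only: inner_sum_left) (simp only: inner_sum_right)

text \<open>Independence kills the mixed terms of the expanded square. This is why the \<open>\<gamma>\<close>-norm on a
  Hilbert space is the Hilbert-Schmidt norm.\<close>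

lemma gaussian_sum_norm_sq:
  fixes v :: "nat \<Rightarrow> 'e::real_inner"
  shows "(\<integral>\<^sup>+ x. ennreal ((norm (\<Sum>j<n. x j *\<^sub>R v j))\<^sup>2) \<partial>std_gaussians n) = ennreal (\<Sum>j<n. (norm (v j))\<^sup>2)"
proof -
  have eq: "(norm (\<Sum>j<n. x j *\<^sub>R v j))\<^sup>2 = (\<Sum>i<n. \<Sum>j<n. (x i * x j) * (v i \<bullet> v j))" for x
    unfolding power2_norm_eq_inner inner_sum_sum by (simp add: mult_ac)
  have int: "integrable (std_gaussians n) (\<lambda>x. \<Sum>i<n. \<Sum>j<n. (x i * x j) * (v i \<bullet> v j))"
    by (intro Bochner_Integration.integrable_sum integrable_mult_left std_gaussians_moments) auto
  have ij: "integrable (std_gaussians n) (\<lambda>x. (x i * x j) * (v i \<bullet> v j))" if "i < n" "j < n" for i j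
    using that by (intro integrable_mult_left std_gaussians_moments)
  have "(LINT x|std_gaussians n. (\<Sum>i<n. \<Sum>j<n. (x i * x j) * (v i \<bullet> v j))) =
    (\<Sum>i<n. \<Sum>j<n. (LINT x|std_gaussians n. (x i * x j) * (v i \<bullet> v j)))"
    by (rule integral_sum_sum) (rule ij)
  also have "\<dots> = (\<Sum>i<n. \<Sum>j<n. (if i = j then 1 else 0) * (v i \<bullet> v j))"
    by (intro sum.cong refl) (simp add: std_gaussians_moments)
  also have "\<dots> = (\<Sum>j<n. (norm (v j))\<^sup>2)"
  proof (intro sum.cong refl)
    fix i assume "i \<in> {..<n}"
    have "(\<Sum>j<n. (if i = j then 1 else 0) * (v i \<bullet> v j)) = (\<Sum>j<n. if i = j then v i \<bullet> v i else 0)"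
      by (intro sum.cong) auto
    then show "(\<Sum>j<n. (if i = j then 1 else 0) * (v i \<bullet> v j)) = (norm (v i))\<^sup>2"
      using \<open>i \<in> {..<n}\<close> by (simp add: power2_norm_eq_inner)
  qed
  finally have val: "(LINT x|std_gaussians n. (\<Sum>i<n. \<Sum>j<n. (x i * x j) * (v i \<bullet> v j))) = (\<Sum>j<n. (norm (v j))\<^sup>2)" .
  show ?thesis
    unfolding eq val[symmetric]
    by (rule nn_integral_eq_integral[OF int]) (simp flip: eq)
qed

lemma gamma_norm_sq_sum:
  fixes R :: "(real \<Rightarrow> real) \<Rightarrow> 'e::real_inner"
  shows "gamma_norm_sq T R = (SUP (n, h)\<in>{(n, h). L2_orthonormal T n h}. ennreal (\<Sum>j<n. (norm (R (h j)))\<^sup>2))"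
  unfolding gamma_norm_sq_def gaussian_sum_norm_sq ..

lemma gamma_norm_sq_cong:
  fixes R :: "(real \<Rightarrow> real) \<Rightarrow> 'e::real_inner"
  assumes "\<And>h. h \<in> L2_fun T \<Longrightarrow> R h = R' h"
  shows "gamma_norm_sq T R = gamma_norm_sq T R'"
  unfolding gamma_norm_sq_sum
  by (rule SUP_cong) (auto simp: L2_orthonormal_def assms intro!: arg_cong[where f=ennreal] sum.cong)

lemma sum_le_gamma_norm_sq:
  fixes R :: "(real \<Rightarrow> real) \<Rightarrow> 'e::real_inner"
  assumes "L2_orthonormal T n h"
  shows "ennreal (\<Sum>j<n. (norm (R (h j)))\<^sup>2) \<le> gamma_norm_sq T R"
  unfolding gamma_norm_sq_sum by (rule SUP_upper2[of "(n, h)"]) (auto simp: assms)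

lemma gamma_norm_sq_leI:
  fixes R :: "(real \<Rightarrow> real) \<Rightarrow> 'e::real_inner"
  assumes "\<And>n h. L2_orthonormal T n h \<Longrightarrow> ennreal (\<Sum>j<n. (norm (R (h j)))\<^sup>2) \<le> c"
  shows "gamma_norm_sq T R \<le> c"
  unfolding gamma_norm_sq_sum by (rule SUP_least) (auto simp: assms)

lemma finite_measure_time: "finite_measure (time_measure T)"
  by (rule finite_measureI) (simp add: space_restrict_space emeasure_restrict_space emeasure_lborel_Icc_eq)

lemma L2_fun_iff: "h \<in> L2_fun T \<longleftrightarrow> h \<in> borel_measurable (time_measure T) \<and> L2sq (time_measure T) h < \<infinity>"
proof -
  have "integrable (time_measure T) (\<lambda>u. (h u)\<^sup>2) \<longleftrightarrow> L2sq (time_measure T) h < \<infinity>" if "h \<in> borel_measurable (time_measure T)"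
    using that L2sq_integrable(1)[of h "time_measure T"] by (auto simp: L2sq_def integrable_iff_bounded)
  then show ?thesis by (auto simp: L2_fun_def)
qed

lemma L2sq_L2_fun: "h \<in> L2_fun T \<Longrightarrow> L2sq (time_measure T) h = ennreal (L2_inner T h h)"
  using L2sq_integrable(2)[of h "time_measure T"] by (simp add: L2_fun_iff L2_inner_def power2_eq_square)

lemma L2_inner_nonneg: "0 \<le> L2_inner T h h"
  unfolding L2_inner_def by (rule integral_nonneg_AE) simp

lemma L2_fun_add: "f \<in> L2_fun T \<Longrightarrow> g \<in> L2_fun T \<Longrightarrow> (\<lambda>u. f u + g u) \<in> L2_fun T"
  unfolding L2_fun_iff by (blast intro: borel_measurable_add borel_measurable_diff L2sq_add_finite)

lemma L2_fun_diff: "f \<in> L2_fun T \<Longrightarrow> g \<in> L2_fun T \<Longrightarrow> (\<lambda>u. f u - g u) \<in> L2_fun T"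
  unfolding L2_fun_iff by (blast intro: borel_measurable_add borel_measurable_diff L2sq_add_finite)

lemma L2_fun_cmult: "f \<in> L2_fun T \<Longrightarrow> (\<lambda>u. c * f u) \<in> L2_fun T"
  unfolding L2_fun_iff using L2sq_scaleR[of f "time_measure T" c] by (auto simp: ennreal_mult_less_top)

lemma L2_fun_zero: "(\<lambda>u. 0) \<in> L2_fun T"
  unfolding L2_fun_iff by simp

lemma L2_fun_sum: "(\<And>i. i \<in> I \<Longrightarrow> f i \<in> L2_fun T) \<Longrightarrow> (\<lambda>u. \<Sum>i\<in>I. f i u) \<in> L2_fun T"
  by (induction I rule: infinite_finite_induct) (auto simp: L2_fun_zero L2_fun_add)

lemma L2_fun_indicator:
  assumes "A \<in> sets (time_measure T)"
  shows "(\<lambda>u. indicat_real A u * c) \<in> L2_fun T"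
proof -
  interpret finite_measure "time_measure T" by (rule finite_measure_time)
  have "simple_function (time_measure T) (\<lambda>u. indicat_real A u * c)"
    using assms by (intro simple_function_mult simple_function_indicator simple_function_const)
  then show ?thesis unfolding L2_fun_iff using L2sq_simple_finite borel_measurable_simple_function by blast
qed

lemma integrable_mult_L2_fun:
  assumes "f \<in> L2_fun T" "g \<in> L2_fun T"
  shows "integrable (time_measure T) (\<lambda>u. f u * g u)"
proof (rule Bochner_Integration.integrable_bound)
  show "integrable (time_measure T) (\<lambda>u. (f u)\<^sup>2 + (g u)\<^sup>2)" using assms by (auto simp: L2_fun_def)
  show "AE u in time_measure T. norm (f u * g u) \<le> norm ((f u)\<^sup>2 + (g u)\<^sup>2)"
  proof (rule AE_I2)
    fix u
    have "2 * (\<bar>f u\<bar> * \<bar>g u\<bar>) \<le> (f u)\<^sup>2 + (g u)\<^sup>2" using sum_squares_bound[of "\<bar>f u\<bar>" "\<bar>g u\<bar>"] by simp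
    moreover have "0 \<le> \<bar>f u\<bar> * \<bar>g u\<bar>" by simp
    ultimately have "\<bar>f u\<bar> * \<bar>g u\<bar> \<le> (f u)\<^sup>2 + (g u)\<^sup>2" by linarith
    then show "norm (f u * g u) \<le> norm ((f u)\<^sup>2 + (g u)\<^sup>2)" by (simp add: abs_mult)
  qed
qed (use assms in \<open>auto simp: L2_fun_def\<close>)

definition kernel_op :: "real \<Rightarrow> (real \<Rightarrow> 'e) \<Rightarrow> (real \<Rightarrow> real) \<Rightarrow> 'e::{real_normed_vector, complete_space, second_countable_topology}" where
  "kernel_op T f h = (LINT u|time_measure T. h u *\<^sub>R f u)"

text \<open>Simple functions close to \<open>f\<close> in \<open>L\<^sup>1\<close> have Cauchy integrals, whose limit is the integral of
  \<open>f\<close>. Completeness enters as convergence of Cauchy sequences, so the sort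
  \<open>complete_space\<close> suffices in place of \<open>banach\<close>.\<close>

lemma integrableI_complete:
  fixes f :: "'a \<Rightarrow> 'b::{real_normed_vector, complete_space, second_countable_topology}"
  assumes [measurable]: "f \<in> borel_measurable N" and fin: "(\<integral>\<^sup>+ x. norm (f x) \<partial>N) < \<infinity>"
  shows "integrable N f"
proof -
  obtain s :: "nat \<Rightarrow> 'a \<Rightarrow> 'b" where S: "(\<forall>i. simple_function N (s i)) \<and> (\<forall>x\<in>space N. (\<lambda>i. s i x) \<longlonglongrightarrow> f x) \<and>
    (\<forall>i. \<forall>x\<in>space N. dist (s i x) 0 \<le> 2 * dist (f x) 0)"
    using borel_measurable_implies_sequence_metric[OF assms(1), of 0] by (elim exE) (erule that)
  then have s: "\<And>i. simple_function N (s i)" "\<And>x. x \<in> space N \<Longrightarrow> (\<lambda>i. s i x) \<longlonglongrightarrow> f x" by simp_all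
  have s_le: "norm (s i x) \<le> 2 * norm (f x)" if "x \<in> space N" for i x
    using S that by simp
  note [measurable] = borel_measurable_simple_function[OF s(1)]
  have int: "Bochner_Integration.simple_bochner_integrable N (s i)" for i
  proof (rule simple_bochner_integrableI_bounded[OF s(1)])
    have "(\<integral>\<^sup>+ x. norm (s i x) \<partial>N) \<le> (\<integral>\<^sup>+ x. 2 * ennreal (norm (f x)) \<partial>N)"
    proof (rule nn_integral_mono)
      fix x assume "x \<in> space N"
      then have "ennreal (norm (s i x)) \<le> ennreal (2 * norm (f x))" by (intro ennreal_leI s_le)
      then show "ennreal (norm (s i x)) \<le> 2 * ennreal (norm (f x))" by (simp add: ennreal_mult)
    qed
    also have "\<dots> < \<infinity>" using fin by (simp add: nn_integral_cmult ennreal_mult_less_top)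
    finally show "(\<integral>\<^sup>+ x. norm (s i x) \<partial>N) < \<infinity>" .
  qed
  have lim: "(\<lambda>i. \<integral>\<^sup>+ x. norm (f x - s i x) \<partial>N) \<longlonglongrightarrow> 0"
  proof -
    have "(\<lambda>i. \<integral>\<^sup>+ x. norm (f x - s i x) \<partial>N) \<longlonglongrightarrow> (\<integral>\<^sup>+ x. 0 \<partial>N)"
    proof (rule nn_integral_dominated_convergence[where w = "\<lambda>x. 3 * ennreal (norm (f x))"])
      show "(\<integral>\<^sup>+ x. 3 * ennreal (norm (f x)) \<partial>N) < \<infinity>"
        using fin by (simp add: nn_integral_cmult ennreal_mult_less_top)
      show "AE x in N. ennreal (norm (f x - s i x)) \<le> 3 * ennreal (norm (f x))" for i
      proof (rule AE_I2)
        fix x assume "x \<in> space N"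
        then have "norm (f x - s i x) \<le> 3 * norm (f x)"
          using norm_triangle_ineq4[of "f x" "s i x"] s_le[of x i] by simp
        then have "ennreal (norm (f x - s i x)) \<le> ennreal (3 * norm (f x))" by (rule ennreal_leI)
        then show "ennreal (norm (f x - s i x)) \<le> 3 * ennreal (norm (f x))" by (simp add: ennreal_mult)
      qed
      show "AE x in N. (\<lambda>i. ennreal (norm (f x - s i x))) \<longlonglongrightarrow> 0"
      proof (rule AE_I2)
        fix x assume "x \<in> space N"
        then have "(\<lambda>i. norm (f x - s i x)) \<longlonglongrightarrow> norm (f x - f x)" by (intro tendsto_intros s(2))
        then show "(\<lambda>i. ennreal (norm (f x - s i x))) \<longlonglongrightarrow> 0"
          using tendsto_ennrealI by fastforce
      qed
    qed simp_all
    then show ?thesis by simp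
  qed
  have "Cauchy (\<lambda>i. Bochner_Integration.simple_bochner_integral N (s i))"
  proof (rule metric_CauchyI)
    fix e :: real assume "0 < e"
    then have "0 < ennreal (e / 2)" by simp
    then have "eventually (\<lambda>i. (\<integral>\<^sup>+ x. norm (f x - s i x) \<partial>N) < ennreal (e / 2)) sequentially"
      using lim by (intro order_tendstoD)
    then obtain n where n: "\<And>i. i \<ge> n \<Longrightarrow> (\<integral>\<^sup>+ x. norm (f x - s i x) \<partial>N) < ennreal (e / 2)"
      by (auto simp: eventually_sequentially)
    have "dist (Bochner_Integration.simple_bochner_integral N (s i)) (Bochner_Integration.simple_bochner_integral N (s j)) < e" if "i \<ge> n" "j \<ge> n" for i j
    proof -
      have "ennreal (norm (Bochner_Integration.simple_bochner_integral N (s i) - Bochner_Integration.simple_bochner_integral N (s j))) \<le>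
          (\<integral>\<^sup>+ x. norm (f x - s i x) \<partial>N) + (\<integral>\<^sup>+ x. norm (f x - s j x) \<partial>N)"
        by (rule simple_bochner_integral_bounded[OF assms(1) int int])
      also have "\<dots> < ennreal (e / 2) + ennreal (e / 2)" by (intro add_strict_mono n that)
      also have "\<dots> = ennreal e" using \<open>0 < e\<close> by (simp flip: ennreal_plus)
      finally show ?thesis by (simp add: dist_norm ennreal_less_iff)
    qed
    then show "\<exists>n. \<forall>i\<ge>n. \<forall>j\<ge>n. dist (Bochner_Integration.simple_bochner_integral N (s i)) (Bochner_Integration.simple_bochner_integral N (s j)) < e" by blast
  qed
  then have "convergent (\<lambda>i. Bochner_Integration.simple_bochner_integral N (s i))" by (rule Cauchy_convergent)
  then obtain x where "(\<lambda>i. Bochner_Integration.simple_bochner_integral N (s i)) \<longlonglongrightarrow> x" by (auto simp: convergent_def)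
  then have "has_bochner_integral N f x"
    by (intro has_bochner_integral.intros[OF assms(1) int lim])
  then show ?thesis by (rule integrable.intros)
qed

lemma integrable_kernel:
  fixes f :: "real \<Rightarrow> 'e::{real_normed_vector, complete_space, second_countable_topology}"
  assumes h: "h \<in> L2_fun T" and f: "f \<in> borel_measurable (time_measure T)" "L2sq (time_measure T) f < \<infinity>"
  shows "integrable (time_measure T) (\<lambda>u. h u *\<^sub>R f u)"
proof (rule integrableI_complete)
  have "integrable (time_measure T) (\<lambda>u. norm (h u *\<^sub>R f u))"
  proof (rule Bochner_Integration.integrable_bound)
  show "integrable (time_measure T) (\<lambda>u. (h u)\<^sup>2 + (norm (f u))\<^sup>2)"
    using h L2sq_integrable(1)[OF f] by (auto simp: L2_fun_def)
  show "AE u in time_measure T. norm (norm (h u *\<^sub>R f u)) \<le> norm ((h u)\<^sup>2 + (norm (f u))\<^sup>2)"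
  proof (rule AE_I2)
    fix u
    have "2 * (\<bar>h u\<bar> * norm (f u)) \<le> (h u)\<^sup>2 + (norm (f u))\<^sup>2" using sum_squares_bound[of "\<bar>h u\<bar>" "norm (f u)"] by simp
    moreover have "0 \<le> \<bar>h u\<bar> * norm (f u)" by simp
    ultimately have "\<bar>h u\<bar> * norm (f u) \<le> (h u)\<^sup>2 + (norm (f u))\<^sup>2" by linarith
    then show "norm (norm (h u *\<^sub>R f u)) \<le> norm ((h u)\<^sup>2 + (norm (f u))\<^sup>2)" by simp
  qed
  qed (use h f in \<open>auto simp: L2_fun_def\<close>)
  then show "(\<integral>\<^sup>+ u. norm (h u *\<^sub>R f u) \<partial>time_measure T) < \<infinity>"
    by (simp add: integrable_iff_bounded)
qed (use h f in \<open>auto simp: L2_fun_def\<close>)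

lemma kernel_op_cmult: "kernel_op T f (\<lambda>u. c * h u) = c *\<^sub>R kernel_op T f h"
  unfolding kernel_op_def scaleR_scaleR[symmetric] by (rule integral_scaleR_right)

lemma kernel_op_diff:
  fixes f g :: "real \<Rightarrow> 'e::{real_normed_vector, complete_space, second_countable_topology}"
  assumes "f \<in> borel_measurable (time_measure T)" "L2sq (time_measure T) f < \<infinity>"
    "g \<in> borel_measurable (time_measure T)" "L2sq (time_measure T) g < \<infinity>" "h \<in> L2_fun T"
  shows "kernel_op T (\<lambda>u. f u - g u) h = kernel_op T f h - kernel_op T g h"
  unfolding kernel_op_def scaleR_diff_right
  by (intro Bochner_Integration.integral_diff integrable_kernel assms)

text \<open>Expand \<open>0 \<le> \<integral> \<parallel>f - (\<Sum>j<n. h\<^sub>j v\<^sub>j)\<parallel>\<^sup>2\<close> for the vector-valued Fourier coefficients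
  \<open>v\<^sub>j = \<integral> h\<^sub>j f\<close>.\<close>

lemma kernel_bessel:
  fixes f :: "real \<Rightarrow> 'e::{real_inner, complete_space, second_countable_topology}"
  assumes h: "L2_orthonormal T n h" and f: "f \<in> borel_measurable (time_measure T)" "L2sq (time_measure T) f < \<infinity>"
  shows "(\<Sum>j<n. (norm (kernel_op T f (h j)))\<^sup>2) \<le> (LINT u|time_measure T. (norm (f u))\<^sup>2)"
proof -
  let ?v = "\<lambda>j. kernel_op T f (h j)"
  have h_L2: "\<And>j. j < n \<Longrightarrow> h j \<in> L2_fun T"
    and h_orth: "\<And>i j. i < n \<Longrightarrow> j < n \<Longrightarrow> (LINT u|time_measure T. h i u * h j u) = (if i = j then 1 else 0)"
    using h by (auto simp: L2_orthonormal_def L2_inner_def)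
  have expand: "(norm (f u - (\<Sum>j<n. h j u *\<^sub>R ?v j)))\<^sup>2 = (norm (f u))\<^sup>2 - 2 * (\<Sum>j<n. ?v j \<bullet> (h j u *\<^sub>R f u))
      + (\<Sum>i<n. \<Sum>j<n. (h i u * h j u) * (?v i \<bullet> ?v j))" for u
  proof -
    have a: "f u \<bullet> (\<Sum>j<n. h j u *\<^sub>R ?v j) = (\<Sum>j<n. ?v j \<bullet> (h j u *\<^sub>R f u))"
      by (simp add: inner_sum_right inner_commute)
    have b: "(\<Sum>j<n. h j u *\<^sub>R ?v j) \<bullet> (\<Sum>j<n. h j u *\<^sub>R ?v j) = (\<Sum>i<n. \<Sum>j<n. (h i u * h j u) * (?v i \<bullet> ?v j))"
      unfolding inner_sum_sum by (simp add: mult_ac)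
    have c: "(\<Sum>j<n. h j u *\<^sub>R ?v j) \<bullet> f u = (\<Sum>j<n. ?v j \<bullet> (h j u *\<^sub>R f u))"
      unfolding a[symmetric] by (rule inner_commute)
    show ?thesis
      unfolding power2_norm_eq_inner inner_diff_left inner_diff_right a b c by argo
  qed
  have i1: "integrable (time_measure T) (\<lambda>u. ?v j \<bullet> (h j u *\<^sub>R f u))" if "j < n" for j
    using integrable_kernel[OF h_L2[OF that] f] by (rule integrable_inner_right)
  have i2: "integrable (time_measure T) (\<lambda>u. h i u * h j u)" if "i < n" "j < n" for i j
    using h_L2 that by (intro integrable_mult_L2_fun)
  have "0 \<le> (LINT u|time_measure T. (norm (f u - (\<Sum>j<n. h j u *\<^sub>R ?v j)))\<^sup>2)"
    by (rule integral_nonneg_AE) simp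
  also have "\<dots> = (LINT u|time_measure T. (norm (f u))\<^sup>2) - 2 * (\<Sum>j<n. (LINT u|time_measure T. ?v j \<bullet> (h j u *\<^sub>R f u)))
      + (\<Sum>i<n. \<Sum>j<n. (LINT u|time_measure T. h i u * h j u) * (?v i \<bullet> ?v j))"
  proof -
    have iB: "integrable (time_measure T) (\<lambda>u. \<Sum>j<n. ?v j \<bullet> (h j u *\<^sub>R f u))"
      using i1 by (intro Bochner_Integration.integrable_sum) auto
    have iC: "integrable (time_measure T) (\<lambda>u. \<Sum>i<n. \<Sum>j<n. (h i u * h j u) * (?v i \<bullet> ?v j))"
      using i2 by (intro Bochner_Integration.integrable_sum integrable_mult_left) auto
    have B: "(LINT u|time_measure T. (\<Sum>j<n. ?v j \<bullet> (h j u *\<^sub>R f u))) = (\<Sum>j<n. (LINT u|time_measure T. ?v j \<bullet> (h j u *\<^sub>R f u)))"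
      using i1 by (intro Bochner_Integration.integral_sum) auto
    have "(LINT u|time_measure T. (\<Sum>i<n. \<Sum>j<n. (h i u * h j u) * (?v i \<bullet> ?v j))) =
        (\<Sum>i<n. \<Sum>j<n. (LINT u|time_measure T. (h i u * h j u) * (?v i \<bullet> ?v j)))"
      using i2 by (intro integral_sum_sum integrable_mult_left) auto
    then have C: "(LINT u|time_measure T. (\<Sum>i<n. \<Sum>j<n. (h i u * h j u) * (?v i \<bullet> ?v j))) =
        (\<Sum>i<n. \<Sum>j<n. (LINT u|time_measure T. h i u * h j u) * (?v i \<bullet> ?v j))"
      by (simp only: integral_mult_left_zero)
    note iA = L2sq_integrable(1)[OF f]
    show ?thesis
      unfolding expand Bochner_Integration.integral_add[OF Bochner_Integration.integrable_diff[OF iA integrable_mult_right[OF iB]] iC]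
        Bochner_Integration.integral_diff[OF iA integrable_mult_right[OF iB]] integral_mult_right_zero B C ..
  qed
  also have "(\<Sum>j<n. (LINT u|time_measure T. ?v j \<bullet> (h j u *\<^sub>R f u))) = (\<Sum>j<n. (norm (?v j))\<^sup>2)"
  proof (intro sum.cong refl)
    fix j assume "j \<in> {..<n}"
    then have "(LINT u|time_measure T. ?v j \<bullet> (h j u *\<^sub>R f u)) = ?v j \<bullet> (LINT u|time_measure T. h j u *\<^sub>R f u)"
      using integrable_kernel[OF h_L2 f] by (intro integral_inner_right) auto
    then show "(LINT u|time_measure T. ?v j \<bullet> (h j u *\<^sub>R f u)) = (norm (?v j))\<^sup>2"
      by (simp add: power2_norm_eq_inner kernel_op_def)
  qed
  also have "(\<Sum>i<n. \<Sum>j<n. (LINT u|time_measure T. h i u * h j u) * (?v i \<bullet> ?v j)) = (\<Sum>j<n. (norm (?v j))\<^sup>2)"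
  proof (intro sum.cong refl)
    fix i assume "i \<in> {..<n}"
    then have "(\<Sum>j<n. (LINT u|time_measure T. h i u * h j u) * (?v i \<bullet> ?v j)) = (\<Sum>j<n. if i = j then ?v i \<bullet> ?v i else 0)"
      using h_orth by (intro sum.cong) auto
    then show "(\<Sum>j<n. (LINT u|time_measure T. h i u * h j u) * (?v i \<bullet> ?v j)) = (norm (?v i))\<^sup>2"
      using \<open>i \<in> {..<n}\<close> by (simp add: power2_norm_eq_inner)
  qed
  finally show ?thesis by simp
qed

text \<open>Cauchy-Schwarz is Bessel's inequality for the single vector \<open>h / \<parallel>h\<parallel>\<close>.\<close>

lemma norm_kernel_op_sq_le:
  fixes f :: "real \<Rightarrow> 'e::{real_inner, complete_space, second_countable_topology}"
  assumes h: "h \<in> L2_fun T" and f: "f \<in> borel_measurable (time_measure T)" "L2sq (time_measure T) f < \<infinity>"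
  shows "(norm (kernel_op T f h))\<^sup>2 \<le> L2_inner T h h * (LINT u|time_measure T. (norm (f u))\<^sup>2)"
proof (cases "L2_inner T h h = 0")
  case True
  then have "AE u in time_measure T. (h u)\<^sup>2 = 0"
    using h integral_nonneg_eq_0_iff_AE[of "time_measure T" "\<lambda>u. (h u)\<^sup>2"]
    by (simp add: L2_inner_def L2_fun_def power2_eq_square)
  then have "kernel_op T f h = (LINT u|time_measure T. 0)"
    unfolding kernel_op_def using h f by (intro integral_cong_AE) (auto simp: L2_fun_def)
  then show ?thesis using True by simp
next
  case False
  then have pos: "0 < L2_inner T h h" using L2_inner_nonneg[of T h] by simp
  let ?c = "1 / sqrt (L2_inner T h h)"
  have c2: "?c\<^sup>2 * L2_inner T h h = 1" using pos by (simp add: power_divide)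
  have "L2_inner T (\<lambda>u. ?c * h u) (\<lambda>u. ?c * h u) = (LINT u|time_measure T. ?c\<^sup>2 * (h u * h u))"
    unfolding L2_inner_def by (simp add: power2_eq_square mult_ac)
  also have "\<dots> = 1" using c2 unfolding L2_inner_def by simp
  finally have "L2_orthonormal T 1 (\<lambda>_ u. ?c * h u)"
    using L2_fun_cmult[OF h, of ?c] by (auto simp: L2_orthonormal_def)
  from kernel_bessel[OF this f]
  have "(norm (kernel_op T f (\<lambda>u. ?c * h u)))\<^sup>2 \<le> (LINT u|time_measure T. (norm (f u))\<^sup>2)" by simp
  also have "kernel_op T f (\<lambda>u. ?c * h u) = ?c *\<^sub>R kernel_op T f h"
    by (rule kernel_op_cmult)
  finally have "?c\<^sup>2 * (norm (kernel_op T f h))\<^sup>2 \<le> (LINT u|time_measure T. (norm (f u))\<^sup>2)"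
    by (simp add: power_mult_distrib power_divide)
  then have "L2_inner T h h * (?c\<^sup>2 * (norm (kernel_op T f h))\<^sup>2) \<le> L2_inner T h h * (LINT u|time_measure T. (norm (f u))\<^sup>2)"
    using pos by (intro mult_left_mono) auto
  also have "L2_inner T h h * (?c\<^sup>2 * (norm (kernel_op T f h))\<^sup>2) = (?c\<^sup>2 * L2_inner T h h) * (norm (kernel_op T f h))\<^sup>2"
    by (simp only: mult_ac)
  finally show ?thesis unfolding c2 by simp
qed

lemma kernel_op_L2_operators:
  fixes f :: "real \<Rightarrow> 'e::{real_inner, complete_space, second_countable_topology}"
  assumes f: "f \<in> borel_measurable (time_measure T)" "L2sq (time_measure T) f < \<infinity>"
  shows "kernel_op T f \<in> L2_operators T"
proof -
  have "norm (kernel_op T f h) \<le> sqrt (LINT u|time_measure T. (norm (f u))\<^sup>2) * sqrt (L2_inner T h h)" if "h \<in> L2_fun T" for h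
    using real_le_rsqrt[OF norm_kernel_op_sq_le[OF that f]] by (simp add: real_sqrt_mult mult.commute)
  then show ?thesis
    unfolding L2_operators_def using integrable_kernel[OF _ f]
    by (auto simp: kernel_op_cmult kernel_op_def[of T f "\<lambda>u. _ u + _ u"] scaleR_add_left) (auto simp: kernel_op_def)
qed

text \<open>Let \<open>s\<close> be a simple function close to \<open>f\<close>. The system consists of the normalised indicators of
  the level sets \<open>A\<close> of \<open>s\<close> that are not null. The operator maps the indicator of \<open>A\<close> to
  \<open>w = \<integral>\<^sub>A f\<close>, so it contributes \<open>\<parallel>w\<parallel>\<^sup>2 / |A|\<close>. Replacing \<open>f\<close> by its mean on \<open>A\<close> is the
  best approximation by a constant, hence this contribution is at least
  \<open>\<integral>\<^sub>A \<parallel>f\<parallel>\<^sup>2 - \<integral>\<^sub>A \<parallel>f - s\<parallel>\<^sup>2\<close>.\<close>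

lemma orthonormal_indicators_nearly_attain:
  fixes f :: "real \<Rightarrow> 'e::{real_inner, complete_space, second_countable_topology}"
  assumes f: "f \<in> borel_measurable (time_measure T)" "L2sq (time_measure T) f < \<infinity>" and "0 < \<epsilon>"
  shows "\<exists>n h. L2_orthonormal T n h \<and>
    (LINT u|time_measure T. (norm (f u))\<^sup>2) - \<epsilon> \<le> (\<Sum>j<n. (norm (kernel_op T f (h j)))\<^sup>2)"
proof -
  let ?N = "time_measure T"
  interpret finite_measure ?N by (rule finite_measure_time)
  obtain s where s: "simple_function ?N s" "L2sq ?N (\<lambda>u. f u - s u) < ennreal \<epsilon>"
    using L2_simple_dense[OF f \<open>0 < \<epsilon>\<close>] by blast
  have s_meas [measurable]: "s \<in> borel_measurable ?N" using s(1) by (rule borel_measurable_simple_function)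
  note f(1)[measurable]
  have fs: "(\<lambda>u. f u - s u) \<in> borel_measurable ?N" "L2sq ?N (\<lambda>u. f u - s u) < \<infinity>"
    using s(2) by (auto intro: less_trans)
  have err: "(LINT u|?N. (norm (f u - s u))\<^sup>2) < \<epsilon>"
    using s(2) unfolding L2sq_integrable(2)[OF fs] by (subst (asm) ennreal_less_iff) (auto intro!: integral_nonneg_AE)
  define Y where "Y = s ` space ?N"
  define A where "A = (\<lambda>y. s -` {y} \<inter> space ?N)"
  have Y: "finite Y" unfolding Y_def using s(1) by (rule simple_functionD)
  have A [measurable]: "A y \<in> sets ?N" for y unfolding A_def using s(1) by (rule simple_functionD)
  have A_disj: "A y \<inter> A z = {}" if "y \<noteq> z" for y z using that by (auto simp: A_def)
  define m where "m = (\<lambda>y. measure ?N (A y))"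
  define w where "w = (\<lambda>y. LINT u|?N. indicat_real (A y) u *\<^sub>R f u)"
  have ind_L2: "indicat_real (A y) \<in> L2_fun T" for y using L2_fun_indicator[OF A, of y 1] by simp
  have int_f: "integrable ?N (\<lambda>u. (norm (f u))\<^sup>2)" by (rule L2sq_integrable(1)[OF f])
  have int_fs: "integrable ?N (\<lambda>u. (norm (f u - s u))\<^sup>2)" by (rule L2sq_integrable(1)[OF fs])
  have int_Af: "integrable ?N (\<lambda>u. indicat_real (A y) u * (norm (f u))\<^sup>2)" for y
    using integrable_real_mult_indicator[OF A int_f, of y] by (simp add: mult.commute)
  have int_Afs: "integrable ?N (\<lambda>u. indicat_real (A y) u * (norm (f u - s u))\<^sup>2)" for y
    using integrable_real_mult_indicator[OF A int_fs, of y] by (simp add: mult.commute)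
  have int_w: "integrable ?N (\<lambda>u. indicat_real (A y) u *\<^sub>R f u)" for y
    by (rule integrable_kernel[OF ind_L2 f])
  have int_ind: "integrable ?N (indicat_real (A y))" for y
    by (rule integrable_real_indicator) (auto simp: emeasure_eq_measure)
  have ind_m: "(LINT u|?N. indicat_real (A y) u) = m y" for y
  proof -
    have "A y \<inter> space ?N = A y" using sets.sets_into_space[OF A[of y]] by auto
    then show ?thesis unfolding m_def Bochner_Integration.integral_indicator by simp
  qed
  \<comment> \<open>On \<open>A y\<close> the function \<open>s\<close> is the constant \<open>y\<close>, so the square expands with constant coefficients.\<close>
  have level: "(LINT u|?N. indicat_real (A y) u * (norm (f u))\<^sup>2) - (LINT u|?N. indicat_real (A y) u * (norm (f u - s u))\<^sup>2)
      = 2 * (y \<bullet> w y) - m y * (norm y)\<^sup>2" for y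
  proof -
    have "indicat_real (A y) u * (norm (f u))\<^sup>2 - indicat_real (A y) u * (norm (f u - s u))\<^sup>2
        = 2 * (y \<bullet> (indicat_real (A y) u *\<^sub>R f u)) - (norm y)\<^sup>2 * indicat_real (A y) u" if "u \<in> space ?N" for u
      using that
      by (auto simp: indicator_def A_def power2_norm_eq_inner inner_diff_left inner_diff_right inner_commute)
    then have "(LINT u|?N. indicat_real (A y) u * (norm (f u))\<^sup>2 - indicat_real (A y) u * (norm (f u - s u))\<^sup>2)
        = (LINT u|?N. 2 * (y \<bullet> (indicat_real (A y) u *\<^sub>R f u)) - (norm y)\<^sup>2 * indicat_real (A y) u)"
      by (intro Bochner_Integration.integral_cong) auto
    also have "\<dots> = (LINT u|?N. 2 * (y \<bullet> (indicat_real (A y) u *\<^sub>R f u))) - (LINT u|?N. (norm y)\<^sup>2 * indicat_real (A y) u)"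
      by (intro Bochner_Integration.integral_diff integrable_mult_right integrable_inner_right int_w int_ind)
    also have "\<dots> = 2 * (y \<bullet> w y) - (norm y)\<^sup>2 * m y"
      unfolding integral_mult_right_zero integral_inner_right[OF int_w] w_def ind_m ..
    finally show ?thesis using int_Af[of y] int_Afs[of y] by (simp add: mult.commute)
  qed
  \<comment> \<open>Expanding \<open>0 \<le> \<parallel>w y - m y *\<^sub>R y\<parallel>\<^sup>2\<close>; on a null level set both sides vanish.\<close>
  have level_le: "2 * (y \<bullet> w y) - m y * (norm y)\<^sup>2 \<le> (if m y > 0 then (norm (w y))\<^sup>2 / m y else 0)" for y
  proof (cases "m y > 0")
    case True
    have "0 \<le> (norm (w y - m y *\<^sub>R y))\<^sup>2" by simp
    also have "\<dots> = (norm (w y))\<^sup>2 - m y * (2 * (y \<bullet> w y)) + m y * (m y * (norm y)\<^sup>2)"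
      by (simp add: power2_norm_eq_inner inner_diff_left inner_diff_right inner_commute algebra_simps)
    finally have "m y * (2 * (y \<bullet> w y) - m y * (norm y)\<^sup>2) \<le> (norm (w y))\<^sup>2" by (simp add: algebra_simps)
    then show ?thesis using True by (simp add: pos_le_divide_eq mult.commute)
  next
    case False
    then have "m y = 0" unfolding m_def by (simp add: zero_less_measure_iff)
    then have "AE u in ?N. u \<notin> A y"
      unfolding m_def using A[of y] by (intro AE_not_in null_setsI) (auto simp: emeasure_eq_measure)
    then have "w y = (LINT u|?N. 0)" unfolding w_def by (intro integral_cong_AE) (auto simp: indicator_def)
    then show ?thesis using \<open>m y = 0\<close> by simp
  qed
  have part: "(\<Sum>y\<in>Y. indicat_real (A y) u * g u) = g u" if "u \<in> space ?N" for g :: "real \<Rightarrow> real" and u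
  proof -
    have "(\<Sum>y\<in>Y. indicat_real (A y) u * g u) = (\<Sum>y\<in>Y. if y = s u then g u else 0)"
      using that by (intro sum.cong) (auto simp: A_def indicator_def)
    then show ?thesis using Y that by (simp add: Y_def)
  qed
  have sum_f: "(\<Sum>y\<in>Y. (LINT u|?N. indicat_real (A y) u * (norm (f u))\<^sup>2)) = (LINT u|?N. (norm (f u))\<^sup>2)"
    unfolding Bochner_Integration.integral_sum[symmetric, OF int_Af]
    by (intro Bochner_Integration.integral_cong refl part)
  have sum_fs: "(\<Sum>y\<in>Y. (LINT u|?N. indicat_real (A y) u * (norm (f u - s u))\<^sup>2)) = (LINT u|?N. (norm (f u - s u))\<^sup>2)"
    unfolding Bochner_Integration.integral_sum[symmetric, OF int_Afs]
    by (intro Bochner_Integration.integral_cong refl part)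
  define Y' where "Y' = {y \<in> Y. m y > 0}"
  have "finite Y'" unfolding Y'_def using Y by simp
  then obtain b where b: "bij_betw b {..<card Y'} Y'"
    using ex_bij_betw_nat_finite atLeast0LessThan by metis
  define h where "h = (\<lambda>j u. indicat_real (A (b j)) u * (1 / sqrt (m (b j))))"
  have bY: "m (b j) > 0" if "j < card Y'" for j
    using b that by (auto simp: bij_betw_def Y'_def)
  have orth: "L2_orthonormal T (card Y') h"
    unfolding L2_orthonormal_def
  proof (intro conjI allI impI)
    show "h j \<in> L2_fun T" for j unfolding h_def by (rule L2_fun_indicator[OF A])
    fix i j assume ij: "i < card Y'" "j < card Y'"
    show "L2_inner T (h i) (h j) = (if i = j then 1 else 0)"
    proof (cases "i = j")
      case True
      have "L2_inner T (h i) (h i) = (LINT u|?N. indicat_real (A (b i)) u * (1 / m (b i)))"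
        unfolding L2_inner_def h_def using bY[OF ij(1)]
        by (intro Bochner_Integration.integral_cong) (auto simp: indicator_def)
      also have "\<dots> = m (b i) * (1 / m (b i))" unfolding integral_mult_left_zero ind_m ..
      also have "\<dots> = 1" using bY[OF ij(1)] by simp
      finally show ?thesis using True by simp
    next
      case False
      then have "b i \<noteq> b j" using b ij by (auto simp: bij_betw_def inj_on_def)
      then have eq: "(\<lambda>u. h i u * h j u) = (\<lambda>u. 0)"
      proof (intro ext)
        fix u
        have "u \<notin> A (b i) \<or> u \<notin> A (b j)" using A_disj[OF \<open>b i \<noteq> b j\<close>] by blast
        then show "h i u * h j u = 0" by (auto simp: h_def)
      qed
      show ?thesis using False unfolding L2_inner_def eq by simp
    qed
  qed
  have val: "(norm (kernel_op T f (h j)))\<^sup>2 = (norm (w (b j)))\<^sup>2 / m (b j)" if "j < card Y'" for j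
  proof -
    have "kernel_op T f (h j) = (LINT u|?N. (1 / sqrt (m (b j))) *\<^sub>R (indicat_real (A (b j)) u *\<^sub>R f u))"
      unfolding kernel_op_def h_def by (intro Bochner_Integration.integral_cong) auto
    also have "\<dots> = (1 / sqrt (m (b j))) *\<^sub>R w (b j)" unfolding w_def by (rule integral_scaleR_right)
    finally show ?thesis using bY[OF that] by (simp add: power_mult_distrib power_divide)
  qed
  have "(\<Sum>j<card Y'. (norm (kernel_op T f (h j)))\<^sup>2) = (\<Sum>j<card Y'. (norm (w (b j)))\<^sup>2 / m (b j))"
    using val by (intro sum.cong) auto
  also have "\<dots> = (\<Sum>y\<in>Y'. (norm (w y))\<^sup>2 / m y)" by (rule sum.reindex_bij_betw[OF b])
  also have "\<dots> = (\<Sum>y\<in>Y. if m y > 0 then (norm (w y))\<^sup>2 / m y else 0)"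
    unfolding Y'_def by (rule sum.inter_filter[OF Y])
  also have "\<dots> \<ge> (\<Sum>y\<in>Y. 2 * (y \<bullet> w y) - m y * (norm y)\<^sup>2)"
    by (intro sum_mono level_le)
  finally have "(LINT u|?N. (norm (f u))\<^sup>2) - (LINT u|?N. (norm (f u - s u))\<^sup>2) \<le> (\<Sum>j<card Y'. (norm (kernel_op T f (h j)))\<^sup>2)"
    unfolding level[symmetric] sum_subtractf sum_f sum_fs .
  then show ?thesis using err orth by (intro exI[of _ "card Y'"] exI[of _ h]) auto
qed

theorem gamma_norm_sq_kernel_op:
  fixes f :: "real \<Rightarrow> 'e::{real_inner, complete_space, second_countable_topology}"
  assumes f: "f \<in> borel_measurable (time_measure T)" "L2sq (time_measure T) f < \<infinity>"
  shows "gamma_norm_sq T (kernel_op T f) = L2sq (time_measure T) f"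
proof (rule antisym)
  show "gamma_norm_sq T (kernel_op T f) \<le> L2sq (time_measure T) f"
    unfolding L2sq_integrable(2)[OF f] by (intro gamma_norm_sq_leI ennreal_leI kernel_bessel f)
  show "L2sq (time_measure T) f \<le> gamma_norm_sq T (kernel_op T f)"
  proof (rule ennreal_le_epsilon)
    fix \<epsilon> :: real assume "0 < \<epsilon>"
    then obtain n h where h: "L2_orthonormal T n h"
      "(LINT u|time_measure T. (norm (f u))\<^sup>2) - \<epsilon> \<le> (\<Sum>j<n. (norm (kernel_op T f (h j)))\<^sup>2)"
      using orthonormal_indicators_nearly_attain[OF f] by blast
    have "L2sq (time_measure T) f \<le> ennreal ((\<Sum>j<n. (norm (kernel_op T f (h j)))\<^sup>2) + \<epsilon>)"
      unfolding L2sq_integrable(2)[OF f] using h(2) by (intro ennreal_leI) simp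
    also have "\<dots> = ennreal (\<Sum>j<n. (norm (kernel_op T f (h j)))\<^sup>2) + ennreal \<epsilon>"
      using \<open>0 < \<epsilon>\<close> by (intro ennreal_plus) (auto intro: sum_nonneg)
    also have "\<dots> \<le> gamma_norm_sq T (kernel_op T f) + ennreal \<epsilon>"
      by (intro add_right_mono sum_le_gamma_norm_sq h(1))
    finally show "L2sq (time_measure T) f \<le> gamma_norm_sq T (kernel_op T f) + ennreal \<epsilon>" .
  qed
qed

text \<open>Parseval in a finite-dimensional range splits the sum of \<open>\<parallel>R h\<^sub>j\<parallel>\<^sup>2\<close> into finitely many coordinate
  functionals \<open>h \<mapsto> R h \<bullet> e\<^sub>k\<close>, and Bessel's inequality bounds the contribution of each by the
  squared operator norm of \<open>R\<close>.\<close>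

lemma gamma_norm_sq_finite_rank:
  fixes R :: "(real \<Rightarrow> real) \<Rightarrow> 'e::real_inner"
  assumes "R \<in> finite_rank_operators T"
  shows "gamma_norm_sq T R < \<infinity>"
proof -
  from assms obtain B where R: "R \<in> L2_operators T" and B: "finite B" "R ` L2_fun T \<subseteq> span B"
    by (auto simp: finite_rank_operators_def)
  from R obtain C where "\<forall>f\<in>L2_fun T. norm (R f) \<le> C * sqrt (L2_inner T f f)"
    unfolding L2_operators_def by blast
  then have C: "\<And>f. f \<in> L2_fun T \<Longrightarrow> norm (R f) \<le> C * sqrt (L2_inner T f f)" by blast
  have R_add: "\<And>f g. f \<in> L2_fun T \<Longrightarrow> g \<in> L2_fun T \<Longrightarrow> R (\<lambda>u. f u + g u) = R f + R g"
    and R_scale: "\<And>c f. f \<in> L2_fun T \<Longrightarrow> R (\<lambda>u. c * f u) = c *\<^sub>R R f"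
    using R by (auto simp: L2_operators_def)
  have R_zero: "R (\<lambda>u. 0) = 0" using R_scale[OF L2_fun_zero, of 0] by simp
  obtain e K where e: "orthonormal_seq e" "\<And>x. x \<in> span B \<Longrightarrow> (norm x)\<^sup>2 = (\<Sum>k<K. (x \<bullet> e k)\<^sup>2)"
    using parseval_finite_span[OF B(1)] by blast
  have "gamma_norm_sq T R \<le> ennreal (real K * C\<^sup>2)"
  proof (rule gamma_norm_sq_leI, rule ennreal_leI)
    fix n h assume h: "L2_orthonormal T n h"
    then have hL: "\<And>j. j < n \<Longrightarrow> h j \<in> L2_fun T"
      and h_orth: "\<And>i j. i < n \<Longrightarrow> j < n \<Longrightarrow> (LINT u|time_measure T. h i u * h j u) = (if i = j then 1 else 0)"
      by (auto simp: L2_orthonormal_def L2_inner_def)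
    have coord: "(\<Sum>j<n. (R (h j) \<bullet> e k)\<^sup>2) \<le> C\<^sup>2" for k
    proof -
      \<comment> \<open>Bessel by duality: the functional is tested on \<open>\<Sum>j<n. a j h j\<close>, where its value and the squared norm of the argument are both \<open>S\<close>.\<close>
      define a where "a = (\<lambda>j. R (h j) \<bullet> e k)"
      define S where "S = (\<Sum>j<n. (a j)\<^sup>2)"
      have sum_R: "m \<le> n \<Longrightarrow> R (\<lambda>u. \<Sum>j<m. a j * h j u) = (\<Sum>j<m. a j *\<^sub>R R (h j))" for m
      proof (induction m)
        case (Suc m)
        have "(\<lambda>u. \<Sum>j<m. a j * h j u) \<in> L2_fun T"
          using hL Suc.prems by (intro L2_fun_sum L2_fun_cmult) auto
        then show ?case
          using Suc R_add[of "\<lambda>u. \<Sum>j<m. a j * h j u" "\<lambda>u. a m * h m u"] R_scale hL[of m]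
          by (simp add: L2_fun_cmult)
      qed (simp add: R_zero)
      let ?g = "\<lambda>u. \<Sum>j<n. a j * h j u"
      have g: "?g \<in> L2_fun T" using hL by (auto intro!: L2_fun_sum L2_fun_cmult)
      have sq: "?g u * ?g u = (\<Sum>i<n. \<Sum>j<n. (a i * a j) * (h i u * h j u))" for u
        by (simp add: sum_product mult_ac)
      have "L2_inner T ?g ?g = (\<Sum>i<n. \<Sum>j<n. (a i * a j) * (if i = j then 1 else 0))"
      proof -
        have "L2_inner T ?g ?g = (LINT u|time_measure T. (\<Sum>i<n. \<Sum>j<n. (a i * a j) * (h i u * h j u)))"
          unfolding L2_inner_def by (intro Bochner_Integration.integral_cong refl sq)
        also have "\<dots> = (\<Sum>i<n. \<Sum>j<n. (LINT u|time_measure T. (a i * a j) * (h i u * h j u)))"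
          using hL by (intro integral_sum_sum integrable_mult_right integrable_mult_L2_fun) auto
        finally show ?thesis using h_orth by simp
      qed
      also have "\<dots> = S" unfolding S_def by (simp add: power2_eq_square if_distrib cong: if_cong)
      finally have gS: "L2_inner T ?g ?g = S" .
      have S0: "S \<ge> 0" unfolding S_def by (intro sum_nonneg) auto
      have "R ?g \<bullet> e k = (\<Sum>j<n. a j *\<^sub>R R (h j)) \<bullet> e k" by (simp only: sum_R[OF order_refl])
      also have "\<dots> = S" unfolding inner_sum_left S_def by (simp add: power2_eq_square a_def)
      finally have "S = R ?g \<bullet> e k" by simp
      also have "\<dots> \<le> norm (R ?g) * norm (e k)" by (rule norm_cauchy_schwarz)
      also have "\<dots> \<le> norm (R ?g) * 1"
        using e(1) unfolding orthonormal_seq_def by (intro mult_left_mono) (metis norm_zero zero_le_one order_refl, simp)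
      also have "\<dots> \<le> C * sqrt S" using C[OF g] unfolding gS by simp
      finally have le: "S \<le> C * sqrt S" .
      show ?thesis
      proof (cases "S = 0")
        case False
        then have "sqrt S > 0" using S0 by simp
        moreover have "sqrt S * sqrt S \<le> C * sqrt S" using le S0 by simp
        ultimately have "sqrt S \<le> C" by (metis mult_right_le_imp_le)
        then have "(sqrt S)\<^sup>2 \<le> C\<^sup>2" using S0 by (intro power_mono) auto
        then show ?thesis using S0 by (simp add: S_def a_def)
      qed (simp add: S_def a_def)
    qed
    have "(\<Sum>j<n. (norm (R (h j)))\<^sup>2) = (\<Sum>j<n. \<Sum>k<K. (R (h j) \<bullet> e k)\<^sup>2)"
      using B(2) hL by (intro sum.cong e(2)) auto
    also have "\<dots> = (\<Sum>k<K. \<Sum>j<n. (R (h j) \<bullet> e k)\<^sup>2)" by (rule sum.swap)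
    also have "\<dots> \<le> (\<Sum>k<K. C\<^sup>2)" by (intro sum_mono coord)
    finally show "(\<Sum>j<n. (norm (R (h j)))\<^sup>2) \<le> real K * C\<^sup>2" by simp
  qed
  then show ?thesis by (rule le_less_trans) simp
qed

lemma gamma_norm_sq_gamma_space:
  fixes R :: "(real \<Rightarrow> real) \<Rightarrow> 'e::real_inner"
  assumes "R \<in> gamma_space T"
  shows "gamma_norm_sq T R < \<infinity>"
proof -
  obtain S where S: "S \<in> finite_rank_operators T" "gamma_norm_sq T (op_diff R S) < ennreal (1\<^sup>2)"
    using assms unfolding gamma_space_def by (auto dest: spec[of _ 1])
  have "gamma_norm_sq T R \<le> 2 * gamma_norm_sq T (op_diff R S) + 2 * gamma_norm_sq T S"
  proof (rule gamma_norm_sq_leI)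
    fix n h assume h: "L2_orthonormal T n h"
    have "(\<Sum>j<n. (norm (R (h j)))\<^sup>2) \<le> (\<Sum>j<n. 2 * (norm (op_diff R S (h j)))\<^sup>2 + 2 * (norm (S (h j)))\<^sup>2)"
    proof (rule sum_mono)
      fix j show "(norm (R (h j)))\<^sup>2 \<le> 2 * (norm (op_diff R S (h j)))\<^sup>2 + 2 * (norm (S (h j)))\<^sup>2"
        using norm_add_sq_le[of "op_diff R S (h j)" "S (h j)"] by (simp add: op_diff_def)
    qed
    also have "\<dots> = 2 * (\<Sum>j<n. (norm (op_diff R S (h j)))\<^sup>2) + 2 * (\<Sum>j<n. (norm (S (h j)))\<^sup>2)"
      by (simp add: sum.distrib sum_distrib_left)
    finally have "ennreal (\<Sum>j<n. (norm (R (h j)))\<^sup>2) \<le>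
        ennreal (2 * (\<Sum>j<n. (norm (op_diff R S (h j)))\<^sup>2) + 2 * (\<Sum>j<n. (norm (S (h j)))\<^sup>2))" by (rule ennreal_leI)
    also have "\<dots> = 2 * ennreal (\<Sum>j<n. (norm (op_diff R S (h j)))\<^sup>2) + 2 * ennreal (\<Sum>j<n. (norm (S (h j)))\<^sup>2)"
      by (simp add: ennreal_plus ennreal_mult sum_nonneg)
    also have "\<dots> \<le> 2 * gamma_norm_sq T (op_diff R S) + 2 * gamma_norm_sq T S"
      by (intro add_mono mult_left_mono sum_le_gamma_norm_sq h) auto
    finally show "ennreal (\<Sum>j<n. (norm (R (h j)))\<^sup>2) \<le> 2 * gamma_norm_sq T (op_diff R S) + 2 * gamma_norm_sq T S" .
  qed
  also have "\<dots> < \<infinity>"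
    using S gamma_norm_sq_finite_rank[OF S(1)] less_trans[OF S(2), of \<infinity>] by (auto simp: ennreal_mult_less_top)
  finally show ?thesis .
qed

lemma kernel_op_simple_finite_rank:
  fixes s :: "real \<Rightarrow> 'e::{real_inner, complete_space, second_countable_topology}"
  assumes "simple_function (time_measure T) s"
  shows "kernel_op T s \<in> finite_rank_operators T"
proof -
  interpret finite_measure "time_measure T" by (rule finite_measure_time)
  have s: "s \<in> borel_measurable (time_measure T)" "L2sq (time_measure T) s < \<infinity>"
    using assms borel_measurable_simple_function L2sq_simple_finite by auto
  let ?Y = "s ` space (time_measure T)"
  let ?A = "\<lambda>y. s -` {y} \<inter> space (time_measure T)"
  have Y: "finite ?Y" by (rule simple_functionD(1)[OF assms])
  have A: "?A y \<in> sets (time_measure T)" for y by (rule simple_functionD(2)[OF assms])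
  have "kernel_op T s h \<in> span ?Y" if h: "h \<in> L2_fun T" for h
  proof -
    have "h u *\<^sub>R s u = (\<Sum>y\<in>?Y. (h u * indicat_real (?A y) u) *\<^sub>R y)" if "u \<in> space (time_measure T)" for u
    proof -
      have "(\<Sum>y\<in>?Y. (h u * indicat_real (?A y) u) *\<^sub>R y) = (\<Sum>y\<in>?Y. if y = s u then h u *\<^sub>R y else 0)"
        using that by (intro sum.cong) (auto simp: indicator_def)
      then show ?thesis using Y that by simp
    qed
    then have "kernel_op T s h = (LINT u|time_measure T. (\<Sum>y\<in>?Y. (h u * indicat_real (?A y) u) *\<^sub>R y))"
      unfolding kernel_op_def by (intro Bochner_Integration.integral_cong) auto
    also have "\<dots> = (\<Sum>y\<in>?Y. (LINT u|time_measure T. h u * indicat_real (?A y) u) *\<^sub>R y)"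
    proof -
      have int: "integrable (time_measure T) (\<lambda>u. h u * indicat_real (?A y) u)" for y
        using integrable_mult_L2_fun[OF h L2_fun_indicator[OF A, of y 1]] by simp
      have "(LINT u|time_measure T. (\<Sum>y\<in>?Y. (h u * indicat_real (?A y) u) *\<^sub>R y)) =
          (\<Sum>y\<in>?Y. (LINT u|time_measure T. (h u * indicat_real (?A y) u) *\<^sub>R y))"
        by (intro Bochner_Integration.integral_sum integrable_scaleR_left int)
      then show ?thesis by (simp only: integral_scaleR_left[OF int])
    qed
    also have "\<dots> \<in> span ?Y" by (intro span_sum span_scale span_base)
    finally show ?thesis .
  qed
  then show ?thesis
    unfolding finite_rank_operators_def using kernel_op_L2_operators[OF s] Y by blast
qed

lemma kernel_op_gamma_space:
  fixes f :: "real \<Rightarrow> 'e::{real_inner, complete_space, second_countable_topology}"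
  assumes f: "f \<in> borel_measurable (time_measure T)" "L2sq (time_measure T) f < \<infinity>"
  shows "kernel_op T f \<in> gamma_space T"
  unfolding gamma_space_def
proof (intro CollectI conjI allI impI kernel_op_L2_operators f)
  interpret finite_measure "time_measure T" by (rule finite_measure_time)
  fix \<epsilon> :: real assume "0 < \<epsilon>"
  then obtain s where s: "simple_function (time_measure T) s" "L2sq (time_measure T) (\<lambda>u. f u - s u) < ennreal (\<epsilon>\<^sup>2)"
    using L2_simple_dense[OF f, of "\<epsilon>\<^sup>2"] by auto
  have s': "s \<in> borel_measurable (time_measure T)" "L2sq (time_measure T) s < \<infinity>"
    using s(1) borel_measurable_simple_function L2sq_simple_finite by auto
  have "gamma_norm_sq T (op_diff (kernel_op T f) (kernel_op T s)) = gamma_norm_sq T (kernel_op T (\<lambda>u. f u - s u))"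
    by (rule gamma_norm_sq_cong) (simp add: op_diff_def kernel_op_diff[OF f s'])
  also have "\<dots> = L2sq (time_measure T) (\<lambda>u. f u - s u)"
    by (rule gamma_norm_sq_kernel_op[OF borel_measurable_diff[OF f(1) s'(1)]
          L2sq_add_finite(2)[OF f(1) s'(1) f(2) s'(2)]])
  finally show "\<exists>S\<in>finite_rank_operators T. gamma_norm_sq T (op_diff (kernel_op T f) S) < ennreal (\<epsilon>\<^sup>2)"
    using s(2) kernel_op_simple_finite_rank[OF s(1)] by (intro bexI[of _ "kernel_op T s"]) simp_all
qed



section \<open>Operators represented weakly by a function\<close>

lemma borel_eq_rat_atMost: "(borel :: real measure) = sigma UNIV (range (\<lambda>q::rat. {..real_of_rat q}))"
proof (rule borel_eq_sigmaI1[OF borel_eq_atMost])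
  fix X :: "real set" assume "X \<in> range atMost"
  then obtain a where X: "X = {..a}" by auto
  have "{..a} = (\<Inter>q\<in>{q::rat. a < real_of_rat q}. {..real_of_rat q})"
  proof (intro set_eqI iffI)
    fix x assume x: "x \<in> (\<Inter>q\<in>{q::rat. a < real_of_rat q}. {..real_of_rat q})"
    show "x \<in> {..a}"
    proof (rule ccontr)
      assume "x \<notin> {..a}"
      then obtain q where "a < real_of_rat q" "real_of_rat q < x" using of_rat_dense[of a x] by auto
      then show False using x by auto
    qed
  qed auto
  also have "\<dots> \<in> sets (sigma UNIV (range (\<lambda>q::rat. {..real_of_rat q})))"
  proof (rule sets.countable_INT'')
    show "UNIV \<in> sets (sigma UNIV (range (\<lambda>q::rat. {..real_of_rat q})))"
      using sets.top[of "sigma UNIV (range (\<lambda>q::rat. {..real_of_rat q}))"] by simp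
  qed auto
  finally show "X \<in> sets (sigma UNIV (range (\<lambda>q::rat. {..real_of_rat q})))" unfolding X .
qed auto

lemma sets_borel_rat: "sets (borel :: real measure) = sigma_sets UNIV (range (\<lambda>q::rat. {..real_of_rat q}))"
proof -
  have "sets (borel :: real measure) = sets (sigma UNIV (range (\<lambda>q::rat. {..real_of_rat q})))"
    by (rule arg_cong[OF borel_eq_rat_atMost])
  also have "\<dots> = sigma_sets UNIV (range (\<lambda>q::rat. {..real_of_rat q}))"
    by (rule sets_measure_of) simp
  finally show ?thesis .
qed

text \<open>A countable \<open>\<pi>\<close>-system that generates the Borel sets of \<open>[0,T]\<close>. Countability matters because
  a process represents a random operator only up to a null set that depends on the argument \<open>h\<close>.\<close>

definition time_sections :: "real \<Rightarrow> real set set" where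
  "time_sections T = range (\<lambda>q::rat. {0..T} \<inter> {..real_of_rat q})"

lemma space_time [simp]: "space (time_measure T) = {0..T}"
  by (simp add: space_restrict_space)

lemma sets_time: "sets (time_measure T) = sigma_sets {0..T} (time_sections T)"
proof -
  have "sets (time_measure T) = (\<inter>) {0..T} ` sets (borel :: real measure)"
    by (simp add: sets_restrict_space)
  also note sets_borel_rat
  also have "(\<inter>) {0..T} ` sigma_sets UNIV (range (\<lambda>q::rat. {..real_of_rat q})) = sigma_sets {0..T} ((\<inter>) {0..T} ` (range (\<lambda>q::rat. {..real_of_rat q})))"
  proof (rule sigma_sets_Int)
    have "{0..T} \<in> sets (borel :: real measure)" by simp
    then show "{0..T} \<in> sigma_sets UNIV (range (\<lambda>q::rat. {..real_of_rat q}))"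
      unfolding sets_borel_rat .
  qed simp
  also have "(\<inter>) {0..T} ` (range (\<lambda>q::rat. {..real_of_rat q})) = time_sections T"
    unfolding time_sections_def image_image ..
  finally show ?thesis .
qed

lemma time_sections_top: "{0..T} \<in> time_sections T"
proof -
  obtain q where "T < real_of_rat q" using of_rat_dense[of T "T + 1"] by auto
  then have "{0..T} = {0..T} \<inter> {..real_of_rat q}" by auto
  then show ?thesis unfolding time_sections_def by blast
qed

lemma Int_stable_time_sections: "Int_stable (time_sections T)"
proof (rule Int_stableI)
  fix a b assume "a \<in> time_sections T" "b \<in> time_sections T"
  then obtain p q where "a = {0..T} \<inter> {..real_of_rat p}" "b = {0..T} \<inter> {..real_of_rat q}"
    by (auto simp: time_sections_def)
  moreover have "real_of_rat (min p q) = min (real_of_rat p) (real_of_rat q)"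
    by (simp add: min_def of_rat_less_eq)
  ultimately have "a \<inter> b = {0..T} \<inter> {..real_of_rat (min p q)}" by auto
  then show "a \<inter> b \<in> time_sections T" unfolding time_sections_def by blast
qed

lemma time_sections_sets: "A \<in> time_sections T \<Longrightarrow> A \<in> sets (time_measure T)"
  unfolding sets_time by auto

text \<open>A bounded functional is determined by its values on the indicators of a generating
  \<open>\<pi>\<close>-system.\<close>

lemma L2_functional_eq_0:
  fixes D :: "(real \<Rightarrow> real) \<Rightarrow> real"
  assumes add: "\<And>f g. f \<in> L2_fun T \<Longrightarrow> g \<in> L2_fun T \<Longrightarrow> D (\<lambda>u. f u + g u) = D f + D g"
    and scale: "\<And>c f. f \<in> L2_fun T \<Longrightarrow> D (\<lambda>u. c * f u) = c * D f"
    and bound: "\<And>f. f \<in> L2_fun T \<Longrightarrow> \<bar>D f\<bar> \<le> C * sqrt (L2_inner T f f)"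
    and zero: "\<And>A. A \<in> time_sections T \<Longrightarrow> D (indicat_real A) = 0"
    and h: "h \<in> L2_fun T"
  shows "D h = 0"
proof -
  have gen: "sets (time_measure T) = sigma_sets (space (time_measure T)) (time_sections T)"
      "space (time_measure T) \<in> time_sections T"
    using sets_time time_sections_top by auto
  have "h \<in> borel_measurable (time_measure T)" "L2sq (time_measure T) h < \<infinity>"
    using h by (auto simp: L2_fun_iff)
  with finite_measure_time Int_stable_time_sections gen show ?thesis
  proof (induction rule: L2_induct)
    case (indicator A e)
    have "indicat_real A \<in> L2_fun T" using L2_fun_indicator[OF time_sections_sets[OF indicator], of 1] by simp
    then show ?case using scale[of "indicat_real A" e] zero[OF indicator] by (simp add: mult.commute)
  next
    case (add f g)
    then show ?case using assms(1)[of f g] by (simp add: L2_fun_iff)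
  next
    case (limit f)
    then have f: "f \<in> L2_fun T" by (simp add: L2_fun_iff)
    have "(D f)\<^sup>2 \<le> C\<^sup>2 * \<epsilon>" if \<epsilon>: "\<epsilon> > 0" for \<epsilon>
    proof -
      obtain g where "g \<in> borel_measurable (time_measure T)" "L2sq (time_measure T) g < \<infinity>" "D g = 0"
        and less: "L2sq (time_measure T) (\<lambda>x. f x - g x) < ennreal \<epsilon>"
        using limit(3)[OF \<epsilon>] by blast
      then have g: "g \<in> L2_fun T" by (simp add: L2_fun_iff)
      let ?d = "\<lambda>x. f x - g x"
      have d: "?d \<in> L2_fun T" using f g by (rule L2_fun_diff)
      have "D f = D (\<lambda>u. ?d u + g u)" by simp
      then have "D f = D ?d" using assms(1)[OF d g] \<open>D g = 0\<close> by simp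
      then have "(D f)\<^sup>2 \<le> (C * sqrt (L2_inner T ?d ?d))\<^sup>2"
        using bound[OF d] by (metis abs_ge_zero power2_abs power_mono)
      also have "\<dots> = C\<^sup>2 * L2_inner T ?d ?d"
        using L2_inner_nonneg[of T ?d] by (simp add: power_mult_distrib)
      also have "\<dots> \<le> C\<^sup>2 * \<epsilon>"
      proof -
        have "ennreal (L2_inner T ?d ?d) < ennreal \<epsilon>" using less unfolding L2sq_L2_fun[OF d] .
        then have "L2_inner T ?d ?d < \<epsilon>" using L2_inner_nonneg[of T ?d] by (simp add: ennreal_less_iff)
        then show ?thesis by (intro mult_left_mono) auto
      qed
      finally show ?thesis .
    qed
    note le = this
    have "(D f)\<^sup>2 \<le> 0"
    proof (rule field_le_epsilon)
      fix e :: real assume "0 < e"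
      then have "(D f)\<^sup>2 \<le> C\<^sup>2 * (e / (C\<^sup>2 + 1))" by (intro le) (simp add: add_nonneg_pos)
      also have "\<dots> = e * (C\<^sup>2 / (C\<^sup>2 + 1))" by simp
      also have "\<dots> \<le> e * 1" using \<open>0 < e\<close> by (intro mult_left_mono) (auto simp: divide_le_eq add_nonneg_pos)
      finally show "(D f)\<^sup>2 \<le> 0 + e" by simp
    qed
    then show ?case by simp
  qed
qed

text \<open>The coordinates \<open>e\<^sub>k \<bullet> R h\<close> and \<open>\<integral> h (e\<^sub>k \<bullet> f)\<close> are bounded functionals that agree on
  \<open>time_sections T\<close>, hence everywhere. So the projection of \<open>R\<close> to the span of \<open>e\<^sub>0, \<dots>, e\<^sub>K\<^sub>-\<^sub>1\<close> is the
  integral operator of the projection of \<open>f\<close>, whose \<open>L\<^sup>2\<close> norm is at most the \<open>\<gamma>\<close>-norm of \<open>R\<close>.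
  Fatou's lemma for \<open>K \<rightarrow> \<infinity>\<close> makes \<open>f\<close> square integrable, and then \<open>R\<close> is its integral operator.\<close>

lemma gamma_operator_is_kernel_op:
  fixes f :: "real \<Rightarrow> 'e::{real_inner, complete_space, second_countable_topology}"
  assumes R: "R \<in> L2_operators T" "gamma_norm_sq T R < \<infinity>"
    and f: "f \<in> borel_measurable (time_measure T)"
    and e: "orthonormal_seq e" "\<And>x :: 'e. (\<lambda>k. (x \<bullet> e k)\<^sup>2) sums (norm x)\<^sup>2"
    and fk: "\<And>k::nat. (\<lambda>u. e k \<bullet> f u) \<in> L2_fun T"
    and eq: "\<And>k A. A \<in> time_sections T \<Longrightarrow> e k \<bullet> R (indicat_real A) = (LINT u|time_measure T. indicat_real A u * (e k \<bullet> f u))"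
  shows "L2sq (time_measure T) f < \<infinity>" "\<And>h. h \<in> L2_fun T \<Longrightarrow> R h = kernel_op T f h"
proof -
  note f[measurable]
  obtain C where C: "\<And>h. h \<in> L2_fun T \<Longrightarrow> norm (R h) \<le> C * sqrt (L2_inner T h h)"
    using R(1) unfolding L2_operators_def by blast
  have R_add: "\<And>f g. f \<in> L2_fun T \<Longrightarrow> g \<in> L2_fun T \<Longrightarrow> R (\<lambda>u. f u + g u) = R f + R g"
    and R_scale: "\<And>c f. f \<in> L2_fun T \<Longrightarrow> R (\<lambda>u. c * f u) = c *\<^sub>R R f"
    using R by (auto simp: L2_operators_def)
  have norm_e: "norm (e k) \<le> 1" for k using e(1) unfolding orthonormal_seq_def by (metis norm_zero zero_le_one order_refl)
  have weak: "e k \<bullet> R h = (LINT u|time_measure T. h u * (e k \<bullet> f u))" if h: "h \<in> L2_fun T" for k h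
  proof -
    let ?g = "\<lambda>u. e k \<bullet> f u"
    define D where "D = (\<lambda>h. e k \<bullet> R h - kernel_op T ?g h)"
    define K where "K = sqrt (LINT u|time_measure T. (norm (?g u))\<^sup>2)"
    have g: "?g \<in> borel_measurable (time_measure T)" "L2sq (time_measure T) ?g < \<infinity>" using fk[of k] by (auto simp: L2_fun_iff)
    have "D h = 0"
    proof (rule L2_functional_eq_0[OF _ _ _ _ h, where C = "C + K"])
      fix f g assume "f \<in> L2_fun T" "g \<in> L2_fun T"
      then show "D (\<lambda>u. f u + g u) = D f + D g"
        using integrable_kernel[OF _ g] by (simp add: D_def R_add inner_add_right kernel_op_def distrib_right)
    next
      fix c f assume "f \<in> L2_fun T"
      then show "D (\<lambda>u. c * f u) = c * D f"
        by (simp add: D_def R_scale kernel_op_cmult right_diff_distrib)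
    next
      fix f assume f: "f \<in> L2_fun T"
      have "\<bar>e k \<bullet> R f\<bar> \<le> norm (e k) * norm (R f)" by (rule Cauchy_Schwarz_ineq2)
      also have "\<dots> \<le> 1 * (C * sqrt (L2_inner T f f))" using norm_e C[OF f] by (intro mult_mono) auto
      finally have 1: "\<bar>e k \<bullet> R f\<bar> \<le> C * sqrt (L2_inner T f f)" by simp
      have 2: "\<bar>kernel_op T ?g f\<bar> \<le> K * sqrt (L2_inner T f f)"
        using real_le_rsqrt[OF norm_kernel_op_sq_le[OF f g]] by (simp add: real_sqrt_mult mult.commute K_def)
      show "\<bar>D f\<bar> \<le> (C + K) * sqrt (L2_inner T f f)"
        using 1 2 abs_triangle_ineq4[of "e k \<bullet> R f" "kernel_op T ?g f"] by (simp add: D_def distrib_right)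
    next
      fix A assume "A \<in> time_sections T"
      then show "D (indicat_real A) = 0" using eq[of A k] by (simp add: D_def kernel_op_def)
    qed
    then show ?thesis by (simp add: D_def kernel_op_def)
  qed
  define P where "P = (\<lambda>K u. \<Sum>k<K. (f u \<bullet> e k) *\<^sub>R e k)"
  have P_meas [measurable]: "P K \<in> borel_measurable (time_measure T)" for K unfolding P_def by measurable
  have norm_P: "(norm (P K u))\<^sup>2 = (\<Sum>k<K. (f u \<bullet> e k)\<^sup>2)" for K u
    unfolding P_def by (rule orthonormal_seq_norm_combination[OF e(1)])
  have P_fin: "L2sq (time_measure T) (P K) < \<infinity>" for K
  proof -
    have "integrable (time_measure T) (\<lambda>u. \<Sum>k<K. (f u \<bullet> e k)\<^sup>2)"
      using fk by (intro Bochner_Integration.integrable_sum) (auto simp: L2_fun_def inner_commute)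
    then show ?thesis unfolding L2sq_def norm_P by (simp add: integrable_iff_bounded sum_nonneg)
  qed
  have P_le: "L2sq (time_measure T) (P K) \<le> gamma_norm_sq T R" for K
    unfolding gamma_norm_sq_kernel_op[OF P_meas P_fin, symmetric]
  proof (rule gamma_norm_sq_leI)
    fix n h assume h: "L2_orthonormal T n h"
    have "norm (kernel_op T (P K) (h j)) \<le> norm (R (h j))" if "j < n" for j
    proof -
      have hj: "h j \<in> L2_fun T" using h that by (simp add: L2_orthonormal_def)
      have int: "integrable (time_measure T) (\<lambda>u. h j u * (e k \<bullet> f u))" for k
        by (rule integrable_mult_L2_fun[OF hj fk])
      have "kernel_op T (P K) (h j) = (LINT u|time_measure T. (\<Sum>k<K. (h j u * (e k \<bullet> f u)) *\<^sub>R e k))"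
        unfolding kernel_op_def P_def scaleR_sum_right scaleR_scaleR by (simp add: inner_commute)
      also have "\<dots> = (\<Sum>k<K. (LINT u|time_measure T. (h j u * (e k \<bullet> f u)) *\<^sub>R e k))"
        by (intro Bochner_Integration.integral_sum integrable_scaleR_left int)
      also have "\<dots> = (\<Sum>k<K. (R (h j) \<bullet> e k) *\<^sub>R e k)"
        by (simp only: integral_scaleR_left[OF int] weak[OF hj, symmetric] inner_commute)
      finally have "(norm (kernel_op T (P K) (h j)))\<^sup>2 = (\<Sum>k<K. (R (h j) \<bullet> e k)\<^sup>2)"
        by (simp only: orthonormal_seq_norm_combination[OF e(1)])
      also have "\<dots> \<le> (norm (R (h j)))\<^sup>2" by (rule orthonormal_seq_bessel[OF e(1)])
      finally show ?thesis by (rule power2_le_imp_le) simp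
    qed
    then have "(\<Sum>j<n. (norm (kernel_op T (P K) (h j)))\<^sup>2) \<le> (\<Sum>j<n. (norm (R (h j)))\<^sup>2)"
      by (intro sum_mono power_mono) auto
    then have "ennreal (\<Sum>j<n. (norm (kernel_op T (P K) (h j)))\<^sup>2) \<le> ennreal (\<Sum>j<n. (norm (R (h j)))\<^sup>2)"
      by (rule ennreal_leI)
    also have "\<dots> \<le> gamma_norm_sq T R" by (rule sum_le_gamma_norm_sq[OF h])
    finally show "ennreal (\<Sum>j<n. (norm (kernel_op T (P K) (h j)))\<^sup>2) \<le> gamma_norm_sq T R" .
  qed
  have "L2sq (time_measure T) f = (\<integral>\<^sup>+ u. liminf (\<lambda>K. ennreal ((norm (P K u))\<^sup>2)) \<partial>time_measure T)"
    unfolding L2sq_def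
  proof (rule nn_integral_cong)
    fix u
    have "(\<lambda>K. (norm (P K u))\<^sup>2) \<longlonglongrightarrow> (norm (f u))\<^sup>2"
      using e(2)[of "f u"] unfolding norm_P sums_def .
    then have "(\<lambda>K. ennreal ((norm (P K u))\<^sup>2)) \<longlonglongrightarrow> ennreal ((norm (f u))\<^sup>2)" by (rule tendsto_ennrealI)
    then show "ennreal ((norm (f u))\<^sup>2) = liminf (\<lambda>K. ennreal ((norm (P K u))\<^sup>2))"
      using lim_imp_Liminf[OF sequentially_bot] by metis
  qed
  also have "\<dots> \<le> liminf (\<lambda>K. L2sq (time_measure T) (P K))"
    unfolding L2sq_def by (rule nn_integral_liminf) measurable
  also have "\<dots> \<le> gamma_norm_sq T R"
    by (rule order_trans[OF Liminf_le_Limsup[OF sequentially_bot] Limsup_bounded]) (simp add: P_le)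
  finally show fin: "L2sq (time_measure T) f < \<infinity>" using R(2) by (rule le_less_trans)
  show "R h = kernel_op T f h" if h: "h \<in> L2_fun T" for h
  proof -
    have int: "integrable (time_measure T) (\<lambda>u. h u *\<^sub>R f u)" by (rule integrable_kernel[OF h f fin])
    have "e k \<bullet> kernel_op T f h = (LINT u|time_measure T. e k \<bullet> (h u *\<^sub>R f u))" for k
      unfolding kernel_op_def by (rule integral_inner_right[OF int, symmetric])
    then have "e k \<bullet> (R h - kernel_op T f h) = 0" for k
      using weak[OF h, of k] by (simp add: inner_diff_right)
    then have "(\<lambda>k::nat. 0::real) sums (norm (R h - kernel_op T f h))\<^sup>2"
      using e(2)[of "R h - kernel_op T f h"] by (simp add: inner_commute)
    then have "(norm (R h - kernel_op T f h))\<^sup>2 = 0" using sums_unique2[OF sums_zero] by metis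
    then show ?thesis by simp
  qed
qed



section \<open>Processes and random operators\<close>

text \<open>The fraction \<open>1/8\<close> leaves room for the factor \<open>2\<close> of \<open>L2sq_add\<close> and for a strict inequality.\<close>

lemma L2sq_add_less:
  fixes f g :: "'a \<Rightarrow> 'b::{real_normed_vector, second_countable_topology}"
  assumes "f \<in> borel_measurable N" "g \<in> borel_measurable N" and "0 < \<epsilon>"
    and "L2sq N f < ennreal (\<epsilon> / 8)" "L2sq N g < ennreal (\<epsilon> / 8)"
  shows "L2sq N (\<lambda>x. f x + g x) < ennreal \<epsilon>"
proof -
  have "L2sq N (\<lambda>x. f x + g x) \<le> 2 * L2sq N f + 2 * L2sq N g" by (rule L2sq_add) fact+
  also have "\<dots> \<le> ennreal 2 * ennreal (\<epsilon> / 8) + ennreal 2 * ennreal (\<epsilon> / 8)"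
    using assms by (intro add_mono mult_mono) (auto intro: less_imp_le)
  also have "\<dots> = ennreal (2 * (\<epsilon> / 8) + 2 * (\<epsilon> / 8))"
    using \<open>0 < \<epsilon>\<close> by (subst (1 2) ennreal_mult[symmetric]) (auto simp flip: ennreal_plus)
  also have "\<dots> < ennreal \<epsilon>" using \<open>0 < \<epsilon>\<close> by (intro ennreal_lessI) auto
  finally show ?thesis .
qed

text \<open>The integrals are summable, so the sum of the functions is almost everywhere finite.\<close>

lemma AE_tendsto_0_geometric:
  fixes a :: "nat \<Rightarrow> 'a \<Rightarrow> ennreal"
  assumes [measurable]: "\<And>n. a n \<in> borel_measurable N"
    and le: "\<And>n. (\<integral>\<^sup>+ x. a n x \<partial>N) \<le> ennreal ((1 / 2) ^ n)"
  shows "AE x in N. (\<lambda>n. a n x) \<longlonglongrightarrow> 0"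
proof -
  have "(\<integral>\<^sup>+ x. (\<Sum>n. a n x) \<partial>N) = (\<Sum>n. \<integral>\<^sup>+ x. a n x \<partial>N)" by (rule nn_integral_suminf) measurable
  also have "\<dots> \<le> (\<Sum>n. ennreal ((1 / 2) ^ n))" by (intro suminf_le le) auto
  also have "\<dots> = ennreal (\<Sum>n. (1 / 2) ^ n)"
    by (rule suminf_ennreal2) (auto simp: summable_geometric)
  also have "\<dots> < \<infinity>" by simp
  finally have "AE x in N. (\<Sum>n. a n x) \<noteq> \<infinity>"
    by (intro nn_integral_PInf_AE) auto
  then show ?thesis
  proof eventually_elim
    case (elim x)
    have fin: "a n x \<noteq> \<infinity>" for n using elim ennreal_suminf_lessD[of "\<lambda>n. a n x" \<infinity> n] by (auto simp: less_top)
    have eq: "(\<lambda>n. ennreal (enn2real (a n x))) = (\<lambda>n. a n x)" using fin by (intro ext) (simp add: less_top)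
    have "summable (\<lambda>n. enn2real (a n x))"
      by (rule summable_suminf_not_top) (use elim eq in auto)
    then have "(\<lambda>n. enn2real (a n x)) \<longlonglongrightarrow> 0" by (rule summable_LIMSEQ_zero)
    then have "(\<lambda>n. ennreal (enn2real (a n x))) \<longlonglongrightarrow> ennreal 0" by (rule tendsto_ennrealI)
    then show ?case unfolding eq by simp
  qed
qed

lemma sets_pair_generator:
  assumes Ea: "sets A = sigma_sets (space A) Ea" "space A \<in> Ea"
  shows "sets (A \<Otimes>\<^sub>M B) = sigma_sets (space (A \<Otimes>\<^sub>M B)) {a \<times> b | a b. a \<in> Ea \<and> b \<in> sets B}"
    (is "_ = sigma_sets ?\<Omega> ?G")
proof (rule antisym)
  have Ea_sets: "a \<in> sets A" if "a \<in> Ea" for a using Ea(1) that by auto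
  have G: "?G \<subseteq> sets (A \<Otimes>\<^sub>M B)" using Ea_sets by auto
  then have sub: "?G \<subseteq> Pow ?\<Omega>" using sets.space_closed by blast
  show "sigma_sets ?\<Omega> ?G \<subseteq> sets (A \<Otimes>\<^sub>M B)" using G by (rule sets.sigma_sets_subset)
  let ?N = "sigma ?\<Omega> ?G"
  have N: "sets ?N = sigma_sets ?\<Omega> ?G" using sub by (rule sets_measure_of)
  have "sets (A \<Otimes>\<^sub>M B) \<subseteq> sets ?N"
  proof (rule sets_pair_in_sets)
    fix a b assume a: "a \<in> sets A" and b: "b \<in> sets B"
    have "a \<in> sigma_sets (space A) Ea" using a Ea(1) by simp
    then show "a \<times> b \<in> sets ?N"
    proof induction
      case (Basic a)
      then show ?case unfolding N using b by (intro sigma_sets.Basic) blast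
    next
      case (Compl a)
      have "space A \<times> b \<in> sets ?N" unfolding N using b Ea(2) by (intro sigma_sets.Basic) blast
      moreover have "(space A - a) \<times> b = space A \<times> b - a \<times> b" by auto
      ultimately show ?case using Compl.IH by simp
    next
      case (Union a)
      have "(\<Union>i. a i) \<times> b = (\<Union>i. a i \<times> b)" by auto
      then show ?case using Union.IH by auto
    qed simp
  qed
  then show "sets (A \<Otimes>\<^sub>M B) \<subseteq> sigma_sets ?\<Omega> ?G" unfolding N .
qed

lemma (in complete_measure) borel_measurable_AE_cong:
  fixes f g :: "'a \<Rightarrow> 'b::topological_space"
  assumes f: "f \<in> borel_measurable M" and eq: "AE x in M. g x = f x"
  shows "g \<in> borel_measurable M"
proof (rule measurableI)
  fix B :: "'b set" assume B: "B \<in> sets borel"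
  obtain N where N: "N \<in> null_sets M" "{x \<in> space M. g x \<noteq> f x} \<subseteq> N" using eq by (auto elim!: AE_E)
  define C where "C = ((f -` B \<inter> space M) - N) \<union> (g -` B \<inter> space M \<inter> N)"
  have eq': "g -` B \<inter> space M = C"
  proof -
    have "g x = f x" if "x \<in> space M" "x \<notin> N" for x using N(2) that by blast
    then show ?thesis unfolding C_def by auto
  qed
  have "g -` B \<inter> space M \<inter> N \<in> sets M" by (rule complete[OF _ N(1)]) simp
  moreover have "(f -` B \<inter> space M) - N \<in> sets M" using f B N(1) by auto
  ultimately have "C \<in> sets M" unfolding C_def by blast
  then show "g -` B \<inter> space M \<in> sets M" unfolding eq' .
qed simp

lemma gamma_norm_power2: "(gamma_norm T R)\<^sup>2 = enn2real (gamma_norm_sq T R)"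
  by (simp add: gamma_norm_def)

locale process_space = prob_space M for M :: "'a measure" +
  fixes T :: real
  assumes complete_M: "complete_measure M"
begin

sublocale time: finite_measure "time_measure T" by (rule finite_measure_time)

sublocale P: pair_sigma_finite "time_measure T" M ..

sublocale proc: finite_measure "process_measure M T"
  by (rule finite_measure_pair_measure) (rule finite_measure_axioms, rule finite_measure_time)

lemma space_process [simp]: "space (process_measure M T) = {0..T} \<times> space M"
  by (simp add: space_pair_measure)

lemma measurable_section [measurable (raw)]:
  "\<phi> \<in> borel_measurable (process_measure M T) \<Longrightarrow> \<omega> \<in> space M \<Longrightarrow> (\<lambda>u. \<phi> (u, \<omega>)) \<in> borel_measurable (time_measure T)"
  by (rule measurable_compose[OF measurable_Pair2'])

lemma measurable_L2sq_section:
  fixes \<phi> :: "real \<times> 'a \<Rightarrow> 'e::{real_normed_vector, second_countable_topology}"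
  assumes [measurable]: "\<phi> \<in> borel_measurable (process_measure M T)"
  shows "(\<lambda>\<omega>. L2sq (time_measure T) (\<lambda>u. \<phi> (u, \<omega>))) \<in> borel_measurable M"
proof -
  have "(\<lambda>p. ennreal ((norm (\<phi> (snd p, fst p)))\<^sup>2)) \<in> borel_measurable (M \<Otimes>\<^sub>M time_measure T)" by measurable
  from time.borel_measurable_nn_integral_fst[OF this] show ?thesis by (simp add: L2sq_def)
qed

lemma L2sq_process:
  fixes \<phi> :: "real \<times> 'a \<Rightarrow> 'e::{real_normed_vector, second_countable_topology}"
  assumes [measurable]: "\<phi> \<in> borel_measurable (process_measure M T)"
  shows "(\<integral>\<^sup>+ \<omega>. L2sq (time_measure T) (\<lambda>u. \<phi> (u, \<omega>)) \<partial>M) = L2sq (process_measure M T) \<phi>"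
  unfolding L2sq_def by (rule P.nn_integral_snd) measurable

lemma AE_L2sq_section:
  fixes \<phi> :: "real \<times> 'a \<Rightarrow> 'e::{real_normed_vector, second_countable_topology}"
  assumes "\<phi> \<in> borel_measurable (process_measure M T)" "L2sq (process_measure M T) \<phi> < \<infinity>"
  shows "AE \<omega> in M. L2sq (time_measure T) (\<lambda>u. \<phi> (u, \<omega>)) < \<infinity>"
proof -
  have "AE \<omega> in M. L2sq (time_measure T) (\<lambda>u. \<phi> (u, \<omega>)) \<noteq> \<infinity>"
    using assms by (intro nn_integral_PInf_AE measurable_L2sq_section) (auto simp: L2sq_process)
  then show ?thesis by (simp add: less_top)
qed

text \<open>The defining property of \<open>X\<close> has an exceptional null set for each \<open>h\<close> and each functional. It
  is used only for the countably many \<open>h\<close> in \<open>time_sections T\<close> and the functionals of an orthonormal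
  sequence, so one null set suffices.\<close>

lemma defines_rv_kernel:
  fixes \<phi> :: "real \<times> 'a \<Rightarrow> 'e::{real_inner, complete_space, second_countable_topology}"
  assumes def: "defines_rv M T \<phi> X"
  shows "AE \<omega> in M. L2sq (time_measure T) (\<lambda>u. \<phi> (u, \<omega>)) < \<infinity> \<and>
    (\<forall>h\<in>L2_fun T. X \<omega> h = kernel_op T (\<lambda>u. \<phi> (u, \<omega>)) h)"
proof -
  obtain e :: "nat \<Rightarrow> 'e" where e: "orthonormal_seq e" "\<And>x. (\<lambda>k. (x \<bullet> e k)\<^sup>2) sums (norm x)\<^sup>2"
    using parseval_separable by blast
  have meas: "\<phi> \<in> borel_measurable (process_measure M T)" and X: "\<And>\<omega>. \<omega> \<in> space M \<Longrightarrow> X \<omega> \<in> gamma_space T"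
    and L2: "\<And>x :: 'e \<Rightarrow>\<^sub>L real. AE \<omega> in M. (\<lambda>u. blinfun_apply x (\<phi> (u, \<omega>))) \<in> L2_fun T"
    and eq: "\<And>h (x :: 'e \<Rightarrow>\<^sub>L real). h \<in> L2_fun T \<Longrightarrow> AE \<omega> in M.
        blinfun_apply x (X \<omega> h) = (LINT u|time_measure T. h u * blinfun_apply x (\<phi> (u, \<omega>)))"
    using def by (auto simp: defines_rv_def gamma_rv_def)
  have 1: "AE \<omega> in M. \<forall>k. (\<lambda>u. e k \<bullet> \<phi> (u, \<omega>)) \<in> L2_fun T"
    unfolding AE_all_countable using L2[of "blinfun_inner_right (e _)"] by simp
  have "countable (time_sections T)" by (simp add: time_sections_def)
  then have 2: "AE \<omega> in M. \<forall>A\<in>time_sections T. \<forall>k. e k \<bullet> X \<omega> (indicat_real A) =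
      (LINT u|time_measure T. indicat_real A u * (e k \<bullet> \<phi> (u, \<omega>)))"
  proof (rule AE_ball_countable[THEN iffD2], intro ballI)
    fix A assume "A \<in> time_sections T"
    then have "indicat_real A \<in> L2_fun T" using L2_fun_indicator[OF time_sections_sets, of A T 1] by simp
    then show "AE \<omega> in M. \<forall>k. e k \<bullet> X \<omega> (indicat_real A) = (LINT u|time_measure T. indicat_real A u * (e k \<bullet> \<phi> (u, \<omega>)))"
      unfolding AE_all_countable using eq[of "indicat_real A" "blinfun_inner_right (e _)"] by simp
  qed
  show ?thesis
    using 1 2 AE_space
  proof eventually_elim
    case (elim \<omega>)
    have R: "X \<omega> \<in> L2_operators T" "gamma_norm_sq T (X \<omega>) < \<infinity>"
      using X[OF elim(3)] gamma_norm_sq_gamma_space[OF X[OF elim(3)]] by (auto simp: gamma_space_def)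
    show ?case
      using gamma_operator_is_kernel_op[OF R measurable_section[OF meas elim(3)] e] elim(1,2) by blast
  qed
qed

theorem L2sq_eq_L2_gamma_norm:
  fixes \<phi> :: "real \<times> 'a \<Rightarrow> 'e::{real_inner, complete_space, second_countable_topology}"
  assumes def: "defines_rv M T \<phi> X" and X: "X \<in> L2_gamma M T"
  shows "L2sq (process_measure M T) \<phi> = ennreal ((L2_gamma_norm M T X)\<^sup>2)"
proof -
  have meas: "\<phi> \<in> borel_measurable (process_measure M T)" using def by (simp add: defines_rv_def)
  have int: "integrable M (\<lambda>\<omega>. (gamma_norm T (X \<omega>))\<^sup>2)" using X by (simp add: L2_gamma_def)
  have "L2sq (process_measure M T) \<phi> = (\<integral>\<^sup>+ \<omega>. ennreal ((gamma_norm T (X \<omega>))\<^sup>2) \<partial>M)"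
    unfolding L2sq_process[OF meas, symmetric]
  proof (rule nn_integral_cong_AE)
    show "AE \<omega> in M. L2sq (time_measure T) (\<lambda>u. \<phi> (u, \<omega>)) = ennreal ((gamma_norm T (X \<omega>))\<^sup>2)"
      using defines_rv_kernel[OF def] AE_space
    proof eventually_elim
      case (elim \<omega>)
      have "gamma_norm_sq T (X \<omega>) = L2sq (time_measure T) (\<lambda>u. \<phi> (u, \<omega>))"
        using elim gamma_norm_sq_cong[of T "X \<omega>"] gamma_norm_sq_kernel_op[OF measurable_section[OF meas elim(2)]] by metis
      then show ?case using elim by (simp add: gamma_norm_power2)
    qed
  qed
  also have "\<dots> = ennreal (LINT \<omega>|M. (gamma_norm T (X \<omega>))\<^sup>2)"
    by (rule nn_integral_eq_integral[OF int]) simp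
  finally show ?thesis by (simp add: L2_gamma_norm_def)
qed

text \<open>The difference of two random operators need not be strongly measurable as it stands; its norm is
  almost surely the \<open>L\<^sup>2\<close> norm of the difference of the processes, and completeness of \<open>M\<close> makes it
  measurable.\<close>

theorem L2sq_eq_L2_gamma_dist:
  fixes \<phi> \<psi> :: "real \<times> 'a \<Rightarrow> 'e::{real_inner, complete_space, second_countable_topology}"
  assumes def: "defines_rv M T \<phi> X" "defines_rv M T \<psi> Y" and XY: "X \<in> L2_gamma M T" "Y \<in> L2_gamma M T"
  shows "L2sq (process_measure M T) (\<lambda>p. \<phi> p - \<psi> p) = ennreal ((L2_gamma_dist M T X Y)\<^sup>2)"
proof -
  interpret complete_measure M by (rule complete_M)
  have meas: "\<phi> \<in> borel_measurable (process_measure M T)" "\<psi> \<in> borel_measurable (process_measure M T)"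
    using def by (simp_all add: defines_rv_def)
  then have dmeas: "(\<lambda>p. \<phi> p - \<psi> p) \<in> borel_measurable (process_measure M T)" by (rule borel_measurable_diff)
  define a where "a = (\<lambda>\<omega>. L2sq (time_measure T) (\<lambda>u. \<phi> (u, \<omega>) - \<psi> (u, \<omega>)))"
  have a_meas [measurable]: "a \<in> borel_measurable M" unfolding a_def by (rule measurable_L2sq_section[OF dmeas])
  have "L2sq (process_measure M T) \<phi> < \<infinity>" "L2sq (process_measure M T) \<psi> < \<infinity>"
    using L2sq_eq_L2_gamma_norm[OF def(1) XY(1)] L2sq_eq_L2_gamma_norm[OF def(2) XY(2)] by simp_all
  then have fin: "L2sq (process_measure M T) (\<lambda>p. \<phi> p - \<psi> p) < \<infinity>" by (rule L2sq_add_finite(2)[OF meas])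
  have int_a: "(\<integral>\<^sup>+ \<omega>. a \<omega> \<partial>M) = L2sq (process_measure M T) (\<lambda>p. \<phi> p - \<psi> p)"
    unfolding a_def by (rule L2sq_process[OF dmeas])
  have "AE \<omega> in M. a \<omega> < \<infinity>" unfolding a_def by (rule AE_L2sq_section[OF dmeas fin])
  then have a_real: "AE \<omega> in M. ennreal (enn2real (a \<omega>)) = a \<omega>" by eventually_elim simp
  have eq: "AE \<omega> in M. (gamma_norm T (op_diff (X \<omega>) (Y \<omega>)))\<^sup>2 = enn2real (a \<omega>)"
    using defines_rv_kernel[OF def(1)] defines_rv_kernel[OF def(2)] AE_space
  proof eventually_elim
    case (elim \<omega>)
    note m = measurable_section[OF meas(1) elim(3)] measurable_section[OF meas(2) elim(3)]
    have fin': "L2sq (time_measure T) (\<lambda>u. \<phi> (u, \<omega>)) < \<infinity>" "L2sq (time_measure T) (\<lambda>u. \<psi> (u, \<omega>)) < \<infinity>"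
      using elim by auto
    have "gamma_norm_sq T (op_diff (X \<omega>) (Y \<omega>)) = gamma_norm_sq T (kernel_op T (\<lambda>u. \<phi> (u, \<omega>) - \<psi> (u, \<omega>)))"
      by (rule gamma_norm_sq_cong) (use elim in \<open>simp add: op_diff_def kernel_op_diff[OF m(1) fin'(1) m(2) fin'(2)]\<close>)
    also have "\<dots> = a \<omega>"
      unfolding a_def by (rule gamma_norm_sq_kernel_op[OF borel_measurable_diff[OF m] L2sq_add_finite(2)[OF m fin']])
    finally show ?case by (simp add: gamma_norm_power2)
  qed
  have [measurable]: "(\<lambda>\<omega>. (gamma_norm T (op_diff (X \<omega>) (Y \<omega>)))\<^sup>2) \<in> borel_measurable M"
    by (rule borel_measurable_AE_cong[OF _ eq]) measurable
  have "(LINT \<omega>|M. (gamma_norm T (op_diff (X \<omega>) (Y \<omega>)))\<^sup>2) = (LINT \<omega>|M. enn2real (a \<omega>))"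
    by (rule integral_cong_AE[OF _ _ eq]) measurable
  also have "\<dots> = enn2real (\<integral>\<^sup>+ \<omega>. ennreal (enn2real (a \<omega>)) \<partial>M)"
    by (rule integral_eq_nn_integral) auto
  also have "(\<integral>\<^sup>+ \<omega>. ennreal (enn2real (a \<omega>)) \<partial>M) = (\<integral>\<^sup>+ \<omega>. a \<omega> \<partial>M)"
    using a_real by (rule nn_integral_cong_AE)
  finally have "(LINT \<omega>|M. (gamma_norm T (op_diff (X \<omega>) (Y \<omega>)))\<^sup>2) = enn2real (L2sq (process_measure M T) (\<lambda>p. \<phi> p - \<psi> p))"
    unfolding int_a .
  then show ?thesis using fin by (simp add: L2_gamma_dist_def L2_gamma_norm_def)
qed

text \<open>On the null set where the path is not square integrable the integral operator is replaced by
  \<open>0\<close>, since every value of a random operator has to lie in \<open>gamma_space T\<close>.\<close>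

definition rv_of_process :: "(real \<times> 'a \<Rightarrow> 'e::{real_normed_vector, complete_space, second_countable_topology}) \<Rightarrow> 'a \<Rightarrow> (real \<Rightarrow> real) \<Rightarrow> 'e" where
  "rv_of_process \<phi> \<omega> = (if L2sq (time_measure T) (\<lambda>u. \<phi> (u, \<omega>)) < \<infinity> then kernel_op T (\<lambda>u. \<phi> (u, \<omega>)) else (\<lambda>h. 0))"

text \<open>A process with finitely many paths. Unlike a simple function on \<open>[0,T] \<times> \<Omega>\<close>, it induces a
  random operator that is a simple function on \<open>\<Omega>\<close>, as strong measurability requires.\<close>

definition simple_path :: "('a \<Rightarrow> real \<Rightarrow> 'e::{real_normed_vector, second_countable_topology}) \<Rightarrow> bool" where
  "simple_path S \<longleftrightarrow> simple_function M S \<and> (\<lambda>p. S (snd p) (fst p)) \<in> borel_measurable (process_measure M T) \<and>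
     (\<forall>\<omega>\<in>space M. S \<omega> \<in> borel_measurable (time_measure T) \<and> L2sq (time_measure T) (S \<omega>) < \<infinity>)"

lemma simple_path_dense:
  fixes \<phi> :: "real \<times> 'a \<Rightarrow> 'e::{real_normed_vector, second_countable_topology}"
  assumes \<phi>: "\<phi> \<in> borel_measurable (process_measure M T)" "L2sq (process_measure M T) \<phi> < \<infinity>" and "0 < \<epsilon>"
  shows "\<exists>S. simple_path S \<and> L2sq (process_measure M T) (\<lambda>p. \<phi> p - S (snd p) (fst p)) < ennreal \<epsilon>"
proof -
  let ?G = "{a \<times> b |a b. a \<in> sets (time_measure T) \<and> b \<in> sets M}"
  have gen: "sets (process_measure M T) = sigma_sets (space (process_measure M T)) ?G"
    by (simp only: sets_pair_measure space_pair_measure)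
  have top: "space (process_measure M T) \<in> ?G"
    by (simp only: space_pair_measure) (use sets.top in blast)
  have "\<forall>\<epsilon>>0. \<exists>S. simple_path S \<and> L2sq (process_measure M T) (\<lambda>p. \<phi> p - S (snd p) (fst p)) < ennreal \<epsilon>"
    using proc.finite_measure_axioms Int_stable_pair_measure_generator gen top \<phi>
  proof (induction rule: L2_induct)
    case (indicator A e)
    then obtain a b where ab: "A = a \<times> b" "a \<in> sets (time_measure T)" "b \<in> sets M" by blast
    note ab(2,3)[measurable]
    define S where "S = (\<lambda>\<omega> u. (indicat_real a u * indicat_real b \<omega>) *\<^sub>R e)"
    have "simple_function M S"
      unfolding S_def by (rule simple_function_compose1[OF simple_function_indicator[OF ab(3)]])
    moreover have "(\<lambda>p. S (snd p) (fst p)) \<in> borel_measurable (process_measure M T)"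
      unfolding S_def by measurable
    moreover have "S \<omega> \<in> borel_measurable (time_measure T) \<and> L2sq (time_measure T) (S \<omega>) < \<infinity>" for \<omega>
    proof -
      have "simple_function (time_measure T) (S \<omega>)"
        unfolding S_def by (rule simple_function_compose1[OF simple_function_indicator[OF ab(2)]])
      then show ?thesis using time.L2sq_simple_finite borel_measurable_simple_function by blast
    qed
    moreover have "indicat_real A p *\<^sub>R e - S (snd p) (fst p) = 0" for p
      by (cases p) (auto simp: S_def ab(1) indicator_def)
    ultimately show ?case by (intro allI impI exI[of _ S]) (simp add: simple_path_def)
  next
    case (add f g)
    show ?case
    proof (intro allI impI)
      fix \<epsilon> :: real assume "0 < \<epsilon>"
      then have "0 < \<epsilon> / 8" by simp
      then obtain S1 S2 where S1: "simple_path S1" "L2sq (process_measure M T) (\<lambda>p. f p - S1 (snd p) (fst p)) < ennreal (\<epsilon> / 8)"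
        and S2: "simple_path S2" "L2sq (process_measure M T) (\<lambda>p. g p - S2 (snd p) (fst p)) < ennreal (\<epsilon> / 8)"
        using add by meson
      let ?S = "\<lambda>\<omega> u. S1 \<omega> u + S2 \<omega> u"
      have m: "(\<lambda>p. S1 (snd p) (fst p)) \<in> borel_measurable (process_measure M T)"
        "(\<lambda>p. S2 (snd p) (fst p)) \<in> borel_measurable (process_measure M T)"
        using S1(1) S2(1) by (auto simp: simple_path_def)
      have "simple_function M ?S"
        using S1(1) S2(1) by (intro simple_function_compose2[of M S1 S2 "\<lambda>a b u. a u + b u"]) (auto simp: simple_path_def)
      moreover have "?S \<omega> \<in> borel_measurable (time_measure T) \<and> L2sq (time_measure T) (?S \<omega>) < \<infinity>"
        if "\<omega> \<in> space M" for \<omega>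
      proof -
        have S: "S1 \<omega> \<in> borel_measurable (time_measure T)" "S2 \<omega> \<in> borel_measurable (time_measure T)"
          "L2sq (time_measure T) (S1 \<omega>) < \<infinity>" "L2sq (time_measure T) (S2 \<omega>) < \<infinity>"
          using S1(1) S2(1) that by (simp_all add: simple_path_def)
        then show ?thesis using borel_measurable_add[OF S(1,2)] L2sq_add_finite(1)[OF S] by blast
      qed
      ultimately have "simple_path ?S"
        using borel_measurable_add[OF m] unfolding simple_path_def by blast
      moreover have "L2sq (process_measure M T) (\<lambda>p. (f p - S1 (snd p) (fst p)) + (g p - S2 (snd p) (fst p))) < ennreal \<epsilon>"
        by (rule L2sq_add_less[OF borel_measurable_diff[OF add(1) m(1)] borel_measurable_diff[OF add(3) m(2)] \<open>0 < \<epsilon>\<close> S1(2) S2(2)])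
      then have "L2sq (process_measure M T) (\<lambda>p. (f p + g p) - ?S (snd p) (fst p)) < ennreal \<epsilon>"
        by (simp add: algebra_simps)
      ultimately show "\<exists>S. simple_path S \<and> L2sq (process_measure M T) (\<lambda>p. (f p + g p) - S (snd p) (fst p)) < ennreal \<epsilon>"
        by blast
    qed
  next
    case (limit f)
    show ?case
    proof (intro allI impI)
      fix \<epsilon> :: real assume "0 < \<epsilon>"
      then have "0 < \<epsilon> / 8" by simp
      then obtain g S where g: "g \<in> borel_measurable (process_measure M T)" "L2sq (process_measure M T) (\<lambda>p. f p - g p) < ennreal (\<epsilon> / 8)"
        and S: "simple_path S" "L2sq (process_measure M T) (\<lambda>p. g p - S (snd p) (fst p)) < ennreal (\<epsilon> / 8)"
        using limit(3) by meson
      have m: "(\<lambda>p. S (snd p) (fst p)) \<in> borel_measurable (process_measure M T)"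
        using S(1) by (auto simp: simple_path_def)
      have "L2sq (process_measure M T) (\<lambda>p. (f p - g p) + (g p - S (snd p) (fst p))) < ennreal \<epsilon>"
        by (rule L2sq_add_less[OF borel_measurable_diff[OF limit(1) g(1)] borel_measurable_diff[OF g(1) m] \<open>0 < \<epsilon>\<close> g(2) S(2)])
      then show "\<exists>S. simple_path S \<and> L2sq (process_measure M T) (\<lambda>p. f p - S (snd p) (fst p)) < ennreal \<epsilon>"
        using S(1) by auto
    qed
  qed
  then show ?thesis using \<open>0 < \<epsilon>\<close> by blast
qed

lemma gamma_norm_rv_of_process:
  fixes \<phi> :: "real \<times> 'a \<Rightarrow> 'e::{real_inner, complete_space, second_countable_topology}"
  assumes "\<phi> \<in> borel_measurable (process_measure M T)" "\<omega> \<in> space M"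
  shows "(gamma_norm T (rv_of_process \<phi> \<omega>))\<^sup>2 = enn2real (L2sq (time_measure T) (\<lambda>u. \<phi> (u, \<omega>)))"
    "rv_of_process \<phi> \<omega> \<in> gamma_space T"
proof -
  have zero: "kernel_op T (\<lambda>u. 0 :: 'e) = (\<lambda>h. 0)" by (auto simp: kernel_op_def)
  have "gamma_norm_sq T (\<lambda>h. 0 :: 'e) = 0" "(\<lambda>h. 0 :: 'e) \<in> gamma_space T"
    using gamma_norm_sq_kernel_op[of "\<lambda>u. 0 :: 'e" T] kernel_op_gamma_space[of "\<lambda>u. 0 :: 'e" T] unfolding zero by simp_all
  then show "(gamma_norm T (rv_of_process \<phi> \<omega>))\<^sup>2 = enn2real (L2sq (time_measure T) (\<lambda>u. \<phi> (u, \<omega>)))"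
    "rv_of_process \<phi> \<omega> \<in> gamma_space T"
    using gamma_norm_sq_kernel_op[OF measurable_section[OF assms]] kernel_op_gamma_space[OF measurable_section[OF assms]]
    by (auto simp: rv_of_process_def gamma_norm_power2 not_less top_unique)
qed

theorem rv_of_process_in_L2_gamma:
  fixes \<phi> :: "real \<times> 'a \<Rightarrow> 'e::{real_inner, complete_space, second_countable_topology}"
  assumes \<phi>: "\<phi> \<in> borel_measurable (process_measure M T)" "L2sq (process_measure M T) \<phi> < \<infinity>"
  shows "defines_rv M T \<phi> (rv_of_process \<phi>)" "rv_of_process \<phi> \<in> L2_gamma M T"
proof -
  let ?X = "rv_of_process \<phi>"
  have fin: "AE \<omega> in M. L2sq (time_measure T) (\<lambda>u. \<phi> (u, \<omega>)) < \<infinity>" by (rule AE_L2sq_section[OF \<phi>])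
  have ex: "\<forall>n::nat. \<exists>S. simple_path S \<and> L2sq (process_measure M T) (\<lambda>p. \<phi> p - S (snd p) (fst p)) < ennreal ((1 / 2) ^ n)"
    by (intro allI simple_path_dense[OF \<phi>]) simp
  obtain S :: "nat \<Rightarrow> 'a \<Rightarrow> real \<Rightarrow> 'e" where "\<forall>n. simple_path (S n) \<and>
      L2sq (process_measure M T) (\<lambda>p. \<phi> p - S n (snd p) (fst p)) < ennreal ((1 / 2) ^ n)"
    using choice[OF ex] by (elim exE) (erule that)
  then have S: "\<And>n. simple_path (S n)"
    "\<And>n. L2sq (process_measure M T) (\<lambda>p. \<phi> p - S n (snd p) (fst p)) < ennreal ((1 / 2) ^ n)"
    by simp_all
  have S_meas: "(\<lambda>p. S n (snd p) (fst p)) \<in> borel_measurable (process_measure M T)" for n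
    using S(1)[of n] by (simp add: simple_path_def)
  have S_sec: "S n \<omega> \<in> borel_measurable (time_measure T)" "L2sq (time_measure T) (S n \<omega>) < \<infinity>" if "\<omega> \<in> space M" for n \<omega>
    using S(1)[of n] that by (simp_all add: simple_path_def)
  define a where "a = (\<lambda>n \<omega>. L2sq (time_measure T) (\<lambda>u. \<phi> (u, \<omega>) - S n \<omega> u))"
  have "a n \<in> borel_measurable M" for n
    unfolding a_def using measurable_L2sq_section[OF borel_measurable_diff[OF \<phi>(1) S_meas[of n]]] by simp
  moreover have "(\<integral>\<^sup>+ \<omega>. a n \<omega> \<partial>M) \<le> ennreal ((1 / 2) ^ n)" for n
    unfolding a_def using L2sq_process[OF borel_measurable_diff[OF \<phi>(1) S_meas[of n]]] S(2)[of n] by simp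
  ultimately have a0: "AE \<omega> in M. (\<lambda>n. a n \<omega>) \<longlonglongrightarrow> 0" by (rule AE_tendsto_0_geometric)
  have rv: "gamma_rv M T ?X"
    unfolding gamma_rv_def
  proof (intro conjI ballI exI[of _ "\<lambda>n \<omega>. kernel_op T (S n \<omega>)"] allI)
    show "?X \<omega> \<in> gamma_space T" if "\<omega> \<in> space M" for \<omega> by (rule gamma_norm_rv_of_process[OF \<phi>(1) that])
    show "simple_function M (\<lambda>\<omega>. kernel_op T (S n \<omega>))" for n
    proof -
      have "simple_function M (S n)" using S(1)[of n] by (simp add: simple_path_def)
      then show ?thesis by (rule simple_function_compose1)
    qed
    show "(\<lambda>\<omega>. kernel_op T (S n \<omega>)) ` space M \<subseteq> gamma_space T" for n
      using S_sec by (auto intro!: kernel_op_gamma_space)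
    show "AE \<omega> in M. (\<lambda>n. gamma_norm T (op_diff (kernel_op T (S n \<omega>)) (?X \<omega>))) \<longlonglongrightarrow> 0"
      using a0 fin AE_space
    proof eventually_elim
      case (elim \<omega>)
      note m = measurable_section[OF \<phi>(1) elim(3)]
      have "gamma_norm_sq T (op_diff (kernel_op T (S n \<omega>)) (?X \<omega>)) = a n \<omega>" for n
      proof -
        have "gamma_norm_sq T (op_diff (kernel_op T (S n \<omega>)) (?X \<omega>)) = gamma_norm_sq T (kernel_op T (\<lambda>u. S n \<omega> u - \<phi> (u, \<omega>)))"
          by (rule gamma_norm_sq_cong)
            (use elim in \<open>simp add: op_diff_def rv_of_process_def kernel_op_diff[OF S_sec[OF elim(3)] m elim(2)]\<close>)
        also have "\<dots> = L2sq (time_measure T) (\<lambda>u. S n \<omega> u - \<phi> (u, \<omega>))"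
          by (rule gamma_norm_sq_kernel_op[OF borel_measurable_diff[OF S_sec(1)[OF elim(3)] m]
                L2sq_add_finite(2)[OF S_sec(1)[OF elim(3)] m S_sec(2)[OF elim(3)] elim(2)]])
        also have "\<dots> = a n \<omega>" unfolding a_def by (rule L2sq_diff_commute)
        finally show ?thesis .
      qed
      then have eq: "(\<lambda>n. gamma_norm T (op_diff (kernel_op T (S n \<omega>)) (?X \<omega>))) = (\<lambda>n. sqrt (enn2real (a n \<omega>)))"
        by (simp add: gamma_norm_def)
      have "(\<lambda>n. enn2real (a n \<omega>)) \<longlonglongrightarrow> 0"
        using elim(1) by (intro tendsto_enn2real) auto
      then have "(\<lambda>n. sqrt (enn2real (a n \<omega>))) \<longlonglongrightarrow> sqrt 0" by (rule tendsto_real_sqrt)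
      then show ?case unfolding eq by simp
    qed
  qed
  show "defines_rv M T \<phi> ?X"
    unfolding defines_rv_def
  proof (intro conjI \<phi>(1) rv allI ballI)
    fix x :: "'e \<Rightarrow>\<^sub>L real"
    show "AE \<omega> in M. (\<lambda>u. blinfun_apply x (\<phi> (u, \<omega>))) \<in> L2_fun T"
      using fin AE_space
    proof eventually_elim
      case (elim \<omega>)
      note m = measurable_section[OF \<phi>(1) elim(2)]
      have "L2sq (time_measure T) (\<lambda>u. blinfun_apply x (\<phi> (u, \<omega>))) \<le> L2sq (time_measure T) (\<lambda>u. norm x *\<^sub>R \<phi> (u, \<omega>))"
        by (rule L2sq_mono) (use norm_blinfun[of x] in simp)
      also have "\<dots> < \<infinity>" using elim(1) by (simp add: L2sq_scaleR[OF m] ennreal_mult_less_top)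
      finally have "L2sq (time_measure T) (\<lambda>u. blinfun_apply x (\<phi> (u, \<omega>))) < \<infinity>" .
      moreover have "blinfun_apply x \<in> borel_measurable borel"
        by (intro borel_measurable_continuous_onI linear_continuous_on blinfun.bounded_linear_right)
      then have "(\<lambda>u. blinfun_apply x (\<phi> (u, \<omega>))) \<in> borel_measurable (time_measure T)"
        by (rule measurable_compose[OF m])
      ultimately show ?case unfolding L2_fun_iff by blast
    qed
  next
    fix h and x :: "'e \<Rightarrow>\<^sub>L real" assume h: "h \<in> L2_fun T"
    show "AE \<omega> in M. blinfun_apply x (?X \<omega> h) = (LINT u|time_measure T. h u * blinfun_apply x (\<phi> (u, \<omega>)))"
      using fin AE_space
    proof eventually_elim
      case (elim \<omega>)
      have int: "integrable (time_measure T) (\<lambda>u. h u *\<^sub>R \<phi> (u, \<omega>))"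
        by (rule integrable_kernel[OF h measurable_section[OF \<phi>(1) elim(2)] elim(1)])
      have "blinfun_apply x (kernel_op T (\<lambda>u. \<phi> (u, \<omega>)) h) = (LINT u|time_measure T. blinfun_apply x (h u *\<^sub>R \<phi> (u, \<omega>)))"
        unfolding kernel_op_def by (rule integral_bounded_linear[OF blinfun.bounded_linear_right int, symmetric])
      then show ?case using elim(1) by (simp add: rv_of_process_def blinfun.scaleR_right)
    qed
  qed
  have "integrable M (\<lambda>\<omega>. (gamma_norm T (?X \<omega>))\<^sup>2)"
  proof -
    have m: "(\<lambda>\<omega>. enn2real (L2sq (time_measure T) (\<lambda>u. \<phi> (u, \<omega>)))) \<in> borel_measurable M"
      using measurable_L2sq_section[OF \<phi>(1)] by measurable
    have "(\<integral>\<^sup>+ \<omega>. ennreal (enn2real (L2sq (time_measure T) (\<lambda>u. \<phi> (u, \<omega>)))) \<partial>M) =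
        (\<integral>\<^sup>+ \<omega>. L2sq (time_measure T) (\<lambda>u. \<phi> (u, \<omega>)) \<partial>M)"
      by (rule nn_integral_cong_AE) (use fin in \<open>eventually_elim, simp\<close>)
    also have "\<dots> < \<infinity>" unfolding L2sq_process[OF \<phi>(1)] by (rule \<phi>(2))
    finally have "integrable M (\<lambda>\<omega>. enn2real (L2sq (time_measure T) (\<lambda>u. \<phi> (u, \<omega>))))"
      by (intro integrableI_nonneg m) auto
    then show ?thesis
      by (rule Bochner_Integration.integrable_cong[THEN iffD1, rotated 2]) (simp_all add: gamma_norm_rv_of_process(1)[OF \<phi>(1)])
  qed
  then show "?X \<in> L2_gamma M T" using rv by (simp add: L2_gamma_def)
qed

end



section \<open>Adapted processes and translation in time\<close>

lemma L2sq_sum_finite: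
  fixes f :: "'i \<Rightarrow> 'a \<Rightarrow> 'b::{real_normed_vector, second_countable_topology}"
  assumes "\<And>i. i \<in> I \<Longrightarrow> f i \<in> borel_measurable N" "\<And>i. i \<in> I \<Longrightarrow> L2sq N (f i) < \<infinity>"
  shows "L2sq N (\<lambda>x. \<Sum>i\<in>I. f i x) < \<infinity>"
  using assms
proof (induction I rule: infinite_finite_induct)
  case (insert i I)
  have "f i \<in> borel_measurable N" "(\<lambda>x. \<Sum>i\<in>I. f i x) \<in> borel_measurable N" "L2sq N (f i) < \<infinity>"
    "L2sq N (\<lambda>x. \<Sum>i\<in>I. f i x) < \<infinity>"
    using insert by (auto intro!: borel_measurable_sum)
  from L2sq_add_finite(1)[OF this] show ?case by (simp add: insert.hyps)
qed simp_all

lemma increasing_chain_le: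
  fixes t :: "nat \<Rightarrow> real"
  assumes "\<And>i. i < n \<Longrightarrow> t i < t (Suc i)" "i \<le> j" "j \<le> n"
  shows "t i \<le> t j"
  using assms(2,3)
proof (induction j rule: dec_induct)
  case (step j)
  then show ?case using assms(1)[of j] by simp
qed simp

locale adapted_space = process_space M T for M :: "'a measure" and T :: real +
  fixes F :: "real \<Rightarrow> 'a measure"
  assumes T_pos: "0 < T"
    and subalgebra_F: "\<And>u. u \<in> {0..T} \<Longrightarrow> subalgebra M (F u)"
    and F_mono: "\<And>s t. 0 \<le> s \<Longrightarrow> s \<le> t \<Longrightarrow> t \<le> T \<Longrightarrow> sets (F s) \<subseteq> sets (F t)"
begin

abbreviation "\<mu> \<equiv> process_measure M T"
abbreviation "Sig \<equiv> Sigma_adapted M T F"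

lemma space_F: "u \<in> {0..T} \<Longrightarrow> space (F u) = space M"
  using subalgebra_F by (auto simp: subalgebra_def)

lemma sets_F: "u \<in> {0..T} \<Longrightarrow> D \<in> sets (F u) \<Longrightarrow> D \<in> sets M"
  using subalgebra_F by (auto simp: subalgebra_def)

lemma Sigma_generator_subset:
  "{B \<in> sets \<mu>. \<forall>u\<in>{0..T}. (\<lambda>\<omega>. indicator B (u, \<omega>) :: real) \<in> borel_measurable (F u)} \<subseteq> Pow ({0..T} \<times> space M)"
  using sets.sets_into_space[of _ \<mu>] by auto

lemma space_Sigma [simp]: "space Sig = {0..T} \<times> space M"
  unfolding Sigma_adapted_def by (rule space_measure_of[OF Sigma_generator_subset])

lemma sets_SigmaI:
  assumes "B \<in> sets \<mu>" "\<And>u. u \<in> {0..T} \<Longrightarrow> (\<lambda>\<omega>. indicator B (u, \<omega>) :: real) \<in> borel_measurable (F u)"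
  shows "B \<in> sets Sig"
  unfolding Sigma_adapted_def sets_measure_of[OF Sigma_generator_subset]
  using assms by (intro sigma_sets.Basic) blast

lemma subalgebra_Sigma: "subalgebra \<mu> Sig"
  unfolding subalgebra_def
proof
  have "sigma_sets ({0..T} \<times> space M) {B \<in> sets \<mu>. \<forall>u\<in>{0..T}. (\<lambda>\<omega>. indicator B (u, \<omega>) :: real) \<in> borel_measurable (F u)} \<subseteq> sets \<mu>"
    using sets.sigma_sets_subset[of _ \<mu>] by simp
  then show "sets Sig \<subseteq> sets \<mu>"
    unfolding Sigma_adapted_def sets_measure_of[OF Sigma_generator_subset] .
qed simp

lemma measurable_Sigma_process: "f \<in> borel_measurable Sig \<Longrightarrow> f \<in> borel_measurable \<mu>"
  by (rule measurable_from_subalg[OF subalgebra_Sigma])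

lemma measurable_Sigma_section:
  assumes f: "f \<in> borel_measurable Sig" and u: "u \<in> {0..T}"
  shows "(\<lambda>\<omega>. f (u, \<omega>)) \<in> borel_measurable (F u)"
proof -
  have "Pair u \<in> measurable (F u) Sig"
    unfolding Sigma_adapted_def
  proof (rule measurable_measure_of[OF Sigma_generator_subset])
    show "Pair u \<in> space (F u) \<rightarrow> {0..T} \<times> space M" using space_F[OF u] u by auto
    fix B assume "B \<in> {B \<in> sets \<mu>. \<forall>u\<in>{0..T}. (\<lambda>\<omega>. indicator B (u, \<omega>) :: real) \<in> borel_measurable (F u)}"
    then have "(\<lambda>\<omega>. indicator B (u, \<omega>) :: real) \<in> borel_measurable (F u)" using u by blast
    then have "(\<lambda>\<omega>. indicator B (u, \<omega>) :: real) -` {1} \<inter> space (F u) \<in> sets (F u)"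
      by (rule measurable_sets) simp
    also have "(\<lambda>\<omega>. indicator B (u, \<omega>) :: real) -` {1} \<inter> space (F u) = Pair u -` B \<inter> space (F u)"
      by (auto simp: indicator_def)
    finally show "Pair u -` B \<inter> space (F u) \<in> sets (F u)" .
  qed
  then show ?thesis by (rule measurable_compose[OF _ f])
qed

lemma adapted_rectangle:
  assumes I: "I \<in> sets borel" "I \<subseteq> {s..T}" and s: "0 \<le> s" "s \<le> T" and D: "D \<in> sets (F s)"
  shows "I \<times> D \<in> sets Sig"
proof (rule sets_SigmaI)
  have "I \<inter> {0..T} = I" using I(2) s by auto
  then have "I \<in> sets (time_measure T)" using I(1) by (auto simp: sets_restrict_space image_iff intro!: bexI[of _ I])
  then show "I \<times> D \<in> sets \<mu>" using sets_F[of s D] s D by auto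
  fix u assume u: "u \<in> {0..T}"
  show "(\<lambda>\<omega>. indicator (I \<times> D) (u, \<omega>) :: real) \<in> borel_measurable (F u)"
  proof (cases "u \<in> I")
    case True
    then have "s \<le> u" using I(2) by auto
    then have "D \<in> sets (F u)" using F_mono[of s u] s u D by auto
    then have "(\<lambda>\<omega>. indicat_real D \<omega>) \<in> borel_measurable (F u)" by simp
    then show ?thesis using True by (simp add: indicator_def)
  next
    case False
    then show ?thesis by (simp add: indicator_def)
  qed
qed

text \<open>A step on \<open>(t\<^sub>i, t\<^sub>i\<^sub>+\<^sub>1]\<close> is known at time \<open>t\<^sub>i\<close>, so it is adapted.\<close>

lemma step_process_measurable:
  fixes \<phi> :: "real \<times> 'a \<Rightarrow> 'e::{real_normed_vector, second_countable_topology}"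
  assumes "step_process T F \<phi>"
  shows "\<phi> \<in> borel_measurable Sig" "L2sq \<mu> \<phi> < \<infinity>"
proof -
  obtain n m :: nat and t :: "nat \<Rightarrow> real" and A e0 and D :: "nat \<Rightarrow> nat \<Rightarrow> 'a set" and e :: "nat \<Rightarrow> nat \<Rightarrow> 'e" where
    t: "0 \<le> t 0" "\<forall>i<n. t i < t (Suc i)" "t n \<le> T" and A: "A \<in> sets (F 0)"
    and D: "\<forall>i<n. (\<forall>j<m. D j i \<in> sets (F (t i))) \<and> disjoint_family_on (\<lambda>j. D j i) {..<m}"
    and \<phi>: "\<phi> = (\<lambda>p. indicator ({0} \<times> A) p *\<^sub>R e0 +
               (\<Sum>i<n. \<Sum>j<m. indicator ({t i<..t (Suc i)} \<times> D j i) p *\<^sub>R e j i))"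
    using assms unfolding step_process_def by (elim exE conjE) blast
  have A': "{0} \<times> A \<in> sets Sig" using T_pos A by (intro adapted_rectangle[of _ 0]) auto
  have D': "{t i<..t (Suc i)} \<times> D j i \<in> sets Sig" if "i < n" "j < m" for i j
  proof (rule adapted_rectangle[of _ "t i"])
    have "t 0 \<le> t i" "t (Suc i) \<le> t n" "t i \<le> t n" using t(2) that increasing_chain_le[of n t] by auto
    then show "{t i<..t (Suc i)} \<subseteq> {t i..T}" "0 \<le> t i" "t i \<le> T" using t by auto
    show "D j i \<in> sets (F (t i))" using D that by blast
  qed simp
  have B: "(\<lambda>p. indicat_real B p *\<^sub>R x) \<in> borel_measurable Sig \<and> L2sq \<mu> (\<lambda>p. indicat_real B p *\<^sub>R x) < \<infinity>"
    if "B \<in> sets Sig" for B and x :: 'e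
  proof
    have "simple_function Sig (\<lambda>p. indicat_real B p *\<^sub>R x)"
      by (rule simple_function_compose1[OF simple_function_indicator[OF that]])
    then show "(\<lambda>p. indicat_real B p *\<^sub>R x) \<in> borel_measurable Sig" by (rule borel_measurable_simple_function)
    have "B \<in> sets \<mu>" using that subalgebra_Sigma by (auto simp: subalgebra_def)
    then have "simple_function \<mu> (\<lambda>p. indicat_real B p *\<^sub>R x)"
      by (rule simple_function_compose1[OF simple_function_indicator])
    then show "L2sq \<mu> (\<lambda>p. indicat_real B p *\<^sub>R x) < \<infinity>" by (rule proc.L2sq_simple_finite)
  qed
  have m1: "(\<lambda>p. \<Sum>j<m. indicat_real ({t i<..t (Suc i)} \<times> D j i) p *\<^sub>R e j i) \<in> borel_measurable Sig" if "i < n" for i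
    using B[OF D'[OF that]] by (intro borel_measurable_sum) auto
  have m2: "(\<lambda>p. \<Sum>i<n. \<Sum>j<m. indicat_real ({t i<..t (Suc i)} \<times> D j i) p *\<^sub>R e j i) \<in> borel_measurable Sig"
    by (rule borel_measurable_sum) (rule m1, simp)
  have f1: "L2sq \<mu> (\<lambda>p. \<Sum>j<m. indicat_real ({t i<..t (Suc i)} \<times> D j i) p *\<^sub>R e j i) < \<infinity>" if "i < n" for i
    using B[OF D'[OF that]] by (intro L2sq_sum_finite measurable_Sigma_process) auto
  have f2: "L2sq \<mu> (\<lambda>p. \<Sum>i<n. \<Sum>j<m. indicat_real ({t i<..t (Suc i)} \<times> D j i) p *\<^sub>R e j i) < \<infinity>"
  proof (rule L2sq_sum_finite)
    fix i assume "i \<in> {..<n}"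
    then have i: "i < n" by simp
    show "(\<lambda>p. \<Sum>j<m. indicat_real ({t i<..t (Suc i)} \<times> D j i) p *\<^sub>R e j i) \<in> borel_measurable \<mu>"
      by (rule measurable_Sigma_process[OF m1[OF i]])
    show "L2sq \<mu> (\<lambda>p. \<Sum>j<m. indicat_real ({t i<..t (Suc i)} \<times> D j i) p *\<^sub>R e j i) < \<infinity>"
      by (rule f1[OF i])
  qed
  show "\<phi> \<in> borel_measurable Sig" unfolding \<phi> using B[OF A', of e0] m2 by (intro borel_measurable_add) auto
  show "L2sq \<mu> \<phi> < \<infinity>"
    unfolding \<phi>
    by (rule L2sq_add_finite(1)[OF measurable_Sigma_process measurable_Sigma_process[OF m2] _ f2])
      (use B[OF A', of e0] in blast)+
qed

text \<open>Extension by \<open>0\<close> outside \<open>[0,T]\<close>, so that a process can be translated in time.\<close>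

definition zero_ext :: "(real \<times> 'a \<Rightarrow> 'e::real_normed_vector) \<Rightarrow> real \<times> 'a \<Rightarrow> 'e" where
  "zero_ext \<phi> p = (if fst p \<in> {0..T} then \<phi> p else 0)"

lemma measurable_zero_ext:
  fixes \<phi> :: "real \<times> 'a \<Rightarrow> 'e::{real_normed_vector, second_countable_topology}"
  assumes \<phi>: "\<phi> \<in> borel_measurable \<mu>"
  shows "zero_ext \<phi> \<in> borel_measurable (borel \<Otimes>\<^sub>M M)"
proof -
  let ?c = "\<lambda>v. max 0 (min T v)"
  have "?c \<in> measurable borel (time_measure T)"
    using T_pos by (intro measurable_restrict_space2) (auto simp: measurable_lborel1)
  then have "(\<lambda>p. (?c (fst p), snd p)) \<in> measurable (borel \<Otimes>\<^sub>M M) \<mu>"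
    by (intro measurable_Pair measurable_compose[OF measurable_fst] measurable_snd)
  then have [measurable]: "(\<lambda>p. \<phi> (?c (fst p), snd p)) \<in> borel_measurable (borel \<Otimes>\<^sub>M M)"
    by (rule measurable_compose[OF _ \<phi>])
  have "zero_ext \<phi> = (\<lambda>p. if fst p \<in> {0..T} then \<phi> (?c (fst p), snd p) else 0)"
    by (auto simp: zero_ext_def)
  then show ?thesis by simp
qed

lemma measurable_zero_ext_compose:
  fixes \<phi> :: "real \<times> 'a \<Rightarrow> 'e::{real_normed_vector, second_countable_topology}"
  assumes "\<phi> \<in> borel_measurable \<mu>" "g \<in> borel_measurable N" "h \<in> measurable N M"
  shows "(\<lambda>x. zero_ext \<phi> (g x, h x)) \<in> borel_measurable N"
  by (rule measurable_compose[OF measurable_Pair[OF assms(2,3)] measurable_zero_ext[OF assms(1)]])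

sublocale LP: pair_sigma_finite lborel M ..

abbreviation shift_diff :: "(real \<times> 'a \<Rightarrow> 'e::real_normed_vector) \<Rightarrow> real \<Rightarrow> real \<times> 'a \<Rightarrow> 'e" where
  "shift_diff \<phi> r p \<equiv> zero_ext \<phi> (fst p + r, snd p) - zero_ext \<phi> p"

lemma measurable_shift:
  fixes \<phi> :: "real \<times> 'a \<Rightarrow> 'e::{real_normed_vector, second_countable_topology}"
  assumes "\<phi> \<in> borel_measurable \<mu>"
  shows "(\<lambda>p. zero_ext \<phi> (fst p + r, snd p)) \<in> borel_measurable (lborel \<Otimes>\<^sub>M M)"
  by (rule measurable_zero_ext_compose[OF assms]) measurable

lemma measurable_zero_ext':
  fixes \<phi> :: "real \<times> 'a \<Rightarrow> 'e::{real_normed_vector, second_countable_topology}"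
  assumes "\<phi> \<in> borel_measurable \<mu>"
  shows "zero_ext \<phi> \<in> borel_measurable (lborel \<Otimes>\<^sub>M M)"
  using measurable_shift[OF assms, of 0] by simp

lemma L2sq_shift:
  fixes \<phi> :: "real \<times> 'a \<Rightarrow> 'e::{real_normed_vector, second_countable_topology}"
  assumes \<phi>: "\<phi> \<in> borel_measurable \<mu>"
  shows "L2sq (lborel \<Otimes>\<^sub>M M) (\<lambda>p. zero_ext \<phi> (fst p + r, snd p)) = L2sq \<mu> \<phi>"
proof -
  have "L2sq (lborel \<Otimes>\<^sub>M M) (\<lambda>p. zero_ext \<phi> (fst p + r, snd p)) =
      (\<integral>\<^sup>+ \<omega>. (\<integral>\<^sup>+ v. ennreal ((norm (zero_ext \<phi> (v + r, \<omega>)))\<^sup>2) \<partial>lborel) \<partial>M)"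
    unfolding L2sq_def using measurable_shift[OF \<phi>, of r]
    by (subst LP.nn_integral_snd[symmetric]) auto
  also have "\<dots> = (\<integral>\<^sup>+ \<omega>. L2sq (time_measure T) (\<lambda>u. \<phi> (u, \<omega>)) \<partial>M)"
  proof (rule nn_integral_cong)
    fix \<omega> assume \<omega>: "\<omega> \<in> space M"
    have "(\<lambda>v. zero_ext \<phi> (v, \<omega>)) \<in> borel_measurable borel"
      using \<omega> by (intro measurable_zero_ext_compose[OF \<phi>]) auto
    then have m: "(\<lambda>v. ennreal ((norm (zero_ext \<phi> (v, \<omega>)))\<^sup>2)) \<in> borel_measurable borel" by measurable
    have "(\<integral>\<^sup>+ v. ennreal ((norm (zero_ext \<phi> (v + r, \<omega>)))\<^sup>2) \<partial>lborel) = (\<integral>\<^sup>+ v. ennreal ((norm (zero_ext \<phi> (v, \<omega>)))\<^sup>2) \<partial>lborel)"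
      using nn_integral_real_affine[OF m, of 1 r] by (simp add: add.commute)
    also have "\<dots> = (\<integral>\<^sup>+ v. ennreal ((norm (\<phi> (v, \<omega>)))\<^sup>2) * indicator {0..T} v \<partial>lborel)"
      by (rule nn_integral_cong) (simp add: zero_ext_def indicator_def)
    also have "\<dots> = L2sq (time_measure T) (\<lambda>u. \<phi> (u, \<omega>))"
      unfolding L2sq_def by (subst nn_integral_restrict_space) auto
    finally show "(\<integral>\<^sup>+ v. ennreal ((norm (zero_ext \<phi> (v + r, \<omega>)))\<^sup>2) \<partial>lborel) = L2sq (time_measure T) (\<lambda>u. \<phi> (u, \<omega>))" .
  qed
  also have "\<dots> = L2sq \<mu> \<phi>" by (rule L2sq_process[OF \<phi>])
  finally show ?thesis .
qed

lemma zero_ext_add: "zero_ext (\<lambda>p. f p + g p) p = zero_ext f p + zero_ext g p"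
  by (simp add: zero_ext_def)

text \<open>For the indicator of \<open>[0,c] \<times> b\<close> a translation by \<open>r\<close> changes values only for times within
  \<open>r\<close> of one of the two endpoints. The property passes to \<open>L\<^sup>2\<close> limits because translations
  preserve the norm.\<close>

theorem translation_continuous:
  fixes \<phi> :: "real \<times> 'a \<Rightarrow> 'e::{real_normed_vector, second_countable_topology}"
  assumes \<phi>: "\<phi> \<in> borel_measurable \<mu>" "L2sq \<mu> \<phi> < \<infinity>" and "0 < \<epsilon>"
  shows "\<exists>\<delta>>0. \<forall>r. 0 < r \<and> r < \<delta> \<longrightarrow> L2sq (lborel \<Otimes>\<^sub>M M) (shift_diff \<phi> r) < ennreal \<epsilon>"
proof -
  let ?G = "{a \<times> b |a b. a \<in> time_sections T \<and> b \<in> sets M}"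
  have gen: "sets \<mu> = sigma_sets (space \<mu>) ?G"
    by (rule sets_pair_generator) (use sets_time time_sections_top in auto)
  have top: "space \<mu> \<in> ?G" using time_sections_top by auto
  have stable: "Int_stable ?G"
  proof (rule Int_stableI)
    fix A B assume "A \<in> ?G" "B \<in> ?G"
    then obtain a b a' b' where "A = a \<times> b" "B = a' \<times> b'" "a \<in> time_sections T" "a' \<in> time_sections T" "b \<in> sets M" "b' \<in> sets M"
      by blast
    moreover have "a \<inter> a' \<in> time_sections T" using calculation Int_stable_time_sections by (auto simp: Int_stable_def)
    ultimately show "A \<inter> B \<in> ?G" by (auto simp: Times_Int_Times)
  qed
  have "\<forall>\<epsilon>>0. \<exists>\<delta>>0. \<forall>r. 0 < r \<and> r < \<delta> \<longrightarrow> L2sq (lborel \<Otimes>\<^sub>M M) (shift_diff \<phi> r) < ennreal \<epsilon>"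
    using proc.finite_measure_axioms stable gen top \<phi>
  proof (induction rule: L2_induct)
    case (indicator A e)
    then obtain q b where A: "A = ({0..T} \<inter> {..real_of_rat q}) \<times> b" "b \<in> sets M" by (auto simp: time_sections_def)
    define c where "c = min T (real_of_rat q)"
    have bound: "L2sq (lborel \<Otimes>\<^sub>M M) (shift_diff (\<lambda>p. indicat_real A p *\<^sub>R e) r) \<le> ennreal ((norm e)\<^sup>2 * (2 * r))" if r: "0 < r" for r
    proof -
      define g where "g = (\<lambda>v. ennreal ((norm e)\<^sup>2) * (indicator {- r..0} v + indicator {c - r..c} v :: ennreal))"
      have "L2sq (lborel \<Otimes>\<^sub>M M) (shift_diff (\<lambda>p. indicat_real A p *\<^sub>R e) r) \<le> (\<integral>\<^sup>+ p. g (fst p) \<partial>(lborel \<Otimes>\<^sub>M M))"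
        unfolding L2sq_def
      proof (rule nn_integral_mono)
        fix p :: "real \<times> 'a"
        obtain v \<omega> where p: "p = (v, \<omega>)" by (cases p)
        show "ennreal ((norm (shift_diff (\<lambda>p. indicat_real A p *\<^sub>R e) r p))\<^sup>2) \<le> g (fst p)"
        proof (cases "v \<in> {- r..0} \<or> v \<in> {c - r..c}")
          case True
          have "norm (shift_diff (\<lambda>p. indicat_real A p *\<^sub>R e) r p) \<le> norm e"
            by (auto simp: zero_ext_def indicator_def)
          then have "ennreal ((norm (shift_diff (\<lambda>p. indicat_real A p *\<^sub>R e) r p))\<^sup>2) \<le> ennreal ((norm e)\<^sup>2)"
            by (intro ennreal_leI power_mono) auto
          also have "\<dots> \<le> g (fst p)"
            using True mult_left_mono[of 1 "indicator {- r..0} v + indicator {c - r..c} v :: ennreal" "ennreal ((norm e)\<^sup>2)"]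
            by (auto simp: g_def p indicator_def split: if_splits)
          finally show ?thesis .
        next
          case False
          then have "v + r \<in> {0..T} \<inter> {..real_of_rat q} \<longleftrightarrow> v \<in> {0..T} \<inter> {..real_of_rat q}"
            using r by (auto simp: c_def)
          then have "shift_diff (\<lambda>p. indicat_real A p *\<^sub>R e) r p = 0"
            by (auto simp: zero_ext_def indicator_def A p)
          then show ?thesis by simp
        qed
      qed
      also have "\<dots> = (\<integral>\<^sup>+ v. (\<integral>\<^sup>+ \<omega>. g v \<partial>M) \<partial>lborel)"
        by (subst nn_integral_fst[symmetric]) (auto simp: g_def)
      also have "\<dots> = (\<integral>\<^sup>+ v. g v \<partial>lborel)" by (simp add: emeasure_space_1)
      also have "\<dots> = ennreal ((norm e)\<^sup>2) * (emeasure lborel {- r..0} + emeasure lborel {c - r..c})"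
        unfolding g_def by (simp add: nn_integral_cmult nn_integral_add)
      also have "\<dots> = ennreal ((norm e)\<^sup>2 * (2 * r))"
        using r by (simp add: ennreal_mult flip: ennreal_plus)
      finally show ?thesis .
    qed
    show ?case
    proof (intro allI impI)
      fix \<epsilon> :: real assume \<epsilon>: "0 < \<epsilon>"
      define \<delta> where "\<delta> = \<epsilon> / (2 * (norm e)\<^sup>2 + 1)"
      have den: "0 < 2 * (norm e)\<^sup>2 + 1" by (simp add: add_nonneg_pos)
      have "L2sq (lborel \<Otimes>\<^sub>M M) (shift_diff (\<lambda>p. indicat_real A p *\<^sub>R e) r) < ennreal \<epsilon>" if "0 < r" "r < \<delta>" for r
      proof -
        have "r * (2 * (norm e)\<^sup>2 + 1) < \<epsilon>" using that(2) den by (simp add: \<delta>_def pos_less_divide_eq)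
        then have "(norm e)\<^sup>2 * (2 * r) < \<epsilon>" using that(1) by (simp add: algebra_simps)
        then have "ennreal ((norm e)\<^sup>2 * (2 * r)) < ennreal \<epsilon>" using \<epsilon> by (intro ennreal_lessI)
        then show ?thesis by (rule le_less_trans[OF bound[OF that(1)]])
      qed
      moreover have "0 < \<delta>" using \<epsilon> den by (simp add: \<delta>_def)
      ultimately show "\<exists>\<delta>>0. \<forall>r. 0 < r \<and> r < \<delta> \<longrightarrow> L2sq (lborel \<Otimes>\<^sub>M M) (shift_diff (\<lambda>p. indicat_real A p *\<^sub>R e) r) < ennreal \<epsilon>"
        by blast
    qed
  next
    case (add f g)
    show ?case
    proof (intro allI impI)
      fix \<epsilon> :: real assume \<epsilon>: "0 < \<epsilon>"
      then have e8: "0 < \<epsilon> / 8" by simp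
      obtain d1 where d1: "d1 > 0" "\<And>r. 0 < r \<Longrightarrow> r < d1 \<Longrightarrow> L2sq (lborel \<Otimes>\<^sub>M M) (shift_diff f r) < ennreal (\<epsilon> / 8)"
        using add(5) e8 by blast
      obtain d2 where d2: "d2 > 0" "\<And>r. 0 < r \<Longrightarrow> r < d2 \<Longrightarrow> L2sq (lborel \<Otimes>\<^sub>M M) (shift_diff g r) < ennreal (\<epsilon> / 8)"
        using add(6) e8 by blast
      have "L2sq (lborel \<Otimes>\<^sub>M M) (shift_diff (\<lambda>p. f p + g p) r) < ennreal \<epsilon>" if "0 < r" "r < min d1 d2" for r
      proof -
        have "L2sq (lborel \<Otimes>\<^sub>M M) (\<lambda>p. shift_diff f r p + shift_diff g r p) < ennreal \<epsilon>"
          by (rule L2sq_add_less[OF borel_measurable_diff[OF measurable_shift[OF add(1)] measurable_zero_ext'[OF add(1)]]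
              borel_measurable_diff[OF measurable_shift[OF add(3)] measurable_zero_ext'[OF add(3)]] \<epsilon>])
            (use d1 d2 that in auto)
        then show ?thesis by (simp add: zero_ext_add algebra_simps)
      qed
      then show "\<exists>\<delta>>0. \<forall>r. 0 < r \<and> r < \<delta> \<longrightarrow> L2sq (lborel \<Otimes>\<^sub>M M) (shift_diff (\<lambda>p. f p + g p) r) < ennreal \<epsilon>"
        using d1(1) d2(1) by (intro exI[of _ "min d1 d2"]) auto
    qed
  next
    case (limit f)
    show ?case
    proof (intro allI impI)
      fix \<epsilon> :: real assume \<epsilon>: "0 < \<epsilon>"
      then have e: "0 < \<epsilon> / 8" "0 < \<epsilon> / 8 / 8" by simp_all
      obtain g where g: "g \<in> borel_measurable \<mu>" "L2sq \<mu> (\<lambda>p. f p - g p) < ennreal (\<epsilon> / 8 / 8)"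
        and "\<forall>\<epsilon>>0. \<exists>\<delta>>0. \<forall>r. 0 < r \<and> r < \<delta> \<longrightarrow> L2sq (lborel \<Otimes>\<^sub>M M) (shift_diff g r) < ennreal \<epsilon>"
        using limit(3)[OF e(2)] by blast
      then obtain d where d: "d > 0" "\<And>r. 0 < r \<Longrightarrow> r < d \<Longrightarrow> L2sq (lborel \<Otimes>\<^sub>M M) (shift_diff g r) < ennreal (\<epsilon> / 8)"
        using e(1) by blast
      let ?h = "\<lambda>p. f p - g p"
      have h: "?h \<in> borel_measurable \<mu>" using limit(1) g(1) by (rule borel_measurable_diff)
      have "L2sq (lborel \<Otimes>\<^sub>M M) (shift_diff f r) < ennreal \<epsilon>" if "0 < r" "r < d" for r
      proof -
        have s: "L2sq (lborel \<Otimes>\<^sub>M M) (\<lambda>p. zero_ext ?h (fst p + r, snd p)) < ennreal (\<epsilon> / 8 / 8)"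
          "L2sq (lborel \<Otimes>\<^sub>M M) (\<lambda>p. - zero_ext ?h p) < ennreal (\<epsilon> / 8 / 8)"
          using g(2) L2sq_shift[OF h, of r] L2sq_shift[OF h, of 0] by simp_all
        have "L2sq (lborel \<Otimes>\<^sub>M M) (\<lambda>p. zero_ext ?h (fst p + r, snd p) + - zero_ext ?h p) < ennreal (\<epsilon> / 8)"
          by (rule L2sq_add_less[OF measurable_shift[OF h] borel_measurable_uminus[OF measurable_zero_ext'[OF h]] e(1) s])
        then have hs: "L2sq (lborel \<Otimes>\<^sub>M M) (shift_diff ?h r) < ennreal (\<epsilon> / 8)" by simp
        have "L2sq (lborel \<Otimes>\<^sub>M M) (\<lambda>p. shift_diff ?h r p + shift_diff g r p) < ennreal \<epsilon>"
          by (rule L2sq_add_less[OF borel_measurable_diff[OF measurable_shift[OF h] measurable_zero_ext'[OF h]]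
              borel_measurable_diff[OF measurable_shift[OF g(1)] measurable_zero_ext'[OF g(1)]] \<epsilon> hs d(2)[OF that]])
        moreover have "shift_diff ?h r p + shift_diff g r p = shift_diff f r p" for p
          by (simp add: zero_ext_def)
        ultimately show ?thesis by simp
      qed
      then show "\<exists>\<delta>>0. \<forall>r. 0 < r \<and> r < \<delta> \<longrightarrow> L2sq (lborel \<Otimes>\<^sub>M M) (shift_diff f r) < ennreal \<epsilon>"
        using d(1) by blast
    qed
  qed
  then show ?thesis using \<open>0 < \<epsilon>\<close> by blast
qed

end



section \<open>Approximation by adapted step processes\<close>

context adapted_space
begin

definition shift_energy :: "(real \<times> 'a \<Rightarrow> 'e::real_normed_vector) \<Rightarrow> real \<Rightarrow> real \<Rightarrow> ennreal" where
  "shift_energy \<phi> r v = (\<integral>\<^sup>+ \<omega>. ennreal ((norm (zero_ext \<phi> (v + r, \<omega>) - zero_ext \<phi> (v, \<omega>)))\<^sup>2) \<partial>M)"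

lemma measurable_shift_energy:
  fixes \<phi> :: "real \<times> 'a \<Rightarrow> 'e::{real_normed_vector, second_countable_topology}"
  assumes \<phi>: "\<phi> \<in> borel_measurable \<mu>" and g: "g \<in> borel_measurable N" and h: "h \<in> borel_measurable N"
  shows "(\<lambda>x. shift_energy \<phi> (g x) (h x)) \<in> borel_measurable N"
proof -
  note [measurable] = g h
  have [measurable]: "(\<lambda>x. zero_ext \<phi> (h (fst x) + g (fst x), snd x)) \<in> borel_measurable (N \<Otimes>\<^sub>M M)"
    by (rule measurable_zero_ext_compose[OF \<phi>]) measurable
  have [measurable]: "(\<lambda>x. zero_ext \<phi> (h (fst x), snd x)) \<in> borel_measurable (N \<Otimes>\<^sub>M M)"
    by (rule measurable_zero_ext_compose[OF \<phi>]) measurable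
  have "(\<lambda>x. ennreal ((norm (zero_ext \<phi> (h (fst x) + g (fst x), snd x) - zero_ext \<phi> (h (fst x), snd x)))\<^sup>2)) \<in> borel_measurable (N \<Otimes>\<^sub>M M)"
    by measurable
  from borel_measurable_nn_integral_fst[OF this] show ?thesis by (simp add: shift_energy_def)
qed

lemma nn_integral_shift_energy:
  fixes \<phi> :: "real \<times> 'a \<Rightarrow> 'e::{real_normed_vector, second_countable_topology}"
  assumes \<phi>: "\<phi> \<in> borel_measurable \<mu>"
  shows "(\<integral>\<^sup>+ v. shift_energy \<phi> r v \<partial>lborel) = L2sq (lborel \<Otimes>\<^sub>M M) (shift_diff \<phi> r)"
proof -
  have "(\<lambda>p. ennreal ((norm (shift_diff \<phi> r p))\<^sup>2)) \<in> borel_measurable (lborel \<Otimes>\<^sub>M M)"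
    using measurable_shift[OF \<phi>] measurable_zero_ext'[OF \<phi>] by measurable
  from nn_integral_fst[OF this] show ?thesis by (simp add: shift_energy_def L2sq_def)
qed

text \<open>averaging over the offset\<close>

text \<open>The sum is the squared error of freezing \<open>\<phi>\<close> at the left end points of a grid of mesh \<open>\<delta>\<close> with
  offset \<open>s\<close>. A fixed grid may be bad, since it only sees the values of \<open>\<phi>\<close> at countably many times.
  Integrated over all offsets, the left end points run through the whole time axis, and the error
  becomes an average of the squared norms of \<open>\<phi>\<close> minus its translates by \<open>r \<le> \<delta>\<close>.\<close>

lemma good_grid_offset:
  fixes \<phi> :: "real \<times> 'a \<Rightarrow> 'e::{real_normed_vector, second_countable_topology}"
  assumes \<phi>: "\<phi> \<in> borel_measurable \<mu>" and pos: "0 < \<delta>" "0 < \<epsilon>"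
    and small: "\<And>r. 0 < r \<Longrightarrow> r \<le> \<delta> \<Longrightarrow> L2sq (lborel \<Otimes>\<^sub>M M) (shift_diff \<phi> r) \<le> ennreal (\<epsilon> / 2)"
  shows "\<exists>s. 0 < s \<and> s < \<delta> \<and>
    (\<Sum>k\<le>n. \<integral>\<^sup>+ r. indicator {0<..\<delta>} r * shift_energy \<phi> r (s + (real k - 1) * \<delta>) \<partial>lborel) < ennreal \<epsilon>"
proof (rule ccontr)
  let ?c = "\<lambda>k. (real k - 1) * \<delta>"
  let ?E = "\<lambda>s. \<Sum>k\<le>n. \<integral>\<^sup>+ r. indicator {0<..\<delta>} r * shift_energy \<phi> r (s + ?c k) \<partial>lborel"
  assume "\<not> ?thesis"
  then have big: "ennreal \<epsilon> \<le> ?E s" if "0 < s" "s < \<delta>" for s using that by (meson not_le)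
  have [measurable]: "(\<lambda>x. shift_energy \<phi> (g x) (h x)) \<in> borel_measurable N"
    if "g \<in> borel_measurable N" "h \<in> borel_measurable N" for g h and N :: "'b measure"
    using measurable_shift_energy[OF \<phi> that] .
  have m3: "(\<lambda>x. shift_energy \<phi> (snd x) (fst x + ?c k)) \<in> borel_measurable (lborel \<Otimes>\<^sub>M lborel)" for k
    by (rule measurable_shift_energy[OF \<phi>]) measurable
  have m4: "(\<lambda>(s, r). indicator {0<..<\<delta>} s * (indicator {0<..\<delta>} r * shift_energy \<phi> r (s + ?c k))) \<in> borel_measurable (lborel \<Otimes>\<^sub>M lborel)" for k
    using m3[of k] by (simp add: split_beta')
  have m2: "(\<lambda>r. shift_energy \<phi> r v) \<in> borel_measurable lborel" for v
    by (rule measurable_shift_energy[OF \<phi>]) measurable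
  have m1: "(\<lambda>v. shift_energy \<phi> r v) \<in> borel_measurable borel" for r
    by (rule measurable_shift_energy[OF \<phi>]) measurable
  have m5: "(\<lambda>s. \<integral>\<^sup>+ r. indicator {0<..<\<delta>} s * (indicator {0<..\<delta>} r * shift_energy \<phi> r (s + ?c k)) \<partial>lborel) \<in> borel_measurable lborel" for k
    using lborel.borel_measurable_nn_integral_fst[OF m4[of k]] by simp
  have "ennreal \<epsilon> * ennreal \<delta> = (\<integral>\<^sup>+ s. ennreal \<epsilon> * indicator {0<..<\<delta>} s \<partial>lborel)"
    using pos by (simp add: nn_integral_cmult_indicator)
  also have "\<dots> \<le> (\<integral>\<^sup>+ s. (\<Sum>k\<le>n. \<integral>\<^sup>+ r. indicator {0<..<\<delta>} s * (indicator {0<..\<delta>} r * shift_energy \<phi> r (s + ?c k)) \<partial>lborel) \<partial>lborel)"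
  proof (rule nn_integral_mono)
    fix s :: real
    show "ennreal \<epsilon> * indicator {0<..<\<delta>} s \<le> (\<Sum>k\<le>n. \<integral>\<^sup>+ r. indicator {0<..<\<delta>} s * (indicator {0<..\<delta>} r * shift_energy \<phi> r (s + ?c k)) \<partial>lborel)"
      using big[of s] by (cases "s \<in> {0<..<\<delta>}") auto
  qed
  also have "\<dots> = (\<Sum>k\<le>n. \<integral>\<^sup>+ s. (\<integral>\<^sup>+ r. indicator {0<..<\<delta>} s * (indicator {0<..\<delta>} r * shift_energy \<phi> r (s + ?c k)) \<partial>lborel) \<partial>lborel)"
    by (rule nn_integral_sum) (rule m5)
  also have "\<dots> = (\<Sum>k\<le>n. \<integral>\<^sup>+ r. (\<integral>\<^sup>+ s. indicator {0<..<\<delta>} s * (indicator {0<..\<delta>} r * shift_energy \<phi> r (s + ?c k)) \<partial>lborel) \<partial>lborel)"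
    by (intro sum.cong refl lborel_pair.Fubini'[symmetric]) (rule m4)
  also have "\<dots> = (\<Sum>k\<le>n. \<integral>\<^sup>+ r. indicator {0<..\<delta>} r * (\<integral>\<^sup>+ v. indicator {?c k<..<?c k + \<delta>} v * shift_energy \<phi> r v \<partial>lborel) \<partial>lborel)"
  proof (intro sum.cong refl nn_integral_cong)
    fix k and r :: real
    have "(\<integral>\<^sup>+ v. indicator {?c k<..<?c k + \<delta>} v * shift_energy \<phi> r v \<partial>lborel) =
        (\<integral>\<^sup>+ s. indicator {?c k<..<?c k + \<delta>} (?c k + s) * shift_energy \<phi> r (?c k + s) \<partial>lborel)"
      using nn_integral_real_affine[of "\<lambda>v. indicator {?c k<..<?c k + \<delta>} v * shift_energy \<phi> r v" 1 "?c k"] m1[of r] by simp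
    also have "\<dots> = (\<integral>\<^sup>+ s. indicator {0<..<\<delta>} s * shift_energy \<phi> r (s + ?c k) \<partial>lborel)"
      by (intro nn_integral_cong) (auto simp: indicator_def add.commute)
    finally have eq: "(\<integral>\<^sup>+ v. indicator {?c k<..<?c k + \<delta>} v * shift_energy \<phi> r v \<partial>lborel) =
        (\<integral>\<^sup>+ s. indicator {0<..<\<delta>} s * shift_energy \<phi> r (s + ?c k) \<partial>lborel)" .
    have m: "(\<lambda>s. shift_energy \<phi> r (s + ?c k)) \<in> borel_measurable lborel"
      by (rule measurable_shift_energy[OF \<phi>]) measurable
    show "(\<integral>\<^sup>+ s. indicator {0<..<\<delta>} s * (indicator {0<..\<delta>} r * shift_energy \<phi> r (s + ?c k)) \<partial>lborel) =
        indicator {0<..\<delta>} r * (\<integral>\<^sup>+ v. indicator {?c k<..<?c k + \<delta>} v * shift_energy \<phi> r v \<partial>lborel)"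
      unfolding eq using m by (cases "r \<in> {0<..\<delta>}") auto
  qed
  also have "\<dots> = (\<integral>\<^sup>+ r. (\<Sum>k\<le>n. indicator {0<..\<delta>} r * (\<integral>\<^sup>+ v. indicator {?c k<..<?c k + \<delta>} v * shift_energy \<phi> r v \<partial>lborel)) \<partial>lborel)"
  proof (rule nn_integral_sum[symmetric])
    fix k
    have "(\<lambda>x. indicator {?c k<..<?c k + \<delta>} (snd x) * shift_energy \<phi> (fst x) (snd x)) \<in> borel_measurable (lborel \<Otimes>\<^sub>M lborel)"
      using measurable_shift_energy[OF \<phi>, of fst "lborel \<Otimes>\<^sub>M lborel" snd] by simp
    from lborel.borel_measurable_nn_integral_fst[OF this]
    show "(\<lambda>r. indicator {0<..\<delta>} r * (\<integral>\<^sup>+ v. indicator {?c k<..<?c k + \<delta>} v * shift_energy \<phi> r v \<partial>lborel)) \<in> borel_measurable lborel"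
      by simp
  qed
  also have "\<dots> \<le> (\<integral>\<^sup>+ r. ennreal (\<epsilon> / 2) * indicator {0<..\<delta>} r \<partial>lborel)"
  proof (rule nn_integral_mono)
    fix r :: real
    show "(\<Sum>k\<le>n. indicator {0<..\<delta>} r * (\<integral>\<^sup>+ v. indicator {?c k<..<?c k + \<delta>} v * shift_energy \<phi> r v \<partial>lborel)) \<le> ennreal (\<epsilon> / 2) * indicator {0<..\<delta>} r"
    proof (cases "r \<in> {0<..\<delta>}")
      case True
      have "(\<Sum>k\<le>n. (\<integral>\<^sup>+ v. indicator {?c k<..<?c k + \<delta>} v * shift_energy \<phi> r v \<partial>lborel)) =
          (\<integral>\<^sup>+ v. (\<Sum>k\<le>n. indicator {?c k<..<?c k + \<delta>} v * shift_energy \<phi> r v) \<partial>lborel)"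
        using m1[of r] by (intro nn_integral_sum[symmetric]) simp
      also have "\<dots> \<le> (\<integral>\<^sup>+ v. shift_energy \<phi> r v \<partial>lborel)"
      proof (rule nn_integral_mono)
        fix v :: real
        have "disjoint_family_on (\<lambda>k. {?c k<..<?c k + \<delta>}) {..n}"
          unfolding disjoint_family_on_def
        proof (intro ballI impI)
          fix i j :: nat assume "i \<noteq> j"
          then have "real i + 1 \<le> real j \<or> real j + 1 \<le> real i" by linarith
          then have "?c i + \<delta> \<le> ?c j \<or> ?c j + \<delta> \<le> ?c i"
            using pos(1) mult_right_mono[of "real i" "real j - 1" \<delta>] mult_right_mono[of "real j" "real i - 1" \<delta>]
            by (auto simp: algebra_simps)
          then show "{?c i<..<?c i + \<delta>} \<inter> {?c j<..<?c j + \<delta>} = {}" by auto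
        qed
        then have "(\<Sum>k\<le>n. indicator {?c k<..<?c k + \<delta>} v :: ennreal) = indicator (\<Union>k\<le>n. {?c k<..<?c k + \<delta>}) v"
          by (intro indicator_UN_disjoint[symmetric]) auto
        also have "\<dots> \<le> 1" by (simp add: indicator_def)
        finally have "(\<Sum>k\<le>n. indicator {?c k<..<?c k + \<delta>} v :: ennreal) * shift_energy \<phi> r v \<le> 1 * shift_energy \<phi> r v"
          by (rule mult_right_mono) simp
        then show "(\<Sum>k\<le>n. indicator {?c k<..<?c k + \<delta>} v * shift_energy \<phi> r v) \<le> shift_energy \<phi> r v"
          by (simp only: sum_distrib_right mult_1)
      qed
      also have "\<dots> \<le> ennreal (\<epsilon> / 2)"
        unfolding nn_integral_shift_energy[OF \<phi>] using True by (intro small) auto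
      finally show ?thesis using True by simp
    qed simp
  qed
  also have "\<dots> = ennreal (\<epsilon> / 2) * ennreal \<delta>"
    using pos by (simp add: nn_integral_cmult_indicator)
  finally have "ennreal (\<epsilon> * \<delta>) \<le> ennreal (\<epsilon> / 2 * \<delta>)"
    using pos ennreal_mult[of \<epsilon> \<delta>] ennreal_mult[of "\<epsilon> / 2" \<delta>] by simp
  then show False using pos by (simp add: ennreal_le_iff)
qed

text \<open>The approximation keeps on each grid interval the value of \<open>\<phi>\<close> at the left end point, which is
  known at that time and takes finitely many values; a good offset makes the error small.\<close>

lemma simple_adapted_step_approx:
  fixes \<phi> :: "real \<times> 'a \<Rightarrow> 'e::{real_normed_vector, second_countable_topology}"
  assumes simple: "simple_function Sig \<phi>" and "0 < \<epsilon>"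
  shows "\<exists>\<psi>. step_process T F \<psi> \<and> L2sq \<mu> (\<lambda>p. \<phi> p - \<psi> p) < ennreal \<epsilon>"
proof -
  have meas_Sig: "\<phi> \<in> borel_measurable Sig" using simple by (rule borel_measurable_simple_function)
  then have meas: "\<phi> \<in> borel_measurable \<mu>" by (rule measurable_Sigma_process)
  have fin_range: "finite (\<phi> ` ({0..T} \<times> space M))" using simple simple_functionD(1)[OF simple] by simp
  have "simple_function \<mu> \<phi>"
    unfolding simple_function_def using fin_range simple_functionD(2)[OF simple] subalgebra_Sigma
    by (auto simp: subalgebra_def)
  then have L2: "L2sq \<mu> \<phi> < \<infinity>" by (rule proc.L2sq_simple_finite)
  have "0 < \<epsilon> / 2" using \<open>0 < \<epsilon>\<close> by simp
  from translation_continuous[OF meas L2 this] obtain d where d: "d > 0"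
    "\<And>r. 0 < r \<Longrightarrow> r < d \<Longrightarrow> L2sq (lborel \<Otimes>\<^sub>M M) (shift_diff \<phi> r) < ennreal (\<epsilon> / 2)" by blast
  obtain N :: nat where N: "T / d < real N" using reals_Archimedean2 by blast
  define n where "n = Suc N"
  define \<delta> where "\<delta> = T / real n"
  have n: "0 < n" "real n * \<delta> = T" and \<delta>: "0 < \<delta>" using T_pos by (auto simp: n_def \<delta>_def)
  have "\<delta> < d"
  proof -
    have "T / d < real n" using N by (simp add: n_def)
    then have "T < real n * d" using d(1) by (simp add: pos_divide_less_eq)
    then show ?thesis using n(1) by (simp add: \<delta>_def pos_divide_less_eq mult.commute)
  qed
  then have "\<And>r. 0 < r \<Longrightarrow> r \<le> \<delta> \<Longrightarrow> L2sq (lborel \<Otimes>\<^sub>M M) (shift_diff \<phi> r) \<le> ennreal (\<epsilon> / 2)"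
    using d(2) by (meson le_less_trans less_imp_le)
  from good_grid_offset[OF meas \<delta> \<open>0 < \<epsilon>\<close> this, of n] obtain s where s: "0 < s" "s < \<delta>"
    and small: "(\<Sum>k\<le>n. \<integral>\<^sup>+ r. indicator {0<..\<delta>} r * shift_energy \<phi> r (s + (real k - 1) * \<delta>) \<partial>lborel) < ennreal \<epsilon>"
    by blast
  \<comment> \<open>The point \<open>a 0\<close> is negative, where the extended process is \<open>0\<close>; accordingly the step process starts with \<open>0\<close> on \<open>[0, s]\<close>.\<close>
  define a where "a = (\<lambda>k::nat. s + (real k - 1) * \<delta>)"
  define t where "t = (\<lambda>i. if i < n then s + real i * \<delta> else T)"
  have t_a: "t i = a (Suc i)" if "i < n" for i using that by (simp add: t_def a_def)
  have t_le: "t (Suc i) \<le> a (Suc i) + \<delta>" if "i < n" for i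
  proof (cases "Suc i < n")
    case False
    then have "Suc i = n" using that by simp
    then have "T = (real i + 1) * \<delta>" using n(2) by auto
    then show ?thesis using s False by (simp add: t_def a_def algebra_simps)
  qed (simp add: t_def a_def algebra_simps)
  have t_inc: "t i < t (Suc i)" if "i < n" for i
  proof (cases "Suc i < n")
    case True
    then show ?thesis using \<delta> that by (simp add: t_def algebra_simps)
  next
    case False
    then have "Suc i = n" using that by simp
    then have "T = (real i + 1) * \<delta>" using n(2) by auto
    then show ?thesis using s False that by (simp add: t_def algebra_simps)
  qed
  have t_mono: "i \<le> j \<Longrightarrow> j \<le> n \<Longrightarrow> t i \<le> t j" for i j
    by (rule increasing_chain_le[of n t, OF t_inc])
  have t0: "t 0 = s" and tn: "t n = T" using n by (auto simp: t_def)
  have t_in: "t i \<in> {0..T}" if "i \<le> n" for i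
    using t_mono[of 0 i] t_mono[of i n] that s t0 tn by auto
  obtain m :: nat and y where y: "bij_betw y {..<m} (\<phi> ` ({0..T} \<times> space M))"
    using ex_bij_betw_nat_finite[OF fin_range] atLeast0LessThan by metis
  define D where "D = (\<lambda>j i. {\<omega> \<in> space M. \<phi> (t i, \<omega>) = y j})"
  define \<psi> where "\<psi> = (\<lambda>p. indicator ({0} \<times> {}) p *\<^sub>R (0::'e) +
               (\<Sum>i<n. \<Sum>j<m. indicator ({t i<..t (Suc i)} \<times> D j i) p *\<^sub>R y j))"
  have step: "step_process T F \<psi>"
    unfolding step_process_def
  proof (intro exI conjI)
    show "\<psi> = (\<lambda>p. indicator ({0} \<times> {}) p *\<^sub>R (0::'e) +
               (\<Sum>i<n. \<Sum>j<m. indicator ({t i<..t (Suc i)} \<times> D j i) p *\<^sub>R (\<lambda>j i. y j) j i))" by (simp add: \<psi>_def)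
    show "0 \<le> t 0" "t n \<le> T" "\<forall>i<n. t i < t (Suc i)" using s t0 tn t_inc by auto
    show "\<forall>i<n. (\<forall>j<m. D j i \<in> sets (F (t i))) \<and> disjoint_family_on (\<lambda>j. D j i) {..<m}"
    proof (intro allI impI conjI)
      fix i j assume "i < n" "j < m"
      have ti: "t i \<in> {0..T}" using t_in \<open>i < n\<close> by simp
      have "(\<lambda>\<omega>. \<phi> (t i, \<omega>)) -` {y j} \<inter> space (F (t i)) \<in> sets (F (t i))"
        by (rule measurable_sets[OF measurable_Sigma_section[OF meas_Sig ti]]) simp
      also have "(\<lambda>\<omega>. \<phi> (t i, \<omega>)) -` {y j} \<inter> space (F (t i)) = D j i"
        unfolding D_def space_F[OF ti] by auto
      finally show "D j i \<in> sets (F (t i))" .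
    next
      fix i assume "i < n"
      show "disjoint_family_on (\<lambda>j. D j i) {..<m}"
        using y by (auto simp: disjoint_family_on_def D_def bij_betw_def inj_on_def)
    qed
  qed simp
  have row: "(\<Sum>j<m. indicator ({t i<..t (Suc i)} \<times> D j i) (u, \<omega>) *\<^sub>R y j) = (if u \<in> {t i<..t (Suc i)} then \<phi> (t i, \<omega>) else 0)"
    if "i < n" "\<omega> \<in> space M" for i u \<omega>
  proof -
    have "\<phi> (t i, \<omega>) \<in> y ` {..<m}" using y t_in[of i] that by (auto simp: bij_betw_def)
    then obtain j0 where j0: "j0 < m" "\<phi> (t i, \<omega>) = y j0" by auto
    have "(\<Sum>j<m. indicator ({t i<..t (Suc i)} \<times> D j i) (u, \<omega>) *\<^sub>R y j) =
        (\<Sum>j<m. if j = j0 then (if u \<in> {t i<..t (Suc i)} then y j0 else 0) else 0)"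
    proof (intro sum.cong refl)
      fix j assume "j \<in> {..<m}"
      then have "\<omega> \<in> D j i \<longleftrightarrow> j = j0"
        using y j0 that(2) by (auto simp: D_def bij_betw_def inj_on_def)
      then show "indicator ({t i<..t (Suc i)} \<times> D j i) (u, \<omega>) *\<^sub>R y j = (if j = j0 then (if u \<in> {t i<..t (Suc i)} then y j0 else 0) else 0)"
        by (simp add: indicator_def)
    qed
    then show ?thesis using j0 by simp
  qed
  have \<psi>_val: "\<psi> (u, \<omega>) = (\<Sum>i<n. if u \<in> {t i<..t (Suc i)} then \<phi> (t i, \<omega>) else 0)" if "\<omega> \<in> space M" for u \<omega>
    unfolding \<psi>_def using row[OF _ that] by simp
  have pointwise: "\<exists>k\<le>n. u \<in> {a k<..a k + \<delta>} \<and> \<psi> (u, \<omega>) = zero_ext \<phi> (a k, \<omega>)"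
    if u: "u \<in> {0..T}" and \<omega>: "\<omega> \<in> space M" for u \<omega>
  proof (cases "u \<le> s")
    case True
    have "u \<notin> {t i<..t (Suc i)}" if "i < n" for i using t_mono[of 0 i] t0 True that by auto
    then have "\<psi> (u, \<omega>) = 0" unfolding \<psi>_val[OF \<omega>] by (intro sum.neutral) auto
    moreover have "a 0 < 0" "a 0 + \<delta> = s" using s by (auto simp: a_def)
    ultimately show ?thesis using True u by (intro exI[of _ 0]) (auto simp: zero_ext_def)
  next
    case False
    define i1 where "i1 = (LEAST i. u \<le> t i)"
    have i1: "u \<le> t i1" "i1 \<le> n"
      unfolding i1_def by (rule LeastI[of _ n], use u tn in simp) (rule Least_le, use u tn in simp)
    have "i1 \<noteq> 0"
    proof
      assume "i1 = 0"
      then have "u \<le> t 0" using i1(1) by simp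
      then show False using False t0 by simp
    qed
    then obtain i where i: "i1 = Suc i" by (cases i1) auto
    have "\<not> u \<le> t i" unfolding i1_def using not_less_Least[of i "\<lambda>i. u \<le> t i"] i i1_def by auto
    then have ui: "u \<in> {t i<..t (Suc i)}" "i < n" using i1 i by auto
    have "u \<notin> {t i'<..t (Suc i')}" if "i' < n" "i' \<noteq> i" for i'
      using that ui t_mono[of "Suc i'" i] t_mono[of "Suc i" i'] by (cases "i' < i") auto
    then have "\<psi> (u, \<omega>) = (\<Sum>i'<n. if i' = i then \<phi> (t i, \<omega>) else 0)"
      unfolding \<psi>_val[OF \<omega>] using ui by (intro sum.cong) auto
    then have "\<psi> (u, \<omega>) = zero_ext \<phi> (a (Suc i), \<omega>)"
      using ui t_in[of i] t_a[of i] by (simp add: zero_ext_def)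
    moreover have "u \<in> {a (Suc i)<..a (Suc i) + \<delta>}" using ui t_a[of i] t_le[of i] by auto
    ultimately show ?thesis using ui by (intro exI[of _ "Suc i"]) auto
  qed
  have \<psi>_meas: "\<psi> \<in> borel_measurable \<mu>" by (rule measurable_Sigma_process[OF step_process_measurable(1)[OF step]])
  have diff_meas: "(\<lambda>p. ennreal ((norm (\<phi> p - \<psi> p))\<^sup>2)) \<in> borel_measurable (time_measure T \<Otimes>\<^sub>M M)"
    using meas \<psi>_meas by measurable
  have "L2sq \<mu> (\<lambda>p. \<phi> p - \<psi> p) = (\<integral>\<^sup>+ u. (\<integral>\<^sup>+ \<omega>. ennreal ((norm (\<phi> (u, \<omega>) - \<psi> (u, \<omega>)))\<^sup>2) \<partial>M) \<partial>time_measure T)"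
    unfolding L2sq_def by (rule nn_integral_fst[symmetric, OF diff_meas])
  also have "\<dots> \<le> (\<integral>\<^sup>+ u. (\<Sum>k\<le>n. indicator {a k<..a k + \<delta>} u * shift_energy \<phi> (u - a k) (a k)) \<partial>time_measure T)"
  proof (rule nn_integral_mono)
    fix u assume "u \<in> space (time_measure T)"
    then have u: "u \<in> {0..T}" by simp
    have ind: "(\<integral>\<^sup>+ \<omega>. indicator {a k<..a k + \<delta>} u * ennreal ((norm (zero_ext \<phi> (a k + (u - a k), \<omega>) - zero_ext \<phi> (a k, \<omega>)))\<^sup>2) \<partial>M)
        = indicator {a k<..a k + \<delta>} u * shift_energy \<phi> (u - a k) (a k)" for k
      by (cases "u \<in> {a k<..a k + \<delta>}") (auto simp: shift_energy_def)
    have m: "(\<lambda>\<omega>. indicator {a k<..a k + \<delta>} u * ennreal ((norm (zero_ext \<phi> (a k + (u - a k), \<omega>) - zero_ext \<phi> (a k, \<omega>)))\<^sup>2)) \<in> borel_measurable M" for k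
    proof -
      have [measurable]: "(\<lambda>\<omega>. zero_ext \<phi> (v, \<omega>)) \<in> borel_measurable M" for v
        by (rule measurable_zero_ext_compose[OF meas]) auto
      show ?thesis by measurable
    qed
    have "(\<integral>\<^sup>+ \<omega>. ennreal ((norm (\<phi> (u, \<omega>) - \<psi> (u, \<omega>)))\<^sup>2) \<partial>M) \<le>
        (\<integral>\<^sup>+ \<omega>. (\<Sum>k\<le>n. indicator {a k<..a k + \<delta>} u * ennreal ((norm (zero_ext \<phi> (a k + (u - a k), \<omega>) - zero_ext \<phi> (a k, \<omega>)))\<^sup>2)) \<partial>M)"
    proof (rule nn_integral_mono)
      fix \<omega> assume \<omega>: "\<omega> \<in> space M"
      obtain k where k: "k \<le> n" "u \<in> {a k<..a k + \<delta>}" "\<psi> (u, \<omega>) = zero_ext \<phi> (a k, \<omega>)"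
        using pointwise[OF u \<omega>] by blast
      have "ennreal ((norm (\<phi> (u, \<omega>) - \<psi> (u, \<omega>)))\<^sup>2) =
          indicator {a k<..a k + \<delta>} u * ennreal ((norm (zero_ext \<phi> (a k + (u - a k), \<omega>) - zero_ext \<phi> (a k, \<omega>)))\<^sup>2)"
        using k u by (simp add: zero_ext_def)
      also have "\<dots> \<le> (\<Sum>k\<le>n. indicator {a k<..a k + \<delta>} u * ennreal ((norm (zero_ext \<phi> (a k + (u - a k), \<omega>) - zero_ext \<phi> (a k, \<omega>)))\<^sup>2))"
        using k(1) by (intro member_le_sum) auto
      finally show "ennreal ((norm (\<phi> (u, \<omega>) - \<psi> (u, \<omega>)))\<^sup>2) \<le>
          (\<Sum>k\<le>n. indicator {a k<..a k + \<delta>} u * ennreal ((norm (zero_ext \<phi> (a k + (u - a k), \<omega>) - zero_ext \<phi> (a k, \<omega>)))\<^sup>2))" .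
    qed
    also have "\<dots> = (\<Sum>k\<le>n. \<integral>\<^sup>+ \<omega>. indicator {a k<..a k + \<delta>} u * ennreal ((norm (zero_ext \<phi> (a k + (u - a k), \<omega>) - zero_ext \<phi> (a k, \<omega>)))\<^sup>2) \<partial>M)"
      by (rule nn_integral_sum) (rule m)
    also have "\<dots> = (\<Sum>k\<le>n. indicator {a k<..a k + \<delta>} u * shift_energy \<phi> (u - a k) (a k))"
      unfolding ind ..
    finally show "(\<integral>\<^sup>+ \<omega>. ennreal ((norm (\<phi> (u, \<omega>) - \<psi> (u, \<omega>)))\<^sup>2) \<partial>M) \<le>
        (\<Sum>k\<le>n. indicator {a k<..a k + \<delta>} u * shift_energy \<phi> (u - a k) (a k))" .
  qed
  also have "\<dots> = (\<integral>\<^sup>+ u. (\<Sum>k\<le>n. indicator {a k<..a k + \<delta>} u * shift_energy \<phi> (u - a k) (a k)) * indicator {0..T} u \<partial>lborel)"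
    by (rule nn_integral_restrict_space) simp
  also have "\<dots> \<le> (\<integral>\<^sup>+ u. (\<Sum>k\<le>n. indicator {a k<..a k + \<delta>} u * shift_energy \<phi> (u - a k) (a k)) \<partial>lborel)"
    by (rule nn_integral_mono) (simp add: indicator_def)
  also have "\<dots> = (\<Sum>k\<le>n. \<integral>\<^sup>+ u. indicator {a k<..a k + \<delta>} u * shift_energy \<phi> (u - a k) (a k) \<partial>lborel)"
    using measurable_shift_energy[OF meas, of "\<lambda>u. u - a _" lborel "\<lambda>u. a _"] by (intro nn_integral_sum) simp
  also have "\<dots> = (\<Sum>k\<le>n. \<integral>\<^sup>+ r. indicator {0<..\<delta>} r * shift_energy \<phi> r (s + (real k - 1) * \<delta>) \<partial>lborel)"
  proof (intro sum.cong refl)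
    fix k
    have m: "(\<lambda>u. indicator {a k<..a k + \<delta>} u * shift_energy \<phi> (u - a k) (a k)) \<in> borel_measurable borel"
      using measurable_shift_energy[OF meas, of "\<lambda>u. u - a k" borel "\<lambda>u. a k"] by simp
    have "(\<integral>\<^sup>+ u. indicator {a k<..a k + \<delta>} u * shift_energy \<phi> (u - a k) (a k) \<partial>lborel) =
        (\<integral>\<^sup>+ r. indicator {a k<..a k + \<delta>} (a k + r) * shift_energy \<phi> r (a k) \<partial>lborel)"
      using nn_integral_real_affine[OF m, of 1 "a k"] by simp
    also have "\<dots> = (\<integral>\<^sup>+ r. indicator {0<..\<delta>} r * shift_energy \<phi> r (a k) \<partial>lborel)"
      by (intro nn_integral_cong) (auto simp: indicator_def)
    finally show "(\<integral>\<^sup>+ u. indicator {a k<..a k + \<delta>} u * shift_energy \<phi> (u - a k) (a k) \<partial>lborel) =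
        (\<integral>\<^sup>+ r. indicator {0<..\<delta>} r * shift_energy \<phi> r (s + (real k - 1) * \<delta>) \<partial>lborel)"
      by (simp add: a_def)
  qed
  also have "\<dots> < ennreal \<epsilon>" by (rule small)
  finally show ?thesis using step by blast
qed

lemma L2sq_restr_Sigma:
  fixes f :: "real \<times> 'a \<Rightarrow> 'e::{real_normed_vector, second_countable_topology}"
  assumes "f \<in> borel_measurable Sig"
  shows "L2sq (restr_to_subalg \<mu> Sig) f = L2sq \<mu> f"
  unfolding L2sq_def by (rule nn_integral_subalgebra2[OF subalgebra_Sigma]) (use assms in measurable)

theorem step_process_dense:
  fixes \<phi> :: "real \<times> 'a \<Rightarrow> 'e::{real_normed_vector, second_countable_topology}"
  assumes \<phi>: "\<phi> \<in> borel_measurable Sig" "L2sq \<mu> \<phi> < \<infinity>" and "0 < \<epsilon>"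
  shows "\<exists>\<psi>. step_process T F \<psi> \<and> L2sq \<mu> (\<lambda>p. \<phi> p - \<psi> p) < ennreal \<epsilon>"
proof -
  let ?N = "restr_to_subalg \<mu> Sig"
  have sets_N: "sets ?N = sets Sig" by (rule sets_restr_to_subalg[OF subalgebra_Sigma])
  have e: "0 < \<epsilon> / 8" using \<open>0 < \<epsilon>\<close> by simp
  have "\<phi> \<in> borel_measurable ?N" using \<phi>(1) sets_N by (simp cong: measurable_cong_sets)
  moreover have "L2sq ?N \<phi> < \<infinity>" using \<phi> by (simp add: L2sq_restr_Sigma)
  ultimately obtain s where s: "simple_function ?N s" "L2sq ?N (\<lambda>p. \<phi> p - s p) < ennreal (\<epsilon> / 8)"
    using L2_simple_dense[OF _ _ e] by blast
  have s_Sig: "simple_function Sig s"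
    using s(1) sets_N unfolding simple_function_def by (simp add: space_restr_to_subalg)
  have s_meas: "s \<in> borel_measurable Sig" using s_Sig by (rule borel_measurable_simple_function)
  have s2: "L2sq \<mu> (\<lambda>p. \<phi> p - s p) < ennreal (\<epsilon> / 8)"
    using s(2) L2sq_restr_Sigma[OF borel_measurable_diff[OF \<phi>(1) s_meas]] by simp
  obtain \<psi> where \<psi>: "step_process T F \<psi>" "L2sq \<mu> (\<lambda>p. s p - \<psi> p) < ennreal (\<epsilon> / 8)"
    using simple_adapted_step_approx[OF s_Sig e] by blast
  note \<psi>_meas = step_process_measurable(1)[OF \<psi>(1)]
  have "L2sq \<mu> (\<lambda>p. (\<phi> p - s p) + (s p - \<psi> p)) < ennreal \<epsilon>"
    by (rule L2sq_add_less[OF measurable_Sigma_process[OF borel_measurable_diff[OF \<phi>(1) s_meas]]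
        measurable_Sigma_process[OF borel_measurable_diff[OF s_meas \<psi>_meas]] \<open>0 < \<epsilon>\<close> s2 \<psi>(2)])
  then show ?thesis using \<psi>(1) by auto
qed

text \<open>Approximation of \<open>\<phi>\<close> by step processes in \<open>L\<^sup>2\<close> is approximation of its random operator,
  by the isometry \<open>L2sq_eq_L2_gamma_dist\<close>.\<close>

theorem defines_adapted_rv_of_process:
  fixes \<phi> :: "real \<times> 'a \<Rightarrow> 'e::{real_inner, complete_space, second_countable_topology}"
  assumes \<phi>: "\<phi> \<in> borel_measurable Sig" "L2sq \<mu> \<phi> < \<infinity>"
  shows "defines_adapted M T F \<phi> (rv_of_process \<phi>)"
proof -
  note rv = rv_of_process_in_L2_gamma[OF measurable_Sigma_process[OF \<phi>(1)] \<phi>(2)]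
  have "\<exists>\<psi> S. step_process T F \<psi> \<and> S \<in> L2_gamma M T \<and> defines_rv M T \<psi> S \<and> L2_gamma_dist M T (rv_of_process \<phi>) S < \<epsilon>"
    if "0 < \<epsilon>" for \<epsilon>
  proof -
    have "0 < \<epsilon>\<^sup>2" using that by simp
    then obtain \<psi> where \<psi>: "step_process T F \<psi>" "L2sq \<mu> (\<lambda>p. \<phi> p - \<psi> p) < ennreal (\<epsilon>\<^sup>2)"
      using step_process_dense[OF \<phi>] by blast
    note \<psi>_rv = rv_of_process_in_L2_gamma[OF measurable_Sigma_process[OF step_process_measurable(1)[OF \<psi>(1)]] step_process_measurable(2)[OF \<psi>(1)]]
    have "ennreal ((L2_gamma_dist M T (rv_of_process \<phi>) (rv_of_process \<psi>))\<^sup>2) < ennreal (\<epsilon>\<^sup>2)"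
      using L2sq_eq_L2_gamma_dist[OF rv(1) \<psi>_rv(1) rv(2) \<psi>_rv(2)] \<psi>(2) by simp
    then have "(L2_gamma_dist M T (rv_of_process \<phi>) (rv_of_process \<psi>))\<^sup>2 < \<epsilon>\<^sup>2" by (simp add: ennreal_less_iff)
    then have "L2_gamma_dist M T (rv_of_process \<phi>) (rv_of_process \<psi>) < \<epsilon>"
      using that by (intro power2_less_imp_less[of _ \<epsilon>]) auto
    then show ?thesis using \<psi>(1) \<psi>_rv by blast
  qed
  then show ?thesis using rv by (simp add: defines_adapted_def L2_gamma_adapted_def)
qed

text \<open>Approximating step processes converge to \<open>\<phi>\<close> almost everywhere if the errors are chosen
  summable, and their limit, set to \<open>0\<close> where it does not exist, inherits their adaptedness.\<close>

theorem adapted_modification: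
  fixes \<phi> :: "real \<times> 'a \<Rightarrow> 'e::{real_inner, complete_space, second_countable_topology}"
  assumes "defines_adapted M T F \<phi> X"
  shows "\<exists>\<phi>'\<in>borel_measurable Sig. AE p in \<mu>. \<phi> p = \<phi>' p"
proof -
  have def: "defines_rv M T \<phi> X" and X: "X \<in> L2_gamma M T"
    and approx: "\<And>\<epsilon>. \<epsilon> > 0 \<Longrightarrow> \<exists>\<psi> S. step_process T F \<psi> \<and> S \<in> L2_gamma M T \<and> defines_rv M T \<psi> S \<and> L2_gamma_dist M T X S < \<epsilon>"
    using assms by (auto simp: defines_adapted_def L2_gamma_adapted_def)
  have meas: "\<phi> \<in> borel_measurable \<mu>" using def by (simp add: defines_rv_def)
  have ex: "\<forall>n::nat. \<exists>\<psi>. step_process T F \<psi> \<and> L2sq \<mu> (\<lambda>p. \<phi> p - \<psi> p) \<le> ennreal ((1 / 2) ^ n)"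
  proof
    fix n :: nat
    have "0 < sqrt ((1 / 2) ^ n)" by simp
    then obtain \<psi> S where \<psi>: "step_process T F \<psi>" "S \<in> L2_gamma M T" "defines_rv M T \<psi> S"
      "L2_gamma_dist M T X S < sqrt ((1 / 2) ^ n)" using approx by blast
    have "0 \<le> L2_gamma_dist M T X S" by (simp add: L2_gamma_dist_def L2_gamma_norm_def integral_nonneg_AE)
    then have "(L2_gamma_dist M T X S)\<^sup>2 \<le> (sqrt ((1 / 2) ^ n))\<^sup>2" using \<psi>(4) by (intro power_mono) auto
    then have "(L2_gamma_dist M T X S)\<^sup>2 \<le> (1 / 2) ^ n" by simp
    then show "\<exists>\<psi>. step_process T F \<psi> \<and> L2sq \<mu> (\<lambda>p. \<phi> p - \<psi> p) \<le> ennreal ((1 / 2) ^ n)"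
      using L2sq_eq_L2_gamma_dist[OF def \<psi>(3) X \<psi>(2)] \<psi>(1) by (intro exI[of _ \<psi>]) (simp add: ennreal_leI)
  qed
  obtain \<psi> :: "nat \<Rightarrow> real \<times> 'a \<Rightarrow> 'e" where "\<forall>n. step_process T F (\<psi> n) \<and> L2sq \<mu> (\<lambda>p. \<phi> p - \<psi> n p) \<le> ennreal ((1 / 2) ^ n)"
    using choice[OF ex] by (elim exE) (erule that)
  then have \<psi>: "\<And>n. step_process T F (\<psi> n)" "\<And>n. L2sq \<mu> (\<lambda>p. \<phi> p - \<psi> n p) \<le> ennreal ((1 / 2) ^ n)" by simp_all
  have \<psi>_Sig [measurable]: "\<psi> n \<in> borel_measurable Sig" for n by (rule step_process_measurable(1)[OF \<psi>(1)])
  note \<psi>_meas = measurable_Sigma_process[OF \<psi>_Sig]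
  have "AE p in \<mu>. (\<lambda>n. ennreal ((norm (\<phi> p - \<psi> n p))\<^sup>2)) \<longlonglongrightarrow> 0"
  proof (rule AE_tendsto_0_geometric)
    show "(\<lambda>p. ennreal ((norm (\<phi> p - \<psi> n p))\<^sup>2)) \<in> borel_measurable \<mu>" for n
      using meas \<psi>_meas[of n] by measurable
    show "(\<integral>\<^sup>+ p. ennreal ((norm (\<phi> p - \<psi> n p))\<^sup>2) \<partial>\<mu>) \<le> ennreal ((1 / 2) ^ n)" for n
      using \<psi>(2)[of n] by (simp add: L2sq_def)
  qed
  then have conv: "AE p in \<mu>. (\<lambda>n. \<psi> n p) \<longlonglongrightarrow> \<phi> p"
  proof eventually_elim
    case (elim p)
    then have "(\<lambda>n. enn2real (ennreal ((norm (\<phi> p - \<psi> n p))\<^sup>2))) \<longlonglongrightarrow> 0" by (intro tendsto_enn2real) auto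
    then have "(\<lambda>n. sqrt ((norm (\<phi> p - \<psi> n p))\<^sup>2)) \<longlonglongrightarrow> sqrt 0" by (intro tendsto_real_sqrt) simp
    then have "(\<lambda>n. dist (\<psi> n p) (\<phi> p)) \<longlonglongrightarrow> 0" by (simp add: dist_norm norm_minus_commute)
    then show ?case by (rule tendsto_dist_iff[THEN iffD2])
  qed
  define C where "C = {p \<in> space Sig. Cauchy (\<lambda>n. \<psi> n p)}"
  have C: "C \<in> sets Sig" unfolding C_def by (rule sets_Collect_Cauchy) (rule \<psi>_Sig)
  define \<phi>' where "\<phi>' = (\<lambda>p. lim (\<lambda>n. if p \<in> C then \<psi> n p else 0))"
  have lim: "(\<lambda>n. if p \<in> C then \<psi> n p else 0) \<longlonglongrightarrow> \<phi>' p" for p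
  proof (cases "p \<in> C")
    case True
    then have "convergent (\<lambda>n. \<psi> n p)" by (intro Cauchy_convergent) (simp add: C_def)
    then show ?thesis using True by (simp add: \<phi>'_def convergent_LIMSEQ_iff)
  next
    case False
    then show ?thesis by (simp add: \<phi>'_def)
  qed
  have "\<phi>' \<in> borel_measurable Sig"
  proof (rule borel_measurable_LIMSEQ_metric)
    show "(\<lambda>p. if p \<in> C then \<psi> n p else 0) \<in> borel_measurable Sig" for n
      using C by measurable
    show "(\<lambda>n. if p \<in> C then \<psi> n p else 0) \<longlonglongrightarrow> \<phi>' p" for p by (rule lim)
  qed
  moreover have "AE p in \<mu>. \<phi> p = \<phi>' p"
    using conv AE_space
  proof eventually_elim
    case (elim p)
    then have "p \<in> C" unfolding C_def using LIMSEQ_imp_Cauchy by auto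
    then have "(\<lambda>n. \<psi> n p) \<longlonglongrightarrow> \<phi>' p" using lim[of p] by simp
    then show ?case using elim(1) LIMSEQ_unique by blast
  qed
  ultimately show ?thesis by blast
qed

end



section \<open>Metric projection onto random convex compact sets\<close>

lemma compact_infdist_attained:
  assumes "compact K" "K \<noteq> {}"
  shows "\<exists>y\<in>K. dist x y = infdist x K"
proof -
  have c: "continuous_on K (dist x)" by (intro continuous_intros)
  obtain y where y: "y \<in> K" "\<forall>z\<in>K. dist x y \<le> dist x z"
    using continuous_attains_inf[OF assms c] by blast
  then have "infdist x K = dist x y"
    using assms by (intro antisym infdist_le) (auto simp: infdist_def intro!: cINF_greatest)
  then show ?thesis using y by auto
qed

text \<open>For fixed \<open>x\<close>, compactness turns \<open>infdist x (H s) \<le> a\<close> into the statement that \<open>H s\<close> meets a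
  closed ball. Joint measurability follows since \<open>infdist x A\<close> is the infimum of
  \<open>dist x d + infdist d A\<close> over a countable dense set of points \<open>d\<close>.\<close>

lemma measurable_infdist:
  fixes H :: "'s \<Rightarrow> 'e::{metric_space, second_countable_topology} set"
  assumes meas: "set_valued_measurable N H"
    and comp: "\<And>s. s \<in> space N \<Longrightarrow> compact (H s) \<and> H s \<noteq> {}"
  shows "(\<lambda>p. infdist (snd p) (H (fst p))) \<in> borel_measurable (N \<Otimes>\<^sub>M borel)"
proof -
  have 1: "(\<lambda>s. infdist x (H s)) \<in> borel_measurable N" for x
  proof (rule borel_measurable_iff_le[THEN iffD2], rule allI)
    fix a
    have "{s \<in> space N. infdist x (H s) \<le> a} = {s \<in> space N. H s \<inter> cball x a \<noteq> {}}"
    proof (intro Collect_cong conj_cong refl)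
      fix s assume s: "s \<in> space N"
      obtain y where y: "y \<in> H s" "dist x y = infdist x (H s)"
        using compact_infdist_attained[of "H s" x] comp[OF s] by blast
      show "infdist x (H s) \<le> a \<longleftrightarrow> H s \<inter> cball x a \<noteq> {}"
      proof
        assume "infdist x (H s) \<le> a"
        then have "y \<in> H s \<inter> cball x a" using y by simp
        then show "H s \<inter> cball x a \<noteq> {}" by blast
      next
        assume "H s \<inter> cball x a \<noteq> {}"
        then obtain z where "z \<in> H s" "dist x z \<le> a" by auto
        then show "infdist x (H s) \<le> a" using infdist_le[of z "H s" x] by simp
      qed
    qed
    also have "\<dots> \<in> sets N" using meas by (auto simp: set_valued_measurable_def)
    finally show "{s \<in> space N. infdist x (H s) \<le> a} \<in> sets N" .
  qed
  obtain D :: "'e set" where D: "countable D" "\<And>X. open X \<Longrightarrow> X \<noteq> {} \<Longrightarrow> \<exists>d\<in>D. d \<in> X"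
    by (erule countable_dense_setE)
  have "D \<noteq> {}" using D(2)[of UNIV] by auto
  have eq: "infdist x A = (INF d\<in>D. dist x d + infdist d A)" for x and A :: "'e set"
  proof (rule antisym)
    show "infdist x A \<le> (INF d\<in>D. dist x d + infdist d A)"
      using \<open>D \<noteq> {}\<close> by (intro cINF_greatest) (auto intro: order_trans[OF infdist_triangle] simp: add.commute)
    show "(INF d\<in>D. dist x d + infdist d A) \<le> infdist x A"
    proof (rule field_le_epsilon)
      fix e :: real assume "0 < e"
      then obtain d where d: "d \<in> D" "d \<in> ball x (e / 2)" using D(2)[of "ball x (e / 2)"] by auto
      have "(INF d\<in>D. dist x d + infdist d A) \<le> dist x d + infdist d A"
        using d(1) by (intro cINF_lower bdd_belowI2[of _ 0]) (auto simp: infdist_nonneg)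
      also have "\<dots> \<le> infdist x A + e"
        using d(2) infdist_triangle[of d A x] by (simp add: dist_commute)
      finally show "(INF d\<in>D. dist x d + infdist d A) \<le> infdist x A + e" .
    qed
  qed
  have eq': "(\<lambda>p. infdist (snd p) (H (fst p))) = (\<lambda>p. INF d\<in>D. dist (snd p) d + infdist d (H (fst p)))"
    by (intro ext eq)
  show ?thesis
  proof (rule ssubst[OF eq', of "\<lambda>f. f \<in> borel_measurable (N \<Otimes>\<^sub>M borel)"], rule borel_measurable_cINF_real[OF D(1)])
    fix d
    have [measurable]: "(\<lambda>p. infdist d (H (fst p))) \<in> borel_measurable (N \<Otimes>\<^sub>M borel)"
      by (rule measurable_compose[OF measurable_fst 1])
    have [measurable]: "(\<lambda>p. dist (snd p) d) \<in> borel_measurable (N \<Otimes>\<^sub>M borel)"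
      by measurable
    show "(\<lambda>p. dist (snd p) d + infdist d (H (fst p))) \<in> borel_measurable (N \<Otimes>\<^sub>M borel)" by measurable
  qed
qed

definition metric_proj :: "'e::metric_space set \<Rightarrow> 'e \<Rightarrow> 'e" where
  "metric_proj K x = (SOME y. y \<in> K \<and> dist x y = infdist x K)"

lemma metric_proj:
  assumes "compact K" "K \<noteq> {}"
  shows "metric_proj K x \<in> K" "dist x (metric_proj K x) = infdist x K"
  using someI_ex[of "\<lambda>y. y \<in> K \<and> dist x y = infdist x K"] compact_infdist_attained[OF assms, of x]
  unfolding metric_proj_def by blast+

text \<open>The midpoint of \<open>y\<close> and the projection lies in \<open>K\<close>, so it is no closer to \<open>x\<close> than the
  projection; the parallelogram law then keeps \<open>y\<close> near the projection. In particular the nearest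
  point is unique.\<close>

lemma metric_proj_stable:
  fixes K :: "'e::real_inner set"
  assumes K: "compact K" "K \<noteq> {}" "convex K" and y: "y \<in> K" "dist x y \<le> infdist x K + \<epsilon>"
  shows "(dist y (metric_proj K x))\<^sup>2 \<le> 4 * infdist x K * \<epsilon> + 2 * \<epsilon>\<^sup>2"
proof -
  let ?p = "metric_proj K x" and ?d = "infdist x K"
  have p: "?p \<in> K" "dist x ?p = ?d" using metric_proj[OF K(1,2)] by auto
  have "(1/2) *\<^sub>R y + (1/2) *\<^sub>R ?p \<in> K" using K(3) y(1) p(1) by (rule convexD) auto
  then have "?d \<le> dist x ((1/2) *\<^sub>R y + (1/2) *\<^sub>R ?p)" by (rule infdist_le)
  then have "?d\<^sup>2 \<le> (dist x ((1/2) *\<^sub>R y + (1/2) *\<^sub>R ?p))\<^sup>2"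
    by (intro power_mono) (auto simp: infdist_nonneg)
  also have "x - ((1/2) *\<^sub>R y + (1/2) *\<^sub>R ?p) = (1/2) *\<^sub>R ((x - y) + (x - ?p))"
    by (simp add: algebra_simps flip: scaleR_add_left)
  then have "(dist x ((1/2) *\<^sub>R y + (1/2) *\<^sub>R ?p))\<^sup>2 = (norm ((x - y) + (x - ?p)))\<^sup>2 / 4"
    by (simp add: dist_norm power_divide)
  finally have mid: "4 * ?d\<^sup>2 \<le> (norm ((x - y) + (x - ?p)))\<^sup>2" by simp
  have "(norm ((x - y) + (x - ?p)))\<^sup>2 + (norm ((x - y) - (x - ?p)))\<^sup>2 = 2 * (norm (x - y))\<^sup>2 + 2 * (norm (x - ?p))\<^sup>2"
    by (simp add: power2_norm_eq_inner inner_add_left inner_add_right inner_diff_left inner_diff_right inner_commute)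
  moreover have "norm ((x - y) - (x - ?p)) = dist y ?p" by (simp add: dist_norm norm_minus_commute)
  moreover have "norm (x - ?p) = ?d" "norm (x - y) = dist x y" using p(2) by (auto simp: dist_norm)
  ultimately have "(dist y ?p)\<^sup>2 \<le> 2 * (dist x y)\<^sup>2 - 2 * ?d\<^sup>2" using mid by simp
  also have "(dist x y)\<^sup>2 \<le> (?d + \<epsilon>)\<^sup>2" using y(2) by (intro power_mono) auto
  finally show ?thesis by (simp add: power2_sum algebra_simps)
qed

text \<open>Among the points of a dense sequence choose the first that is nearly in \<open>H s\<close> and nearly as
  close to \<open>g s\<close> as the nearest point. This is a measurable choice, and by \<open>metric_proj_stable\<close> it
  converges to the projection.\<close>

lemma measurable_metric_proj:
  fixes H :: "'s \<Rightarrow> 'e::{real_inner, second_countable_topology} set"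
  assumes meas: "set_valued_measurable N H"
    and H: "\<And>s. s \<in> space N \<Longrightarrow> H s \<in> K_ccmpt"
    and g [measurable]: "g \<in> borel_measurable N"
  shows "(\<lambda>s. metric_proj (H s) (g s)) \<in> borel_measurable N"
proof -
  have K: "compact (H s)" "H s \<noteq> {}" "convex (H s)" if "s \<in> space N" for s
    using H[OF that] by (auto simp: K_ccmpt_def)
  have inf: "(\<lambda>p. infdist (snd p) (H (fst p))) \<in> borel_measurable (N \<Otimes>\<^sub>M borel)"
    using meas K by (intro measurable_infdist) auto
  have inf_comp [measurable]: "(\<lambda>s. infdist (x s) (H s)) \<in> borel_measurable N" if [measurable]: "x \<in> borel_measurable N" for x
    using measurable_compose[OF measurable_Pair[OF measurable_ident_sets[OF refl] that] inf] by simp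
  obtain d :: "nat \<Rightarrow> 'e" where d: "\<And>X. open X \<Longrightarrow> X \<noteq> {} \<Longrightarrow> \<exists>n. d n \<in> X"
    by (rule dense_sequence) blast
  define Q where "Q = (\<lambda>n k s. infdist (d k) (H s) < 1 / real (Suc n) \<and> dist (g s) (d k) < infdist (g s) (H s) + 1 / real (Suc n))"
  define p where "p = (\<lambda>n s. d (LEAST k. Q n k s))"
  have [measurable]: "Measurable.pred N (Q n k)" for n k unfolding Q_def by measurable
  have "p n \<in> borel_measurable N" for n
    unfolding p_def by (rule measurable_compose[where N = "count_space UNIV"]) measurable
  moreover have "(\<lambda>n. p n s) \<longlonglongrightarrow> metric_proj (H s) (g s)" if s: "s \<in> space N" for s
  proof -
    let ?q = "metric_proj (H s) (g s)" and ?D = "infdist (g s) (H s)"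
    have q: "?q \<in> H s" "dist (g s) ?q = ?D" using metric_proj[OF K(1,2)[OF s]] by auto
    have Q: "Q n (LEAST k. Q n k s) s" for n
    proof (rule LeastI_ex)
      obtain k where k: "d k \<in> ball ?q (1 / real (Suc n))" using d[of "ball ?q (1 / real (Suc n))"] by auto
      have "infdist (d k) (H s) < 1 / real (Suc n)"
        using k infdist_le[OF q(1), of "d k"] by (simp add: dist_commute)
      moreover have "dist (g s) (d k) < ?D + 1 / real (Suc n)"
        using k q(2) dist_triangle[of "g s" "d k" ?q] by simp
      ultimately show "\<exists>k. Q n k s" unfolding Q_def by blast
    qed
    have bound: "dist (p n s) ?q \<le> 1 / real (Suc n) + sqrt (4 * ?D * (2 / real (Suc n)) + 2 * (2 / real (Suc n))\<^sup>2)" for n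
    proof -
      have Qn: "infdist (p n s) (H s) < 1 / real (Suc n)" "dist (g s) (p n s) < ?D + 1 / real (Suc n)"
        using Q[of n] by (auto simp: Q_def p_def)
      obtain y where y: "y \<in> H s" "dist (p n s) y = infdist (p n s) (H s)"
        using compact_infdist_attained[OF K(1,2)[OF s]] by blast
      have "2 / real (Suc n) = 1 / real (Suc n) + 1 / real (Suc n)" by simp
      then have "dist (g s) y \<le> ?D + 2 / real (Suc n)"
        using Qn y(2) dist_triangle[of "g s" y "p n s"] by linarith
      then have "(dist y ?q)\<^sup>2 \<le> 4 * ?D * (2 / real (Suc n)) + 2 * (2 / real (Suc n))\<^sup>2"
        by (rule metric_proj_stable[OF K[OF s] y(1)])
      then have "dist y ?q \<le> sqrt (4 * ?D * (2 / real (Suc n)) + 2 * (2 / real (Suc n))\<^sup>2)" by (rule real_le_rsqrt)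
      then show ?thesis using Qn(1) y(2) dist_triangle[of "p n s" ?q y] by simp
    qed
    have lim: "(\<lambda>n. c / real (Suc n)) \<longlonglongrightarrow> 0" for c
      using tendsto_mult[OF tendsto_const[of c] LIMSEQ_inverse_real_of_nat] by (simp add: divide_inverse)
    have "(\<lambda>n. 1 / real (Suc n) + sqrt (4 * ?D * (2 / real (Suc n)) + 2 * (2 / real (Suc n))\<^sup>2)) \<longlonglongrightarrow>
        0 + sqrt (4 * ?D * 0 + 2 * 0\<^sup>2)"
      by (intro tendsto_intros lim)
    then have l: "(\<lambda>n. 1 / real (Suc n) + sqrt (4 * ?D * (2 / real (Suc n)) + 2 * (2 / real (Suc n))\<^sup>2)) \<longlonglongrightarrow> 0"
      by simp
    have "(\<lambda>n. dist (p n s) ?q) \<longlonglongrightarrow> 0"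
    proof (rule tendsto_sandwich[OF _ _ tendsto_const l])
      show "eventually (\<lambda>n. dist (p n s) ?q \<le> 1 / real (Suc n) + sqrt (4 * ?D * (2 / real (Suc n)) + 2 * (2 / real (Suc n))\<^sup>2)) sequentially"
        by (rule always_eventually) (intro allI bound)
    qed simp
    then show ?thesis by (rule tendsto_dist_iff[THEN iffD2])
  qed
  ultimately show ?thesis by (rule borel_measurable_LIMSEQ_metric)
qed

lemma metric_proj_near:
  assumes "compact K" "x \<in> K"
  shows "dist (metric_proj K d) x \<le> 2 * dist d x"
proof -
  have "dist d (metric_proj K d) = infdist d K" using assms by (intro metric_proj) auto
  also have "\<dots> \<le> dist d x" by (rule infdist_le[OF assms(2)])
  finally show ?thesis using dist_triangle[of "metric_proj K d" x d] by (simp add: dist_commute)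
qed



section \<open>Analytic representation of product measurable sets\<close>

definition locally_constant :: "((nat \<Rightarrow> nat) \<Rightarrow> 'c) \<Rightarrow> bool" where
  "locally_constant C \<longleftrightarrow> (\<forall>s. \<exists>n. \<forall>s'. (\<forall>j<n. s' j = s j) \<longrightarrow> C s' = C s)"

text \<open>The Souslin operation over \<open>\<R>\<close>. Instead of a scheme indexed by finite sequences, the \<open>i\<close>-th
  set depends on the whole branch in a locally constant way; recoding of branches is then
  substitution.\<close>

definition analytic_over :: "'p set set \<Rightarrow> 'p set \<Rightarrow> bool" where
  "analytic_over \<R> B \<longleftrightarrow> (\<exists>C :: nat \<Rightarrow> (nat \<Rightarrow> nat) \<Rightarrow> 'p set.
     (\<forall>i s. C i s \<in> \<R>) \<and> (\<forall>i. locally_constant (C i)) \<and> B = {p. \<exists>s. \<forall>i. p \<in> C i s})"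

lemma locally_constant_const: "locally_constant (\<lambda>_. c)"
  by (auto simp: locally_constant_def)

lemma analytic_over_base: "B \<in> \<R> \<Longrightarrow> analytic_over \<R> B"
  unfolding analytic_over_def by (intro exI[of _ "\<lambda>_ _. B"]) (auto simp: locally_constant_const)

lemma locally_constant_reindex:
  assumes "locally_constant C"
  shows "locally_constant (\<lambda>s. C (\<lambda>j. s (f j)))"
  unfolding locally_constant_def
proof
  fix s :: "nat \<Rightarrow> nat"
  obtain n where n: "\<And>s'. (\<forall>j<n. s' j = s (f j)) \<Longrightarrow> C s' = C (\<lambda>j. s (f j))"
    using assms[unfolded locally_constant_def, rule_format, of "\<lambda>j. s (f j)"] by blast
  define m where "m = Suc (Max (insert 0 (f ` {..<n})))"
  have m: "f j < m" if "j < n" for j unfolding m_def using that by (simp add: le_imp_less_Suc)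
  then show "\<exists>n. \<forall>s'. (\<forall>j<n. s' j = s j) \<longrightarrow> C (\<lambda>j. s' (f j)) = C (\<lambda>j. s (f j))"
    by (intro exI[of _ m] allI impI n) (simp add: m)
qed

text \<open>A sequence of branches is coded as one branch by a pairing of the indices.\<close>

lemma analytic_over_INT:
  assumes "\<And>m::nat. analytic_over \<R> (B m)"
  shows "analytic_over \<R> (\<Inter>m. B m)"
proof -
  have "\<forall>m. \<exists>C :: nat \<Rightarrow> (nat \<Rightarrow> nat) \<Rightarrow> 'a set. (\<forall>i s. C i s \<in> \<R>) \<and>
      (\<forall>i. locally_constant (C i)) \<and> B m = {p. \<exists>s. \<forall>i. p \<in> C i s}"
    using assms unfolding analytic_over_def by simp
  then obtain C :: "nat \<Rightarrow> nat \<Rightarrow> (nat \<Rightarrow> nat) \<Rightarrow> 'a set" where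
    C: "\<And>m i s. C m i s \<in> \<R>" "\<And>m i. locally_constant (C m i)"
      "\<And>m. B m = {p. \<exists>s. \<forall>i. p \<in> C m i s}"
    by (elim choice[elim_format] exE) blast
  define C' where "C' = (\<lambda>i (s::nat \<Rightarrow> nat). case prod_decode i of (m, k) \<Rightarrow> C m k (\<lambda>j. s (prod_encode (m, j))))"
  have "(\<Inter>m. B m) = {p. \<exists>s. \<forall>i. p \<in> C' i s}"
  proof (intro set_eqI iffI)
    fix p assume "p \<in> (\<Inter>m. B m)"
    then have "\<forall>m. \<exists>s. \<forall>i. p \<in> C m i s" using C(3) by auto
    then obtain s where s: "\<And>m i. p \<in> C m i (s m)" by metis
    define t where "t = (\<lambda>n. case prod_decode n of (m, j) \<Rightarrow> s m j)"
    have "p \<in> C' i t" for i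
      using s by (cases "prod_decode i") (simp add: C'_def t_def)
    then show "p \<in> {p. \<exists>s. \<forall>i. p \<in> C' i s}" by auto
  next
    fix p assume "p \<in> {p. \<exists>s. \<forall>i. p \<in> C' i s}"
    then obtain s where s: "\<And>i. p \<in> C' i s" by auto
    have "p \<in> C m k (\<lambda>j. s (prod_encode (m, j)))" for m k
      using s[of "prod_encode (m, k)"] by (simp add: C'_def)
    then show "p \<in> (\<Inter>m. B m)" using C(3) by blast
  qed
  moreover have "locally_constant (C' i)" for i
    unfolding C'_def
    by (cases "prod_decode i") (simp add: locally_constant_reindex[OF C(2), where f = "\<lambda>j. prod_encode (_, j)"])
  moreover have "C' i s \<in> \<R>" for i s
    unfolding C'_def by (cases "prod_decode i") (simp add: C(1))
  ultimately show ?thesis unfolding analytic_over_def by blast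
qed

text \<open>The first entry of the branch tells which of the sets is meant.\<close>

lemma analytic_over_UN:
  assumes "\<And>m::nat. analytic_over \<R> (B m)"
  shows "analytic_over \<R> (\<Union>m. B m)"
proof -
  have "\<forall>m. \<exists>C :: nat \<Rightarrow> (nat \<Rightarrow> nat) \<Rightarrow> 'a set. (\<forall>i s. C i s \<in> \<R>) \<and>
      (\<forall>i. locally_constant (C i)) \<and> B m = {p. \<exists>s. \<forall>i. p \<in> C i s}"
    using assms unfolding analytic_over_def by simp
  then obtain C :: "nat \<Rightarrow> nat \<Rightarrow> (nat \<Rightarrow> nat) \<Rightarrow> 'a set" where
    C: "\<And>m i s. C m i s \<in> \<R>" "\<And>m i. locally_constant (C m i)"
      "\<And>m. B m = {p. \<exists>s. \<forall>i. p \<in> C m i s}"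
    by (elim choice[elim_format] exE) blast
  define C' where "C' = (\<lambda>i (s::nat \<Rightarrow> nat). C (s 0) i (\<lambda>j. s (Suc j)))"
  have "(\<Union>m. B m) = {p. \<exists>s. \<forall>i. p \<in> C' i s}"
  proof (intro set_eqI iffI)
    fix p assume "p \<in> (\<Union>m. B m)"
    then obtain m s where "\<And>i. p \<in> C m i s" using C(3) by auto
    then show "p \<in> {p. \<exists>s. \<forall>i. p \<in> C' i s}"
      by (auto simp: C'_def intro!: exI[of _ "case_nat m s"])
  next
    fix p assume "p \<in> {p. \<exists>s. \<forall>i. p \<in> C' i s}"
    then show "p \<in> (\<Union>m. B m)" unfolding C(3) C'_def by blast
  qed
  moreover have "locally_constant (C' i)" for i
    unfolding locally_constant_def
  proof
    fix s :: "nat \<Rightarrow> nat"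
    have "locally_constant (\<lambda>t. C (s 0) i (\<lambda>j. t (Suc j)))"
      by (rule locally_constant_reindex[OF C(2)])
    then obtain n where n: "\<And>s'. (\<forall>j<n. s' j = s j) \<Longrightarrow> C (s 0) i (\<lambda>j. s' (Suc j)) = C (s 0) i (\<lambda>j. s (Suc j))"
      unfolding locally_constant_def by (elim allE[where x=s]) blast
    show "\<exists>n. \<forall>s'. (\<forall>j<n. s' j = s j) \<longrightarrow> C' i s' = C' i s"
    proof (intro exI[of _ "Suc n"] allI impI)
      fix s' assume s': "\<forall>j<Suc n. s' j = s j"
      then have "C (s 0) i (\<lambda>j. s' (Suc j)) = C (s 0) i (\<lambda>j. s (Suc j))" by (intro n) simp
      moreover have "s' 0 = s 0" using s' by simp
      ultimately show "C' i s' = C' i s" by (simp add: C'_def)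
    qed
  qed
  moreover have "C' i s \<in> \<R>" for i s unfolding C'_def by (simp add: C(1))
  ultimately show ?thesis unfolding analytic_over_def by blast
qed

definition closed_rectangles :: "'s measure \<Rightarrow> ('s \<times> 'e::topological_space) set set" where
  "closed_rectangles N = {A \<times> K | A K. A \<in> sets N \<and> closed K}"

lemma open_countable_union_closed:
  fixes U :: "'e::metric_space set"
  assumes "open U"
  shows "\<exists>K :: nat \<Rightarrow> 'e set. (\<forall>i. closed (K i)) \<and> U = (\<Union>i. K i)"
proof (cases "U = UNIV")
  case True
  then show ?thesis by (intro exI[of _ "\<lambda>_. UNIV"]) auto
next
  case False
  let ?K = "\<lambda>i::nat. {x. infdist x (- U) \<ge> 1 / real (Suc i)}"
  have "closed (?K i)" for i
    by (intro closed_Collect_le continuous_intros)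
  moreover have "U = (\<Union>i. ?K i)"
  proof (intro set_eqI iffI)
    fix x assume "x \<in> U"
    then have "infdist x (- U) > 0"
      using in_closed_iff_infdist_zero[of "- U" x] assms False infdist_nonneg[of x "- U"]
      by (auto simp: closed_Compl less_le)
    then obtain i where "1 / real (Suc i) < infdist x (- U)"
      using nat_approx_posE[of "infdist x (- U)"] by auto
    then show "x \<in> (\<Union>i. ?K i)" by (auto intro!: exI[of _ i])
  next
    fix x assume "x \<in> (\<Union>i. ?K i)"
    then obtain i where i: "1 / real (Suc i) \<le> infdist x (- U)" by auto
    then have "0 < infdist x (- U)" by (rule less_le_trans[rotated]) simp
    then have "infdist x (- U) > 0" .
    then show "x \<in> U" using infdist_zero[of x "- U"] by (metis ComplI less_irrefl)
  qed
  ultimately show ?thesis by (intro exI[of _ ?K]) simp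
qed

text \<open>The sets that are analytic together with their complement form a \<open>\<sigma>\<close>-algebra. It contains
  \<open>A \<times> UNIV\<close> for measurable \<open>A\<close>, and \<open>space N \<times> K\<close> for closed \<open>K\<close> because the complement of \<open>K\<close>
  is a countable union of closed sets.\<close>

lemma analytic_over_product_sets:
  fixes B :: "('s \<times> 'e::metric_space) set"
  assumes B: "B \<in> sets (N \<Otimes>\<^sub>M borel)"
  shows "analytic_over (closed_rectangles N) B"
proof -
  let ?O = "space N \<times> (UNIV :: 'e set)"
  let ?an = "analytic_over (closed_rectangles N :: ('s \<times> 'e) set set)"
  define \<S> where "\<S> = {B. B \<subseteq> ?O \<and> ?an B \<and> ?an (?O - B)}"
  have rect: "?an (A \<times> K)" if "A \<in> sets N" "closed K" for A K
    using that by (intro analytic_over_base) (auto simp: closed_rectangles_def)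
  have "sigma_algebra ?O \<S>"
    unfolding sigma_algebra_iff2
  proof (intro conjI ballI allI impI)
    show "\<S> \<subseteq> Pow ?O" by (auto simp: \<S>_def)
    show "{} \<in> \<S>" using rect[of "{}" UNIV] rect[of "space N" UNIV] by (auto simp: \<S>_def)
    show "?O - s \<in> \<S>" if "s \<in> \<S>" for s
      using that by (auto simp: \<S>_def double_diff)
    show "(\<Union>i. A i) \<in> \<S>" if "range A \<subseteq> \<S>" for A :: "nat \<Rightarrow> _"
    proof -
      have A: "A i \<subseteq> ?O" "?an (A i)" "?an (?O - A i)" for i
        using that by (auto simp: \<S>_def)
      have "?O - (\<Union>i. A i) = (\<Inter>i. ?O - A i)" by auto
      moreover have "?an (\<Inter>i. ?O - A i)" by (rule analytic_over_INT) (rule A)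
      moreover have "?an (\<Union>i. A i)" by (rule analytic_over_UN) (rule A)
      ultimately show ?thesis using A(1) unfolding \<S>_def by auto
    qed
  qed
  then interpret S: sigma_algebra ?O \<S> .
  let ?M = "sigma ?O \<S>"
  have sets: "sets ?M = \<S>" and space: "space ?M = ?O"
    using S.sets_measure_of_eq S.space_closed by auto
  have fst: "fst \<in> measurable ?M N"
  proof (rule measurableI)
    fix A assume A: "A \<in> sets N"
    have eq: "fst -` A \<inter> space ?M = A \<times> UNIV" unfolding space using sets.sets_into_space[OF A] by auto
    have "?O - A \<times> UNIV = (space N - A) \<times> UNIV" by auto
    then have "A \<times> (UNIV :: 'e set) \<in> \<S>"
      using rect[of A UNIV] rect[of "space N - A" UNIV] A sets.sets_into_space[OF A] by (auto simp: \<S>_def)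
    then show "fst -` A \<inter> space ?M \<in> sets ?M" unfolding eq sets .
  qed (auto simp: space)
  have "snd \<in> borel_measurable ?M"
    unfolding borel_eq_closed
  proof (rule measurable_measure_of)
    fix K :: "'e set" assume "K \<in> Collect closed"
    then have K: "closed K" by simp
    obtain L :: "nat \<Rightarrow> 'e set" where L: "\<And>i. closed (L i)" "- K = (\<Union>i. L i)"
      using open_countable_union_closed[of "- K"] K by (auto simp: open_Compl)
    have eq: "snd -` K \<inter> space ?M = space N \<times> K" unfolding space by auto
    have "?O - space N \<times> K = (\<Union>i. space N \<times> L i)" using L(2) by auto
    then have "space N \<times> K \<in> \<S>"
      using rect[of "space N" K] K L(1) by (auto simp: \<S>_def intro!: analytic_over_UN rect)
    then show "snd -` K \<inter> space ?M \<in> sets ?M" unfolding eq sets .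
  qed auto
  then have "(\<lambda>p. (fst p, snd p)) \<in> measurable ?M (N \<Otimes>\<^sub>M borel)"
    using fst by (intro measurable_Pair) auto
  then have "(\<lambda>p. (fst p, snd p)) -` B \<inter> space ?M \<in> sets ?M" by (rule measurable_sets[OF _ B])
  moreover have "(\<lambda>p. (fst p, snd p)) -` B \<inter> space ?M = B"
    using sets.sets_into_space[OF B] by (auto simp: space space_pair_measure)
  ultimately have "B \<in> \<S>" unfolding sets by simp
  then show ?thesis unfolding \<S>_def by blast
qed



section \<open>Measurable sections of non-null projections\<close>

text \<open>Continuity from below of the outer measure.\<close>

lemma (in finite_measure) small_cover_UN:
  assumes "incseq Q" and cover: "\<And>n. \<exists>A\<in>sets M. Q n \<subseteq> A \<and> emeasure M A \<le> c"
  shows "\<exists>A\<in>sets M. (\<Union>n. Q n) \<subseteq> A \<and> emeasure M A \<le> c"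
proof -
  obtain A where A: "\<And>n. A n \<in> sets M" "\<And>n. Q n \<subseteq> A n" "\<And>n. emeasure M (A n) \<le> c"
    using cover by metis
  define B where "B = (\<lambda>n. \<Inter>m\<in>{n..}. A m)"
  have B: "B n \<in> sets M" for n
    unfolding B_def by (rule sets.countable_INT') (auto simp: A)
  have inc: "incseq B" unfolding B_def by (auto simp: incseq_def)
  have QB: "Q n \<subseteq> B n" for n
    unfolding B_def using A(2) \<open>incseq Q\<close> by (force simp: incseq_def)
  have "emeasure M (B n) \<le> c" for n
  proof -
    have "emeasure M (B n) \<le> emeasure M (A n)" by (rule emeasure_mono) (auto simp: B_def A)
    with A(3)[of n] show ?thesis by simp
  qed
  then have "emeasure M (\<Union>n. B n) \<le> c"
    using SUP_emeasure_incseq[of B M] B inc by (metis SUP_least image_subset_iff)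
  then show ?thesis
    using B QB by (intro bexI[of _ "\<Union>n. B n"] conjI) auto
qed

lemma (in finite_measure) null_cover_if_small_covers:
  assumes "\<And>n::nat. \<exists>A\<in>sets M. Q \<subseteq> A \<and> emeasure M A \<le> ennreal (1 / real (Suc n))"
  shows "\<exists>A\<in>null_sets M. Q \<subseteq> A"
proof -
  obtain A where A: "\<And>n. A n \<in> sets M" "\<And>n. Q \<subseteq> A n" "\<And>n. emeasure M (A n) \<le> ennreal (1 / real (Suc n))"
    using assms by metis
  have "emeasure M (\<Inter>n. A n) \<le> ennreal (1 / real (Suc n))" for n
    using emeasure_mono[of "\<Inter>n. A n" "A n" M] A(1,3)[of n] by (metis INF_lower UNIV_I order_trans)
  then have "measure M (\<Inter>n. A n) \<le> 1 / real (Suc n)" for n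
    by (simp add: emeasure_eq_measure)
  then have "measure M (\<Inter>n. A n) \<le> 0"
    by (metis nat_approx_posE not_le)
  then have "emeasure M (\<Inter>n. A n) = 0" by (simp add: emeasure_eq_measure ennreal_eq_0_iff)
  then have "(\<Inter>n. A n) \<in> null_sets M" using A(1) by (intro null_setsI) auto
  then show ?thesis using A(2) by blast
qed

definition bounded_by :: "(nat \<Rightarrow> nat) \<Rightarrow> nat list \<Rightarrow> bool" where
  "bounded_by b xs \<longleftrightarrow> (\<forall>j<length xs. xs ! j \<le> b j)"

lemma bounded_by_take: "bounded_by b xs \<Longrightarrow> bounded_by b (take k xs)"
  by (auto simp: bounded_by_def)

lemma finite_bounded_by: "finite {xs. length xs = n \<and> bounded_by b xs}"
proof -
  have sub: "set xs \<subseteq> {..Max (b ` {..n})}" if "bounded_by b xs" "length xs = n" for xs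
  proof
    fix x assume "x \<in> set xs"
    then obtain j where "j < length xs" "xs ! j = x" by (auto simp: in_set_conv_nth)
    then have j: "j < n" "xs ! j = x" using that by auto
    then have "x \<le> b j" using that by (auto simp: bounded_by_def)
    also have "b j \<le> Max (b ` {..n})" using j by (intro Max_ge) auto
    finally show "x \<in> {..Max (b ` {..n})}" by simp
  qed
  have "{xs. length xs = n \<and> bounded_by b xs} \<subseteq> {xs. set xs \<subseteq> {..Max (b ` {..n})} \<and> length xs = n}"
    using sub by blast
  then show ?thesis by (rule finite_subset) (rule finite_lists_length_eq, simp)
qed

locale measurable_tree = finite_measure M for M :: "'s measure" +
  fixes E :: "nat list \<Rightarrow> 's set"
  assumes E_sets [measurable]: "E xs \<in> sets M"
    and E_mono: "E (xs @ ys) \<subseteq> E xs"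
begin

text \<open>\<open>xs\<close> has extensions of every length that obey the bound \<open>b\<close> and whose set contains \<open>s\<close>. Only
  countably many lists are involved, so this is a measurable condition on \<open>s\<close>; by Koenig's lemma it
  means that an infinite branch bounded by \<open>b\<close> passes through \<open>xs\<close>.\<close>

definition alive :: "(nat \<Rightarrow> nat) \<Rightarrow> 's \<Rightarrow> nat list \<Rightarrow> bool" where
  "alive b s xs \<longleftrightarrow> (\<forall>k. \<exists>ys. length ys = k \<and> bounded_by b (xs @ ys) \<and> s \<in> E (xs @ ys))"

text \<open>Koenig's lemma: if every child \<open>n \<le> b (length xs)\<close> dies at some depth, then \<open>xs\<close> itself dies at
  the maximum of these depths plus one.\<close>

lemma alive_extend:
  assumes "alive b s xs"
  shows "\<exists>n. alive b s (xs @ [n])"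
proof (rule ccontr)
  assume "\<nexists>n. alive b s (xs @ [n])"
  then have "\<forall>n. \<exists>k. \<forall>ys. length ys = k \<longrightarrow> bounded_by b (xs @ [n] @ ys) \<longrightarrow> s \<notin> E (xs @ [n] @ ys)"
    unfolding alive_def by (metis append_assoc)
  then obtain k where k: "\<And>n ys. length ys = k n \<Longrightarrow> bounded_by b (xs @ [n] @ ys) \<Longrightarrow> s \<notin> E (xs @ [n] @ ys)"
    by metis
  define K where "K = Max (k ` {..b (length xs)})"
  obtain ys where ys: "length ys = Suc K" "bounded_by b (xs @ ys)" "s \<in> E (xs @ ys)"
    using assms unfolding alive_def by blast
  obtain n zs where zs: "ys = n # zs" "length zs = K" using ys(1) by (cases ys) auto
  have "n \<le> b (length xs)" using ys(2) unfolding zs(1) bounded_by_def by (auto dest: spec[of _ "length xs"])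
  then have kn: "k n \<le> K" unfolding K_def by (intro Max_ge) auto
  let ?t = "take (k n) zs"
  have "bounded_by b (xs @ [n] @ ?t)"
    using bounded_by_take[OF ys(2), of "length xs + Suc (k n)"] zs by simp
  moreover have "s \<in> E (xs @ [n] @ ?t)"
    using E_mono[of "xs @ [n] @ ?t" "drop (k n) zs"] ys(3) zs(1) by auto
  ultimately show False using k[of ?t n] kn zs(2) by simp
qed

primrec leftmost :: "(nat \<Rightarrow> nat) \<Rightarrow> 's \<Rightarrow> nat \<Rightarrow> nat list" where
  "leftmost b s 0 = []"
| "leftmost b s (Suc m) = leftmost b s m @ [LEAST n. alive b s (leftmost b s m @ [n])]"

lemma length_leftmost [simp]: "length (leftmost b s m) = m"
  by (induction m) auto

lemma alive_leftmost:
  assumes "alive b s []"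
  shows "alive b s (leftmost b s m)"
proof (induction m)
  case (Suc m)
  then show ?case using alive_extend[OF Suc] by (auto intro: LeastI)
qed (simp add: assms)

lemma alive_imp_mem: "alive b s xs \<Longrightarrow> s \<in> E xs"
  unfolding alive_def by (metis append_Nil2 length_0_conv)

lemma measurable_alive [measurable]: "Measurable.pred M (\<lambda>s. alive b s xs)"
  unfolding alive_def by measurable

lemma measurable_leftmost [measurable]: "(\<lambda>s. leftmost b s m) \<in> measurable M (count_space UNIV)"
proof (induction m)
  case (Suc m)
  note Suc[measurable]
  have "(\<lambda>s. (\<lambda>xs s. xs @ [LEAST n. alive b s (xs @ [n])]) (leftmost b s m) s) \<in> measurable M (count_space UNIV)"
    by (rule measurable_compose_countable[OF _ Suc]) measurable
  then show ?case by simp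
qed simp

lemma leftmost_conv_map:
  "leftmost b s m = map (\<lambda>j. leftmost b s (Suc j) ! j) [0..<m]"
  by (induction m) (auto simp: nth_append simp del: leftmost.simps(2), simp add: nth_append)

text \<open>Choquet's capacitability argument. The set of points with some branch has positive outer measure,
  larger than some \<open>c\<close>. By continuity from below of the outer measure the entries of the branch can be
  bounded one after the other without going below \<open>c\<close>. With all bounds \<open>b\<close> in place, the points
  that have a list of length \<open>m\<close> bounded by \<open>b\<close> form a measurable set \<open>D m\<close> of measure at least \<open>c\<close>,
  and so does their decreasing intersection. There the tree bounded by \<open>b\<close> is finitely
  branching, hence has a branch, and the leftmost one depends measurably on the point.\<close>

theorem measurable_branch:
  assumes not_null: "\<not> (\<exists>A\<in>null_sets M. {s. \<exists>t. \<forall>k. s \<in> E (map t [0..<k])} \<subseteq> A)"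
  shows "\<exists>D \<tau>. D \<in> sets M \<and> emeasure M D > 0 \<and> (\<forall>j. (\<lambda>s. \<tau> s j) \<in> measurable M (count_space UNIV)) \<and>
    (\<forall>s\<in>D. \<forall>k. s \<in> E (map (\<tau> s) [0..<k]))"
proof -
  define Q where "Q = (\<lambda>m (b::nat \<Rightarrow> nat). {s. \<exists>t. (\<forall>j<m. t j \<le> b j) \<and> (\<forall>k. s \<in> E (map t [0..<k]))})"
  define small where "small = (\<lambda>c Q. \<exists>A\<in>sets M. Q \<subseteq> A \<and> emeasure M A \<le> c)"
  have "Q 0 (\<lambda>_. 0) = {s. \<exists>t. \<forall>k. s \<in> E (map t [0..<k])}" by (simp add: Q_def)
  then obtain n0 where n0: "\<not> small (ennreal (1 / real (Suc n0))) (Q 0 (\<lambda>_. 0))"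
    using null_cover_if_small_covers[of "Q 0 (\<lambda>_. 0)"] not_null unfolding small_def by metis
  let ?c = "ennreal (1 / real (Suc n0))"
  have "\<exists>F. \<forall>m. \<not> small ?c (Q m (F m)) \<and> (\<forall>j<m. F (Suc m) j = F m j)"
  proof (rule dependent_nat_choice)
    show "\<exists>b. \<not> small ?c (Q 0 b)" using n0 by blast
  next
    fix b m assume b: "\<not> small ?c (Q m b)"
    have eq: "Q m b = (\<Union>n. Q (Suc m) (b(m := n)))"
    proof (intro set_eqI iffI)
      fix s assume "s \<in> Q m b"
      then obtain t where "\<forall>j<m. t j \<le> b j" "\<forall>k. s \<in> E (map t [0..<k])" by (auto simp: Q_def)
      then have "s \<in> Q (Suc m) (b(m := t m))" unfolding Q_def by (auto simp: less_Suc_eq)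
      then show "s \<in> (\<Union>n. Q (Suc m) (b(m := n)))" by blast
    next
      fix s assume "s \<in> (\<Union>n. Q (Suc m) (b(m := n)))"
      then obtain n t where "\<forall>j<Suc m. t j \<le> (b(m := n)) j" "\<forall>k. s \<in> E (map t [0..<k])" by (auto simp: Q_def)
      then show "s \<in> Q m b" unfolding Q_def by (auto simp: less_Suc_eq)
    qed
    have "incseq (\<lambda>n. Q (Suc m) (b(m := n)))"
    proof (rule incseq_SucI, rule subsetI)
      fix n s assume "s \<in> Q (Suc m) (b(m := n))"
      then obtain t where t: "\<forall>j<Suc m. t j \<le> (b(m := n)) j" "\<forall>k. s \<in> E (map t [0..<k])" by (auto simp: Q_def)
      have "\<forall>j<Suc m. t j \<le> (b(m := Suc n)) j" using t(1) by (auto dest: spec)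
      then show "s \<in> Q (Suc m) (b(m := Suc n))" using t(2) unfolding Q_def by blast
    qed
    then have "\<exists>n. \<not> small ?c (Q (Suc m) (b(m := n)))"
      using small_cover_UN[of "\<lambda>n. Q (Suc m) (b(m := n))" ?c] b unfolding eq small_def by blast
    then obtain n where "\<not> small ?c (Q (Suc m) (b(m := n)))" by blast
    then show "\<exists>b'. \<not> small ?c (Q (Suc m) b') \<and> (\<forall>j<m. b' j = b j)"
      by (intro exI[of _ "b(m := n)"]) auto
  qed
  then obtain F where F: "\<And>m. \<not> small ?c (Q m (F m))" "\<And>m j. j < m \<Longrightarrow> F (Suc m) j = F m j" by blast
  define b where "b = (\<lambda>j. F (Suc j) j)"
  have Fb: "F m j = b j" if "j < m" for m j
    using that
  proof (induction m)
    case (Suc m)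
    then show ?case using F(2)[of j m] by (cases "j = m") (auto simp: b_def)
  qed simp
  define D where "D = (\<lambda>m. \<Union>xs\<in>{xs. length xs = m \<and> bounded_by b xs}. E xs)"
  have D_sets [measurable]: "D m \<in> sets M" for m
    unfolding D_def by (intro sets.finite_UN finite_bounded_by) auto
  have QD: "Q m (F m) \<subseteq> D m" for m
  proof
    fix s assume "s \<in> Q m (F m)"
    then obtain t where "\<forall>j<m. t j \<le> F m j" "\<forall>k. s \<in> E (map t [0..<k])" by (auto simp: Q_def)
    then have "bounded_by b (map t [0..<m])" "s \<in> E (map t [0..<m])" using Fb by (auto simp: bounded_by_def)
    then show "s \<in> D m" by (auto simp: D_def intro!: exI[of _ "map t [0..<m]"])
  qed
  have D_big: "emeasure M (D m) > ?c" for m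
    using F(1)[of m] QD[of m] D_sets[of m] unfolding small_def by (meson not_le)
  have D_dec: "decseq D"
  proof (rule decseq_SucI, rule subsetI)
    fix m s assume "s \<in> D (Suc m)"
    then obtain xs where xs: "length xs = Suc m" "bounded_by b xs" "s \<in> E xs" by (auto simp: D_def)
    then have "s \<in> E (take m xs)" using E_mono[of "take m xs" "drop m xs"] by auto
    then show "s \<in> D m" using bounded_by_take[OF xs(2), of m] xs(1) by (auto simp: D_def intro!: exI[of _ "take m xs"])
  qed
  define D' where "D' = (\<Inter>m. D m)"
  have "emeasure M D' = (INF m. emeasure M (D m))"
    unfolding D'_def using D_dec by (intro INF_emeasure_decseq[symmetric]) auto
  also have "\<dots> \<ge> ?c" using D_big by (intro INF_greatest) (auto intro: less_imp_le)
  finally have "emeasure M D' \<ge> ?c" .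
  moreover have "0 < ?c" by simp
  ultimately have pos: "emeasure M D' > 0" by (metis less_le_trans)
  have alive: "alive b s []" if "s \<in> D'" for s
    using that unfolding D'_def D_def alive_def by fastforce
  define \<tau> where "\<tau> = (\<lambda>s j. leftmost b s (Suc j) ! j)"
  have "(\<lambda>s. \<tau> s j) \<in> measurable M (count_space UNIV)" for j
    unfolding \<tau>_def by (rule measurable_compose[OF measurable_leftmost]) simp
  moreover have "s \<in> E (map (\<tau> s) [0..<k])" if "s \<in> D'" for s k
    using alive_imp_mem[OF alive_leftmost[OF alive[OF that]], of k]
    unfolding leftmost_conv_map[of b s k] \<tau>_def .
  moreover have "D' \<in> sets M" unfolding D'_def by measurable
  ultimately show ?thesis using pos by blast
qed

end

text \<open>The even entries of the branch code the point as before; the odd entry \<open>2 i + 1\<close> names a member of a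
  dense sequence within \<open>1 / 2\<^sup>i\<close> of the second component. The branch then determines the second
  component.\<close>

lemma analytic_over_small_code:
  fixes B :: "('s \<times> 'e::{metric_space, second_countable_topology}) set"
  assumes "analytic_over (closed_rectangles N) B"
  shows "\<exists>C d. (\<forall>i t. C i t \<in> closed_rectangles N) \<and> (\<forall>i. locally_constant (C i)) \<and>
    B = {p. \<exists>t. \<forall>i. p \<in> C i t} \<and> (\<forall>i t. C (2 * i + 1) t = space N \<times> cball (d (t (2 * i + 1))) (1 / 2 ^ i))"
proof -
  obtain C :: "nat \<Rightarrow> (nat \<Rightarrow> nat) \<Rightarrow> ('s \<times> 'e) set" where "(\<forall>i s. C i s \<in> closed_rectangles N) \<and> (\<forall>i. locally_constant (C i)) \<and>
    B = {p. \<exists>s. \<forall>i. p \<in> C i s}"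
    using assms unfolding analytic_over_def by (elim exE) (erule that)
  then have C: "\<And>i s. C i s \<in> closed_rectangles N" "\<And>i. locally_constant (C i)"
    "B = {p. \<exists>s. \<forall>i. p \<in> C i s}" by simp_all
  obtain d :: "nat \<Rightarrow> 'e" where d: "\<And>X. open X \<Longrightarrow> X \<noteq> {} \<Longrightarrow> \<exists>n. d n \<in> X"
    by (rule dense_sequence) blast
  define C' where "C' = (\<lambda>i (t::nat \<Rightarrow> nat). if even i then C (i div 2) (\<lambda>j. t (2 * j))
    else space N \<times> cball (d (t i)) (1 / 2 ^ (i div 2)))"
  have "C' i t \<in> closed_rectangles N" for i t
    using C(1) by (auto simp: C'_def closed_rectangles_def)
  moreover have "locally_constant (C' i)" for i
  proof (cases "even i")
    case True
    then show ?thesis using locally_constant_reindex[OF C(2)] by (simp add: C'_def)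
  next
    case False
    then show ?thesis by (auto simp: C'_def locally_constant_def intro!: exI[of _ "Suc i"])
  qed
  moreover have "B = {p. \<exists>t. \<forall>i. p \<in> C' i t}"
  proof (intro set_eqI iffI)
    fix p assume "p \<in> B"
    then obtain s where s: "\<And>i. p \<in> C i s" using C(3) by auto
    obtain A K where AK: "C 0 s = A \<times> K" "A \<in> sets N" using C(1)[of 0 s] by (auto simp: closed_rectangles_def)
    have p: "fst p \<in> space N"
      using s[of 0] sets.sets_into_space[OF AK(2)] unfolding AK(1) by (auto simp: subset_iff)
    have "\<forall>i::nat. \<exists>n. d n \<in> ball (snd p) (1 / 2 ^ i)" using d by (metis open_ball ball_eq_empty zero_less_divide_1_iff zero_less_numeral zero_less_power not_le)
    then obtain c where c: "\<And>i::nat. d (c i) \<in> ball (snd p) (1 / 2 ^ i)" by metis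
    define t where "t = (\<lambda>i. if even i then s (i div 2) else c (i div 2))"
    have "p \<in> C' i t" for i
      using s[of "i div 2"] c[of "i div 2"] p by (cases p) (auto simp: C'_def t_def dist_commute intro: less_imp_le)
    then show "p \<in> {p. \<exists>t. \<forall>i. p \<in> C' i t}" by blast
  next
    fix p assume "p \<in> {p. \<exists>t. \<forall>i. p \<in> C' i t}"
    then obtain t where t: "\<And>i. p \<in> C' i t" by auto
    have "p \<in> C i (\<lambda>j. t (2 * j))" for i using t[of "2 * i"] by (simp add: C'_def)
    then show "p \<in> B" using C(3) by blast
  qed
  moreover have "\<forall>i t. C' (2 * i + 1) t = space N \<times> cball (d (t (2 * i + 1))) (1 / 2 ^ i)"
    by (simp add: C'_def)
  ultimately show ?thesis by blast
qed

text \<open>\<open>Em m t\<close> collects the conditions on the first component that are determined by the first \<open>m\<close>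
  entries of the branch \<open>t\<close>, provided that the corresponding conditions \<open>Km m t\<close> on the second component
  are compatible. Along an infinite branch the sets \<open>Km m t\<close> are closed, nested and shrink in diameter, so by
  completeness they determine a point. A measurable choice of branches on a set of positive measure
  thus yields a section, as the limit of the points named by the odd entries.\<close>

theorem nonnull_projection_section:
  fixes B :: "('s \<times> 'e::{complete_space, second_countable_topology}) set"
  assumes "finite_measure N" and B: "B \<in> sets (N \<Otimes>\<^sub>M borel)"
    and not_null: "\<not> (\<exists>A\<in>null_sets N. fst ` B \<subseteq> A)"
  shows "\<exists>D f. D \<in> sets N \<and> emeasure N D > 0 \<and> f \<in> borel_measurable N \<and> (\<forall>s\<in>D. (s, f s) \<in> B)"
proof -
  interpret finite_measure N by fact
  obtain C :: "nat \<Rightarrow> (nat \<Rightarrow> nat) \<Rightarrow> ('s \<times> 'e) set" and d :: "nat \<Rightarrow> 'e" where Cd: "(\<forall>i t. C i t \<in> closed_rectangles N) \<and> (\<forall>i. locally_constant (C i)) \<and>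
    B = {p. \<exists>t. \<forall>i. p \<in> C i t} \<and> (\<forall>i t. C (2 * i + 1) t = space N \<times> cball (d (t (2 * i + 1))) (1 / 2 ^ i))"
    using analytic_over_small_code[OF analytic_over_product_sets[OF B]] by (elim exE) (erule that)
  have C: "\<And>i t. C i t \<in> closed_rectangles N" "\<And>i. locally_constant (C i)"
    "B = {p. \<exists>t. \<forall>i. p \<in> C i t}" "\<And>i t. C (2 * i + 1) t = space N \<times> cball (d (t (2 * i + 1))) (1 / 2 ^ i)"
    using Cd by blast+
  have ex: "\<forall>R\<in>closed_rectangles N. \<exists>AK. R = fst AK \<times> snd AK \<and> fst AK \<in> sets N \<and> closed (snd AK :: 'e set)"
    by (auto simp: closed_rectangles_def)
  obtain AK where AK: "\<forall>R\<in>closed_rectangles N. R = fst (AK R) \<times> snd (AK R) \<and> fst (AK R) \<in> sets N \<and> closed (snd (AK R) :: 'e set)"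
    using bchoice[OF ex] by (elim exE) (erule that)
  define a where "a = (\<lambda>R. fst (AK R))"
  define k where "k = (\<lambda>R. snd (AK R))"
  have ak: "R = a R \<times> k R \<and> a R \<in> sets N \<and> closed (k R :: 'e set)" if "R \<in> closed_rectangles N" for R
    using AK that unfolding a_def k_def by blast
  \<comment> \<open>\<open>det m i t\<close>: the first \<open>m\<close> entries of \<open>t\<close> determine the \<open>i\<close>-th rectangle.\<close>
  define det where "det = (\<lambda>m i t. \<forall>t'. (\<forall>j<m. t' j = t j) \<longrightarrow> C i t' = C i t)"
  define I where "I = (\<lambda>m t. {i. i < m \<and> det m i t})"
  define Km where "Km = (\<lambda>m t. \<Inter>i\<in>I m t. k (C i t))"
  define Em where "Em = (\<lambda>m t. if Km m t = {} then {} else space N \<inter> (\<Inter>i\<in>I m t. a (C i t)))"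
  have det_eq: "C i t' = C i t" if "\<And>j. j < m \<Longrightarrow> t' j = t j" "det m i t" for m i t t'
    using that unfolding det_def by blast
  have det_imp: "det m i t'" if agree: "\<And>j. j < m \<Longrightarrow> t' j = t j" and det: "det m i t" for m i t t'
    unfolding det_def
  proof (intro allI impI)
    fix t'' assume t'': "\<forall>j<m. t'' j = t' j"
    have "C i t'' = C i t" using t'' agree by (intro det_eq[OF _ det]) simp
    also have "\<dots> = C i t'" using agree by (intro det_eq[OF _ det, symmetric]) simp
    finally show "C i t'' = C i t'" .
  qed
  have det_cong: "det m i t' = det m i t" "det m i t \<Longrightarrow> C i t' = C i t" if "\<And>j. j < m \<Longrightarrow> t' j = t j" for m i t t'
    using det_imp[of m t' t i] det_imp[of m t t' i] det_eq[of m t' t i] that by metis+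
  have Em_cong: "Em m t' = Em m t" if "\<And>j. j < m \<Longrightarrow> t' j = t j" for m t t'
  proof -
    have I: "I m t' = I m t" using det_cong(1)[OF that] by (auto simp: I_def)
    have "C i t' = C i t" if "i \<in> I m t" for i using det_cong(2)[OF \<open>\<And>j. j < m \<Longrightarrow> t' j = t j\<close>] that by (auto simp: I_def)
    then show ?thesis unfolding Em_def Km_def I by simp
  qed
  have I_mono: "I m t \<subseteq> I n t" if "m \<le> n" for m n t
  proof
    fix i assume "i \<in> I m t"
    then have "i < m" "det m i t" by (auto simp: I_def)
    moreover have "det n i t"
      unfolding det_def using det_eq[OF _ \<open>det m i t\<close>] that by (meson less_le_trans)
    ultimately show "i \<in> I n t" using that by (simp add: I_def)
  qed
  have Em_mono: "Em n t \<subseteq> Em m t" if "m \<le> n" for m n t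
  proof -
    have "Km n t \<subseteq> Km m t" using I_mono[OF that] unfolding Km_def by (rule INF_superset_mono) simp
    moreover have "(\<Inter>i\<in>I n t. a (C i t)) \<subseteq> (\<Inter>i\<in>I m t. a (C i t))"
      using I_mono[OF that] by (rule INF_superset_mono) simp
    ultimately show ?thesis unfolding Em_def by auto
  qed
  have Em_sets: "Em m t \<in> sets N" for m t
  proof -
    have "finite (I m t)" by (auto simp: I_def)
    then have "space N \<inter> (\<Inter>i\<in>I m t. a (C i t)) \<in> sets N"
      using ak[OF C(1)] by (cases "I m t = {}") (blast intro: sets.Int sets.finite_INT sets.top | simp)+
    then show ?thesis by (auto simp: Em_def)
  qed
  have eventually_I: "\<exists>m0. \<forall>m\<ge>m0. i \<in> I m t" for i t
  proof -
    obtain n where n: "\<forall>t'. (\<forall>j<n. t' j = t j) \<longrightarrow> C i t' = C i t"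
      using C(2)[of i] unfolding locally_constant_def by blast
    then have "\<forall>t'. (\<forall>j<max n (Suc i). t' j = t j) \<longrightarrow> C i t' = C i t"
      by (intro allI impI) (erule allE, erule mp, simp)
    then have "det (max n (Suc i)) i t" unfolding det_def .
    then have "i \<in> I (max n (Suc i)) t" unfolding I_def by simp
    then show ?thesis using I_mono by blast
  qed
  have branch: "\<exists>x. (\<lambda>i. d (t (2 * i + 1))) \<longlonglongrightarrow> x \<and> (s, x) \<in> B" if s: "\<And>m. s \<in> Em m t" for s t
  proof -
    have closed: "closed (Km m t)" for m
      unfolding Km_def using ak C(1) by (intro closed_INT) auto
    have ne: "Km m t \<noteq> {}" for m using s[of m] by (auto simp: Em_def)
    have small: "\<exists>n. \<forall>x\<in>Km n t. \<forall>y\<in>Km n t. dist x y < e" if "e > 0" for e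
    proof -
      have "\<exists>i. (1 / 2 :: real) ^ i < e / 2" by (rule real_arch_pow_inv) (use that in auto)
      then obtain i :: nat where i: "1 / 2 ^ i < e / 2" unfolding power_one_over by blast
      obtain n where n: "2 * i + 1 \<in> I n t" using eventually_I by blast
      have "k (C (2 * i + 1) t) = cball (d (t (2 * i + 1))) (1 / 2 ^ i)"
        using ak[OF C(1)[of "2 * i + 1" t]] C(4)[of i t] s[of 0] by (auto simp: Em_def times_eq_iff split: if_splits)
      then have "Km n t \<subseteq> cball (d (t (2 * i + 1))) (1 / 2 ^ i)"
        using n unfolding Km_def by blast
      then have *: "dist (d (t (2 * i + 1))) x \<le> 1 / 2 ^ i" if "x \<in> Km n t" for x
        using that by (auto simp: subset_iff)
      have "dist x y < e" if "x \<in> Km n t" "y \<in> Km n t" for x y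
        using *[OF that(1)] *[OF that(2)] i dist_triangle3[of x y "d (t (2 * i + 1))"] by linarith
      then show ?thesis by blast
    qed
    obtain x where x: "\<And>m. x \<in> Km m t"
    proof -
      have "\<exists>x. \<Inter>(range (\<lambda>m. Km m t)) = {x}"
      proof (rule decreasing_closed_nest_sing[OF closed ne])
        show "Km n t \<subseteq> Km m t" if "m \<le> n" for m n
          using I_mono[OF that] unfolding Km_def by (rule INF_superset_mono) simp
      qed (use small in blast)
      then show ?thesis using that by blast
    qed
    have mem: "(s, x) \<in> C i t" for i
    proof -
      obtain m where m: "i \<in> I m t" using eventually_I by blast
      have "s \<in> a (C i t)" using s[of m] m by (auto simp: Em_def split: if_splits)
      moreover have "x \<in> k (C i t)" using x[of m] m by (auto simp: Km_def)
      ultimately show ?thesis using ak[OF C(1)[of i t]] by blast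
    qed
    have "(\<lambda>i. d (t (2 * i + 1))) \<longlonglongrightarrow> x"
    proof (rule metric_LIMSEQ_I)
      fix r :: real assume "0 < r"
      have "\<exists>i. (1 / 2 :: real) ^ i < r" by (rule real_arch_pow_inv) (use \<open>0 < r\<close> in auto)
      then obtain i :: nat where i: "1 / 2 ^ i < r" unfolding power_one_over by blast
      have "dist (d (t (2 * n + 1))) x < r" if "n \<ge> i" for n
      proof -
        have "dist (d (t (2 * n + 1))) x \<le> 1 / 2 ^ n" using mem[of "2 * n + 1"] unfolding C(4) by simp
        also have "\<dots> \<le> 1 / 2 ^ i" using that by (intro divide_left_mono power_increasing) auto
        finally show ?thesis using i by simp
      qed
      then show "\<exists>no. \<forall>n\<ge>no. dist (d (t (2 * n + 1))) x < r" by blast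
    qed
    then show ?thesis using mem C(3) by blast
  qed
  define E where "E = (\<lambda>xs. Em (length xs) (\<lambda>j. if j < length xs then xs ! j else 0))"
  have E_map: "E (map t [0..<m]) = Em m t" for t m
    unfolding E_def by (simp, rule Em_cong) simp
  interpret measurable_tree N E
  proof
    show "E xs \<in> sets N" for xs by (simp add: E_def Em_sets)
    fix xs ys :: "nat list"
    let ?t = "\<lambda>j. if j < length (xs @ ys) then (xs @ ys) ! j else 0"
    have "E (xs @ ys) \<subseteq> Em (length xs) ?t" unfolding E_def by (rule Em_mono) simp
    also have "\<dots> = E xs" unfolding E_def by (rule Em_cong) (simp add: nth_append)
    finally show "E (xs @ ys) \<subseteq> E xs" .
  qed
  have "fst ` B \<subseteq> {s. \<exists>t. \<forall>m. s \<in> E (map t [0..<m])}"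
  proof (clarsimp simp: E_map)
    fix s x assume "(s, x) \<in> B"
    then obtain t where t: "\<And>i. (s, x) \<in> C i t" using C(3) by auto
    then have "(s, x) \<in> a (C i t) \<times> k (C i t)" for i using ak[OF C(1)[of i t]] by auto
    then have *: "s \<in> a (C i t)" "x \<in> k (C i t)" for i by auto
    moreover have "s \<in> space N" using t[of 1] C(4)[of 0 t] by auto
    moreover have "x \<in> Km m t" for m unfolding Km_def by (rule INT_I) (rule *)
    ultimately have "s \<in> Em m t" for m unfolding Em_def by auto
    then show "\<exists>t. \<forall>m. s \<in> Em m t" by blast
  qed
  then have "\<not> (\<exists>A\<in>null_sets N. {s. \<exists>t. \<forall>m. s \<in> E (map t [0..<m])} \<subseteq> A)"
    using not_null by (meson subset_trans)
  from measurable_branch[OF this] obtain D and \<tau> :: "'s \<Rightarrow> nat \<Rightarrow> nat" where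
    "D \<in> sets N \<and> emeasure N D > 0 \<and> (\<forall>j. (\<lambda>s. \<tau> s j) \<in> measurable N (count_space UNIV)) \<and>
      (\<forall>s\<in>D. \<forall>k. s \<in> E (map (\<tau> s) [0..<k]))"
    by (elim exE) (erule that)
  then have D: "D \<in> sets N" "emeasure N D > 0"
    and \<tau>: "\<And>j. (\<lambda>s. \<tau> s j) \<in> measurable N (count_space UNIV)" "\<And>s k. s \<in> D \<Longrightarrow> s \<in> E (map (\<tau> s) [0..<k])"
    by blast+
  define F where "F = (\<lambda>i s. if s \<in> D then d (\<tau> s (2 * i + 1)) else d 0)"
  define f where "f = (\<lambda>s. lim (\<lambda>i. F i s))"
  have F_meas: "F i \<in> borel_measurable N" for i
    unfolding F_def using D(1) by (intro measurable_If_set measurable_compose[OF \<tau>(1)]) auto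
  have F_D: "(\<lambda>i. F i s) \<longlonglongrightarrow> f s \<and> (s, f s) \<in> B" if s: "s \<in> D" for s
  proof -
    obtain x where "(\<lambda>i. d (\<tau> s (2 * i + 1))) \<longlonglongrightarrow> x" "(s, x) \<in> B"
      using branch[of s "\<tau> s"] \<tau>(2)[OF s] by (auto simp: E_map)
    then show ?thesis using s limI[of "\<lambda>i. F i s" x] by (simp add: F_def f_def)
  qed
  have "(\<lambda>i. F i s) \<longlonglongrightarrow> f s" for s
    using F_D[of s] by (cases "s \<in> D") (auto simp: F_def f_def)
  then have "f \<in> borel_measurable N"
    by (intro borel_measurable_LIMSEQ_metric[OF F_meas])
  then show ?thesis using D F_D by blast
qed



section \<open>Selections of the driver\<close>

lemma INF_ennreal_dist:
  assumes "compact C" "C \<noteq> {}"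
  shows "(INF y\<in>C. ennreal (dist x y)) = ennreal (infdist x C)"
proof (rule antisym)
  obtain y where "y \<in> C" "dist x y = infdist x C" using compact_infdist_attained[OF assms] by blast
  then show "(INF y\<in>C. ennreal (dist x y)) \<le> ennreal (infdist x C)" by (metis INF_lower)
  show "ennreal (infdist x C) \<le> (INF y\<in>C. ennreal (dist x y))"
    by (intro INF_greatest ennreal_leI infdist_le)
qed

lemma hausdorff_dist_le_iff:
  assumes "compact B" "B \<noteq> {}" "compact C" "C \<noteq> {}" and "0 \<le> c"
  shows "hausdorff_dist dist B C \<le> ennreal c \<longleftrightarrow> (\<forall>x\<in>B. infdist x C \<le> c) \<and> (\<forall>y\<in>C. infdist y B \<le> c)"
proof -
  have 1: "(INF y\<in>C. ennreal (dist x y)) = ennreal (infdist x C)" for x by (rule INF_ennreal_dist[OF assms(3,4)])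
  have 2: "(INF x\<in>B. ennreal (dist x y)) = ennreal (infdist y B)" for y
    using INF_ennreal_dist[OF assms(1,2), of y] by (simp add: dist_commute)
  show ?thesis unfolding hausdorff_dist_def 1 2 using assms(5) by (simp add: SUP_le_iff)
qed

lemma hausdorff_dist_zero_le_iff:
  fixes B :: "'e::real_normed_vector set"
  assumes "B \<noteq> {}"
  shows "hausdorff_dist dist B {0} \<le> c \<longleftrightarrow> (\<forall>x\<in>B. ennreal (norm x) \<le> c)"
proof -
  obtain b where "b \<in> B" using assms by auto
  have "(INF x\<in>B. ennreal (norm x)) \<le> c" if "\<forall>x\<in>B. ennreal (norm x) \<le> c"
    using that \<open>b \<in> B\<close> by (meson INF_lower order_trans)
  then show ?thesis by (auto simp: hausdorff_dist_def SUP_le_iff)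
qed

text \<open>Projecting a dense sequence of points onto \<open>H s\<close> gives a sequence of measurable selections that
  is dense in \<open>H s\<close>. Its supremum of norms is the radius \<open>R\<close>, and the first term within \<open>1\<close> of it
  is a far selection.\<close>

lemma far_selection:
  fixes H :: "'s \<Rightarrow> 'e::{real_inner, second_countable_topology} set"
  assumes meas: "set_valued_measurable N H" and H: "\<And>s. s \<in> space N \<Longrightarrow> H s \<in> K_ccmpt"
  shows "\<exists>R f. R \<in> borel_measurable N \<and> f \<in> borel_measurable N \<and>
    (\<forall>s\<in>space N. 0 \<le> R s \<and> hausdorff_dist dist (H s) {0} = ennreal (R s) \<and> f s \<in> H s \<and> R s \<le> norm (f s) + 1)"
proof -
  obtain d :: "nat \<Rightarrow> 'e" where d: "\<And>X. open X \<Longrightarrow> X \<noteq> {} \<Longrightarrow> \<exists>n. d n \<in> X"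
    by (rule dense_sequence) blast
  define p where "p = (\<lambda>k s. metric_proj (H s) (d k))"
  have p_meas [measurable]: "p k \<in> borel_measurable N" for k
    unfolding p_def by (rule measurable_metric_proj[OF meas H]) auto
  have K: "compact (H s)" "H s \<noteq> {}" if "s \<in> space N" for s using H[OF that] by (auto simp: K_ccmpt_def)
  have p_in: "p k s \<in> H s" if "s \<in> space N" for k s unfolding p_def by (rule metric_proj[OF K[OF that]])
  have dense: "\<exists>k. norm x \<le> norm (p k s) + e" if s: "s \<in> space N" and x: "x \<in> H s" and e: "0 < e" for s x e
  proof -
    obtain k where "d k \<in> ball x (e / 2)" using d[of "ball x (e / 2)"] e by auto
    then have "dist (p k s) x \<le> e" unfolding p_def
      using metric_proj_near[OF K(1)[OF s] x, of "d k"] by (simp add: dist_commute)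
    then have "norm x \<le> norm (p k s) + e" using norm_triangle_sub[of x "p k s"] by (simp add: dist_norm norm_minus_commute)
    then show ?thesis by blast
  qed
  have bdd: "bdd_above (range (\<lambda>k. norm (p k s)))" if s: "s \<in> space N" for s
  proof -
    obtain b where "\<forall>x\<in>H s. norm x \<le> b" using compact_imp_bounded[OF K(1)[OF s]] by (auto simp: bounded_iff)
    then show ?thesis using p_in[OF s] by (intro bdd_aboveI2[of _ _ b]) auto
  qed
  define R where "R = (\<lambda>s. SUP k. norm (p k s))"
  have R_meas [measurable]: "R \<in> borel_measurable N"
    unfolding R_def by (rule borel_measurable_cSUP) (auto simp: bdd)
  have R_ge: "norm (p k s) \<le> R s" if "s \<in> space N" for k s
    unfolding R_def using bdd[OF that] by (intro cSUP_upper) auto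
  have R_bound: "norm x \<le> R s" if s: "s \<in> space N" and x: "x \<in> H s" for s x
  proof (rule field_le_epsilon)
    fix e :: real assume "0 < e"
    then obtain k where "norm x \<le> norm (p k s) + e" using dense[OF s x] by blast
    then show "norm x \<le> R s + e" using R_ge[OF s, of k] by simp
  qed
  have R_attained: "\<exists>k. R s \<le> norm (p k s) + 1" if s: "s \<in> space N" for s
  proof -
    have "R s - 1 < R s" by simp
    then obtain k where "R s - 1 < norm (p k s)" unfolding R_def using less_cSUP_iff[OF _ bdd[OF s]] by auto
    then show ?thesis by (intro exI[of _ k]) simp
  qed
  have R_nonneg: "0 \<le> R s" if "s \<in> space N" for s
    using R_ge[OF that, of 0] norm_ge_zero order_trans by blast
  have hd: "hausdorff_dist dist (H s) {0} = ennreal (R s)" if s: "s \<in> space N" for s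
  proof (rule antisym)
    show "hausdorff_dist dist (H s) {0} \<le> ennreal (R s)"
      using R_bound[OF s] K(2)[OF s] by (auto simp: hausdorff_dist_zero_le_iff intro: ennreal_leI)
    have *: "ennreal (norm (p k s)) \<le> hausdorff_dist dist (H s) {0}" for k
      using hausdorff_dist_zero_le_iff[OF K(2)[OF s], of "hausdorff_dist dist (H s) {0}"] p_in[OF s] by auto
    show "ennreal (R s) \<le> hausdorff_dist dist (H s) {0}"
    proof (cases "hausdorff_dist dist (H s) {0}")
      case (real c)
      have "norm (p k s) \<le> c" for k using *[of k] real by simp
      then have "R s \<le> c" unfolding R_def by (intro cSUP_least) auto
      then show ?thesis using real by (simp add: ennreal_leI)
    qed simp
  qed
  define f where "f = (\<lambda>s. p (LEAST k. R s \<le> norm (p k s) + 1) s)"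
  have "f \<in> borel_measurable N"
    unfolding f_def by (rule measurable_compose_countable[where f = p]) measurable
  moreover have "R s \<le> norm (f s) + 1" if "s \<in> space N" for s
    unfolding f_def by (rule LeastI_ex[OF R_attained[OF that]])
  moreover have "f s \<in> H s" if "s \<in> space N" for s unfolding f_def by (rule p_in[OF that])
  ultimately show ?thesis using R_meas hd R_nonneg by blast
qed

locale driver_space = adapted_space M T F for M :: "'a measure" and T :: real and F :: "real \<Rightarrow> 'a measure" +
  fixes G :: "real \<Rightarrow> 'a \<Rightarrow> 'e \<Rightarrow> 'e \<Rightarrow> 'e::{real_inner, complete_space, second_countable_topology} set"
  assumes G_K: "\<And>u \<omega> y z. u \<in> {0..T} \<Longrightarrow> \<omega> \<in> space M \<Longrightarrow> G u \<omega> y z \<in> K_ccmpt"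
    and G_meas: "set_valued_measurable (Sigma_adapted M T F \<Otimes>\<^sub>M borel \<Otimes>\<^sub>M borel) (\<lambda>((u, \<omega>), y, z). G u \<omega> y z)"
begin

abbreviation GP :: "real \<times> 'a \<Rightarrow> 'e \<Rightarrow> 'e \<Rightarrow> 'e set" where
  "GP p y z \<equiv> G (fst p) (snd p) y z"

abbreviation "\<Lambda> \<equiv> Lambda_set M T F G"

lemma GP_K: "p \<in> space Sig \<Longrightarrow> GP p y z \<in> K_ccmpt"
  using G_K by auto

lemma GP_compact: "p \<in> space Sig \<Longrightarrow> compact (GP p y z) \<and> GP p y z \<noteq> {}"
  using GP_K by (auto simp: K_ccmpt_def)

lemma set_valued_measurable_compose:
  assumes [measurable]: "Y \<in> borel_measurable Sig" "Z \<in> borel_measurable Sig"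
  shows "set_valued_measurable Sig (\<lambda>p. GP p (Y p) (Z p))"
  unfolding set_valued_measurable_def
proof (intro allI impI)
  fix B :: "'e set" assume "closed B"
  let ?m = "\<lambda>p. (p, Y p, Z p)"
  have m: "?m \<in> measurable Sig (Sig \<Otimes>\<^sub>M borel \<Otimes>\<^sub>M borel)" by measurable
  let ?S = "{s \<in> space (Sig \<Otimes>\<^sub>M borel \<Otimes>\<^sub>M borel). (\<lambda>((u, \<omega>), y, z). G u \<omega> y z) s \<inter> B \<noteq> {}}"
  have "?S \<in> sets (Sig \<Otimes>\<^sub>M borel \<Otimes>\<^sub>M borel)"
    using G_meas \<open>closed B\<close> unfolding set_valued_measurable_def by blast
  then have "?m -` ?S \<inter> space Sig \<in> sets Sig" by (rule measurable_sets[OF m])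
  also have "?m -` ?S \<inter> space Sig = {p \<in> space Sig. GP p (Y p) (Z p) \<inter> B \<noteq> {}}"
    using measurable_space[OF m] by (auto simp: split_beta)
  finally show "{p \<in> space Sig. GP p (Y p) (Z p) \<inter> B \<noteq> {}} \<in> sets Sig" .
qed

lemma measurable_proj_GP:
  assumes "Y \<in> borel_measurable Sig" "Z \<in> borel_measurable Sig" "g \<in> borel_measurable Sig"
  shows "(\<lambda>p. metric_proj (GP p (Y p) (Z p)) (g p)) \<in> borel_measurable Sig"
  by (rule measurable_metric_proj[OF set_valued_measurable_compose[OF assms(1,2)] GP_K assms(3)])

lemma measurable_infdist_GP:
  assumes "Y \<in> borel_measurable Sig" "Z \<in> borel_measurable Sig" "g \<in> borel_measurable Sig"
  shows "(\<lambda>p. infdist (g p) (GP p (Y p) (Z p))) \<in> borel_measurable Sig"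
proof -
  have "(\<lambda>q. infdist (snd q) (GP (fst q) (Y (fst q)) (Z (fst q)))) \<in> borel_measurable (Sig \<Otimes>\<^sub>M borel)"
    by (rule measurable_infdist[OF set_valued_measurable_compose[OF assms(1,2)] GP_compact])
  from measurable_compose[OF measurable_Pair[OF measurable_ident_sets[OF refl] assms(3)] this]
  show ?thesis by simp
qed

lemma AE_process: "AE p in \<mu>. p \<in> space Sig"
  using AE_space[of \<mu>] by simp

text \<open>An adapted square integrable selection is an element of \<open>\<Lambda> Y Z\<close>; by \<open>Lambda_setE\<close> and
  \<open>adapted_modification_L2\<close> every element arises from one, up to null sets.\<close>

lemma Lambda_setI:
  assumes g: "g \<in> borel_measurable Sig" "L2sq \<mu> g < \<infinity>" and sel: "AE p in \<mu>. g p \<in> GP p (Y p) (Z p)"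
  shows "rv_of_process g \<in> \<Lambda> Y Z"
  using defines_adapted_rv_of_process[OF g] sel unfolding Lambda_set_def by (auto simp: split_beta)

lemma Lambda_setE:
  assumes "X \<in> \<Lambda> Y Z"
  obtains g where "defines_adapted M T F g X" "AE p in \<mu>. g p \<in> GP p (Y p) (Z p)"
  using assms unfolding Lambda_set_def by (auto simp: split_beta)

lemma defines_adaptedD:
  fixes g :: "real \<times> 'a \<Rightarrow> 'e"
  assumes "defines_adapted M T F g X"
  shows "defines_rv M T g X" "X \<in> L2_gamma M T" "g \<in> borel_measurable \<mu>" "L2sq \<mu> g < \<infinity>"
proof -
  show def: "defines_rv M T g X" "X \<in> L2_gamma M T"
    using assms by (auto simp: defines_adapted_def L2_gamma_adapted_def)
  show "g \<in> borel_measurable \<mu>" using def by (simp add: defines_rv_def)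
  show "L2sq \<mu> g < \<infinity>" using L2sq_eq_L2_gamma_norm[OF def] by simp
qed

lemma L2sq_dist_adapted:
  fixes Y Y' :: "real \<times> 'a \<Rightarrow> 'e"
  assumes "defines_adapted M T F Y X" "defines_adapted M T F Y' X'"
  shows "L2sq \<mu> (\<lambda>p. Y p - Y' p) = ennreal ((L2_gamma_dist M T X X')\<^sup>2)"
  by (rule L2sq_eq_L2_gamma_dist[OF defines_adaptedD(1)[OF assms(1)] defines_adaptedD(1)[OF assms(2)]
        defines_adaptedD(2)[OF assms(1)] defines_adaptedD(2)[OF assms(2)]])

lemma L2_gamma_dist_nonneg: "0 \<le> L2_gamma_dist M T X Y"
  by (simp add: L2_gamma_dist_def L2_gamma_norm_def integral_nonneg_AE)

lemma L2_gamma_dist_commute: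
  fixes Y Y' :: "real \<times> 'a \<Rightarrow> 'e"
  assumes "defines_adapted M T F Y X" "defines_adapted M T F Y' X'"
  shows "L2_gamma_dist M T X X' = L2_gamma_dist M T X' X"
proof -
  have "ennreal ((L2_gamma_dist M T X X')\<^sup>2) = ennreal ((L2_gamma_dist M T X' X)\<^sup>2)"
    unfolding L2sq_dist_adapted[OF assms, symmetric] L2sq_dist_adapted[OF assms(2,1), symmetric]
    by (rule L2sq_diff_commute)
  then have "(L2_gamma_dist M T X X')\<^sup>2 = (L2_gamma_dist M T X' X)\<^sup>2" by simp
  then show ?thesis by (rule power2_eq_imp_eq) (rule L2_gamma_dist_nonneg)+
qed

lemma adapted_modification_L2:
  fixes \<phi> :: "real \<times> 'a \<Rightarrow> 'e"
  assumes "defines_adapted M T F \<phi> X"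
  obtains \<phi>' where "\<phi>' \<in> borel_measurable Sig" "AE p in \<mu>. \<phi> p = \<phi>' p" "L2sq \<mu> \<phi>' < \<infinity>"
proof -
  obtain \<phi>' where \<phi>': "\<phi>' \<in> borel_measurable Sig" "AE p in \<mu>. \<phi> p = \<phi>' p"
    using adapted_modification[OF assms] by blast
  then have "L2sq \<mu> \<phi>' = L2sq \<mu> \<phi>" by (intro L2sq_cong_AE) auto
  then show ?thesis using that[OF \<phi>'] defines_adaptedD(4)[OF assms] by simp
qed

lemma L2sq_norm: "L2sq \<mu> (\<lambda>p. norm (f p)) = L2sq \<mu> f"
  by (simp add: L2sq_def)

lemma L2sq_bounded:
  fixes f :: "real \<times> 'a \<Rightarrow> 'b::{real_normed_vector, second_countable_topology}"
  assumes "\<And>p. norm (f p) \<le> c"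
  shows "L2sq \<mu> f < \<infinity>"
proof -
  have "L2sq \<mu> f \<le> L2sq \<mu> (\<lambda>p. c)" using assms by (intro L2sq_mono) (metis abs_ge_self order_trans real_norm_def)
  also have "\<dots> < \<infinity>" by (rule proc.L2sq_simple_finite) simp
  finally show ?thesis .
qed

text \<open>\<open>R p\<close> is the radius of \<open>GP p 0 0\<close> about the origin and \<open>f p\<close> a point of it that nearly
  attains \<open>R p\<close>.\<close>

definition envelope_at_zero :: "(real \<times> 'a \<Rightarrow> real) \<Rightarrow> (real \<times> 'a \<Rightarrow> 'e) \<Rightarrow> bool" where
  "envelope_at_zero R f \<longleftrightarrow> R \<in> borel_measurable Sig \<and> f \<in> borel_measurable Sig \<and>
    (\<forall>p\<in>space Sig. 0 \<le> R p \<and> (\<forall>x\<in>GP p 0 0. norm x \<le> R p) \<and> f p \<in> GP p 0 0 \<and> R p \<le> norm (f p) + 1) \<and>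
    (\<integral>\<^sup>+ \<omega>. (\<integral>\<^sup>+ u. (hausdorff_dist dist (G u \<omega> 0 0) {0})\<^sup>2 \<partial>time_measure T) \<partial>M) = L2sq \<mu> R"

lemma envelope_at_zeroD:
  assumes "envelope_at_zero R f"
  shows "R \<in> borel_measurable Sig" "f \<in> borel_measurable Sig"
    "\<And>p. p \<in> space Sig \<Longrightarrow> 0 \<le> R p" "\<And>p x. p \<in> space Sig \<Longrightarrow> x \<in> GP p 0 0 \<Longrightarrow> norm x \<le> R p"
    "\<And>p. p \<in> space Sig \<Longrightarrow> f p \<in> GP p 0 0" "\<And>p. p \<in> space Sig \<Longrightarrow> R p \<le> norm (f p) + 1"
    "(\<integral>\<^sup>+ \<omega>. (\<integral>\<^sup>+ u. (hausdorff_dist dist (G u \<omega> 0 0) {0})\<^sup>2 \<partial>time_measure T) \<partial>M) = L2sq \<mu> R"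
  using assms unfolding envelope_at_zero_def by blast+

lemma envelope_at_zero_exists: "\<exists>R f. envelope_at_zero R f"
proof -
  have m: "set_valued_measurable Sig (\<lambda>p. GP p 0 0)"
    using set_valued_measurable_compose[of "\<lambda>p. 0" "\<lambda>p. 0"] by simp
  have "\<exists>R f. R \<in> borel_measurable Sig \<and> f \<in> borel_measurable Sig \<and>
    (\<forall>p\<in>space Sig. 0 \<le> R p \<and> hausdorff_dist dist (GP p 0 0) {0} = ennreal (R p) \<and> f p \<in> GP p 0 0 \<and> R p \<le> norm (f p) + 1)"
    by (rule far_selection[OF m]) (rule GP_K)
  then obtain R f where Rf: "R \<in> borel_measurable Sig \<and> f \<in> borel_measurable Sig \<and>
    (\<forall>p\<in>space Sig. 0 \<le> R p \<and> hausdorff_dist dist (GP p 0 0) {0} = ennreal (R p) \<and> f p \<in> GP p 0 0 \<and> R p \<le> norm (f p) + 1)"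
    by (elim exE) (erule that)
  then have R: "R \<in> borel_measurable Sig" by blast
  have "(\<integral>\<^sup>+ \<omega>. (\<integral>\<^sup>+ u. (hausdorff_dist dist (G u \<omega> 0 0) {0})\<^sup>2 \<partial>time_measure T) \<partial>M) =
      (\<integral>\<^sup>+ \<omega>. L2sq (time_measure T) (\<lambda>u. R (u, \<omega>)) \<partial>M)"
    unfolding L2sq_def
  proof (intro nn_integral_cong)
    fix \<omega> u assume "\<omega> \<in> space M" "u \<in> space (time_measure T)"
    then have "(u, \<omega>) \<in> space Sig" by simp
    then have "0 \<le> R (u, \<omega>) \<and> hausdorff_dist dist (GP (u, \<omega>) 0 0) {0} = ennreal (R (u, \<omega>))" using Rf by blast
    then show "(hausdorff_dist dist (G u \<omega> 0 0) {0})\<^sup>2 = ennreal ((norm (R (u, \<omega>)))\<^sup>2)"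
      by (simp add: ennreal_power)
  qed
  also have "\<dots> = L2sq \<mu> R" by (rule L2sq_process[OF measurable_Sigma_process[OF R]])
  finally have int: "(\<integral>\<^sup>+ \<omega>. (\<integral>\<^sup>+ u. (hausdorff_dist dist (G u \<omega> 0 0) {0})\<^sup>2 \<partial>time_measure T) \<partial>M) = L2sq \<mu> R" .
  have bound: "norm x \<le> R p" if "p \<in> space Sig" "x \<in> GP p 0 0" for p x
  proof -
    have "hausdorff_dist dist (GP p 0 0) {0} \<le> ennreal (R p)" "0 \<le> R p" using Rf that(1) by auto
    then show ?thesis using hausdorff_dist_zero_le_iff[of "GP p 0 0"] GP_compact[OF that(1)] that(2) by auto
  qed
  have "envelope_at_zero R f" unfolding envelope_at_zero_def using Rf bound int by blast
  then show ?thesis by blast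
qed

section \<open>From the pointwise conditions to the selection sets\<close>

context
  fixes K :: real
  assumes K_pos: "0 < K"
    and lip: "AE p in \<mu>. \<forall>y z y' z'. hausdorff_dist dist (GP p y z) (GP p y' z') \<le> ennreal (K * (norm (y - y') + norm (z - z')))"
begin

lemma lipschitz_infdist:
  "AE p in \<mu>. \<forall>y z y' z' x. x \<in> GP p y z \<longrightarrow> infdist x (GP p y' z') \<le> K * (norm (y - y') + norm (z - z'))"
  using lip AE_process
proof eventually_elim
  case (elim p)
  show ?case
  proof (intro allI impI)
    fix y z y' z' x assume x: "x \<in> GP p y z"
    have "0 \<le> K * (norm (y - y') + norm (z - z'))" using K_pos by simp
    then show "infdist x (GP p y' z') \<le> K * (norm (y - y') + norm (z - z'))"
      using elim(1) hausdorff_dist_le_iff[of "GP p y z" "GP p y' z'"] GP_compact[OF elim(2)] x by blast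
  qed
qed

text \<open>The point of \<open>G(\<cdot>, Y, Z)\<close> nearest to the origin is at distance at most
  \<open>R + K (\<parallel>Y\<parallel> + \<parallel>Z\<parallel>)\<close> from it. The projection is taken at \<open>\<Sigma>\<^sub>\<FF>\<close>-measurable modifications of
  \<open>Y\<close> and \<open>Z\<close>, which makes it adapted.\<close>

lemma Lambda_set_nonempty:
  assumes Y: "defines_adapted M T F Y X\<^sub>Y" and Z: "defines_adapted M T F Z X\<^sub>Z"
    and fin: "(\<integral>\<^sup>+ \<omega>. (\<integral>\<^sup>+ u. (hausdorff_dist dist (G u \<omega> 0 0) {0})\<^sup>2 \<partial>time_measure T) \<partial>M) < \<infinity>"
  shows "\<Lambda> Y Z \<noteq> {}"
proof -
  obtain R f where E: "envelope_at_zero R f" using envelope_at_zero_exists by blast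
  note R = envelope_at_zeroD[OF E]
  have R_fin: "L2sq \<mu> R < \<infinity>" using fin unfolding R(7) .
  obtain Y' where Y': "Y' \<in> borel_measurable Sig" "AE p in \<mu>. Y p = Y' p" "L2sq \<mu> Y' < \<infinity>"
    by (rule adapted_modification_L2[OF Y])
  obtain Z' where Z': "Z' \<in> borel_measurable Sig" "AE p in \<mu>. Z p = Z' p" "L2sq \<mu> Z' < \<infinity>"
    by (rule adapted_modification_L2[OF Z])
  define g where "g = (\<lambda>p. metric_proj (GP p (Y' p) (Z' p)) 0)"
  have g: "g \<in> borel_measurable Sig" unfolding g_def by (rule measurable_proj_GP[OF Y'(1) Z'(1)]) simp
  let ?b = "\<lambda>p. R p + K *\<^sub>R (norm (Y' p) + norm (Z' p))"
  have "AE p in \<mu>. norm (g p) \<le> norm (?b p)"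
    using lipschitz_infdist AE_process
  proof eventually_elim
    case (elim p)
    obtain x where x: "x \<in> GP p 0 0" using GP_compact[OF elim(2)] by blast
    have "norm (g p) = infdist 0 (GP p (Y' p) (Z' p))"
      using metric_proj(2)[of "GP p (Y' p) (Z' p)" 0] GP_compact[OF elim(2)] by (simp add: g_def)
    also have "\<dots> \<le> infdist x (GP p (Y' p) (Z' p)) + dist 0 x" by (rule infdist_triangle)
    also have "infdist x (GP p (Y' p) (Z' p)) \<le> K * (norm (0 - Y' p) + norm (0 - Z' p))" using elim(1) x by blast
    also have "dist 0 x \<le> R p" using R(4)[OF elim(2) x] by simp
    finally show ?case by simp
  qed
  then have "L2sq \<mu> g \<le> L2sq \<mu> ?b" by (rule L2sq_mono_AE)
  also have "\<dots> < \<infinity>"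
  proof -
    note m = measurable_Sigma_process[OF Y'(1)] measurable_Sigma_process[OF Z'(1)] measurable_Sigma_process[OF R(1)]
    have s: "L2sq \<mu> (\<lambda>p. norm (Y' p) + norm (Z' p)) < \<infinity>"
      by (rule L2sq_add_finite(1)[OF measurable_compose[OF m(1) borel_measurable_norm] measurable_compose[OF m(2) borel_measurable_norm]])
        (simp_all only: L2sq_norm Y'(3) Z'(3))
    have sm: "(\<lambda>p. norm (Y' p) + norm (Z' p)) \<in> borel_measurable \<mu>" using m by measurable
    have "L2sq \<mu> (\<lambda>p. K *\<^sub>R (norm (Y' p) + norm (Z' p))) < \<infinity>"
      unfolding L2sq_scaleR[OF sm] using s by (simp add: ennreal_mult_less_top)
    with R_fin show ?thesis by (intro L2sq_add_finite(1)[OF m(3) borel_measurable_scaleR[OF borel_measurable_const sm]])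
  qed
  finally have g_fin: "L2sq \<mu> g < \<infinity>" .
  have "AE p in \<mu>. g p \<in> GP p (Y p) (Z p)"
    using Y'(2) Z'(2) AE_process
  proof eventually_elim
    case (elim p)
    then show ?case using metric_proj(1)[of "GP p (Y' p) (Z' p)" 0] GP_compact[OF elim(3)] by (simp add: g_def)
  qed
  then show ?thesis using Lambda_setI[OF g g_fin] by blast
qed

lemma Lambda_set_bounded:
  assumes fin: "(\<integral>\<^sup>+ \<omega>. (\<integral>\<^sup>+ u. (hausdorff_dist dist (G u \<omega> 0 0) {0})\<^sup>2 \<partial>time_measure T) \<partial>M) < \<infinity>"
  shows "(SUP X\<in>\<Lambda> (\<lambda>_. 0) (\<lambda>_. 0). ennreal (L2_gamma_norm M T X)) < \<infinity>"
proof -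
  obtain R f where E: "envelope_at_zero R f" using envelope_at_zero_exists by blast
  note R = envelope_at_zeroD[OF E]
  have R_fin: "L2sq \<mu> R < \<infinity>" using fin unfolding R(7) .
  have "ennreal (L2_gamma_norm M T X) \<le> ennreal (sqrt (enn2real (L2sq \<mu> R)))" if X: "X \<in> \<Lambda> (\<lambda>_. 0) (\<lambda>_. 0)" for X
  proof -
    obtain g where g: "defines_adapted M T F g X" "AE p in \<mu>. g p \<in> GP p 0 0"
      using X by (rule Lambda_setE)
    have "AE p in \<mu>. norm (g p) \<le> norm (R p)"
      using g(2) AE_process
    proof eventually_elim
      case (elim p)
      then show ?case using R(4)[OF elim(2,1)] by (metis abs_ge_self order_trans real_norm_def)
    qed
    then have "ennreal ((L2_gamma_norm M T X)\<^sup>2) \<le> L2sq \<mu> R"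
      unfolding L2sq_eq_L2_gamma_norm[OF defines_adaptedD(1,2)[OF g(1)], symmetric] by (rule L2sq_mono_AE)
    also have "L2sq \<mu> R = ennreal (enn2real (L2sq \<mu> R))" using R_fin by simp
    finally have "(L2_gamma_norm M T X)\<^sup>2 \<le> enn2real (L2sq \<mu> R)" by (simp add: ennreal_le_iff)
    then show ?thesis by (intro ennreal_leI real_le_rsqrt)
  qed
  then have "(SUP X\<in>\<Lambda> (\<lambda>_. 0) (\<lambda>_. 0). ennreal (L2_gamma_norm M T X)) \<le> ennreal (sqrt (enn2real (L2sq \<mu> R)))"
    by (rule SUP_least)
  then show ?thesis by (rule le_less_trans) simp
qed

text \<open>Project a selection of \<open>G(\<cdot>, Y, Z)\<close> onto \<open>G(\<cdot>, Y', Z')\<close>; it moves pointwise by at most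
  \<open>K (\<parallel>Y - Y'\<parallel> + \<parallel>Z - Z'\<parallel>)\<close>.\<close>

lemma Lambda_set_lipschitz_half:
  assumes X: "X \<in> \<Lambda> Y Z"
    and Y: "defines_adapted M T F Y X\<^sub>Y" "defines_adapted M T F Y' X\<^sub>Y'"
    and Z: "defines_adapted M T F Z X\<^sub>Z" "defines_adapted M T F Z' X\<^sub>Z'"
  shows "\<exists>X'\<in>\<Lambda> Y' Z'. L2_gamma_dist M T X X' \<le> 2 * K * (L2_gamma_dist M T X\<^sub>Y X\<^sub>Y' + L2_gamma_dist M T X\<^sub>Z X\<^sub>Z')"
proof -
  obtain g where g: "defines_adapted M T F g X" "AE p in \<mu>. g p \<in> GP p (Y p) (Z p)" using X by (rule Lambda_setE)
  obtain g' where g': "g' \<in> borel_measurable Sig" "AE p in \<mu>. g p = g' p" "L2sq \<mu> g' < \<infinity>"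
    by (rule adapted_modification_L2[OF g(1)])
  obtain Y'' where Y'': "Y'' \<in> borel_measurable Sig" "AE p in \<mu>. Y' p = Y'' p" "L2sq \<mu> Y'' < \<infinity>"
    by (rule adapted_modification_L2[OF Y(2)])
  obtain Z'' where Z'': "Z'' \<in> borel_measurable Sig" "AE p in \<mu>. Z' p = Z'' p" "L2sq \<mu> Z'' < \<infinity>"
    by (rule adapted_modification_L2[OF Z(2)])
  define h where "h = (\<lambda>p. metric_proj (GP p (Y'' p) (Z'' p)) (g' p))"
  have h: "h \<in> borel_measurable Sig" unfolding h_def by (rule measurable_proj_GP[OF Y''(1) Z''(1) g'(1)])
  define a where "a = L2_gamma_dist M T X\<^sub>Y X\<^sub>Y'"
  define b where "b = L2_gamma_dist M T X\<^sub>Z X\<^sub>Z'"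
  have ab: "0 \<le> a" "0 \<le> b" unfolding a_def b_def by (rule L2_gamma_dist_nonneg)+
  note mY = borel_measurable_diff[OF defines_adaptedD(3)[OF Y(1)] defines_adaptedD(3)[OF Y(2)]]
  note mZ = borel_measurable_diff[OF defines_adaptedD(3)[OF Z(1)] defines_adaptedD(3)[OF Z(2)]]
  have LY: "L2sq \<mu> (\<lambda>p. Y p - Y' p) = ennreal (a\<^sup>2)"
    unfolding a_def by (rule L2sq_dist_adapted[OF Y(1) Y(2)])
  have LZ: "L2sq \<mu> (\<lambda>p. Z p - Z' p) = ennreal (b\<^sup>2)"
    unfolding b_def by (rule L2sq_dist_adapted[OF Z(1) Z(2)])
  let ?s = "\<lambda>p. norm (Y p - Y' p) + norm (Z p - Z' p)"
  note nY = measurable_compose[OF mY borel_measurable_norm] and nZ = measurable_compose[OF mZ borel_measurable_norm]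
  have sm: "?s \<in> borel_measurable \<mu>" by (rule borel_measurable_add[OF nY nZ])
  have "AE p in \<mu>. norm (g' p - h p) \<le> norm (K *\<^sub>R ?s p)"
    using lipschitz_infdist g(2) g'(2) Y''(2) Z''(2) AE_process
  proof eventually_elim
    case (elim p)
    have "norm (g' p - h p) = infdist (g' p) (GP p (Y'' p) (Z'' p))"
      using metric_proj(2)[of "GP p (Y'' p) (Z'' p)" "g' p"] GP_compact[OF elim(6)] by (simp add: h_def dist_norm)
    also have "\<dots> \<le> K * (norm (Y p - Y'' p) + norm (Z p - Z'' p))" using elim by simp
    also have "\<dots> \<le> norm (K *\<^sub>R ?s p)" using elim by simp
    finally show ?case .
  qed
  then have "L2sq \<mu> (\<lambda>p. g' p - h p) \<le> L2sq \<mu> (\<lambda>p. K *\<^sub>R ?s p)" by (rule L2sq_mono_AE)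
  also have "\<dots> = ennreal (K\<^sup>2) * L2sq \<mu> ?s" by (rule L2sq_scaleR[OF sm])
  also have "\<dots> \<le> ennreal (K\<^sup>2) * (2 * L2sq \<mu> (\<lambda>p. norm (Y p - Y' p)) + 2 * L2sq \<mu> (\<lambda>p. norm (Z p - Z' p)))"
    by (intro mult_left_mono L2sq_add nY nZ) simp
  also have "\<dots> = ennreal (K\<^sup>2 * (2 * a\<^sup>2 + 2 * b\<^sup>2))"
    unfolding L2sq_norm LY LZ by (simp add: ennreal_mult ennreal_plus)
  finally have le: "L2sq \<mu> (\<lambda>p. g' p - h p) \<le> ennreal (K\<^sup>2 * (2 * a\<^sup>2 + 2 * b\<^sup>2))" .
  have m: "g' \<in> borel_measurable \<mu>" "h \<in> borel_measurable \<mu>" using g'(1) h by (auto intro: measurable_Sigma_process)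
  have "L2sq \<mu> (\<lambda>p. g' p - (g' p - h p)) < \<infinity>"
    by (rule L2sq_add_finite(2)[OF m(1) borel_measurable_diff[OF m] g'(3) le_less_trans[OF le]]) simp
  then have h_fin: "L2sq \<mu> h < \<infinity>" by simp
  have "AE p in \<mu>. h p \<in> GP p (Y' p) (Z' p)"
    using Y''(2) Z''(2) AE_process
  proof eventually_elim
    case (elim p)
    then show ?case using metric_proj(1)[of "GP p (Y'' p) (Z'' p)" "g' p"] GP_compact[OF elim(3)] by (simp add: h_def)
  qed
  then have mem: "rv_of_process h \<in> \<Lambda> Y' Z'" by (rule Lambda_setI[OF h h_fin])
  note def_h = defines_adapted_rv_of_process[OF h h_fin]
  have gh: "L2sq \<mu> (\<lambda>p. g p - h p) = L2sq \<mu> (\<lambda>p. g' p - h p)" using g'(2) by (intro L2sq_cong_AE) auto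
  have num: "K\<^sup>2 * (2 * a\<^sup>2 + 2 * b\<^sup>2) \<le> (2 * K * (a + b))\<^sup>2"
  proof -
    have "2 * a\<^sup>2 + 2 * b\<^sup>2 \<le> 4 * (a + b)\<^sup>2" using ab by (simp add: power2_sum)
    then have "K\<^sup>2 * (2 * a\<^sup>2 + 2 * b\<^sup>2) \<le> K\<^sup>2 * (4 * (a + b)\<^sup>2)" by (intro mult_left_mono) auto
    then show ?thesis by (simp add: power_mult_distrib)
  qed
  have "L2_gamma_dist M T X (rv_of_process h) \<le> 2 * K * (a + b)"
  proof -
    have "ennreal ((L2_gamma_dist M T X (rv_of_process h))\<^sup>2) = L2sq \<mu> (\<lambda>p. g p - h p)"
      by (rule L2sq_dist_adapted[OF g(1) def_h, symmetric])
    also note gh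
    also note le
    also note ennreal_leI[OF num]
    finally have "ennreal ((L2_gamma_dist M T X (rv_of_process h))\<^sup>2) \<le> ennreal ((2 * K * (a + b))\<^sup>2)" .
    then have "(L2_gamma_dist M T X (rv_of_process h))\<^sup>2 \<le> (2 * K * (a + b))\<^sup>2" by (rule ennreal_le_iff[THEN iffD1, rotated]) simp
    then show ?thesis by (rule power2_le_imp_le) (use K_pos ab in simp)
  qed
  then show ?thesis using mem unfolding a_def b_def by blast
qed

lemma Lambda_set_lipschitz:
  assumes Y: "defines_adapted M T F Y X\<^sub>Y" "defines_adapted M T F Y' X\<^sub>Y'"
    and Z: "defines_adapted M T F Z X\<^sub>Z" "defines_adapted M T F Z' X\<^sub>Z'"
  shows "hausdorff_dist (L2_gamma_dist M T) (\<Lambda> Y Z) (\<Lambda> Y' Z') \<le>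
    ennreal (2 * K * (L2_gamma_dist M T X\<^sub>Y X\<^sub>Y' + L2_gamma_dist M T X\<^sub>Z X\<^sub>Z'))"
proof -
  let ?c = "2 * K * (L2_gamma_dist M T X\<^sub>Y X\<^sub>Y' + L2_gamma_dist M T X\<^sub>Z X\<^sub>Z')"
  have "(INF X'\<in>\<Lambda> Y' Z'. ennreal (L2_gamma_dist M T X X')) \<le> ennreal ?c" if X: "X \<in> \<Lambda> Y Z" for X
  proof -
    obtain X' where "X' \<in> \<Lambda> Y' Z'" "L2_gamma_dist M T X X' \<le> ?c"
      using Lambda_set_lipschitz_half[OF X Y Z] by blast
    then show ?thesis by (intro INF_lower2[of X'] ennreal_leI)
  qed
  moreover have "(INF X\<in>\<Lambda> Y Z. ennreal (L2_gamma_dist M T X X')) \<le> ennreal ?c" if X': "X' \<in> \<Lambda> Y' Z'" for X'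
  proof -
    obtain X where X: "X \<in> \<Lambda> Y Z" and le: "L2_gamma_dist M T X' X \<le> 2 * K * (L2_gamma_dist M T X\<^sub>Y' X\<^sub>Y + L2_gamma_dist M T X\<^sub>Z' X\<^sub>Z)"
      using Lambda_set_lipschitz_half[OF X' Y(2,1) Z(2,1)] by blast
    obtain g where g: "defines_adapted M T F g X" using X by (rule Lambda_setE)
    obtain g' where g': "defines_adapted M T F g' X'" using X' by (rule Lambda_setE)
    have "L2_gamma_dist M T X X' \<le> ?c"
      using le unfolding L2_gamma_dist_commute[OF g g'] L2_gamma_dist_commute[OF Y] L2_gamma_dist_commute[OF Z] .
    then show ?thesis using X by (intro INF_lower2[of X] ennreal_leI)
  qed
  ultimately show ?thesis unfolding hausdorff_dist_def by (simp add: SUP_le_iff)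
qed

end

end



section \<open>From the selection sets to the pointwise conditions\<close>

context driver_space
begin

definition has_selections :: bool where
  "has_selections \<longleftrightarrow> (\<forall>Y Z X\<^sub>Y X\<^sub>Z. defines_adapted M T F Y X\<^sub>Y \<and> defines_adapted M T F Z X\<^sub>Z \<longrightarrow> \<Lambda> Y Z \<noteq> {})"

lemma zero_defines_adapted: "defines_adapted M T F (\<lambda>_. 0 :: 'e) (rv_of_process (\<lambda>_. 0))"
  by (rule defines_adapted_rv_of_process) simp_all

lemma selection_at_zero:
  assumes has_selections
  obtains g where "g \<in> borel_measurable Sig" "L2sq \<mu> g < \<infinity>" "AE p in \<mu>. g p \<in> GP p 0 0"
proof -
  obtain X where "X \<in> \<Lambda> (\<lambda>_. 0) (\<lambda>_. 0)"
    using assms zero_defines_adapted unfolding has_selections_def by blast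
  then obtain g0 where g0: "defines_adapted M T F g0 X" "AE p in \<mu>. g0 p \<in> GP p 0 0" by (rule Lambda_setE)
  obtain g where g: "g \<in> borel_measurable Sig" "AE p in \<mu>. g0 p = g p" "L2sq \<mu> g < \<infinity>"
    by (rule adapted_modification_L2[OF g0(1)])
  have "AE p in \<mu>. g p \<in> GP p 0 0" using g0(2) g(2) by eventually_elim simp
  then show ?thesis using that g by blast
qed

text \<open>Replace the far selection \<open>f\<close> by a fixed square integrable selection where \<open>\<parallel>f\<parallel> > n\<close>. The
  result is an element of \<open>\<Lambda> 0 0\<close>, so its norm is bounded independently of \<open>n\<close>, and Fatou's lemma
  bounds \<open>f\<close> and with it the radius \<open>R \<le> \<parallel>f\<parallel> + 1\<close>.\<close>

theorem integrable_envelope: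
  assumes sel: has_selections
    and bounded: "(SUP X\<in>\<Lambda> (\<lambda>_. 0) (\<lambda>_. 0). ennreal (L2_gamma_norm M T X)) < \<infinity>"
  shows "(\<integral>\<^sup>+ \<omega>. (\<integral>\<^sup>+ u. (hausdorff_dist dist (G u \<omega> 0 0) {0})\<^sup>2 \<partial>time_measure T) \<partial>M) < \<infinity>"
proof -
  obtain R f where E: "envelope_at_zero R f" using envelope_at_zero_exists by blast
  note R = envelope_at_zeroD[OF E]
  obtain g0 where g0: "g0 \<in> borel_measurable Sig" "L2sq \<mu> g0 < \<infinity>" "AE p in \<mu>. g0 p \<in> GP p 0 0"
    by (rule selection_at_zero[OF sel])
  note R(1,2)[measurable] g0(1)[measurable]
  define C where "C = enn2real (SUP X\<in>\<Lambda> (\<lambda>_. 0) (\<lambda>_. 0). ennreal (L2_gamma_norm M T X))"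
  have C: "L2_gamma_norm M T X \<le> C" if "X \<in> \<Lambda> (\<lambda>_. 0) (\<lambda>_. 0)" for X
  proof -
    have "ennreal (L2_gamma_norm M T X) \<le> (SUP X\<in>\<Lambda> (\<lambda>_. 0) (\<lambda>_. 0). ennreal (L2_gamma_norm M T X))"
      using that by (rule SUP_upper)
    also have "\<dots> = ennreal C" unfolding C_def using bounded by simp
    finally show ?thesis by (rule ennreal_le_iff[THEN iffD1, rotated]) (simp add: C_def)
  qed
  define g where "g = (\<lambda>n p. if norm (f p) \<le> real n then f p else g0 p)"
  have g: "g n \<in> borel_measurable Sig" for n unfolding g_def by measurable
  have g_L2: "L2sq \<mu> (g n) \<le> ennreal (C\<^sup>2)" for n
  proof -
    have m: "(\<lambda>p. norm (g0 p)) \<in> borel_measurable \<mu>" by (rule measurable_Sigma_process) measurable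
    have "L2sq \<mu> (g n) \<le> L2sq \<mu> (\<lambda>p. real n + norm (g0 p))"
      by (rule L2sq_mono) (auto simp: g_def add_increasing2)
    also have "\<dots> < \<infinity>"
      by (rule L2sq_add_finite(1)[OF borel_measurable_const m L2sq_bounded[of _ "real n"]]) (simp_all only: L2sq_norm g0(2) norm_of_nat order_refl)
    finally have fin: "L2sq \<mu> (g n) < \<infinity>" .
    have "AE p in \<mu>. g n p \<in> GP p 0 0"
      using g0(3) AE_process
    proof eventually_elim
      case (elim p)
      then show ?case using R(5)[OF elim(2)] by (simp add: g_def)
    qed
    then have mem: "rv_of_process (g n) \<in> \<Lambda> (\<lambda>_. 0) (\<lambda>_. 0)" by (rule Lambda_setI[OF g fin])
    note d = defines_adaptedD[OF defines_adapted_rv_of_process[OF g fin]]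
    have "0 \<le> L2_gamma_norm M T (rv_of_process (g n))" by (simp add: L2_gamma_norm_def integral_nonneg_AE)
    then have "(L2_gamma_norm M T (rv_of_process (g n)))\<^sup>2 \<le> C\<^sup>2" using C[OF mem] by (intro power_mono)
    then show ?thesis unfolding L2sq_eq_L2_gamma_norm[OF d(1,2)] by (rule ennreal_leI)
  qed
  have "L2sq \<mu> f = (\<integral>\<^sup>+ p. liminf (\<lambda>n. ennreal ((norm (g n p))\<^sup>2)) \<partial>\<mu>)"
    unfolding L2sq_def
  proof (rule nn_integral_cong)
    fix p
    obtain n0 :: nat where n0: "norm (f p) \<le> real n0" using real_arch_simple by blast
    have "eventually (\<lambda>n. ennreal ((norm (f p))\<^sup>2) = ennreal ((norm (g n p))\<^sup>2)) sequentially"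
      unfolding eventually_sequentially
    proof (intro exI[of _ n0] allI impI)
      fix n assume "n0 \<le> n"
      then have "norm (f p) \<le> real n" using n0 by linarith
      then show "ennreal ((norm (f p))\<^sup>2) = ennreal ((norm (g n p))\<^sup>2)" by (simp add: g_def)
    qed
    then have "(\<lambda>n. ennreal ((norm (g n p))\<^sup>2)) \<longlonglongrightarrow> ennreal ((norm (f p))\<^sup>2)"
      by (rule Lim_transform_eventually[OF tendsto_const])
    then show "ennreal ((norm (f p))\<^sup>2) = liminf (\<lambda>n. ennreal ((norm (g n p))\<^sup>2))"
      using lim_imp_Liminf[OF sequentially_bot] by metis
  qed
  also have "\<dots> \<le> liminf (\<lambda>n. L2sq \<mu> (g n))"
    unfolding L2sq_def
  proof (rule nn_integral_liminf)
    fix n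
    have "g n \<in> borel_measurable \<mu>" by (rule measurable_Sigma_process[OF g])
    then show "(\<lambda>p. ennreal ((norm (g n p))\<^sup>2)) \<in> borel_measurable \<mu>" by measurable
  qed
  also have "\<dots> \<le> ennreal (C\<^sup>2)"
    by (rule order_trans[OF Liminf_le_Limsup[OF sequentially_bot] Limsup_bounded]) (simp add: g_L2)
  finally have f_fin: "L2sq \<mu> f < \<infinity>" by (rule le_less_trans) simp
  have "AE p in \<mu>. norm (R p) \<le> norm (norm (f p) + 1)"
    using AE_process by eventually_elim (use R(3,6) in force)
  then have "L2sq \<mu> R \<le> L2sq \<mu> (\<lambda>p. norm (f p) + 1)" by (rule L2sq_mono_AE)
  also have "\<dots> < \<infinity>"
  proof (rule L2sq_add_finite(1))
    show "(\<lambda>p. norm (f p)) \<in> borel_measurable \<mu>" by (rule measurable_Sigma_process) measurable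
    show "L2sq \<mu> (\<lambda>p. norm (f p)) < \<infinity>" by (simp only: L2sq_norm f_fin)
    show "L2sq \<mu> (\<lambda>p. 1 :: real) < \<infinity>" by (rule L2sq_bounded[of _ 1]) simp
  qed simp
  finally show ?thesis unfolding R(7) .
qed

text \<open>The point \<open>x\<close> of \<open>GP p y z\<close> witnesses that the Lipschitz estimate with constant \<open>K\<close> fails at
  \<open>p\<close>. Membership is written as \<open>infdist = 0\<close>, the form in which measurability is known.\<close>

definition violations :: "real \<Rightarrow> ((real \<times> 'a) \<times> 'e \<times> 'e \<times> 'e \<times> 'e \<times> 'e) set" where
  "violations K = {(p, y, z, y', z', x). p \<in> space Sig \<and> infdist x (GP p y z) = 0 \<and>
     K * (norm (y - y') + norm (z - z')) < infdist x (GP p y' z')}"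

lemma sets_violations: "violations K \<in> sets (restr_to_subalg \<mu> Sig \<Otimes>\<^sub>M borel)"
proof -
  let ?P = "Sig \<Otimes>\<^sub>M (borel :: ('e \<times> 'e \<times> 'e \<times> 'e \<times> 'e) measure)"
  have sets_eq: "sets (restr_to_subalg \<mu> Sig \<Otimes>\<^sub>M (borel :: ('e \<times> 'e \<times> 'e \<times> 'e \<times> 'e) measure)) = sets ?P"
    by (intro sets_pair_measure_cong sets_restr_to_subalg subalgebra_Sigma refl)
  define y where "y = (\<lambda>q :: (real \<times> 'a) \<times> 'e \<times> 'e \<times> 'e \<times> 'e \<times> 'e. fst (snd q))"
  define z where "z = (\<lambda>q :: (real \<times> 'a) \<times> 'e \<times> 'e \<times> 'e \<times> 'e \<times> 'e. fst (snd (snd q)))"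
  define y' where "y' = (\<lambda>q :: (real \<times> 'a) \<times> 'e \<times> 'e \<times> 'e \<times> 'e \<times> 'e. fst (snd (snd (snd q))))"
  define z' where "z' = (\<lambda>q :: (real \<times> 'a) \<times> 'e \<times> 'e \<times> 'e \<times> 'e \<times> 'e. fst (snd (snd (snd (snd q)))))"
  define x where "x = (\<lambda>q :: (real \<times> 'a) \<times> 'e \<times> 'e \<times> 'e \<times> 'e \<times> 'e. snd (snd (snd (snd (snd q)))))"
  have comp: "(\<lambda>q. h (snd q)) \<in> borel_measurable ?P" if "continuous_on UNIV h" for h :: "'e \<times> 'e \<times> 'e \<times> 'e \<times> 'e \<Rightarrow> 'e"
    by (rule measurable_compose[OF measurable_snd borel_measurable_continuous_onI[OF that]])
  have [measurable]: "y \<in> borel_measurable ?P" "z \<in> borel_measurable ?P" "y' \<in> borel_measurable ?P"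
    "z' \<in> borel_measurable ?P" "x \<in> borel_measurable ?P"
    unfolding y_def z_def y'_def z'_def x_def by (rule comp, intro continuous_intros)+
  have inf: "(\<lambda>q. infdist (snd q) ((\<lambda>((u, \<omega>), y, z). G u \<omega> y z) (fst q))) \<in> borel_measurable ((Sig \<Otimes>\<^sub>M borel \<Otimes>\<^sub>M borel) \<Otimes>\<^sub>M borel)"
    by (rule measurable_infdist[OF G_meas]) (use GP_compact in \<open>force simp: space_pair_measure\<close>)
  have inf': "(\<lambda>q. infdist (c q) (GP (fst q) (a q) (b q))) \<in> borel_measurable ?P"
    if [measurable]: "a \<in> borel_measurable ?P" "b \<in> borel_measurable ?P" "c \<in> borel_measurable ?P" for a b c
  proof -
    have "(\<lambda>q. ((fst q, a q, b q), c q)) \<in> measurable ?P ((Sig \<Otimes>\<^sub>M borel \<Otimes>\<^sub>M borel) \<Otimes>\<^sub>M borel)" by measurable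
    from measurable_compose[OF this inf] show ?thesis by (simp add: split_beta)
  qed
  have [measurable]: "(\<lambda>q. infdist (x q) (GP (fst q) (y q) (z q))) \<in> borel_measurable ?P"
    "(\<lambda>q. infdist (x q) (GP (fst q) (y' q) (z' q))) \<in> borel_measurable ?P"
    by (rule inf'; measurable)+
  have "violations K = {q \<in> space ?P. infdist (x q) (GP (fst q) (y q) (z q)) = 0 \<and>
      K * (norm (y q - y' q) + norm (z q - z' q)) < infdist (x q) (GP (fst q) (y' q) (z' q))}"
    unfolding violations_def y_def z_def y'_def z'_def x_def by (auto simp: space_pair_measure)
  also have "\<dots> \<in> sets ?P" by measurable
  finally show ?thesis unfolding sets_eq .
qed

text \<open>Cut the section off outside \<open>A\<close>. The point \<open>x\<close> on \<open>A\<close>, continued by a selection of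
  \<open>G(\<cdot>, 0, 0)\<close>, is an element of \<open>\<Lambda> Y Z\<close>, and its distance to every element of \<open>\<Lambda> Y' Z'\<close> is at
  least the \<open>L\<^sup>2\<close> norm of \<open>\<delta>\<close>, the distance of \<open>x\<close> to \<open>G(\<cdot>, y', z')\<close> on \<open>A\<close>. With
  \<open>a = \<parallel>Y - Y'\<parallel>\<close> and \<open>b = \<parallel>Z - Z'\<parallel>\<close>, violation of the estimate with constant \<open>2 K\<close> gives
  \<open>\<parallel>\<delta>\<parallel>\<^sup>2 \<ge> 4 K\<^sup>2 (a\<^sup>2 + b\<^sup>2)\<close>, while the Lipschitz property of \<open>\<Lambda>\<close> gives
  \<open>\<parallel>\<delta>\<parallel>\<^sup>2 \<le> K\<^sup>2 (a + b)\<^sup>2 \<le> 2 K\<^sup>2 (a\<^sup>2 + b\<^sup>2)\<close>. Hence \<open>\<delta> = 0\<close> almost everywhere, although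
  \<open>\<delta> > 0\<close> on \<open>A\<close>.\<close>

lemma no_violating_section:
  assumes sel: has_selections and K: "0 < K"
    and lip: "\<And>Y Z Y' Z' X\<^sub>Y X\<^sub>Z X\<^sub>Y' X\<^sub>Z'. defines_adapted M T F Y X\<^sub>Y \<Longrightarrow> defines_adapted M T F Z X\<^sub>Z \<Longrightarrow>
       defines_adapted M T F Y' X\<^sub>Y' \<Longrightarrow> defines_adapted M T F Z' X\<^sub>Z' \<Longrightarrow>
       hausdorff_dist (L2_gamma_dist M T) (\<Lambda> Y Z) (\<Lambda> Y' Z') \<le>
         ennreal (K * (L2_gamma_dist M T X\<^sub>Y X\<^sub>Y' + L2_gamma_dist M T X\<^sub>Z X\<^sub>Z'))"
    and A: "A \<in> sets Sig" "0 < emeasure \<mu> A"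
    and meas: "y \<in> borel_measurable Sig" "z \<in> borel_measurable Sig" "y' \<in> borel_measurable Sig"
      "z' \<in> borel_measurable Sig" "x \<in> borel_measurable Sig"
    and bounds: "\<And>p. p \<in> A \<Longrightarrow> norm (y p) \<le> c \<and> norm (z p) \<le> c \<and> norm (y' p) \<le> c \<and> norm (z' p) \<le> c \<and> norm (x p) \<le> c"
    and viol: "\<And>p. p \<in> A \<Longrightarrow> (p, y p, z p, y' p, z' p, x p) \<in> violations (2 * K)"
  shows False
proof -
  note meas[measurable] A(1)[measurable]
  obtain g0 where g0: "g0 \<in> borel_measurable Sig" "L2sq \<mu> g0 < \<infinity>" "AE p in \<mu>. g0 p \<in> GP p 0 0"
    by (rule selection_at_zero[OF sel])
  note g0(1)[measurable]
  have "A \<noteq> {}" using A(2) by auto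
  then have c: "0 \<le> c" using bounds norm_ge_zero order_trans by blast
  have cut: "(\<lambda>p. indicat_real A p *\<^sub>R w p) \<in> borel_measurable Sig \<and> L2sq \<mu> (\<lambda>p. indicat_real A p *\<^sub>R w p) < \<infinity>"
    if "w \<in> borel_measurable Sig" "\<And>p. p \<in> A \<Longrightarrow> norm (w p) \<le> c" for w :: "real \<times> 'a \<Rightarrow> 'e"
  proof
    show "(\<lambda>p. indicat_real A p *\<^sub>R w p) \<in> borel_measurable Sig" using that(1) by measurable
    show "L2sq \<mu> (\<lambda>p. indicat_real A p *\<^sub>R w p) < \<infinity>"
      by (rule L2sq_bounded[of _ c]) (use that(2) c in \<open>simp add: indicator_def\<close>)
  qed
  define Y Z Y' Z' where "Y = (\<lambda>p. indicat_real A p *\<^sub>R y p)" and "Z = (\<lambda>p. indicat_real A p *\<^sub>R z p)"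
    and "Y' = (\<lambda>p. indicat_real A p *\<^sub>R y' p)" and "Z' = (\<lambda>p. indicat_real A p *\<^sub>R z' p)"
  have cY: "Y \<in> borel_measurable Sig \<and> L2sq \<mu> Y < \<infinity>" "Z \<in> borel_measurable Sig \<and> L2sq \<mu> Z < \<infinity>"
    "Y' \<in> borel_measurable Sig \<and> L2sq \<mu> Y' < \<infinity>" "Z' \<in> borel_measurable Sig \<and> L2sq \<mu> Z' < \<infinity>"
    unfolding Y_def Z_def Y'_def Z'_def by (rule cut; use meas bounds in blast)+
  have dY: "defines_adapted M T F Y (rv_of_process Y)" "defines_adapted M T F Z (rv_of_process Z)"
    "defines_adapted M T F Y' (rv_of_process Y')" "defines_adapted M T F Z' (rv_of_process Z')"
    using cY by (simp_all add: defines_adapted_rv_of_process)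
  define a where "a = L2_gamma_dist M T (rv_of_process Y) (rv_of_process Y')"
  define b where "b = L2_gamma_dist M T (rv_of_process Z) (rv_of_process Z')"
  have ab: "0 \<le> a" "0 \<le> b" unfolding a_def b_def by (rule L2_gamma_dist_nonneg)+
  have La: "L2sq \<mu> (\<lambda>p. Y p - Y' p) = ennreal (a\<^sup>2)"
    unfolding a_def by (rule L2sq_dist_adapted[OF dY(1) dY(3)])
  have Lb: "L2sq \<mu> (\<lambda>p. Z p - Z' p) = ennreal (b\<^sup>2)"
    unfolding b_def by (rule L2sq_dist_adapted[OF dY(2) dY(4)])
  define g where "g = (\<lambda>p. if p \<in> A then x p else g0 p)"
  have g: "g \<in> borel_measurable Sig" unfolding g_def by measurable
  have A_space: "p \<in> space Sig" if "p \<in> A" for p using sets.sets_into_space[OF A(1)] that by blast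
  have x_in: "x p \<in> GP p (y p) (z p)" if "p \<in> A" for p
  proof -
    have "infdist (x p) (GP p (y p) (z p)) = 0" using viol[OF that] by (simp add: violations_def)
    then show ?thesis
      using GP_compact[OF A_space[OF that]] in_closed_iff_infdist_zero[of "GP p (y p) (z p)" "x p"] compact_imp_closed by blast
  qed
  have g_L2: "L2sq \<mu> g < \<infinity>"
  proof -
    have m: "(\<lambda>p. norm (g0 p)) \<in> borel_measurable \<mu>" by (rule measurable_Sigma_process) measurable
    have "L2sq \<mu> g \<le> L2sq \<mu> (\<lambda>p. c + norm (g0 p))"
    proof (rule L2sq_mono)
      fix p show "norm (g p) \<le> norm (c + norm (g0 p))"
        using bounds[of p] c by (cases "p \<in> A") (auto simp: g_def add_increasing2)
    qed
    also have "\<dots> < \<infinity>"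
      by (rule L2sq_add_finite(1)[OF borel_measurable_const m L2sq_bounded[of _ c]]) (use c in \<open>simp_all only: L2sq_norm g0(2) real_norm_def abs_of_nonneg order_refl\<close>)
    finally show ?thesis .
  qed
  have "AE p in \<mu>. g p \<in> GP p (Y p) (Z p)"
    using g0(3)
  proof eventually_elim
    case (elim p)
    then show ?case using x_in[of p] by (simp add: g_def Y_def Z_def indicator_def)
  qed
  then have g_mem: "rv_of_process g \<in> \<Lambda> Y Z" by (rule Lambda_setI[OF g g_L2])
  note dg = defines_adapted_rv_of_process[OF g g_L2]
  define \<delta> where "\<delta> = (\<lambda>p. indicat_real A p * infdist (x p) (GP p (y' p) (z' p)))"
  have \<delta>_meas: "\<delta> \<in> borel_measurable Sig"
    unfolding \<delta>_def using measurable_infdist_GP[OF meas(3,4,5)] by measurable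
  have far: "L2sq \<mu> \<delta> \<le> ennreal ((L2_gamma_dist M T (rv_of_process g) X')\<^sup>2)" if X': "X' \<in> \<Lambda> Y' Z'" for X'
  proof -
    obtain g' where g': "defines_adapted M T F g' X'" "AE p in \<mu>. g' p \<in> GP p (Y' p) (Z' p)" using X' by (rule Lambda_setE)
    have "AE p in \<mu>. norm (\<delta> p) \<le> norm (g p - g' p)"
      using g'(2)
    proof eventually_elim
      case (elim p)
      show ?case
      proof (cases "p \<in> A")
        case True
        then have "infdist (x p) (GP p (y' p) (z' p)) \<le> dist (x p) (g' p)"
          using elim by (intro infdist_le) (simp add: Y'_def Z'_def)
        then show ?thesis using True by (simp add: \<delta>_def g_def dist_norm infdist_nonneg)
      qed (simp add: \<delta>_def)
    qed
    then have "L2sq \<mu> \<delta> \<le> L2sq \<mu> (\<lambda>p. g p - g' p)" by (rule L2sq_mono_AE)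
    also have "\<dots> = ennreal ((L2_gamma_dist M T (rv_of_process g) X')\<^sup>2)"
      by (rule L2sq_dist_adapted[OF dg g'(1)])
    finally show ?thesis .
  qed
  obtain X0 where X0: "X0 \<in> \<Lambda> Y' Z'" using sel dY(3,4) unfolding has_selections_def by blast
  have "L2sq \<mu> \<delta> < \<infinity>" using far[OF X0] by (rule le_less_trans) simp
  then obtain i where i: "L2sq \<mu> \<delta> = ennreal i" "0 \<le> i" by (cases "L2sq \<mu> \<delta>") auto
  have "sqrt i \<le> K * (a + b)"
  proof -
    have "ennreal (sqrt i) \<le> (INF X'\<in>\<Lambda> Y' Z'. ennreal (L2_gamma_dist M T (rv_of_process g) X'))"
    proof (rule INF_greatest, rule ennreal_leI)
      fix X' assume "X' \<in> \<Lambda> Y' Z'"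
      then have "i \<le> (L2_gamma_dist M T (rv_of_process g) X')\<^sup>2"
        using far[of X'] unfolding i(1) by (simp add: ennreal_le_iff)
      then show "sqrt i \<le> L2_gamma_dist M T (rv_of_process g) X'"
        by (rule real_le_lsqrt[rotated]) (rule L2_gamma_dist_nonneg)
    qed
    also have "\<dots> \<le> (SUP X\<in>\<Lambda> Y Z. INF X'\<in>\<Lambda> Y' Z'. ennreal (L2_gamma_dist M T X X'))"
      by (rule SUP_upper[OF g_mem])
    also have "\<dots> \<le> hausdorff_dist (L2_gamma_dist M T) (\<Lambda> Y Z) (\<Lambda> Y' Z')"
      unfolding hausdorff_dist_def by (rule max.cobounded1)
    also have "\<dots> \<le> ennreal (K * (a + b))" unfolding a_def b_def by (rule lip[OF dY])
    finally show ?thesis by (rule ennreal_le_iff[THEN iffD1, rotated]) (use K ab in simp)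
  qed
  then have "(sqrt i)\<^sup>2 \<le> (K * (a + b))\<^sup>2" using i(2) by (intro power_mono) auto
  moreover have "(a + b)\<^sup>2 \<le> 2 * a\<^sup>2 + 2 * b\<^sup>2" using norm_add_sq_le[of a b] ab by simp
  then have "(K * (a + b))\<^sup>2 \<le> K\<^sup>2 * (2 * a\<^sup>2 + 2 * b\<^sup>2)" unfolding power_mult_distrib by (intro mult_left_mono) auto
  ultimately have upper: "i \<le> K\<^sup>2 * (2 * a\<^sup>2 + 2 * b\<^sup>2)" using i(2) by simp
  have YZm: "(\<lambda>p. Y p - Y' p) \<in> borel_measurable \<mu>" "(\<lambda>p. Z p - Z' p) \<in> borel_measurable \<mu>"
    using cY by (auto intro!: measurable_Sigma_process borel_measurable_diff)
  have m1: "(\<lambda>p. ennreal ((norm (Y p - Y' p))\<^sup>2)) \<in> borel_measurable \<mu>"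
    using YZm(1) by measurable
  have m2: "(\<lambda>p. ennreal ((norm (Z p - Z' p))\<^sup>2)) \<in> borel_measurable \<mu>"
    using YZm(2) by measurable
  have "ennreal ((2 * K)\<^sup>2 * (a\<^sup>2 + b\<^sup>2)) = ennreal ((2 * K)\<^sup>2) * (L2sq \<mu> (\<lambda>p. Y p - Y' p) + L2sq \<mu> (\<lambda>p. Z p - Z' p))"
    unfolding La Lb by (simp add: ennreal_mult ennreal_plus)
  also have "\<dots> = (\<integral>\<^sup>+ p. ennreal ((2 * K)\<^sup>2) * (ennreal ((norm (Y p - Y' p))\<^sup>2) + ennreal ((norm (Z p - Z' p))\<^sup>2)) \<partial>\<mu>)"
    unfolding L2sq_def nn_integral_add[OF m1 m2, symmetric]
    by (rule nn_integral_cmult[OF borel_measurable_add[OF m1 m2], symmetric])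
  also have "\<dots> \<le> L2sq \<mu> \<delta>"
    unfolding L2sq_def
  proof (rule nn_integral_mono)
    fix p
    show "ennreal ((2 * K)\<^sup>2) * (ennreal ((norm (Y p - Y' p))\<^sup>2) + ennreal ((norm (Z p - Z' p))\<^sup>2)) \<le> ennreal ((norm (\<delta> p))\<^sup>2)"
    proof (cases "p \<in> A")
      case True
      let ?\<alpha> = "norm (y p - y' p)" and ?\<beta> = "norm (z p - z' p)"
      have less: "2 * K * (?\<alpha> + ?\<beta>) \<le> \<delta> p" using viol[OF True] True by (simp add: violations_def \<delta>_def)
      have "?\<alpha>\<^sup>2 + ?\<beta>\<^sup>2 \<le> (?\<alpha> + ?\<beta>)\<^sup>2" by (simp add: power2_sum)
      then have "(2 * K)\<^sup>2 * (?\<alpha>\<^sup>2 + ?\<beta>\<^sup>2) \<le> (2 * K * (?\<alpha> + ?\<beta>))\<^sup>2"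
        unfolding power_mult_distrib[of "2 * K"] by (intro mult_left_mono) auto
      also have "\<dots> \<le> (\<delta> p)\<^sup>2" using less K by (intro power_mono) auto
      finally have "ennreal ((2 * K)\<^sup>2 * (?\<alpha>\<^sup>2 + ?\<beta>\<^sup>2)) \<le> ennreal ((norm (\<delta> p))\<^sup>2)" by (intro ennreal_leI) simp
      then show ?thesis using True by (simp add: Y_def Z_def Y'_def Z'_def ennreal_mult ennreal_plus)
    qed (simp add: Y_def Z_def Y'_def Z'_def)
  qed
  finally have lower: "(2 * K)\<^sup>2 * (a\<^sup>2 + b\<^sup>2) \<le> i" unfolding i(1) using i(2) by (simp add: ennreal_le_iff)
  have "K\<^sup>2 * (a\<^sup>2 + b\<^sup>2) \<le> 0" using upper lower by (simp add: power_mult_distrib algebra_simps)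
  moreover have "0 < K\<^sup>2" using K by simp
  ultimately have "a\<^sup>2 + b\<^sup>2 \<le> 0" by (simp add: mult_le_0_iff)
  then have "K\<^sup>2 * (2 * a\<^sup>2 + 2 * b\<^sup>2) \<le> 0" using \<open>0 < K\<^sup>2\<close> by (intro mult_nonneg_nonpos) auto
  then have "i = 0" using upper i(2) by linarith
  then have "(\<integral>\<^sup>+ p. ennreal ((norm (\<delta> p))\<^sup>2) \<partial>\<mu>) = 0" using i(1) by (simp add: L2sq_def)
  moreover have "(\<lambda>p. ennreal ((norm (\<delta> p))\<^sup>2)) \<in> borel_measurable \<mu>"
    using measurable_Sigma_process[OF \<delta>_meas] by measurable
  ultimately have "AE p in \<mu>. ennreal ((norm (\<delta> p))\<^sup>2) = 0" by (simp add: nn_integral_0_iff_AE)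
  then have "AE p in \<mu>. p \<notin> A"
  proof eventually_elim
    case (elim p)
    show ?case
    proof
      assume p: "p \<in> A"
      have "0 \<le> 2 * K * (norm (y p - y' p) + norm (z p - z' p))" using K by simp
      then have "0 < \<delta> p" using viol[OF p] p by (simp add: violations_def \<delta>_def)
      then show False using elim by (simp add: ennreal_eq_0_iff)
    qed
  qed
  moreover have "A \<in> sets \<mu>" using A(1) subalgebra_Sigma by (auto simp: subalgebra_def)
  ultimately have "emeasure \<mu> A = 0" using AE_iff_null_sets null_setsD1 by blast
  then show False using A(2) by simp
qed

text \<open>If the points \<open>p\<close> where the estimate fails are not contained in a null set, some violation can be
  chosen measurably on a set of positive measure. It is bounded on a smaller set of positive
  measure, which \<open>no_violating_section\<close> excludes. The section theorem is applied on
  \<open>\<Sigma>\<^sub>\<FF>\<close>, so that the choice is adapted.\<close>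

theorem pointwise_lipschitz:
  assumes sel: has_selections and K: "0 < K"
    and lip: "\<And>Y Z Y' Z' X\<^sub>Y X\<^sub>Z X\<^sub>Y' X\<^sub>Z'. defines_adapted M T F Y X\<^sub>Y \<Longrightarrow> defines_adapted M T F Z X\<^sub>Z \<Longrightarrow>
       defines_adapted M T F Y' X\<^sub>Y' \<Longrightarrow> defines_adapted M T F Z' X\<^sub>Z' \<Longrightarrow>
       hausdorff_dist (L2_gamma_dist M T) (\<Lambda> Y Z) (\<Lambda> Y' Z') \<le>
         ennreal (K * (L2_gamma_dist M T X\<^sub>Y X\<^sub>Y' + L2_gamma_dist M T X\<^sub>Z X\<^sub>Z'))"
  shows "AE p in \<mu>. \<forall>y z y' z'. hausdorff_dist dist (GP p y z) (GP p y' z') \<le> ennreal (2 * K * (norm (y - y') + norm (z - z')))"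
proof -
  let ?N = "restr_to_subalg \<mu> Sig"
  have sets_N: "sets ?N = sets Sig" by (rule sets_restr_to_subalg[OF subalgebra_Sigma])
  have fin_N: "finite_measure ?N" by (rule finite_measure_restr_to_subalg[OF subalgebra_Sigma proc.finite_measure_axioms])
  have "\<exists>A\<in>null_sets ?N. fst ` violations (2 * K) \<subseteq> A"
  proof (rule ccontr)
    assume "\<not> ?thesis"
    from nonnull_projection_section[OF fin_N sets_violations this]
    obtain D and f :: "real \<times> 'a \<Rightarrow> 'e \<times> 'e \<times> 'e \<times> 'e \<times> 'e" where Df: "D \<in> sets ?N \<and> 0 < emeasure ?N D \<and> f \<in> borel_measurable ?N \<and>
      (\<forall>p\<in>D. (p, f p) \<in> violations (2 * K))"
      by (elim exE) (erule that)
    have D1: "D \<in> sets Sig" using Df unfolding sets_N by (elim conjE)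
    have D2: "0 < emeasure \<mu> D"
      using Df unfolding emeasure_restr_to_subalg[OF subalgebra_Sigma D1] by (elim conjE)
    note D = D1 D2
    have f: "f \<in> borel_measurable Sig"
      using Df unfolding measurable_cong_sets[OF sets_N refl] by (elim conjE)
    note D(1)[measurable]
    define y z y' z' x where "y = (\<lambda>p. fst (f p))" and "z = (\<lambda>p. fst (snd (f p)))" and "y' = (\<lambda>p. fst (snd (snd (f p))))"
      and "z' = (\<lambda>p. fst (snd (snd (snd (f p)))))" and "x = (\<lambda>p. snd (snd (snd (snd (f p)))))"
    have comp: "(\<lambda>p. h (f p)) \<in> borel_measurable Sig" if "continuous_on UNIV h" for h :: "'e \<times> 'e \<times> 'e \<times> 'e \<times> 'e \<Rightarrow> 'e"
      by (rule measurable_compose[OF f borel_measurable_continuous_onI[OF that]])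
    have meas: "y \<in> borel_measurable Sig" "z \<in> borel_measurable Sig" "y' \<in> borel_measurable Sig"
      "z' \<in> borel_measurable Sig" "x \<in> borel_measurable Sig"
      unfolding y_def z_def y'_def z'_def x_def by (rule comp, intro continuous_intros)+
    note meas[measurable]
    define b where "b = (\<lambda>p. max (norm (y p)) (max (norm (z p)) (max (norm (y' p)) (max (norm (z' p)) (norm (x p))))))"
    have [measurable]: "b \<in> borel_measurable Sig" unfolding b_def by measurable
    define A where "A = (\<lambda>n::nat. D \<inter> {p \<in> space Sig. b p \<le> real n})"
    have A_sets: "A n \<in> sets Sig" for n unfolding A_def by measurable
    have "\<exists>n. 0 < emeasure \<mu> (A n)"
    proof (rule ccontr)
      assume "\<not> ?thesis"
      then have "A n \<in> null_sets \<mu>" for n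
        using A_sets[of n] subalgebra_Sigma by (auto simp: subalgebra_def null_sets_def)
      then have "(\<Union>n. A n) \<in> null_sets \<mu>" by blast
      moreover have "D \<subseteq> (\<Union>n. A n)"
      proof
        fix p assume "p \<in> D"
        moreover obtain n :: nat where "b p \<le> real n" using real_arch_simple by blast
        ultimately show "p \<in> (\<Union>n. A n)" using sets.sets_into_space[OF D(1)] by (auto simp: A_def)
      qed
      ultimately have "emeasure \<mu> D \<le> 0"
        using emeasure_mono[of D "\<Union>n. A n" \<mu>] by (metis null_setsD1 null_setsD2)
      then show False using D(2) by simp
    qed
    then obtain n where n: "0 < emeasure \<mu> (A n)" by blast
    have bounds: "norm (y p) \<le> real n \<and> norm (z p) \<le> real n \<and> norm (y' p) \<le> real n \<and> norm (z' p) \<le> real n \<and> norm (x p) \<le> real n"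
      if "p \<in> A n" for p
      using that by (simp add: A_def b_def)
    have viol: "(p, y p, z p, y' p, z' p, x p) \<in> violations (2 * K)" if "p \<in> A n" for p
      using that Df by (simp add: A_def y_def z_def y'_def z'_def x_def)
    show False by (rule no_violating_section[OF sel K lip A_sets n meas bounds viol])
  qed
  then obtain A where A: "A \<in> null_sets ?N" "fst ` violations (2 * K) \<subseteq> A" by blast
  then have "A \<in> null_sets \<mu>" by (simp add: null_sets_restr_to_subalg[OF subalgebra_Sigma])
  then have "AE p in \<mu>. p \<notin> A" by (rule AE_not_in)
  then show ?thesis
    using AE_process
  proof eventually_elim
    case (elim p)
    have one: "infdist x (GP p y' z') \<le> 2 * K * (norm (y - y') + norm (z - z'))" if x: "x \<in> GP p y z" for x y z y' z' :: 'e
    proof (rule ccontr)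
      assume "\<not> ?thesis"
      then have "(p, y, z, y', z', x) \<in> violations (2 * K)" using x elim(2) by (simp add: violations_def)
      then have "p \<in> fst ` violations (2 * K)" by force
      then show False using A(2) elim(1) by blast
    qed
    show ?case
    proof (intro allI)
      fix y z y' z' :: 'e
      have nonneg: "0 \<le> 2 * K * (norm (y - y') + norm (z - z'))" using K by simp
      have other: "infdist x (GP p y z) \<le> 2 * K * (norm (y - y') + norm (z - z'))" if "x \<in> GP p y' z'" for x
        using one[OF that, of y z] by (simp add: norm_minus_commute)
      note c = GP_compact[OF elim(2), THEN conjunct1] GP_compact[OF elim(2), THEN conjunct2]
      show "hausdorff_dist dist (GP p y z) (GP p y' z') \<le> ennreal (2 * K * (norm (y - y') + norm (z - z')))"
        by (rule hausdorff_dist_le_iff[OF c c nonneg, THEN iffD2]) (intro conjI ballI one other)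
    qed
  qed
qed

end

section \<open>Equivalence\<close>

text \<open>The subsets of null sets belong to the generator of \<open>F T\<close>, whose sets are those of \<open>M\<close>; this makes
  \<open>M\<close> complete.\<close>

lemma driver_space_brownian:
  fixes T :: real and M :: "'a measure" and W :: "real \<Rightarrow> 'a \<Rightarrow> real" and F :: "real \<Rightarrow> 'a measure"
    and G :: "real \<Rightarrow> 'a \<Rightarrow> 'e \<Rightarrow> 'e \<Rightarrow> 'e::{real_inner, complete_space, second_countable_topology} set"
  assumes T: "0 < T" and M: "prob_space M" and W: "std_brownian_motion M T W"
    and F: "\<And>t. t \<in> {0..T} \<Longrightarrow> F t = aug_filtration M W t" and M_F: "sets M = sets (F T)"
    and G: "\<And>u \<omega> y z. u \<in> {0..T} \<Longrightarrow> \<omega> \<in> space M \<Longrightarrow> G u \<omega> y z \<in> K_ccmpt"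
    and G_meas: "set_valued_measurable (Sigma_adapted M T F \<Otimes>\<^sub>M borel \<Otimes>\<^sub>M borel) (\<lambda>((u, \<omega>), y, z). G u \<omega> y z)"
  shows "driver_space M T F G"
proof -
  let ?gen = "\<lambda>t. {W s -` B \<inter> space M | s B. s \<in> {0..t} \<and> B \<in> sets borel} \<union> {N. \<exists>N'\<in>null_sets M. N \<subseteq> N'}"
  have gen: "?gen t \<subseteq> Pow (space M)" for t
    using sets.sets_into_space by (auto simp: null_sets_def)
  have sets_F: "sets (F t) = sigma_sets (space M) (?gen t)" and space_F: "space (F t) = space M" if "t \<in> {0..T}" for t
    unfolding F[OF that] aug_filtration_def by (rule sets_measure_of[OF gen]) (rule space_measure_of[OF gen])
  have mono: "sets (F s) \<subseteq> sets (F t)" if "0 \<le> s" "s \<le> t" "t \<le> T" for s t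
  proof -
    have st: "s \<in> {0..T}" "t \<in> {0..T}" using that by auto
    have "?gen s \<subseteq> ?gen t" using that by fastforce
    then show ?thesis unfolding sets_F[OF st(1)] sets_F[OF st(2)] by (rule sigma_sets_mono')
  qed
  have T_in: "T \<in> {0..T}" using T by simp
  have complete: "complete_measure M"
  proof
    fix A B assume "B \<subseteq> A" "A \<in> null_sets M"
    then have "B \<in> ?gen T" by blast
    then have "B \<in> sigma_sets (space M) (?gen T)" by (rule sigma_sets.Basic)
    then show "B \<in> sets M" unfolding M_F sets_F[OF T_in] .
  qed
  show ?thesis
  proof (intro driver_space.intro adapted_space.intro process_space.intro process_space_axioms.intro
      adapted_space_axioms.intro driver_space_axioms.intro)
    show "prob_space M" by (rule M)
    show "complete_measure M" by (rule complete)
    show "0 < T" by (rule T)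
    show "subalgebra M (F u)" if "u \<in> {0..T}" for u
      using mono[of u T] that space_F[OF that] M_F by (simp add: subalgebra_def)
    show "sets (F s) \<subseteq> sets (F t)" if "0 \<le> s" "s \<le> t" "t \<le> T" for s t by (rule mono[OF that])
    show "G u \<omega> y z \<in> K_ccmpt" if "u \<in> {0..T}" "\<omega> \<in> space M" for u \<omega> y z by (rule G[OF that])
    show "set_valued_measurable (Sigma_adapted M T F \<Otimes>\<^sub>M borel \<Otimes>\<^sub>M borel) (\<lambda>((u, \<omega>), y, z). G u \<omega> y z)" by (rule G_meas)
  qed
qed


theorem theorem4p6:
  fixes T :: real and M :: "'a measure" and W :: "real \<Rightarrow> 'a \<Rightarrow> real"
    and F :: "real \<Rightarrow> 'a measure"
    and G :: "real \<Rightarrow> 'a \<Rightarrow> 'e \<Rightarrow> 'e \<Rightarrow> 'e::{real_inner, complete_space, second_countable_topology} set"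
  assumes "0 < T"
    and "prob_space M"
    and "std_brownian_motion M T W"
    and "\<And>t. t \<in> {0..T} \<Longrightarrow> F t = aug_filtration M W t"
    and "sets M = sets (F T)"
    and "\<And>u \<omega> y z. u \<in> {0..T} \<Longrightarrow> \<omega> \<in> space M \<Longrightarrow> G u \<omega> y z \<in> K_ccmpt"
    and "set_valued_measurable (Sigma_adapted M T F \<Otimes>\<^sub>M borel \<Otimes>\<^sub>M borel)
           (\<lambda>((u, \<omega>), y, z). G u \<omega> y z)"
  shows
    "((\<forall>Y Z X\<^sub>Y X\<^sub>Z. defines_adapted M T F Y X\<^sub>Y \<and> defines_adapted M T F Z X\<^sub>Z \<longrightarrow>
         Lambda_set M T F G Y Z \<noteq> {}) \<and>
      (SUP g\<in>Lambda_set M T F G (\<lambda>_. 0) (\<lambda>_. 0). ennreal (L2_gamma_norm M T g)) < \<infinity> \<and>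
      (\<exists>K\<^sub>1>0. \<forall>Y Z Y' Z' X\<^sub>Y X\<^sub>Z X\<^sub>Y' X\<^sub>Z'.
         defines_adapted M T F Y X\<^sub>Y \<and> defines_adapted M T F Z X\<^sub>Z \<and>
         defines_adapted M T F Y' X\<^sub>Y' \<and> defines_adapted M T F Z' X\<^sub>Z' \<longrightarrow>
         hausdorff_dist (L2_gamma_dist M T) (Lambda_set M T F G Y Z) (Lambda_set M T F G Y' Z')
           \<le> ennreal (K\<^sub>1 * (L2_gamma_dist M T X\<^sub>Y X\<^sub>Y' + L2_gamma_dist M T X\<^sub>Z X\<^sub>Z'))))
     \<longleftrightarrow>
     ((\<integral>\<^sup>+ \<omega>. (\<integral>\<^sup>+ u. (hausdorff_dist dist (G u \<omega> 0 0) {0})\<^sup>2 \<partial>time_measure T) \<partial>M) < \<infinity> \<and>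
      (\<exists>K\<^sub>2>0. AE (u, \<omega>) in process_measure M T. \<forall>y z y' z'.
         hausdorff_dist dist (G u \<omega> y z) (G u \<omega> y' z')
           \<le> ennreal (K\<^sub>2 * (norm (y - y') + norm (z - z')))))"
proof -
  interpret driver_space M T F G
    by (rule driver_space_brownian[OF assms])
  show ?thesis
  proof (intro iffI conjI)
    assume \<Gamma>1: "(\<forall>Y Z X\<^sub>Y X\<^sub>Z. defines_adapted M T F Y X\<^sub>Y \<and> defines_adapted M T F Z X\<^sub>Z \<longrightarrow> \<Lambda> Y Z \<noteq> {}) \<and>
      (SUP g\<in>\<Lambda> (\<lambda>_. 0) (\<lambda>_. 0). ennreal (L2_gamma_norm M T g)) < \<infinity> \<and>
      (\<exists>K\<^sub>1>0. \<forall>Y Z Y' Z' X\<^sub>Y X\<^sub>Z X\<^sub>Y' X\<^sub>Z'.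
         defines_adapted M T F Y X\<^sub>Y \<and> defines_adapted M T F Z X\<^sub>Z \<and>
         defines_adapted M T F Y' X\<^sub>Y' \<and> defines_adapted M T F Z' X\<^sub>Z' \<longrightarrow>
         hausdorff_dist (L2_gamma_dist M T) (\<Lambda> Y Z) (\<Lambda> Y' Z')
           \<le> ennreal (K\<^sub>1 * (L2_gamma_dist M T X\<^sub>Y X\<^sub>Y' + L2_gamma_dist M T X\<^sub>Z X\<^sub>Z')))"
    then have sel: has_selections unfolding has_selections_def by blast
    show "(\<integral>\<^sup>+ \<omega>. (\<integral>\<^sup>+ u. (hausdorff_dist dist (G u \<omega> 0 0) {0})\<^sup>2 \<partial>time_measure T) \<partial>M) < \<infinity>"
      using \<Gamma>1 by (intro integrable_envelope[OF sel]) blast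
    from \<Gamma>1 obtain K where K: "0 < K" and lip_all: "\<forall>Y Z Y' Z' X\<^sub>Y X\<^sub>Z X\<^sub>Y' X\<^sub>Z'.
         defines_adapted M T F Y X\<^sub>Y \<and> defines_adapted M T F Z X\<^sub>Z \<and>
         defines_adapted M T F Y' X\<^sub>Y' \<and> defines_adapted M T F Z' X\<^sub>Z' \<longrightarrow>
         hausdorff_dist (L2_gamma_dist M T) (\<Lambda> Y Z) (\<Lambda> Y' Z')
           \<le> ennreal (K * (L2_gamma_dist M T X\<^sub>Y X\<^sub>Y' + L2_gamma_dist M T X\<^sub>Z X\<^sub>Z'))"
      by (elim conjE exE) (erule that)
    have lip: "\<And>Y Z Y' Z' X\<^sub>Y X\<^sub>Z X\<^sub>Y' X\<^sub>Z'.
         defines_adapted M T F Y X\<^sub>Y \<Longrightarrow> defines_adapted M T F Z X\<^sub>Z \<Longrightarrow>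
         defines_adapted M T F Y' X\<^sub>Y' \<Longrightarrow> defines_adapted M T F Z' X\<^sub>Z' \<Longrightarrow>
         hausdorff_dist (L2_gamma_dist M T) (\<Lambda> Y Z) (\<Lambda> Y' Z')
           \<le> ennreal (K * (L2_gamma_dist M T X\<^sub>Y X\<^sub>Y' + L2_gamma_dist M T X\<^sub>Z X\<^sub>Z'))"
      by (rule lip_all[rule_format]) (intro conjI)
    have "AE (u, \<omega>) in process_measure M T. \<forall>y z y' z'.
        hausdorff_dist dist (G u \<omega> y z) (G u \<omega> y' z') \<le> ennreal (2 * K * (norm (y - y') + norm (z - z')))"
      using pointwise_lipschitz[OF sel K lip] by (simp add: split_beta)
    then show "\<exists>K\<^sub>2>0. AE (u, \<omega>) in process_measure M T. \<forall>y z y' z'.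
        hausdorff_dist dist (G u \<omega> y z) (G u \<omega> y' z') \<le> ennreal (K\<^sub>2 * (norm (y - y') + norm (z - z')))"
      using K by (intro exI[of _ "2 * K"]) simp
  next
    assume \<Gamma>2: "(\<integral>\<^sup>+ \<omega>. (\<integral>\<^sup>+ u. (hausdorff_dist dist (G u \<omega> 0 0) {0})\<^sup>2 \<partial>time_measure T) \<partial>M) < \<infinity> \<and>
      (\<exists>K\<^sub>2>0. AE (u, \<omega>) in process_measure M T. \<forall>y z y' z'.
         hausdorff_dist dist (G u \<omega> y z) (G u \<omega> y' z') \<le> ennreal (K\<^sub>2 * (norm (y - y') + norm (z - z'))))"
    then have fin: "(\<integral>\<^sup>+ \<omega>. (\<integral>\<^sup>+ u. (hausdorff_dist dist (G u \<omega> 0 0) {0})\<^sup>2 \<partial>time_measure T) \<partial>M) < \<infinity>" by blast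
    obtain K where K: "0 < K" and "AE (u, \<omega>) in process_measure M T. \<forall>y z y' z'.
        hausdorff_dist dist (G u \<omega> y z) (G u \<omega> y' z') \<le> ennreal (K * (norm (y - y') + norm (z - z')))"
      using \<Gamma>2 by blast
    then have lip: "AE p in process_measure M T. \<forall>y z y' z'.
        hausdorff_dist dist (GP p y z) (GP p y' z') \<le> ennreal (K * (norm (y - y') + norm (z - z')))"
      by (simp add: split_beta)
    show "\<forall>Y Z X\<^sub>Y X\<^sub>Z. defines_adapted M T F Y X\<^sub>Y \<and> defines_adapted M T F Z X\<^sub>Z \<longrightarrow> \<Lambda> Y Z \<noteq> {}"
      using Lambda_set_nonempty[OF K lip _ _ fin] by blast
    show "(SUP g\<in>\<Lambda> (\<lambda>_. 0) (\<lambda>_. 0). ennreal (L2_gamma_norm M T g)) < \<infinity>"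
      by (rule Lambda_set_bounded[OF K lip fin])
    show "\<exists>K\<^sub>1>0. \<forall>Y Z Y' Z' X\<^sub>Y X\<^sub>Z X\<^sub>Y' X\<^sub>Z'.
         defines_adapted M T F Y X\<^sub>Y \<and> defines_adapted M T F Z X\<^sub>Z \<and>
         defines_adapted M T F Y' X\<^sub>Y' \<and> defines_adapted M T F Z' X\<^sub>Z' \<longrightarrow>
         hausdorff_dist (L2_gamma_dist M T) (\<Lambda> Y Z) (\<Lambda> Y' Z')
           \<le> ennreal (K\<^sub>1 * (L2_gamma_dist M T X\<^sub>Y X\<^sub>Y' + L2_gamma_dist M T X\<^sub>Z X\<^sub>Z'))"
      using K Lambda_set_lipschitz[OF K lip] by (intro exI[of _ "2 * K"]) auto
  qed
qed

end
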